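(* Let $n,m\in\mathbb{N}$ and $d=\binom{n+m-1}{n}$. The operator $R_{\mathcal{H}_m}\colon\mathcal{H}_m\to L^2(\mathbb{R}^n,\widetilde\mu_n)^d$ is an isometric isomorphism. If $g\in\mathcal{H}_m$ and $\|g\|_{L^1(\mathbb{R}^{2n})}<+\infty$, then for every $j\in\{1,\ldots,d\}$ (as an equality of elements of $L^2(\mathbb{R}^n,\widetilde\mu_n)$ in the variable $\xi$), $$(R_{\mathcal{H}_m}g)(\xi)_j=\frac{1}{2^{n/2}\pi^{3n/4}}\int_{\mathbb{R}^{2n}}g(u,v)\,e^{-i\langle u,\xi\rangle}\prod_{r=1}^n\psi_{\varphi(j)_r}\left(\frac{\xi_r+2v_r}{\sqrt2}\right)d\mu_{2n}(u,v).$$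
   Context: Notation: $\mathbb{N}=\{1,2,\ldots\}$, $\mathbb{N}_0=\{0,1,2,\ldots\}$; $|k|=k_1+\cdots+k_n$ for $k\in\mathbb{N}_0^n$; $\langle z,w\rangle=\sum_{r=1}^n z_r\overline{w_r}$ and $|z|=\sqrt{\langle z,z\rangle}$ on $\mathbb{C}^n$; $\mu_n$ is Lebesgue measure on $\mathbb{R}^n$, $\mu_{2n}$ is Lebesgue measure on $\mathbb{C}^n\cong\mathbb{R}^{2n}$, and $\widetilde{\mu}_n=(2\pi)^{-n/2}\mu_n$ (so $\widetilde\mu_{2n}=(2\pi)^{-n}\mu_{2n}$). A smooth function $f\colon\mathbb{C}^n\to\mathbb{C}$ is $m$-analytic if $\overline{D}^k f=0$ for every $k\in\mathbb{N}_0^n$ with $|k|=m$, where $\overline{D}^k=\partial_{\overline{z}_1}^{k_1}\cdots\partial_{\overline{z}_n}^{k_n}$ (Wirtinger derivatives). For $\alpha>0$, $\mathcal{F}_{\alpha,m}$ is the Hilbert space of all $m$-analytic functions $f\colon\mathbb{C}^n\to\mathbb{C}$ with $\|f\|^2=\frac{\alpha^n}{\pi^n}\int_{\mathbb{C}^n}|f(z)|^2e^{-\alpha|z|^2}\,d\mu_{2n}(z)<\infty$. The space $\mathcal{H}_m$ consists of all functions on $\mathbb{R}^{2n}=\mathbb{R}^n\times\mathbb{R}^n$ of the form $$(x,y)\mapsto 2^{n/2}e^{-\frac12|x|^2-\frac12|y|^2-i\langle x,y\rangle}f\Bigl(\frac{x+iy}{\sqrt\alpha}\Bigr),\qquad f\in\mathcal{F}_{\alpha,m},$$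 with the inner product of $L^2(\mathbb{R}^{2n},\widetilde\mu_{2n})$; it does not depend on $\alpha$. Let $J_{n,m}=\{k\in\mathbb{N}_0^n\colon |k|\le m-1\}$, which has $d$ elements, and let $\varphi\colon\{1,\ldots,d\}\to J_{n,m}$ be the bijection enumerating $J_{n,m}$ in lexicographic order. Hermite functions: $\psi_j(t)=(2^j j!\sqrt\pi)^{-1/2}e^{-t^2/2}H_j(t)$, with $H_j$ the physicists' Hermite polynomial. For $k\in J_{n,m}$, $\xi,v\in\mathbb{R}^n$, let $q_{k,\xi}(v)=2^{n/2}\pi^{n/4}\prod_{r=1}^n\psi_{k_r}\bigl(\frac{\xi_r+2v_r}{\sqrt2}\bigr)$. Let $F$ be the Fourier–Plancherel transform on $L^2(\mathbb{R}^n,\widetilde\mu_n)$, $(Fh)(\xi)=\int_{\mathbb{R}^n}h(u)e^{-i\langle u,\xi\rangle}\,d\widetilde\mu_n(u)$ for $h\in L^1\cap L^2$, and let $F\otimes I$ be the unitary operator on $L^2(\mathbb{R}^{2n},\widetilde\mu_{2n})$ applying $F$ in the first $n$ variables. Let $\widehat{\mathcal{H}}_m=(F\otimes I)(\mathcal{H}_m)$ and $N\colon\widehat{\mathcal{H}}_m\to L^2(\mathbb{R}^n,\widetilde\mu_n)^d$, $(Ng)(\xi)_j=\int_{\mathbb{R}^n}g(\xi,v)\,q_{\varphi(j),\xi}(v)\,d\widetilde\mu_n(v)$. Define $R_{\mathcal{H}_m}=N(F\otimes I)\colon\mathcal{H}_m\to L^2(\mathbb{R}^n,\widetilde\mu_n)^d$.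 *)

theory Defs
  imports "HOL-Analysis.Analysis" "HOL-Library.Fun_Lexorder"
begin

text \<open>
  The dimension \<open>n\<close> is \<open>CARD('n)\<close>, where the index type \<open>'n\<close> is finite and linearly ordered, so it
  is order isomorphic to \<open>{1..n}\<close>; the order is needed only for the lexicographic enumeration of the
  multi-indices.  Elements of \<open>L\<^sup>2\<close> are represented by square-integrable Borel functions, and equality
  in \<open>L\<^sup>2\<close> is equality almost everywhere.
\<close>

section \<open>Square-integrable functions\<close>

text \<open>Normalised Lebesgue measure \<open>(2\<pi>)\<^bsup>-N/2\<^esup> \<mu>\<^sub>N\<close>, where \<open>N\<close> is the real dimension of \<open>'a\<close>;
  thus \<open>N = 2n\<close> on \<open>(real^'n) \<times> (real^'n)\<close>.\<close>

definition nlborel :: "'a::euclidean_space measure" where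
  "nlborel = scale_measure (ennreal ((2 * pi) powr (- real DIM('a) / 2))) lborel"

definition L2 :: "'a measure \<Rightarrow> ('a \<Rightarrow> complex) set" where
  "L2 M = {f. f \<in> borel_measurable M \<and> integrable M (\<lambda>x. (norm (f x))\<^sup>2)}"

definition L2_norm :: "'a measure \<Rightarrow> ('a \<Rightarrow> complex) \<Rightarrow> real" where
  "L2_norm M f = sqrt (LINT x|M. (norm (f x))\<^sup>2)"

definition L2_tendsto :: "'a measure \<Rightarrow> (nat \<Rightarrow> 'a \<Rightarrow> complex) \<Rightarrow> ('a \<Rightarrow> complex) \<Rightarrow> bool" where
  "L2_tendsto M hs h \<longleftrightarrow> (\<lambda>k. \<integral>\<^sup>+x. ennreal ((norm (hs k x - h x))\<^sup>2) \<partial>M) \<longlonglongrightarrow> 0"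

text \<open>An isometric isomorphism of a vector space \<open>H\<close> of square-integrable functions onto the
  \<open>d\<close>-fold Hilbert sum of \<open>L2 M'\<close>, whose elements are the tuples \<open>(h 1, \<dots>, h d)\<close>.  The elements of
  \<open>H\<close> are individual functions, whereas those of \<open>L2 M'\<close> are identified almost everywhere.\<close>

definition L2_isometric_isomorphism ::
  "'a measure \<Rightarrow> ('a \<Rightarrow> complex) set \<Rightarrow> 'b measure \<Rightarrow> nat
     \<Rightarrow> (('a \<Rightarrow> complex) \<Rightarrow> nat \<Rightarrow> 'b \<Rightarrow> complex) \<Rightarrow> bool" where
  "L2_isometric_isomorphism M H M' d T \<longleftrightarrow>
     H \<subseteq> L2 M \<and>
     (\<forall>g\<in>H. \<forall>j\<in>{1..d}. T g j \<in> L2 M') \<and>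
     (\<forall>g\<in>H. \<forall>h\<in>H. \<forall>a b. (\<lambda>x. a * g x + b * h x) \<in> H \<and>
        (\<forall>j\<in>{1..d}. AE y in M'. T (\<lambda>x. a * g x + b * h x) j y = a * T g j y + b * T h j y)) \<and>
     (\<forall>g\<in>H. L2_set (\<lambda>j. L2_norm M' (T g j)) {1..d} = L2_norm M g) \<and>
     (\<forall>h. (\<forall>j\<in>{1..d}. h j \<in> L2 M') \<longrightarrow>
        (\<exists>!g. g \<in> H \<and> (\<forall>j\<in>{1..d}. AE y in M'. T g j y = h j y)))"


section \<open>Polyanalytic functions and the space \<open>H\<^sub>m\<close>\<close>

definition dir_deriv :: "'a::real_normed_vector \<Rightarrow> ('a \<Rightarrow> complex) \<Rightarrow> 'a \<Rightarrow> complex" where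
  "dir_deriv v f = (\<lambda>z. frechet_derivative f (at z) v)"

text \<open>Real smoothness: all iterated directional derivatives exist and are Frechet differentiable
  (hence continuous).\<close>

definition smooth :: "('a::real_normed_vector \<Rightarrow> complex) \<Rightarrow> bool" where
  "smooth f \<longleftrightarrow> (\<forall>vs. foldr dir_deriv vs f differentiable_on UNIV)"

definition dbar :: "'n::finite \<Rightarrow> (complex^'n \<Rightarrow> complex) \<Rightarrow> complex^'n \<Rightarrow> complex" where
  "dbar r f = (\<lambda>z. (dir_deriv (axis r 1) f z + \<i> * dir_deriv (axis r \<i>) f z) / 2)"

definition dbar_multi ::
  "('n::{finite,linorder} \<Rightarrow> nat) \<Rightarrow> (complex^'n::{finite,linorder} \<Rightarrow> complex)
     \<Rightarrow> complex^'n::{finite,linorder} \<Rightarrow> complex" where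
  "dbar_multi k f = foldr (\<lambda>r. dbar r ^^ k r) (sorted_list_of_set UNIV) f"

definition m_analytic :: "nat \<Rightarrow> (complex^'n::{finite,linorder} \<Rightarrow> complex) \<Rightarrow> bool" where
  "m_analytic m f \<longleftrightarrow> smooth f \<and> (\<forall>k. (\<Sum>r\<in>UNIV. k r) = m \<longrightarrow> dbar_multi k f = (\<lambda>z. 0))"

definition fock :: "real \<Rightarrow> nat \<Rightarrow> (complex^'n::{finite,linorder} \<Rightarrow> complex) set" where
  "fock \<alpha> m = {f. m_analytic m f \<and>
     integrable lborel (\<lambda>z. (norm (f z))\<^sup>2 * exp (- \<alpha> * (norm z)\<^sup>2))}"

definition H_embed ::
  "real \<Rightarrow> (complex^'n \<Rightarrow> complex) \<Rightarrow> (real^'n) \<times> (real^'n) \<Rightarrow> complex" where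
  "H_embed \<alpha> f = (\<lambda>(x, y).
     complex_of_real (2 powr (real CARD('n) / 2)) *
     exp (- complex_of_real ((norm x)\<^sup>2) / 2 - complex_of_real ((norm y)\<^sup>2) / 2
            - \<i> * complex_of_real (x \<bullet> y)) *
     f (\<chi> r. (complex_of_real (x $ r) + \<i> * complex_of_real (y $ r)) / complex_of_real (sqrt \<alpha>)))"

definition H_space ::
  "real \<Rightarrow> nat \<Rightarrow> ((real^'n::{finite,linorder}) \<times> (real^'n::{finite,linorder}) \<Rightarrow> complex) set" where
  "H_space \<alpha> m = H_embed \<alpha> ` fock \<alpha> m"


section \<open>The Fourier--Plancherel transform\<close>

definition fourier_integral ::
  "('a::euclidean_space \<Rightarrow> complex) \<Rightarrow> 'a \<Rightarrow> complex" where
  "fourier_integral h = (\<lambda>\<xi>. LINT u|nlborel. h u * exp (- \<i> * complex_of_real (u \<bullet> \<xi>)))"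

text \<open>The continuous extension of \<open>fourier_integral\<close> from \<open>L\<^sup>1 \<inter> L\<^sup>2\<close> to \<open>L\<^sup>2\<close>; the value is
  determined up to equality almost everywhere.\<close>

definition fourier_plancherel ::
  "('a::euclidean_space \<Rightarrow> complex) \<Rightarrow> 'a \<Rightarrow> complex" where
  "fourier_plancherel h = (SOME g. g \<in> L2 nlborel \<and>
     (\<exists>hs. (\<forall>k. hs k \<in> L2 nlborel \<and> integrable nlborel (hs k)) \<and>
        L2_tendsto nlborel hs h \<and> L2_tendsto nlborel (\<lambda>k. fourier_integral (hs k)) g))"

text \<open>\<open>F \<otimes> I\<close>: the Fourier--Plancherel transform of almost every section \<open>h(\<cdot>, v)\<close>, with a
  representative that is jointly measurable and square integrable.\<close>

definition fourier_plancherel_fst ::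
  "('a::euclidean_space \<times> 'b::euclidean_space \<Rightarrow> complex) \<Rightarrow> 'a \<times> 'b \<Rightarrow> complex" where
  "fourier_plancherel_fst h = (SOME g. g \<in> L2 nlborel \<and>
     (AE v in nlborel. AE \<xi> in nlborel. g (\<xi>, v) = fourier_plancherel (\<lambda>u. h (u, v)) \<xi>))"


section \<open>Hermite functions and the operator \<open>R\<close>\<close>

definition hermite_poly :: "nat \<Rightarrow> real \<Rightarrow> real" where
  "hermite_poly j t = (-1) ^ j * exp (t\<^sup>2) * (deriv ^^ j) (\<lambda>s. exp (- s\<^sup>2)) t"

definition hermite_fun :: "nat \<Rightarrow> real \<Rightarrow> real" where
  "hermite_fun j t = exp (- t\<^sup>2 / 2) * hermite_poly j t / sqrt (2 ^ j * fact j * sqrt pi)"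

definition J_set :: "nat \<Rightarrow> ('n::finite \<Rightarrow> nat) set" where
  "J_set m = {k. (\<Sum>r\<in>UNIV. k r) \<le> m - 1}"

definition lex_enum :: "nat \<Rightarrow> nat \<Rightarrow> ('n::{finite,linorder} \<Rightarrow> nat)" where
  "lex_enum m = (SOME \<phi>. bij_betw \<phi> {1..card (J_set m :: ('n \<Rightarrow> nat) set)} (J_set m) \<and>
     (\<forall>i\<in>{1..card (J_set m :: ('n \<Rightarrow> nat) set)}. \<forall>j\<in>{1..card (J_set m :: ('n \<Rightarrow> nat) set)}.
        i < j \<longrightarrow> less_fun (\<phi> i) (\<phi> j)))"

definition hermite_prod :: "('n::finite \<Rightarrow> nat) \<Rightarrow> real^'n \<Rightarrow> real^'n \<Rightarrow> real" where
  "hermite_prod k \<xi> v = (\<Prod>r\<in>UNIV. hermite_fun (k r) ((\<xi> $ r + 2 * v $ r) / sqrt 2))"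

definition q_fun :: "('n::finite \<Rightarrow> nat) \<Rightarrow> real^'n \<Rightarrow> real^'n \<Rightarrow> real" where
  "q_fun k \<xi> v = 2 powr (real CARD('n) / 2) * pi powr (real CARD('n) / 4) * hermite_prod k \<xi> v"

text \<open>\<open>N_op m g j \<xi>\<close> and \<open>R_op m g j \<xi>\<close> are the \<open>j\<close>-th components \<open>(Ng)(\<xi>)\<^sub>j\<close> and \<open>(Rg)(\<xi>)\<^sub>j\<close>,
  for \<open>j\<close> in \<open>{1..d}\<close>.\<close>

definition N_op ::
  "nat \<Rightarrow> ((real^'n::{finite,linorder}) \<times> (real^'n::{finite,linorder}) \<Rightarrow> complex)
     \<Rightarrow> nat \<Rightarrow> real^'n::{finite,linorder} \<Rightarrow> complex" where
  "N_op m g j = (\<lambda>\<xi>. LINT v|nlborel. g (\<xi>, v) * complex_of_real (q_fun (lex_enum m j) \<xi> v))"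

definition R_op ::
  "nat \<Rightarrow> ((real^'n::{finite,linorder}) \<times> (real^'n::{finite,linorder}) \<Rightarrow> complex)
     \<Rightarrow> nat \<Rightarrow> real^'n::{finite,linorder} \<Rightarrow> complex" where
  "R_op m g = N_op m (fourier_plancherel_fst g)"

end

theory Submission
  imports Defs "HOL-Probability.Probability" "HOL-Complex_Analysis.Complex_Analysis"
begin

text \<open>Under \<open>F \<otimes> I\<close> the space \<open>H\<^sub>m\<close> should become the space of all
  \<open>a(\<xi>, v) = \<Sum>\<^sub>k h\<^sub>k(\<xi>) q\<^sub>k\<^sub>,\<^sub>\<xi>(v)\<close> with \<open>h\<^sub>k \<in> L\<^sup>2\<close>.  Given such \<open>h\<^sub>k\<close>, the inverse partial Fourier transform
  \<open>G\<close> of \<open>a\<close> is a Gaussian factor times a sum of Fourier--Laplace transforms of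
  \<open>h\<^sub>k(\<xi>) e\<^bsup>-|\<xi>|\<^sup>2/4\<^esup>\<close> with coefficients polynomial in \<open>Im z\<close> of degree less than \<open>m\<close>, so \<open>G \<in> H\<^sub>m\<close>.
  Orthonormality of the \<open>q\<^sub>k\<^sub>,\<^sub>\<xi>\<close> for fixed \<open>\<xi>\<close> gives \<open>R G = h\<close>, and together with the Plancherel theorem
  \<open>\<parallel>G\<parallel> = \<parallel>h\<parallel>\<close>.

  It remains to prove that \<open>R\<close> is injective.  If \<open>R g = 0\<close>, where \<open>g\<close> comes from \<open>f\<close>, then for
  \<open>\<Phi>(x, y) = f((x + i y) / \<surd>\<alpha>)\<close> the Hermite recursion and the Plancherel theorem yield
  \<open>\<integral> \<Phi>(p) V(y) e\<^bsup>\<langle>b, p\<rangle>\<^esup> e\<^bsup>-|p|\<^sup>2\<^esup> dp = 0\<close> for all \<open>b \<in> \<complex>\<^sup>n\<close> and all polynomials \<open>V\<close> of degree less than \<open>m\<close>.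
  Differentiating in \<open>b\<close>, one may insert \<open>|p - a|\<^bsup>2j\<^esup>\<close> for \<open>j < m\<close>, which after recentring at \<open>a\<close> says
  that a polyanalytic function has \<open>m\<close> vanishing radial Gaussian moments.  Its averages over the
  circles \<open>t \<mapsto> e\<^bsup>it\<^esup> q\<close> are polynomials in \<open>|q|\<^sup>2\<close> of degree less than \<open>m\<close> along every ray, and hence its value
  at the centre is zero.\<close>

section \<open>Normalised Lebesgue measure and square-integrable functions\<close>

text \<open>\<open>fourier_plancherel\<close> chooses one of many almost everywhere equal limits, so
  all reasoning about it goes through the relation \<open>plancherel_rel\<close>. A norm bound with
  some constant already makes that relation single-valued. The exact norm identity is established
  only for inverse transforms of sections of a synthesis, because there the synthesised section is
  itself the transform and can be tested against its own conjugate. The isometry on all of H then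
  costs nothing beyond injectivity: any g equals the preimage built from R g, whose norm is known.
  The weight thus rests on injectivity, which is proved without describing the image of H under F x
  I. What makes it close is that two bounds match: degree below m in Im p supplies exactly the
  powers |p - a|^(2j) with j < m, since each factor |p - a|^2 costs one degree, and a nonzero
  polynomial of degree below m cannot vanish to order m at a point.\<close>

definition nl_const :: "'a::euclidean_space itself \<Rightarrow> real" where
  "nl_const _ = (2 * pi) powr (- real DIM('a) / 2)"

lemma nl_const_pos [simp]: "nl_const TYPE('a::euclidean_space) > 0"
  by (simp add: nl_const_def)

text \<open>In this form the measure inherits the rules for integrals, null sets and
  sigma-finiteness of densities with a positive constant.\<close>

lemma nlborel_density:
  "(nlborel :: 'a::euclidean_space measure) = density lborel (\<lambda>_. ennreal (nl_const TYPE('a)))"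
  by (rule measure_eqI) (auto simp: nlborel_def nl_const_def emeasure_density_const)

lemma sets_nlborel [simp, measurable_cong]: "sets nlborel = sets borel"
  by (simp add: nlborel_density)

lemma space_nlborel [simp]: "space nlborel = UNIV"
  by (simp add: nlborel_density)

lemma AE_nlborel_iff: "(AE x in nlborel. P x) \<longleftrightarrow> (AE x in (lborel :: 'a::euclidean_space measure). P x)"
  unfolding nlborel_density by (subst AE_density) auto

lemma nn_integral_nlborel:
  fixes f :: "'a::euclidean_space \<Rightarrow> ennreal"
  assumes "f \<in> borel_measurable borel"
  shows "(\<integral>\<^sup>+x. f x \<partial>nlborel) = ennreal (nl_const TYPE('a)) * (\<integral>\<^sup>+x. f x \<partial>lborel)"
  using assms by (simp add: nlborel_density nn_integral_density nn_integral_cmult)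

lemma integrable_scaleR_iff:
  fixes f :: "'a \<Rightarrow> 'b::{banach,second_countable_topology}"
  assumes "c \<noteq> 0"
  shows "integrable M (\<lambda>x. c *\<^sub>R f x) \<longleftrightarrow> integrable M f"
  using integrable_scaleR_right[of "1 / c" M "\<lambda>x. c *\<^sub>R f x"] assms by auto

lemma integrable_nlborel_iff:
  fixes f :: "'a::euclidean_space \<Rightarrow> 'b::{banach,second_countable_topology}"
  shows "integrable nlborel f \<longleftrightarrow> integrable lborel f"
proof -
  have "integrable nlborel f \<longleftrightarrow> f \<in> borel_measurable borel \<and> integrable nlborel f"
    using borel_measurable_integrable by force
  also have "\<dots> \<longleftrightarrow> f \<in> borel_measurable borel \<and> integrable lborel f"
    by (rule conj_cong[OF refl])
      (simp add: nlborel_density integrable_density less_imp_le less_imp_neq[OF nl_const_pos, symmetric]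
        integrable_scaleR_iff)
  also have "\<dots> \<longleftrightarrow> integrable lborel f"
    using borel_measurable_integrable by force
  finally show ?thesis .
qed

text \<open>No integrability is assumed: it is equivalent for the two measures, and where it fails
  both integrals have the default value 0.\<close>

lemma integral_nlborel:
  fixes f :: "'a::euclidean_space \<Rightarrow> 'b::{banach,second_countable_topology}"
  shows "(LINT x|nlborel. f x) = nl_const TYPE('a) *\<^sub>R (LINT x|lborel. f x)"
proof (cases "integrable lborel f")
  case True
  then have "f \<in> borel_measurable borel" by auto
  then show ?thesis
    by (simp add: nlborel_density integral_density less_imp_le)
next
  case False
  then show ?thesis by (simp add: not_integrable_integral_eq integrable_nlborel_iff)
qed

lemma sigma_finite_nlborel: "sigma_finite_measure (nlborel :: 'a::euclidean_space measure)"
  unfolding nlborel_density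
  by (subst sigma_finite_measure.sigma_finite_iff_density_finite[OF sigma_finite_lborel]) auto

interpretation nlborel: sigma_finite_measure nlborel
  by (rule sigma_finite_nlborel)

interpretation nlborel_pair: pair_sigma_finite nlborel nlborel ..

lemma nl_const_prod:
  "nl_const TYPE('a::euclidean_space \<times> 'b::euclidean_space) = nl_const TYPE('a) * nl_const TYPE('b)"
  by (simp add: nl_const_def powr_add[symmetric] field_simps)

text \<open>The exponent in \<open>nl_const\<close> is proportional to the dimension, so the
  constants of the factors multiply to that of the product. Fubini can therefore be applied to
  \<open>nlborel\<close> directly.\<close>

lemma nlborel_prod:
  "nlborel \<Otimes>\<^sub>M nlborel = (nlborel :: ('a::euclidean_space \<times> 'b::euclidean_space) measure)"
proof -
  have "nlborel \<Otimes>\<^sub>M nlborel = density (lborel \<Otimes>\<^sub>M lborel)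
      (\<lambda>(x::'a,y::'b). ennreal (nl_const TYPE('a)) * ennreal (nl_const TYPE('b)))"
    unfolding nlborel_density
    by (rule pair_measure_density) (auto simp: sigma_finite_lborel sigma_finite_nlborel[unfolded nlborel_density])
  also have "\<dots> = nlborel"
    by (simp add: nlborel_density lborel_prod nl_const_prod ennreal_mult' less_imp_le case_prod_beta')
  finally show ?thesis .
qed

section \<open>Algebra, Cauchy-Schwarz inequality and completeness of \<open>L2\<close>\<close>

lemma L2_measurable: "f \<in> L2 M \<Longrightarrow> f \<in> borel_measurable M"
  by (simp add: L2_def)

lemma L2_iff: "f \<in> L2 M \<longleftrightarrow> f \<in> borel_measurable M \<and> (\<integral>\<^sup>+x. ennreal ((norm (f x))\<^sup>2) \<partial>M) < \<infinity>"
  unfolding L2_def by (auto simp: integrable_iff_bounded)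

lemma L2_cong_AE:
  assumes "f \<in> L2 M" "g \<in> borel_measurable M" "AE x in M. f x = g x"
  shows "g \<in> L2 M"
proof -
  have "(\<integral>\<^sup>+x. ennreal ((norm (f x))\<^sup>2) \<partial>M) = (\<integral>\<^sup>+x. ennreal ((norm (g x))\<^sup>2) \<partial>M)"
    using assms(3) by (intro nn_integral_cong_AE) auto
  with assms show ?thesis by (simp add: L2_iff)
qed

lemma norm_add_sq_le: "(norm (a + b :: 'a::real_normed_vector))\<^sup>2 \<le> 2 * (norm a)\<^sup>2 + 2 * (norm b)\<^sup>2"
proof -
  have "(norm (a + b))\<^sup>2 \<le> (norm a + norm b)\<^sup>2"
    by (intro power_mono norm_triangle_ineq) auto
  also have "\<dots> \<le> 2 * (norm a)\<^sup>2 + 2 * (norm b)\<^sup>2"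
    using sum_squares_bound[of "norm a" "norm b"] by (simp add: power2_sum)
  finally show ?thesis .
qed

lemma nn_integral_norm_add_sq_le:
  fixes f g :: "'a \<Rightarrow> complex"
  assumes [measurable]: "f \<in> borel_measurable M" "g \<in> borel_measurable M"
  shows "(\<integral>\<^sup>+x. ennreal ((norm (f x + g x))\<^sup>2) \<partial>M) \<le>
     2 * (\<integral>\<^sup>+x. ennreal ((norm (f x))\<^sup>2) \<partial>M) + 2 * (\<integral>\<^sup>+x. ennreal ((norm (g x))\<^sup>2) \<partial>M)"
proof -
  have "(\<integral>\<^sup>+x. ennreal ((norm (f x + g x))\<^sup>2) \<partial>M) \<le>
      (\<integral>\<^sup>+x. 2 * ennreal ((norm (f x))\<^sup>2) + 2 * ennreal ((norm (g x))\<^sup>2) \<partial>M)"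
  proof (rule nn_integral_mono)
    fix x
    have "ennreal ((norm (f x + g x))\<^sup>2) \<le> ennreal (2 * (norm (f x))\<^sup>2 + 2 * (norm (g x))\<^sup>2)"
      by (intro ennreal_leI norm_add_sq_le)
    then show "ennreal ((norm (f x + g x))\<^sup>2) \<le> 2 * ennreal ((norm (f x))\<^sup>2) + 2 * ennreal ((norm (g x))\<^sup>2)"
      by (simp add: ennreal_mult')
  qed
  also have "\<dots> = 2 * (\<integral>\<^sup>+x. ennreal ((norm (f x))\<^sup>2) \<partial>M) + 2 * (\<integral>\<^sup>+x. ennreal ((norm (g x))\<^sup>2) \<partial>M)"
    by (simp add: nn_integral_add nn_integral_cmult)
  finally show ?thesis .
qed

lemma L2_cmult: "f \<in> L2 M \<Longrightarrow> (\<lambda>x. c * f x) \<in> L2 M"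
  by (auto simp: L2_def norm_mult power_mult_distrib)

lemma L2_add: "f \<in> L2 M \<Longrightarrow> g \<in> L2 M \<Longrightarrow> (\<lambda>x. f x + g x) \<in> L2 M"
  using nn_integral_norm_add_sq_le[of f M g]
  by (auto simp: L2_iff elim!: order.strict_trans1 simp: ennreal_mult_less_top)

lemma L2_diff: "f \<in> L2 M \<Longrightarrow> g \<in> L2 M \<Longrightarrow> (\<lambda>x. f x - g x) \<in> L2 M"
  using L2_add[OF _ L2_cmult[of g M "-1"], of f] by simp

lemma L2_zero: "(\<lambda>x. 0) \<in> L2 M"
  by (simp add: L2_def)

lemma L2_sum: "(\<And>i. i \<in> I \<Longrightarrow> f i \<in> L2 M) \<Longrightarrow> (\<lambda>x. \<Sum>i\<in>I. f i x) \<in> L2 M"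
  by (induction I rule: infinite_finite_induct) (auto simp: L2_zero intro!: L2_add)

lemma L2_cnj: "f \<in> L2 M \<Longrightarrow> (\<lambda>x. cnj (f x)) \<in> L2 M"
  by (auto simp: L2_def intro: borel_measurable_continuous_onI[THEN measurable_compose[rotated]]
      continuous_on_cnj)

lemma L2_bounded_mult:
  assumes "f \<in> L2 M" and [measurable]: "g \<in> borel_measurable M" and "\<And>x. norm (g x) \<le> B"
  shows "(\<lambda>x. f x * g x) \<in> L2 M"
proof -
  have [measurable]: "f \<in> borel_measurable M" and i: "integrable M (\<lambda>x. (norm (f x))\<^sup>2)"
    using assms by (auto simp: L2_def)
  have "integrable M (\<lambda>x. (norm (f x * g x))\<^sup>2)"
  proof (rule Bochner_Integration.integrable_bound)
    show "integrable M (\<lambda>x. (norm (f x))\<^sup>2 * B\<^sup>2)" using i by simp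
    show "AE x in M. norm ((norm (f x * g x))\<^sup>2) \<le> norm ((norm (f x))\<^sup>2 * B\<^sup>2)"
      using assms(3) by (auto simp: norm_mult power_mult_distrib intro!: mult_left_mono power_mono)
  qed simp
  then show ?thesis by (simp add: L2_def)
qed

lemma L2_mult_integrable:
  assumes "f \<in> L2 M" "g \<in> L2 M"
  shows "integrable M (\<lambda>x. f x * g x)"
proof (rule Bochner_Integration.integrable_bound)
  show "integrable M (\<lambda>x. (norm (f x))\<^sup>2 + (norm (g x))\<^sup>2)"
    using assms by (auto simp: L2_def)
  show "AE x in M. norm (f x * g x) \<le> norm ((norm (f x))\<^sup>2 + (norm (g x))\<^sup>2)"
  proof (intro always_eventually allI)
    fix x
    show "norm (f x * g x) \<le> norm ((norm (f x))\<^sup>2 + (norm (g x))\<^sup>2)"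
    proof -
      have "0 \<le> norm (f x) * norm (g x)" by simp
      moreover have "norm ((norm (f x))\<^sup>2 + (norm (g x))\<^sup>2) = (norm (f x))\<^sup>2 + (norm (g x))\<^sup>2"
        by simp
      ultimately show ?thesis
        using sum_squares_bound[of "norm (f x)" "norm (g x)"] unfolding norm_mult by linarith
    qed
  qed
  show "(\<lambda>x. f x * g x) \<in> borel_measurable M"
    using assms by (auto simp: L2_def)
qed

lemma nn_integral_L2_eq:
  assumes "f \<in> L2 M"
  shows "(\<integral>\<^sup>+x. ennreal ((norm (f x))\<^sup>2) \<partial>M) = ennreal ((L2_norm M f)\<^sup>2)"
  using assms by (simp add: L2_def L2_norm_def nn_integral_eq_integral)

lemma L2_norm_nonneg: "L2_norm M f \<ge> 0"
  by (simp add: L2_norm_def)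

lemma nn_integral_prod_sq_le:
  assumes [measurable]: "f \<in> borel_measurable M" "g \<in> borel_measurable M"
  shows "(\<integral>\<^sup>+x. ennreal (norm (f x * g x :: complex)) \<partial>M)\<^sup>2 \<le>
    (\<integral>\<^sup>+x. ennreal ((norm (f x))\<^sup>2) \<partial>M) * (\<integral>\<^sup>+x. ennreal ((norm (g x))\<^sup>2) \<partial>M)"
  using Cauchy_Schwarz_nn_integral[of "\<lambda>x. ennreal (norm (f x))" M "\<lambda>x. ennreal (norm (g x))"]
  by (simp add: norm_mult ennreal_mult ennreal_power)

text \<open>Measurability is enough for this form of Cauchy-Schwarz: if the product is not
  integrable, the integral on the left is 0 by convention.\<close>

lemma norm_LINT_mult_sq_le:
  assumes "f \<in> borel_measurable M" "g \<in> borel_measurable M"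
  shows "ennreal ((norm (LINT x|M. f x * g x :: complex))\<^sup>2) \<le>
    (\<integral>\<^sup>+x. ennreal ((norm (f x))\<^sup>2) \<partial>M) * (\<integral>\<^sup>+x. ennreal ((norm (g x))\<^sup>2) \<partial>M)"
proof -
  have "ennreal (norm (LINT x|M. f x * g x)) \<le> (\<integral>\<^sup>+x. ennreal (norm (f x * g x)) \<partial>M)"
    by (cases "integrable M (\<lambda>x. f x * g x)")
       (auto simp: not_integrable_integral_eq intro: integral_norm_bound_ennreal)
  then have "(ennreal (norm (LINT x|M. f x * g x)))\<^sup>2 \<le> (\<integral>\<^sup>+x. ennreal (norm (f x * g x)) \<partial>M)\<^sup>2"
    by (rule power_mono) auto
  with nn_integral_prod_sq_le[OF assms] show ?thesis
    by (simp add: ennreal_power)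
qed

text \<open>Riesz-Fischer with a rate. The increments are summable almost everywhere, and Fatou's
  lemma hands the Cauchy rate on to the limit. The rate matters later, where convergence is needed
  on almost every section.\<close>

lemma L2_complete:
  fixes f :: "nat \<Rightarrow> 'a \<Rightarrow> complex"
  assumes L2: "\<And>k. f k \<in> L2 M"
    and cauchy: "\<And>j k. k \<le> j \<Longrightarrow> (\<integral>\<^sup>+x. ennreal ((norm (f j x - f k x))\<^sup>2) \<partial>M) \<le> ennreal ((1/4) ^ k)"
  obtains g where "g \<in> L2 M" "\<And>k. (\<integral>\<^sup>+x. ennreal ((norm (f k x - g x))\<^sup>2) \<partial>M) \<le> ennreal ((1/4) ^ k)"
proof -
  have [measurable]: "f k \<in> borel_measurable M" for k using L2 by (simp add: L2_def)
  let ?D = "\<lambda>k x. f (Suc k) x - f k x"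
  \<comment> \<open>The weight 2^k still leaves a convergent sum of integrals, and finiteness of the
    weighted sum at a point bounds the k-th increment there by a multiple of 2^(-k/2), which is
    summable.\<close>
  have "(\<integral>\<^sup>+x. (\<Sum>k. ennreal (2 ^ k * (norm (?D k x))\<^sup>2)) \<partial>M)
      = (\<Sum>k. \<integral>\<^sup>+x. ennreal (2 ^ k * (norm (?D k x))\<^sup>2) \<partial>M)"
    by (rule nn_integral_suminf) simp
  also have "\<dots> \<le> (\<Sum>k. ennreal ((1/2) ^ k))"
  proof (intro suminf_le summableI)
    fix k
    have "(\<integral>\<^sup>+x. ennreal (2 ^ k * (norm (?D k x))\<^sup>2) \<partial>M) = ennreal (2 ^ k) * (\<integral>\<^sup>+x. ennreal ((norm (?D k x))\<^sup>2) \<partial>M)"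
      by (simp add: ennreal_mult' nn_integral_cmult)
    also have "\<dots> \<le> ennreal (2 ^ k) * ennreal ((1/4) ^ k)"
      by (intro mult_left_mono cauchy) auto
    also have "\<dots> = ennreal ((1/2) ^ k)"
      by (simp add: ennreal_mult'[symmetric] power_mult_distrib[symmetric])
    finally show "(\<integral>\<^sup>+x. ennreal (2 ^ k * (norm (?D k x))\<^sup>2) \<partial>M) \<le> ennreal ((1/2) ^ k)" .
  qed
  also have "\<dots> = ennreal (\<Sum>k. (1/2) ^ k)"
    by (intro suminf_ennreal2 summable_geometric) auto
  also have "\<dots> < \<infinity>" by simp
  finally have "AE x in M. (\<Sum>k. ennreal (2 ^ k * (norm (?D k x))\<^sup>2)) \<noteq> \<infinity>"
    by (intro nn_integral_PInf_AE) auto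
  then have conv: "AE x in M. convergent (\<lambda>k. f k x)"
  proof eventually_elim
    case (elim x)
    then have s: "summable (\<lambda>k. 2 ^ k * (norm (?D k x))\<^sup>2)"
      by (intro summable_suminf_not_top) auto
    then have "(\<lambda>k. 2 ^ k * (norm (?D k x))\<^sup>2) \<longlonglongrightarrow> 0" by (rule summable_LIMSEQ_zero)
    then obtain B where B: "\<And>k. norm (2 ^ k * (norm (?D k x))\<^sup>2) \<le> B"
      using convergent_imp_Bseq[of "\<lambda>k. 2 ^ k * (norm (?D k x))\<^sup>2"] by (auto simp: Bseq_def convergent_def)
    have B0: "B \<ge> 0" using B[of 0] norm_ge_zero order_trans by blast
    have "norm (?D k x) \<le> sqrt B * (1 / sqrt 2) ^ k" for k
    proof -
      have "(norm (?D k x))\<^sup>2 \<le> B * (1/2) ^ k"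
        using B[of k] by (simp add: field_simps power_divide)
      then have "sqrt ((norm (?D k x))\<^sup>2) \<le> sqrt (B * (1/2) ^ k)"
        by (rule real_sqrt_le_mono)
      then show ?thesis by (simp add: real_sqrt_mult real_sqrt_power[symmetric] real_sqrt_divide power_one_over)
    qed
    moreover have "summable (\<lambda>k. sqrt B * (1 / sqrt 2) ^ k)"
      by (intro summable_mult summable_geometric) auto
    ultimately have "summable (\<lambda>k. ?D k x)"
      by (rule summable_comparison_test'[where N=0, rotated])
    then have "convergent (\<lambda>n. \<Sum>k<n. ?D k x)" by (simp add: summable_iff_convergent)
    then have "convergent (\<lambda>n. f n x - f 0 x)" by (simp add: sum_lessThan_telescope[of "\<lambda>k. f k x"])
    then have "convergent (\<lambda>n. (f n x - f 0 x) + f 0 x)" by (intro convergent_add convergent_const)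
    then show ?case by simp
  qed
  define g where "g x = lim (\<lambda>k. f k x)" for x
  have [measurable]: "g \<in> borel_measurable M"
    unfolding g_def by measurable
  have lim: "AE x in M. (\<lambda>k. f k x) \<longlonglongrightarrow> g x"
    using conv by eventually_elim (simp add: g_def convergent_LIMSEQ_iff)
  have bound: "(\<integral>\<^sup>+x. ennreal ((norm (f k x - g x))\<^sup>2) \<partial>M) \<le> ennreal ((1/4) ^ k)" for k
  proof -
    have "(\<integral>\<^sup>+x. ennreal ((norm (f k x - g x))\<^sup>2) \<partial>M)
        = (\<integral>\<^sup>+x. liminf (\<lambda>j. ennreal ((norm (f j x - f k x))\<^sup>2)) \<partial>M)"
    proof (rule nn_integral_cong_AE, use lim in eventually_elim)
      case (elim x)
      then have "(\<lambda>j. ennreal ((norm (f j x - f k x))\<^sup>2)) \<longlonglongrightarrow> ennreal ((norm (g x - f k x))\<^sup>2)"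
        by (intro tendsto_intros tendsto_ennrealI) auto
      from lim_imp_Liminf[OF _ this] show ?case by (simp add: norm_minus_commute)
    qed
    also have "\<dots> \<le> liminf (\<lambda>j. \<integral>\<^sup>+x. ennreal ((norm (f j x - f k x))\<^sup>2) \<partial>M)"
      by (intro nn_integral_liminf) auto
    also have "\<dots> \<le> limsup (\<lambda>j. \<integral>\<^sup>+x. ennreal ((norm (f j x - f k x))\<^sup>2) \<partial>M)"
      by (rule Liminf_le_Limsup) simp
    also have "\<dots> \<le> ennreal ((1/4) ^ k)"
      by (intro Limsup_bounded) (auto intro!: eventually_sequentiallyI[of k] cauchy)
    finally show ?thesis .
  qed
  have "(\<lambda>x. f 0 x - g x) \<in> L2 M"
    using bound[of 0] by (auto simp: L2_iff intro: order.strict_trans1)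
  then have "(\<lambda>x. f 0 x - (f 0 x - g x)) \<in> L2 M"
    using L2[of 0] by (rule L2_diff[rotated])
  then have "g \<in> L2 M" by simp
  with bound that show ?thesis by blast
qed

section \<open>Gaussian integrals and linear substitutions\<close>

text \<open>\<open>lborel\<close> is by definition the image of a product of one-dimensional
  Lebesgue measures under expansion in the basis; pulled back along that map the claim is Fubini for
  finite products.\<close>

lemma lborel_integral_prod:
  fixes f :: "'a::euclidean_space \<Rightarrow> real \<Rightarrow> complex"
  assumes "\<And>b. b \<in> Basis \<Longrightarrow> integrable lborel (f b)"
  shows "integrable lborel (\<lambda>x::'a. \<Prod>b\<in>Basis. f b (x \<bullet> b))"
    and "(LINT x|lborel. (\<Prod>b\<in>Basis. f b ((x::'a) \<bullet> b))) = (\<Prod>b\<in>Basis. (LINT t|lborel. f b t))"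
proof -
  have [measurable]: "f b \<in> borel_measurable borel" if "b \<in> Basis" for b
    using assms[OF that] by auto
  interpret I: finite_product_sigma_finite "\<lambda>_. lborel :: real measure" "Basis :: 'a set"
    by standard simp
  have eq: "(lborel :: 'a measure) = distr (\<Pi>\<^sub>M b\<in>Basis. lborel) borel (\<lambda>f. \<Sum>b\<in>Basis. f b *\<^sub>R b)"
    by (subst lborel_def) (simp add: lborel_eq_real)
  have m: "(\<lambda>x::'a. \<Prod>b\<in>Basis. f b (x \<bullet> b)) \<in> borel_measurable borel"
    by measurable
  have m2: "(\<lambda>f. \<Sum>b\<in>Basis. f b *\<^sub>R b) \<in> measurable (\<Pi>\<^sub>M b\<in>(Basis :: 'a set). lborel) (borel :: 'a measure)"
    by measurable
  have int: "integrable (\<Pi>\<^sub>M b\<in>Basis. lborel) (\<lambda>x. \<Prod>b\<in>Basis. f b (x b))"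
    using assms by (intro I.product_integrable_prod) auto
  show "integrable lborel (\<lambda>x::'a. \<Prod>b\<in>Basis. f b (x \<bullet> b))"
    unfolding eq
    by (subst integrable_distr_eq[OF m2 m])
      (use int in \<open>auto simp: inner_sum_left_Basis cong: prod.cong\<close>)
  show "(LINT x|lborel. (\<Prod>b\<in>Basis. f b ((x::'a) \<bullet> b))) = (\<Prod>b\<in>Basis. (LINT t|lborel. f b t))"
    unfolding eq
    by (subst integral_distr[OF m2 m])
      (use I.product_integral_prod[of Basis f] assms in \<open>auto simp: inner_sum_left_Basis cong: prod.cong\<close>)
qed

lemma prod_Basis_vec:
  fixes F :: "real ^ 'n \<Rightarrow> 'b::comm_monoid_mult"
  shows "(\<Prod>b\<in>Basis. F b) = (\<Prod>i\<in>UNIV. F (axis i 1))"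
proof -
  have B: "(Basis :: (real^'n) set) = range (\<lambda>i. axis i 1)"
    by (auto simp: Basis_vec_def)
  have "inj (\<lambda>i::'n. axis i (1::real))"
    by (auto simp: inj_on_def axis_eq_axis)
  from prod.reindex[OF this, of F] show ?thesis unfolding B by (simp add: o_def)
qed

lemma lborel_vec_integral_prod:
  fixes f :: "'n::finite \<Rightarrow> real \<Rightarrow> complex"
  assumes "\<And>i. integrable lborel (f i)"
  shows "integrable lborel (\<lambda>x::real^'n. \<Prod>i\<in>UNIV. f i (x $ i))"
    and "(LINT x|lborel. (\<Prod>i\<in>UNIV. f i ((x::real^'n) $ i))) = (\<Prod>i\<in>UNIV. (LINT t|lborel. f i t))"
  using lborel_integral_prod[of "\<lambda>b::real^'n. f (axis_index b)"] assms
  by (simp_all add: prod_Basis_vec inner_axis axis_index_axis)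

section \<open>Translations and dilations of Lebesgue measure\<close>

lemma integrable_lborel_plus_iff:
  fixes f :: "'a::euclidean_space \<Rightarrow> 'b::{banach,second_countable_topology}"
  shows "integrable lborel (\<lambda>x. f (x + t)) \<longleftrightarrow> integrable lborel f"
    and "(LINT x|lborel. f (x + t)) = (LINT x|lborel. f x)"
proof -
  have *: "integrable lborel (\<lambda>x. f (x + t))" if "integrable lborel f" for f :: "'a \<Rightarrow> 'b" and t
    using that integrable_distr_eq[of "(+) t" lborel borel f]
    by (auto simp: lborel_distr_plus add.commute)
  show "integrable lborel (\<lambda>x. f (x + t)) \<longleftrightarrow> integrable lborel f"
    using *[of f t] *[of "\<lambda>x. f (x + t)" "- t"] by auto
  have "(LINT x|lborel. f (x + t)) = (LINT x|lborel. f x)" if "integrable lborel f" for f :: "'a \<Rightarrow> 'b"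
    using that integral_distr[of "(+) t" lborel borel f]
    by (auto simp: lborel_distr_plus add.commute)
  then show "(LINT x|lborel. f (x + t)) = (LINT x|lborel. f x)"
    using \<open>integrable lborel (\<lambda>x. f (x + t)) \<longleftrightarrow> integrable lborel f\<close>
    by (cases "integrable lborel f") (auto simp: not_integrable_integral_eq)
qed

lemma nn_integral_lborel_plus:
  fixes f :: "'a::euclidean_space \<Rightarrow> ennreal"
  assumes "f \<in> borel_measurable borel"
  shows "(\<integral>\<^sup>+x. f (x + t) \<partial>lborel) = (\<integral>\<^sup>+x. f x \<partial>lborel)"
  using nn_integral_distr[of "(+) t" lborel borel f] assms
  by (simp add: lborel_distr_plus add.commute)

lemma nn_integral_lborel_scale:
  fixes f :: "'a::euclidean_space \<Rightarrow> ennreal"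
  assumes [measurable]: "f \<in> borel_measurable borel" and "c \<noteq> 0"
  shows "(\<integral>\<^sup>+x. f x \<partial>lborel) = ennreal (\<bar>c\<bar> ^ DIM('a)) * (\<integral>\<^sup>+x. f (c *\<^sub>R x) \<partial>lborel)"
  by (subst lborel_affine[OF \<open>c \<noteq> 0\<close>, of 0])
    (simp add: nn_integral_density nn_integral_distr nn_integral_cmult)

lemma integral_lborel_scale:
  fixes f :: "'a::euclidean_space \<Rightarrow> 'b::{banach,second_countable_topology}"
  assumes "integrable lborel f" and "c \<noteq> 0"
  shows "integrable lborel (\<lambda>x. f (c *\<^sub>R x))"
    and "(LINT x|lborel. f x) = (\<bar>c\<bar> ^ DIM('a)) *\<^sub>R (LINT x|lborel. f (c *\<^sub>R x))"
proof -
  have [measurable]: "f \<in> borel_measurable borel" using assms by auto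
  have f: "integrable (density (distr lborel borel ((*\<^sub>R) c)) (\<lambda>_. ennreal (\<bar>c\<bar> ^ DIM('a)))) f"
    using assms lborel_affine[OF \<open>c \<noteq> 0\<close>, of "0::'a"] by simp
  then show "integrable lborel (\<lambda>x. f (c *\<^sub>R x))"
    using \<open>c \<noteq> 0\<close> by (simp add: integrable_density integrable_distr_eq integrable_scaleR_iff)
  show "(LINT x|lborel. f x) = (\<bar>c\<bar> ^ DIM('a)) *\<^sub>R (LINT x|lborel. f (c *\<^sub>R x))"
    by (subst lborel_affine[OF \<open>c \<noteq> 0\<close>, of 0])
      (simp add: integral_density integral_distr)
qed

section \<open>Gaussian integrals\<close>

lemma norm_sq_Basis: "(norm (x::'a::euclidean_space))\<^sup>2 = (\<Sum>b\<in>Basis. (x \<bullet> b)\<^sup>2)"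
  unfolding power2_norm_eq_inner by (subst euclidean_inner) (simp add: power2_eq_square)

text \<open>Up to the factor sqrt(2 pi) this is the characteristic function of the standard normal
  distribution.\<close>

lemma gauss_real_char:
  "integrable lborel (\<lambda>t. exp (complex_of_real (- t\<^sup>2 / 2) + \<i> * complex_of_real (t * p)))"
  "(LINT t|lborel. exp (complex_of_real (- t\<^sup>2 / 2) + \<i> * complex_of_real (t * p)))
     = sqrt (2 * pi) * exp (complex_of_real (- p\<^sup>2 / 2))"
proof -
  have eq: "exp (complex_of_real (- t\<^sup>2 / 2) + \<i> * complex_of_real (t * p))
      = sqrt (2 * pi) *\<^sub>R (normal_density 0 1 t *\<^sub>R iexp (p * t))" for t
    unfolding exp_add exp_of_real by (simp add: normal_density_def scaleR_conv_of_real mult_ac)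
  have n: "integrable lborel (normal_density 0 1)"
    using integrable_normal_moment[of 1 0 0] by simp
  have i: "integrable lborel (\<lambda>t. normal_density 0 1 t *\<^sub>R iexp (p * t))"
    by (rule Bochner_Integration.integrable_bound[OF n]) (auto simp: normal_density_nonneg)
  then show "integrable lborel (\<lambda>t. exp (complex_of_real (- t\<^sup>2 / 2) + \<i> * complex_of_real (t * p)))"
    unfolding eq by (rule integrable_scaleR_right)
  have "char std_normal_distribution p = (LINT t|lborel. normal_density 0 1 t *\<^sub>R iexp (p * t))"
    unfolding char_def by (subst integral_density) (auto simp: normal_density_nonneg)
  then show "(LINT t|lborel. exp (complex_of_real (- t\<^sup>2 / 2) + \<i> * complex_of_real (t * p)))
     = sqrt (2 * pi) * exp (complex_of_real (- p\<^sup>2 / 2))"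
    unfolding eq using i
    by (simp add: char_std_normal_distribution scaleR_conv_of_real exp_of_real[symmetric])
qed

text \<open>A real tilt q needs no shift of contour: -|\<xi>|^2/2 - \<xi>.q equals |q|^2/2 - |\<xi>
  + q|^2/2, so it is a real translation of the untilted case, and the translation turns the
  frequency p into the phase -i p.q.\<close>

lemma gauss_fourier:
  fixes p q :: "'a::euclidean_space"
  shows "integrable nlborel (\<lambda>\<xi>. exp (complex_of_real (- (norm \<xi>)\<^sup>2 / 2 - \<xi> \<bullet> q) + \<i> * complex_of_real (\<xi> \<bullet> p)))"
    and "(LINT \<xi>|nlborel. exp (complex_of_real (- (norm \<xi>)\<^sup>2 / 2 - \<xi> \<bullet> q) + \<i> * complex_of_real (\<xi> \<bullet> p)))
      = exp (complex_of_real (((norm q)\<^sup>2 - (norm p)\<^sup>2) / 2) - \<i> * complex_of_real (p \<bullet> q))"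
proof -
  let ?g = "\<lambda>\<xi>::'a. exp (complex_of_real (- (norm \<xi>)\<^sup>2 / 2) + \<i> * complex_of_real (\<xi> \<bullet> p))"
  let ?h = "\<lambda>\<xi>::'a. exp (complex_of_real (- (norm \<xi>)\<^sup>2 / 2 - \<xi> \<bullet> q) + \<i> * complex_of_real (\<xi> \<bullet> p))"
  define c where "c = exp (complex_of_real ((norm q)\<^sup>2 / 2) - \<i> * complex_of_real (p \<bullet> q))"
  have prod: "?g \<xi> = (\<Prod>b\<in>Basis. exp (complex_of_real (- (\<xi> \<bullet> b)\<^sup>2 / 2) + \<i> * complex_of_real ((\<xi> \<bullet> b) * (p \<bullet> b))))" for \<xi>
    by (simp add: exp_sum[symmetric] sum_subtractf sum_divide_distrib[symmetric] sum_distrib_left[symmetric]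
      norm_sq_Basis euclidean_inner[of \<xi> p])
  have i: "integrable lborel ?g"
    unfolding prod by (rule lborel_integral_prod(1)) (rule gauss_real_char)
  \<comment> \<open>This is where the normalisation of the measure comes from: the standard Gaussian
    has total mass 1.\<close>
  have pi: "nl_const TYPE('a) * (sqrt (2 * pi)) ^ DIM('a) = 1"
    by (simp add: nl_const_def powr_half_sqrt[symmetric] powr_realpow[symmetric] powr_powr powr_add[symmetric])
  have "(LINT \<xi>|lborel. ?g \<xi>) = (\<Prod>b\<in>Basis. complex_of_real (sqrt (2 * pi)) * exp (complex_of_real (- (p \<bullet> b)\<^sup>2 / 2)))"
    unfolding prod by (subst lborel_integral_prod(2)) (simp_all only: gauss_real_char)
  also have "\<dots> = complex_of_real ((sqrt (2 * pi)) ^ DIM('a)) * exp (complex_of_real (- (norm p)\<^sup>2 / 2))"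
    by (simp add: prod.distrib exp_sum[symmetric] sum_negf sum_divide_distrib[symmetric] norm_sq_Basis)
  finally have g: "(LINT \<xi>|nlborel. ?g \<xi>) = exp (complex_of_real (- (norm p)\<^sup>2 / 2))"
    using arg_cong[OF pi, of complex_of_real]
    by (simp add: integral_nlborel scaleR_conv_of_real mult.assoc[symmetric] del: of_real_power)
  have h: "?h \<xi> = c * ?g (\<xi> + q)" for \<xi>
    by (simp add: c_def exp_add[symmetric] power2_norm_eq_inner inner_add_left inner_add_right
        inner_commute algebra_simps add_divide_distrib diff_divide_distrib)
  show "integrable nlborel ?h"
    unfolding h integrable_nlborel_iff
    by (intro integrable_mult_right integrable_lborel_plus_iff(1)[THEN iffD2] i)
  have "(LINT \<xi>|nlborel. ?h \<xi>) = c * (LINT \<xi>|nlborel. ?g \<xi>)"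
    unfolding h integral_nlborel using integrable_lborel_plus_iff(2)[of ?g q] by simp
  also have "\<dots> = exp (complex_of_real (((norm q)\<^sup>2 - (norm p)\<^sup>2) / 2) - \<i> * complex_of_real (p \<bullet> q))"
    unfolding g c_def by (simp add: exp_add[symmetric] diff_divide_distrib algebra_simps)
  finally show "(LINT \<xi>|nlborel. ?h \<xi>) = exp (complex_of_real (((norm q)\<^sup>2 - (norm p)\<^sup>2) / 2) - \<i> * complex_of_real (p \<bullet> q))" .
qed

lemma integrable_exp_norm:
  fixes c :: real
  assumes "a > 0"
  shows "integrable lborel (\<lambda>x::'a::euclidean_space. exp (- a * (norm x)\<^sup>2 + c * norm x))"
proof -
  have g: "integrable lborel (\<lambda>x::'a. exp (- (norm x)\<^sup>2 / 2))"
    using integrable_norm[OF gauss_fourier(1)[of "0::'a" 0]] by (simp add: integrable_nlborel_iff)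
  have "integrable lborel (\<lambda>x::'a. exp (c\<^sup>2 / (2 * a)) * exp (- (norm (sqrt a *\<^sub>R x))\<^sup>2 / 2))"
    using assms by (intro integrable_mult_right integral_lborel_scale(1)[OF g]) auto
  then show ?thesis
  proof (rule Bochner_Integration.integrable_bound)
    show "AE x in lborel. norm (exp (- a * (norm (x::'a))\<^sup>2 + c * norm x)) \<le>
        norm (exp (c\<^sup>2 / (2 * a)) * exp (- (norm (sqrt a *\<^sub>R x))\<^sup>2 / 2))"
    proof (intro always_eventually allI)
      fix x :: 'a
      \<comment> \<open>Expanded and divided by 2a, this bounds c|x| by a constant plus half of the
        Gaussian exponent; the other half remains for integrability.\<close>
      have "0 \<le> (a * norm x - c)\<^sup>2" by simp
      then have "c * norm x \<le> c\<^sup>2 / (2 * a) + a * (norm x)\<^sup>2 / 2"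
        using assms by (simp add: power2_eq_square field_simps)
      then have "- a * (norm x)\<^sup>2 + c * norm x \<le> c\<^sup>2 / (2 * a) - a * (norm x)\<^sup>2 / 2"
        by simp
      then show "norm (exp (- a * (norm x)\<^sup>2 + c * norm x)) \<le>
        norm (exp (c\<^sup>2 / (2 * a)) * exp (- (norm (sqrt a *\<^sub>R x))\<^sup>2 / 2))"
        using assms by (simp add: exp_add[symmetric] power_mult_distrib)
    qed
  qed measurable
qed

section \<open>The identification of pairs of real vectors with complex vectors\<close>

definition cvec :: "(real^'n) \<times> (real^'n) \<Rightarrow> complex^'n" where
  "cvec p = (\<chi> r. Complex (fst p $ r) (snd p $ r))"

lemma cvec_nth: "cvec p $ r = Complex (fst p $ r) (snd p $ r)"
  by (simp add: cvec_def)

lemma bounded_linear_cvec: "bounded_linear (cvec :: (real^'n) \<times> (real^'n) \<Rightarrow> complex^'n)"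
  by (rule linear_conv_bounded_linear[THEN iffD1], unfold_locales)
    (auto simp: vec_eq_iff complex_eq_iff cvec_nth)

lemma norm_cvec: "(norm (cvec (x, y)))\<^sup>2 = (norm x)\<^sup>2 + (norm y)\<^sup>2"
  by (simp add: norm_vec_def L2_set_def sum_nonneg cmod_power2 sum.distrib cvec_nth)

lemma Basis_complex_vec:
  "(Basis :: (complex^'n) set) = range (\<lambda>i. axis i 1) \<union> range (\<lambda>i. axis i \<i>)"
  by (auto simp: Basis_vec_def Basis_complex_def)

text \<open>Lebesgue measure is determined by boxes, and the preimage of a box in complex space is
  the product of the boxes of real parts and of imaginary parts.\<close>

lemma distr_cvec: "distr lborel borel cvec = (lborel :: (complex^'n) measure)"
proof (rule lborel_eqI[symmetric])
  fix l u :: "complex^'n"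
  assume le: "\<And>b. b \<in> Basis \<Longrightarrow> l \<bullet> b \<le> u \<bullet> b"
  define lr li ur ui :: "real^'n" where "lr = (\<chi> i. Re (l$i))" and "li = (\<chi> i. Im (l$i))"
    and "ur = (\<chi> i. Re (u$i))" and "ui = (\<chi> i. Im (u$i))"
  have le1: "Re (l$i) \<le> Re (u$i)" and le2: "Im (l$i) \<le> Im (u$i)" for i
    using le[of "axis i 1"] le[of "axis i \<i>"]
    by (auto simp: Basis_complex_vec inner_axis inner_complex_def)
  have inv: "cvec -` box l u = box lr ur \<times> box li ui"
    by (auto simp: mem_box cvec_nth Basis_complex_vec ball_Un inner_axis inner_complex_def lr_def li_def ur_def ui_def
        Basis_vec_def)
  have inj: "inj (\<lambda>i::'n. axis i (1::complex))" "inj (\<lambda>i::'n. axis i \<i>)"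
    by (auto simp: inj_on_def axis_eq_axis)
  have disj: "range (\<lambda>i::'n. axis i (1::complex)) \<inter> range (\<lambda>i. axis i \<i>) = {}"
    by (auto simp: axis_eq_axis)
  have "emeasure (distr lborel borel cvec) (box l u) = emeasure lborel (cvec -` box l u)"
    using linear_continuous_on[OF bounded_linear_cvec]
    by (subst emeasure_distr) (auto intro: borel_measurable_continuous_onI)
  also have "\<dots> = emeasure (lborel :: (real^'n) measure) (box lr ur) * emeasure (lborel :: (real^'n) measure) (box li ui)"
    unfolding inv by (simp add: lborel.emeasure_pair_measure_Times flip: lborel_prod)
  also have "\<dots> = (\<Prod>b\<in>Basis. (ur - lr) \<bullet> b) * (\<Prod>b\<in>Basis. (ui - li) \<bullet> b)"
    using le1 le2 
    by (simp add: emeasure_lborel_box_eq Basis_vec_def inner_axis lr_def li_def ur_def ui_def inner_diff_left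
        del: ennreal_mult)
      (subst ennreal_mult, auto intro!: prod_nonneg simp: inner_axis)
  also have "(\<Prod>b\<in>Basis. (ur - lr) \<bullet> b) * (\<Prod>b\<in>Basis. (ui - li) \<bullet> b) = (\<Prod>b\<in>Basis. (u - l) \<bullet> b)"
    unfolding Basis_complex_vec
    by (subst prod.union_disjoint)
      (use disj in \<open>auto simp: prod.reindex inj o_def prod_Basis_vec inner_axis inner_complex_def lr_def li_def ur_def ui_def\<close>)
  finally show "emeasure (distr lborel borel cvec) (box l u) = (\<Prod>b\<in>Basis. (u - l) \<bullet> b)" .
qed simp

lemma cvec_measurable [measurable]: "cvec \<in> borel_measurable borel"
  by (intro borel_measurable_continuous_onI linear_continuous_on bounded_linear_cvec)

lemma integrable_cvec_iff:
  fixes f :: "complex^'n \<Rightarrow> 'b::{banach,second_countable_topology}"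
  assumes "f \<in> borel_measurable borel"
  shows "integrable lborel (\<lambda>p. f (cvec p)) \<longleftrightarrow> integrable lborel f"
  using integrable_distr_eq[of "cvec :: (real^'n) \<times> (real^'n) \<Rightarrow> complex^'n" lborel borel f] assms
  by (simp add: distr_cvec)

section \<open>Shears, rotations and the invariance of Lebesgue measure\<close>

definition rot :: "real \<Rightarrow> 'a::euclidean_space \<times> 'a \<Rightarrow> 'a \<times> 'a" where
  "rot \<theta> = (\<lambda>(x, y). (cos \<theta> *\<^sub>R x - sin \<theta> *\<^sub>R y, sin \<theta> *\<^sub>R x + cos \<theta> *\<^sub>R y))"

lemma rot_measurable [measurable]: "rot \<theta> \<in> borel_measurable borel"
  unfolding rot_def case_prod_beta'
  by (intro borel_measurable_continuous_onI continuous_intros)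

definition preserves :: "('a::euclidean_space \<Rightarrow> 'a) \<Rightarrow> bool" where
  "preserves T \<longleftrightarrow> T \<in> borel_measurable borel \<and> distr lborel borel T = lborel"

lemma preserves_comp: "preserves S \<Longrightarrow> preserves T \<Longrightarrow> preserves (\<lambda>x. S (T x))"
  unfolding preserves_def
  using distr_distr[of S borel borel T lborel] by (auto simp: comp_def)

text \<open>For fixed y the shear is a translation in x, so Fubini reduces the claim to translation
  invariance.\<close>

lemma preserves_shear1:
  "preserves (\<lambda>(x::'a::euclidean_space, y::'a). (x + t *\<^sub>R y, y))"
proof -
  let ?T = "\<lambda>(x::'a, y::'a). (x + t *\<^sub>R y, y)"
  have [measurable]: "?T \<in> borel_measurable borel"
    unfolding case_prod_beta' by (intro borel_measurable_continuous_onI continuous_intros)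
  have "distr lborel borel ?T = lborel"
  proof (rule measure_eqI)
    fix A assume "A \<in> sets (distr lborel borel ?T)"
    then have A[measurable]: "A \<in> sets (borel :: ('a \<times> 'a) measure)" by simp
    have "emeasure (distr lborel borel ?T) A = (\<integral>\<^sup>+p. indicator A (?T p) \<partial>lborel)"
      using nn_integral_distr[of ?T lborel borel "indicator A"] by simp
    also have "\<dots> = (\<integral>\<^sup>+y. (\<integral>\<^sup>+x. indicator A (x + t *\<^sub>R y, y) \<partial>lborel) \<partial>lborel)"
      by (subst lborel_prod[symmetric], subst lborel_pair.nn_integral_snd[symmetric]) (auto simp: lborel_prod)
    also have "\<dots> = (\<integral>\<^sup>+y. (\<integral>\<^sup>+x. indicator A (x, y) \<partial>lborel) \<partial>lborel)"
    proof (rule nn_integral_cong)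
      fix y :: 'a
      have "(\<lambda>x. indicator A (x, y) :: ennreal) \<in> borel_measurable borel"
        by measurable
      then show "(\<integral>\<^sup>+x. indicator A (x + t *\<^sub>R y, y) \<partial>lborel) = (\<integral>\<^sup>+x. indicator A (x, y) \<partial>lborel)"
        using nn_integral_lborel_plus[of "\<lambda>x. indicator A (x, y)" "t *\<^sub>R y"] by simp
    qed
    also have "\<dots> = (\<integral>\<^sup>+p. indicator A p \<partial>lborel)"
      by (subst lborel_prod[symmetric], subst lborel_pair.nn_integral_snd[symmetric]) (auto simp: lborel_prod)
    also have "\<dots> = emeasure lborel A" by simp
    finally show "emeasure (distr lborel borel ?T) A = emeasure lborel A" .
  qed simp
  then show ?thesis by (simp add: preserves_def)
qed

lemma preserves_swap: "preserves (\<lambda>(x::'a::euclidean_space, y::'a). (y, x))"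
proof -
  have [measurable]: "(\<lambda>(x::'a, y::'a). (y, x)) \<in> borel_measurable borel"
    unfolding case_prod_beta' by (intro borel_measurable_continuous_onI continuous_intros)
  then show ?thesis
    using lborel_pair.distr_pair_swap[where 'a='a and 'b='a]
    by (simp add: preserves_def lborel_prod borel_prod distr_cong[OF refl sets_lborel[symmetric]])
qed

lemma preserves_shear2:
  "preserves (\<lambda>(x::'a::euclidean_space, y::'a). (x, y + t *\<^sub>R x))"
  using preserves_comp[OF preserves_swap preserves_comp[OF preserves_shear1 preserves_swap]]
  by (simp add: case_prod_beta')

text \<open>A rotation by an angle other than a multiple of \<open>\<pi>\<close> is a product of three shears.\<close>

lemma preserves_rot_aux:
  assumes "cos (\<theta> / 2) \<noteq> 0"
  shows "preserves (rot \<theta> :: 'a::euclidean_space \<times> 'a \<Rightarrow> _)"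
proof -
  define t where "t = tan (\<theta> / 2)"
  have s: "sin \<theta> = 2 * sin (\<theta>/2) * cos (\<theta>/2)" and c: "cos \<theta> = 2 * (cos (\<theta>/2))\<^sup>2 - 1"
    using sin_double[of "\<theta>/2"] cos_double_cos[of "\<theta>/2"] by simp_all
  have 1: "1 - t * sin \<theta> = cos \<theta>"
    using assms sin_squared_eq[of "\<theta>/2"] unfolding s c t_def tan_def
    by (simp add: power2_eq_square)
  have "t * cos (\<theta>/2) = sin (\<theta>/2)" using assms by (simp add: t_def tan_def)
  then have "t * cos \<theta> = 2 * sin (\<theta>/2) * cos (\<theta>/2) - t"
    unfolding c by (simp add: power2_eq_square algebra_simps)
  then have 2: "t + t * cos \<theta> = sin \<theta>" by (simp add: s)
  have "rot \<theta> = (\<lambda>p::'a\<times>'a. (\<lambda>(x, y). (x + (-t) *\<^sub>R y, y)) ((\<lambda>(x, y). (x, y + sin \<theta> *\<^sub>R x)) ((\<lambda>(x, y). (x + (-t) *\<^sub>R y, y)) p)))"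
  proof (rule ext)
    fix p :: "'a \<times> 'a"
    obtain x y where p: "p = (x, y)" by fastforce
    have sc: "(t * 2) *\<^sub>R y = t *\<^sub>R y + t *\<^sub>R y" by (simp flip: scaleR_left_distrib)
    have "x - t *\<^sub>R y - t *\<^sub>R (y + sin \<theta> *\<^sub>R (x - t *\<^sub>R y)) = (1 - t * sin \<theta>) *\<^sub>R x - (t + t * (1 - t * sin \<theta>)) *\<^sub>R y"
      by (simp add: algebra_simps sc)
    moreover have "y + sin \<theta> *\<^sub>R (x - t *\<^sub>R y) = sin \<theta> *\<^sub>R x + (1 - t * sin \<theta>) *\<^sub>R y"
      by (simp add: algebra_simps)
    ultimately show "rot \<theta> p = (\<lambda>(x, y). (x + (-t) *\<^sub>R y, y)) ((\<lambda>(x, y). (x, y + sin \<theta> *\<^sub>R x)) ((\<lambda>(x, y). (x + (-t) *\<^sub>R y, y)) p))"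
      by (simp add: p rot_def 1 2)
  qed
  moreover have "preserves \<dots>"
    by (intro preserves_comp[OF preserves_shear1 preserves_comp[OF preserves_shear2 preserves_shear1]])
  ultimately show ?thesis by simp
qed

text \<open>The factorisation into shears has slope tan(\<theta>/2) and breaks down at a half turn.
  Two rotations by half the angle avoid this, as long as the full angle stays strictly below a full
  turn.\<close>

lemma preserves_rot:
  assumes "\<bar>\<theta>\<bar> < 2 * pi"
  shows "preserves (rot \<theta> :: 'a::euclidean_space \<times> 'a \<Rightarrow> _)"
proof -
  have "cos (\<theta> / 2 / 2) > 0"
    using assms by (intro cos_gt_zero_pi) auto
  then have *: "preserves (rot (\<theta>/2) :: 'a \<times> 'a \<Rightarrow> _)" by (intro preserves_rot_aux) auto
  have sc: "(2 * c) *\<^sub>R a = c *\<^sub>R a + c *\<^sub>R a" for c and a :: 'a by (simp flip: scaleR_left_distrib)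
  have "rot \<theta> = (\<lambda>p::'a\<times>'a. rot (\<theta>/2) (rot (\<theta>/2) p))"
    using sin_add[of "\<theta>/2" "\<theta>/2"] cos_add[of "\<theta>/2" "\<theta>/2"]
    by (auto simp: rot_def fun_eq_iff scaleR_diff_right scaleR_add_right scaleR_diff_left scaleR_add_left mult.commute sc)
  with preserves_comp[OF * *] show ?thesis by simp
qed

lemma preserves_integral:
  fixes f :: "'a::euclidean_space \<Rightarrow> 'b::{banach,second_countable_topology}"
  assumes "preserves T" "f \<in> borel_measurable borel"
  shows "integrable lborel (\<lambda>x. f (T x)) \<longleftrightarrow> integrable lborel f"
    and "(LINT x|lborel. f (T x)) = (LINT x|lborel. f x)"
  using assms integrable_distr_eq[of T lborel borel f] integral_distr[of T lborel borel f]
  by (auto simp: preserves_def)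

lemma preserves_nn_integral:
  assumes "preserves T" "f \<in> borel_measurable borel"
  shows "(\<integral>\<^sup>+x. f (T x) \<partial>lborel) = (\<integral>\<^sup>+x. f x \<partial>lborel)"
  using assms nn_integral_distr[of T lborel borel f]
  by (auto simp: preserves_def)

section \<open>Hermite functions\<close>

text \<open>The raising recursion that results from differentiating Rodrigues' formula once. As
  values of type \<open>real poly\<close> the Hermite polynomials have a degree and a formal
  derivative.\<close>

fun herm :: "nat \<Rightarrow> real poly" where
  "herm 0 = 1"
| "herm (Suc j) = [:0, 2:] * herm j - pderiv (herm j)"

lemma funpow_deriv_gauss:
  "(deriv ^^ j) (\<lambda>s::real. exp (- s\<^sup>2)) = (\<lambda>t. (-1) ^ j * poly (herm j) t * exp (- t\<^sup>2))"
proof (induction j)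
  case (Suc j)
  have "((\<lambda>t. (-1) ^ j * poly (herm j) t * exp (- t\<^sup>2)) has_real_derivative
      (-1) ^ Suc j * poly (herm (Suc j)) t * exp (- t\<^sup>2)) (at t)" for t
    by (auto intro!: derivative_eq_intros poly_DERIV simp: algebra_simps)
  then have "deriv (\<lambda>t. (-1) ^ j * poly (herm j) t * exp (- t\<^sup>2)) t = (-1) ^ Suc j * poly (herm (Suc j)) t * exp (- t\<^sup>2)" for t
    by (rule DERIV_imp_deriv)
  then show ?case by (simp add: Suc.IH fun_eq_iff)
qed simp

lemma hermite_poly_herm: "hermite_poly j t = poly (herm j) t"
proof -
  have "hermite_poly j t = ((-1) ^ j * (-1) ^ j) * (exp (t\<^sup>2) * exp (- t\<^sup>2)) * poly (herm j) t"
    unfolding hermite_poly_def funpow_deriv_gauss by (simp only: mult_ac)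
  also have "(-1::real) ^ j * (-1) ^ j = 1" by (simp flip: power_mult_distrib)
  also have "exp (t\<^sup>2) * exp (- t\<^sup>2) = 1" by (simp flip: exp_add)
  finally show ?thesis by simp
qed

lemma pderiv_herm: "pderiv (herm (Suc j)) = smult (2 * real (Suc j)) (herm j)"
proof (induction j)
  case 0
  then show ?case by (simp add: pderiv_pCons)
next
  case (Suc j)
  have x: "pderiv [:0, 2:] = ([:2:] :: real poly)" by (simp add: pderiv_pCons)
  have "pderiv (herm (Suc (Suc j))) = [:2:] * herm (Suc j) + [:0,2:] * pderiv (herm (Suc j)) - pderiv (pderiv (herm (Suc j)))"
    by (subst herm.simps(2)) (simp only: pderiv_diff pderiv_mult x, simp add: algebra_simps)
  also have "\<dots> = [:2:] * herm (Suc j) + smult (2 * real (Suc j)) ([:0,2:] * herm j - pderiv (herm j))"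
    unfolding Suc.IH by (simp add: pderiv_smult smult_diff_right)
  also have "\<dots> = smult (2 * real (Suc (Suc j))) (herm (Suc j))"
    unfolding herm.simps(2)[of j, symmetric]
    by (simp add: smult_add_left[symmetric] del: herm.simps)
  finally show ?case .
qed

text \<open>The three-term recursion follows from the raising recursion and H_j' = 2 j H_(j-1). At j
  = 0 the index j - 1 truncates to 0, but its coefficient is 0.\<close>

lemma herm_times_t: "t * poly (herm j) t = poly (herm (Suc j)) t / 2 + real j * poly (herm (j - 1)) t"
proof (cases j)
  case (Suc i)
  have "poly (herm (Suc j)) t = 2 * t * poly (herm j) t - poly (pderiv (herm j)) t" by simp
  then show ?thesis unfolding Suc pderiv_herm by (simp add: algebra_simps del: herm.simps)
qed simp

lemma poly_exp_bound:
  fixes p :: "real poly"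
  shows "\<exists>C c. C \<ge> 0 \<and> c \<ge> 0 \<and> (\<forall>t. \<bar>poly p t\<bar> \<le> C * exp (c * \<bar>t\<bar>))"
proof (induction p)
  case 0
  show ?case by (rule exI[of _ 0], rule exI[of _ 0]) simp
next
  case (pCons a p)
  then obtain C c where C: "C \<ge> 0" "c \<ge> 0" "\<And>t. \<bar>poly p t\<bar> \<le> C * exp (c * \<bar>t\<bar>)" by blast
  have "\<bar>poly (pCons a p) t\<bar> \<le> (\<bar>a\<bar> + C) * exp ((c + 1) * \<bar>t\<bar>)" for t
  proof -
    have "\<bar>poly (pCons a p) t\<bar> \<le> \<bar>a\<bar> + \<bar>t\<bar> * \<bar>poly p t\<bar>"
      using abs_triangle_ineq[of a "t * poly p t"] by (simp add: abs_mult)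
    also have "\<dots> \<le> \<bar>a\<bar> * exp ((c + 1) * \<bar>t\<bar>) + exp \<bar>t\<bar> * (C * exp (c * \<bar>t\<bar>))"
    proof (intro add_mono mult_mono C)
      have "1 \<le> exp ((c + 1) * \<bar>t\<bar>)" using C by simp
      then show "\<bar>a\<bar> \<le> \<bar>a\<bar> * exp ((c + 1) * \<bar>t\<bar>)" by (simp add: mult_le_cancel_left1)
      show "\<bar>t\<bar> \<le> exp \<bar>t\<bar>" using exp_ge_add_one_self[of "\<bar>t\<bar>"] by linarith
    qed auto
    also have "\<dots> = (\<bar>a\<bar> + C) * exp ((c + 1) * \<bar>t\<bar>)" by (simp add: algebra_simps exp_add)
    finally show ?thesis .
  qed
  then show ?case using C by (intro exI[of _ "\<bar>a\<bar> + C"] exI[of _ "c + 1"]) auto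
qed

text \<open>Half of the Gaussian absorbs the polynomial: the latter grows at most like e^(c|t|), and
  c|t| is at most c^2 + t^2/4.\<close>

lemma poly_gauss_bound:
  fixes p :: "real poly"
  shows "\<exists>C\<ge>0. \<forall>t. \<bar>poly p t\<bar> * exp (- t\<^sup>2 / 2) \<le> C * exp (- t\<^sup>2 / 4)"
proof -
  obtain C c where C: "C \<ge> 0" "c \<ge> 0" "\<And>t. \<bar>poly p t\<bar> \<le> C * exp (c * \<bar>t\<bar>)"
    using poly_exp_bound[of p] by blast
  have "\<bar>poly p t\<bar> * exp (- t\<^sup>2 / 2) \<le> (C * exp (c\<^sup>2)) * exp (- t\<^sup>2 / 4)" for t
  proof -
    have "0 \<le> (c - \<bar>t\<bar> / 2)\<^sup>2" by simp
    then have "c * \<bar>t\<bar> \<le> c\<^sup>2 + t\<^sup>2 / 4" by (simp add: power2_diff power_divide)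
    then have "exp (c * \<bar>t\<bar>) * exp (- t\<^sup>2 / 2) \<le> exp (c\<^sup>2) * exp (- t\<^sup>2 / 4)"
      by (simp flip: exp_add)
    from mult_left_mono[OF this C(1)]
    have A: "C * exp (c * \<bar>t\<bar>) * exp (- t\<^sup>2 / 2) \<le> (C * exp (c\<^sup>2)) * exp (- t\<^sup>2 / 4)"
      by (simp only: mult.assoc)
    have B: "\<bar>poly p t\<bar> * exp (- t\<^sup>2 / 2) \<le> C * exp (c * \<bar>t\<bar>) * exp (- t\<^sup>2 / 2)"
      by (intro mult_right_mono C) simp
    show ?thesis by (rule order_trans[OF B A])
  qed
  then show ?thesis using C by (intro exI[of _ "C * exp (c\<^sup>2)"]) auto
qed

lemma integrable_exp_real:
  "a > 0 \<Longrightarrow> integrable lborel (\<lambda>t::real. exp (- a * t\<^sup>2))"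
  using integrable_exp_norm[of a 0, where 'a=real] by simp

lemma poly_gauss_integrable:
  fixes p :: "real poly"
  shows "integrable lborel (\<lambda>t. poly p t * exp (- t\<^sup>2))"
proof -
  obtain C where C: "C \<ge> 0" "\<And>t. \<bar>poly p t\<bar> * exp (- t\<^sup>2 / 2) \<le> C * exp (- t\<^sup>2 / 4)"
    using poly_gauss_bound[of p] by blast
  have "integrable lborel (\<lambda>t. C * exp (- (3/4) * t\<^sup>2))"
    by (intro integrable_mult_right integrable_exp_real) simp
  then show ?thesis
  proof (rule Bochner_Integration.integrable_bound)
    show "AE t in lborel. norm (poly p t * exp (- t\<^sup>2)) \<le> norm (C * exp (- (3/4) * t\<^sup>2))"
    proof (intro always_eventually allI)
      fix t :: real
      have "\<bar>poly p t\<bar> * exp (- t\<^sup>2 / 2) * exp (- t\<^sup>2 / 2) \<le> C * exp (- t\<^sup>2 / 4) * exp (- t\<^sup>2 / 2)"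
        by (intro mult_right_mono C) simp
      then show "norm (poly p t * exp (- t\<^sup>2)) \<le> norm (C * exp (- (3/4) * t\<^sup>2))"
        using C by (simp add: abs_mult mult.assoc flip: exp_add)
    qed
  qed (auto intro!: borel_measurable_continuous_onI continuous_intros)
qed

text \<open>The integrand is the derivative of p(t) e^(-t^2), which tends to 0 at both ends.\<close>

lemma poly_gauss_integral_deriv:
  fixes p :: "real poly"
  shows "(LINT t|lborel. poly (pderiv p - [:0, 2:] * p) t * exp (- t\<^sup>2)) = 0"
proof -
  obtain C where C: "C \<ge> 0" "\<And>t. \<bar>poly p t\<bar> * exp (- t\<^sup>2 / 2) \<le> C * exp (- t\<^sup>2 / 4)"
    using poly_gauss_bound[of p] by blast
  have le: "norm (poly p t * exp (- t\<^sup>2)) \<le> C * exp (- t\<^sup>2 / 2)" for t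
  proof -
    have "\<bar>poly p t\<bar> * exp (- t\<^sup>2 / 2) * exp (- t\<^sup>2 / 2) \<le> C * exp (- t\<^sup>2 / 4) * exp (- t\<^sup>2 / 2)"
      by (intro mult_right_mono C) simp
    also have "\<dots> \<le> C * 1 * exp (- t\<^sup>2 / 2)"
      using C by (intro mult_right_mono mult_left_mono) auto
    finally show ?thesis by (simp add: abs_mult mult.assoc flip: exp_add)
  qed
  have lim: "((\<lambda>t. poly p t * exp (- t\<^sup>2)) \<longlongrightarrow> 0) at_top" "((\<lambda>t. poly p t * exp (- t\<^sup>2)) \<longlongrightarrow> 0) at_bot"
  proof -
    have "((\<lambda>t::real. C * exp (- t\<^sup>2 / 2)) \<longlongrightarrow> 0) at_top" by real_asymp
    then show "((\<lambda>t. poly p t * exp (- t\<^sup>2)) \<longlongrightarrow> 0) at_top"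
      by (rule Lim_null_comparison[rotated]) (use le in auto)
    have "((\<lambda>t::real. C * exp (- t\<^sup>2 / 2)) \<longlongrightarrow> 0) at_bot" by real_asymp
    then show "((\<lambda>t. poly p t * exp (- t\<^sup>2)) \<longlongrightarrow> 0) at_bot"
      by (rule Lim_null_comparison[rotated]) (use le in auto)
  qed
  have "(LBINT t=-\<infinity>..\<infinity>. poly (pderiv p - [:0, 2:] * p) t * exp (- t\<^sup>2)) = 0 - 0"
  proof (rule interval_integral_FTC_integrable)
    show "((\<lambda>t. poly p t * exp (- t\<^sup>2)) has_vector_derivative poly (pderiv p - [:0, 2:] * p) t * exp (- t\<^sup>2)) (at t)" for t
      unfolding has_real_derivative_iff_has_vector_derivative[symmetric]
      by (auto intro!: derivative_eq_intros poly_DERIV simp: algebra_simps)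
    show "isCont (\<lambda>t. poly (pderiv p - [:0, 2:] * p) t * exp (- t\<^sup>2)) t" for t
      by (intro continuous_intros)
    show "set_integrable lborel (einterval (-\<infinity>) \<infinity>) (\<lambda>t. poly (pderiv p - [:0, 2:] * p) t * exp (- t\<^sup>2))"
      using poly_gauss_integrable[of "pderiv p - [:0, 2:] * p"] by (simp add: set_integrable_def einterval_def)
  qed (use lim in \<open>simp_all add: ereal_tendsto_simps\<close>)
  then show ?thesis by (simp add: interval_lebesgue_integral_def set_lebesgue_integral_def einterval_def)
qed

text \<open>Integration by parts: H_(j+1) e^(-t^2) is minus the derivative of H_j e^(-t^2).\<close>

lemma herm_integral_step:
  "(LINT t|lborel. poly (p * herm (Suc j)) t * exp (- t\<^sup>2)) = (LINT t|lborel. poly (pderiv p * herm j) t * exp (- t\<^sup>2))"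
proof -
  have "pderiv (p * herm j) - [:0, 2:] * (p * herm j) = pderiv p * herm j - p * herm (Suc j)"
    by (simp add: pderiv_mult algebra_simps)
  then have "(LINT t|lborel. poly (pderiv p * herm j - p * herm (Suc j)) t * exp (- t\<^sup>2)) = 0"
    using poly_gauss_integral_deriv[of "p * herm j"] by simp
  then show ?thesis
    using poly_gauss_integrable[of "pderiv p * herm j"] poly_gauss_integrable[of "p * herm (Suc j)"]
    by (simp only: poly_diff left_diff_distrib Bochner_Integration.integral_diff)
qed

lemma gauss_integral_sq: "(LINT t|lborel. exp (- t\<^sup>2)) = sqrt pi"
proof -
  have c: "complex_of_real (exp (- t\<^sup>2 / 2)) = exp (complex_of_real (- t\<^sup>2 / 2) + \<i> * complex_of_real (t * 0))" for t
    by (simp add: exp_of_real[symmetric])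
  have i: "integrable lborel (\<lambda>t::real. exp (- t\<^sup>2 / 2))"
    using integrable_exp_real[of "1/2"] by simp
  have "complex_of_real (LINT t|lborel. exp (- t\<^sup>2 / 2)) = complex_of_real (sqrt (2 * pi))"
    unfolding integral_complex_of_real[symmetric] c gauss_real_char(2) by simp
  then have "sqrt (2 * pi) = (LINT t|lborel. exp (- t\<^sup>2 / 2))"
    by (simp only: of_real_eq_iff)
  also have "\<dots> = sqrt 2 * (LINT t|lborel. exp (- t\<^sup>2))"
    using integral_lborel_scale(2)[OF i, of "sqrt 2"] by (simp add: power_mult_distrib)
  finally show ?thesis by (simp add: real_sqrt_mult)
qed

text \<open>Integration by parts lowers both indices at once, as the derivative of H_(k+1) is a
  multiple of H_k. Unequal indices end at the derivative of a constant; equal ones end at the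
  Gaussian integral, with the factors 2 (k + 1) collected on the way.\<close>

lemma herm_orthogonal:
  "(LINT t|lborel. poly (herm i * herm j) t * exp (- t\<^sup>2)) = (if i = j then 2 ^ j * fact j * sqrt pi else 0)"
proof (induction j arbitrary: i)
  case 0
  show ?case
  proof (cases i)
    case 0
    then show ?thesis by (simp add: gauss_integral_sq)
  next
    case (Suc k)
    then show ?thesis using herm_integral_step[of 1 k] by simp
  qed
next
  case (Suc j)
  show ?case
  proof (cases i)
    case 0
    then show ?thesis using herm_integral_step[of 1 j] by simp
  next
    case (Suc k)
    have "(LINT t|lborel. poly (herm i * herm (Suc j)) t * exp (- t\<^sup>2))
        = (LINT t|lborel. (2 * real (Suc k)) * (poly (herm k * herm j) t * exp (- t\<^sup>2)))"
      unfolding herm_integral_step Suc pderiv_herm by (simp add: mult.assoc)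
    also have "\<dots> = (2 * real (Suc k)) * (if k = j then 2 ^ j * fact j * sqrt pi else 0)"
      by (simp only: Bochner_Integration.integral_mult_right_zero Suc.IH)
    finally show ?thesis using Suc by (auto simp: algebra_simps)
  qed
qed

section \<open>Hermite functions\<close>

lemma hermite_fun_herm:
  "hermite_fun j t = poly (herm j) t * exp (- t\<^sup>2 / 2) / sqrt (2 ^ j * fact j * sqrt pi)"
  by (simp add: hermite_fun_def hermite_poly_herm)

lemma continuous_hermite_fun [continuous_intros]:
  "continuous_on S f \<Longrightarrow> continuous_on S (\<lambda>x. hermite_fun j (f x))"
  unfolding hermite_fun_herm by (intro continuous_intros) auto

lemma hermite_fun_measurable [measurable]: "hermite_fun j \<in> borel_measurable borel"
  by (intro borel_measurable_continuous_onI continuous_intros)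

lemma hermite_fun_orthonormal:
  "integrable lborel (\<lambda>t. hermite_fun i t * hermite_fun j t)"
  "(LINT t|lborel. hermite_fun i t * hermite_fun j t) = (if i = j then 1 else 0)"
proof -
  have eq: "hermite_fun i t * hermite_fun j t =
      (poly (herm i * herm j) t * exp (- t\<^sup>2)) / (sqrt (2 ^ i * fact i * sqrt pi) * sqrt (2 ^ j * fact j * sqrt pi))" for t
    by (simp add: hermite_fun_herm flip: exp_add)
  show "integrable lborel (\<lambda>t. hermite_fun i t * hermite_fun j t)"
    unfolding eq by (intro integrable_divide_zero poly_gauss_integrable)
  show "(LINT t|lborel. hermite_fun i t * hermite_fun j t) = (if i = j then 1 else 0)"
    unfolding eq integral_divide_zero herm_orthogonal by simp
qed

lemma hermite_fun_bound: "\<exists>C\<ge>0. \<forall>t. \<bar>hermite_fun j t\<bar> \<le> C * exp (- t\<^sup>2 / 4)"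
proof -
  obtain C where C: "C \<ge> 0" "\<And>t. \<bar>poly (herm j) t\<bar> * exp (- t\<^sup>2 / 2) \<le> C * exp (- t\<^sup>2 / 4)"
    using poly_gauss_bound[of "herm j"] by blast
  let ?N = "sqrt (2 ^ j * fact j * sqrt pi)"
  have N: "?N > 0" by simp
  have "\<bar>hermite_fun j t\<bar> \<le> C / ?N * exp (- t\<^sup>2 / 4)" for t
    using divide_right_mono[OF C(2)[of t] less_imp_le[OF N]] by (simp add: hermite_fun_herm abs_mult)
  then show ?thesis using C by (intro exI[of _ "C / ?N"]) auto
qed

section \<open>The functions q: polynomial part, bounds, orthonormality, recursion\<close>

definition herm_prod :: "('n::finite \<Rightarrow> nat) \<Rightarrow> real^'n \<Rightarrow> real^'n \<Rightarrow> real" where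
  "herm_prod k \<xi> v = (\<Prod>r\<in>UNIV. poly (herm (k r)) ((\<xi> $ r + 2 * v $ r) / sqrt 2))"

definition q_const :: "('n::finite \<Rightarrow> nat) \<Rightarrow> real" where
  "q_const k = 2 powr (real CARD('n) / 2) * pi powr (real CARD('n) / 4) / (\<Prod>r\<in>UNIV. sqrt (2 ^ k r * fact (k r) * sqrt pi))"

lemma q_const_pos: "q_const k > 0"
  unfolding q_const_def by (intro divide_pos_pos prod_pos) auto

lemma norm_sq_vec: "(norm (x::real^'n))\<^sup>2 = (\<Sum>r\<in>UNIV. (x $ r)\<^sup>2)"
  by (simp add: norm_vec_def L2_set_def sum_nonneg)

lemma exp_gauss_vec:
  fixes \<xi> v :: "real^'n"
  shows "(\<Prod>r\<in>UNIV. exp (- c * ((\<xi> $ r + 2 * v $ r) / sqrt 2)\<^sup>2)) = exp (- c * (norm (\<xi> + 2 *\<^sub>R v))\<^sup>2 / 2)"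
  by (simp add: exp_sum[symmetric] norm_sq_vec power_divide sum_divide_distrib[symmetric] sum_negf sum_distrib_left[symmetric])

text \<open>With t_r = (\<xi>_r + 2 v_r)/sqrt 2 the exponents t_r^2/2 add up to |\<xi> + 2v|^2/4.
  Polynomial, Gaussian and constant are separated because the Fourier transform treats them
  differently.\<close>

lemma q_fun_eq: "q_fun k \<xi> v = q_const k * herm_prod k \<xi> v * exp (- (norm (\<xi> + 2 *\<^sub>R v))\<^sup>2 / 4)"
proof -
  have "hermite_prod k \<xi> v = herm_prod k \<xi> v * (\<Prod>r\<in>UNIV. exp (- (1/2) * ((\<xi> $ r + 2 * v $ r) / sqrt 2)\<^sup>2)) / (\<Prod>r\<in>UNIV. sqrt (2 ^ k r * fact (k r) * sqrt pi))"
    by (simp add: hermite_prod_def hermite_fun_herm herm_prod_def prod_dividef prod.distrib)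
  then show ?thesis unfolding exp_gauss_vec by (simp add: q_fun_def q_const_def)
qed

text \<open>Half of the Gaussian in each Hermite function has been spent on absorbing its
  polynomial, hence the rate 1/8 in place of 1/4.\<close>

lemma q_fun_bound:
  fixes k :: "'n::finite \<Rightarrow> nat"
  shows "\<exists>C\<ge>0. \<forall>\<xi> v. \<bar>q_fun k \<xi> v\<bar> \<le> C * exp (- (norm (\<xi> + 2 *\<^sub>R v))\<^sup>2 / 8)"
proof -
  have "\<forall>r. \<exists>C\<ge>0. \<forall>t. \<bar>hermite_fun (k r) t\<bar> \<le> C * exp (- t\<^sup>2 / 4)" using hermite_fun_bound by blast
  then obtain C where C: "\<And>r. C r \<ge> 0" "\<And>r t. \<bar>hermite_fun (k r) t\<bar> \<le> C r * exp (- t\<^sup>2 / 4)" by metis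
  let ?D = "2 powr (real CARD('n) / 2) * pi powr (real CARD('n) / 4)"
  have "\<bar>q_fun k \<xi> v\<bar> \<le> (?D * prod C UNIV) * exp (- (norm (\<xi> + 2 *\<^sub>R v))\<^sup>2 / 8)" for \<xi> v
  proof -
    have "\<bar>hermite_prod k \<xi> v\<bar> \<le> (\<Prod>r\<in>UNIV. C r * exp (- (1/4) * ((\<xi> $ r + 2 * v $ r) / sqrt 2)\<^sup>2))"
      unfolding hermite_prod_def abs_prod
    proof (rule prod_mono)
      fix r
      show "0 \<le> \<bar>hermite_fun (k r) ((\<xi> $ r + 2 * v $ r) / sqrt 2)\<bar> \<and>
        \<bar>hermite_fun (k r) ((\<xi> $ r + 2 * v $ r) / sqrt 2)\<bar> \<le> C r * exp (- (1/4) * ((\<xi> $ r + 2 * v $ r) / sqrt 2)\<^sup>2)"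
        using C(2)[of r "(\<xi> $ r + 2 * v $ r) / sqrt 2"] by simp
    qed
    also have "\<dots> = prod C UNIV * exp (- (norm (\<xi> + 2 *\<^sub>R v))\<^sup>2 / 8)"
      unfolding prod.distrib exp_gauss_vec by simp
    finally have "?D * \<bar>hermite_prod k \<xi> v\<bar> \<le> ?D * (prod C UNIV * exp (- (norm (\<xi> + 2 *\<^sub>R v))\<^sup>2 / 8))"
      by (rule mult_left_mono) simp
    then show ?thesis by (simp add: q_fun_def abs_mult mult.assoc)
  qed
  then show ?thesis using C by (intro exI[of _ "?D * prod C UNIV"]) (auto intro!: mult_nonneg_nonneg prod_nonneg)
qed

lemma continuous_q_fun: "continuous_on UNIV (\<lambda>p. q_fun k (fst p) (snd p))"
  unfolding q_fun_def hermite_prod_def by (intro continuous_intros) auto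

lemma q_fun_measurable [measurable]:
  "(\<lambda>p. q_fun k (fst p) (snd p)) \<in> borel_measurable borel"
  "(\<lambda>v. q_fun k \<xi> v) \<in> borel_measurable borel"
  "(\<lambda>\<xi>. q_fun k \<xi> v) \<in> borel_measurable borel"
proof -
  show 1: "(\<lambda>p. q_fun k (fst p) (snd p)) \<in> borel_measurable borel"
    by (intro borel_measurable_continuous_onI continuous_q_fun)
  show "(\<lambda>v. q_fun k \<xi> v) \<in> borel_measurable borel"
    unfolding q_fun_def hermite_prod_def by (intro borel_measurable_continuous_onI continuous_intros) auto
  show "(\<lambda>\<xi>. q_fun k \<xi> v) \<in> borel_measurable borel"
    unfolding q_fun_def hermite_prod_def by (intro borel_measurable_continuous_onI continuous_intros) auto
qed

text \<open>The substitution t = (\<xi>_r + 2 v_r)/sqrt 2 contributes 1/sqrt 2 per coordinate. The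
  prefactor 2^(n/2) pi^(n/4) of q is chosen so that its square, 2^n pi^(n/2), cancels these factors
  together with the (2 pi)^(-n/2) of the measure.\<close>

lemma q_fun_orthonormal:
  fixes k l :: "'n::finite \<Rightarrow> nat"
  shows "(LINT v|nlborel. complex_of_real (q_fun k \<xi> v) * complex_of_real (q_fun l \<xi> v)) = (if k = l then 1 else 0)"
proof -
  let ?f = "\<lambda>r t. complex_of_real (hermite_fun (k r) ((\<xi> $ r + 2 * t) / sqrt 2) * hermite_fun (l r) ((\<xi> $ r + 2 * t) / sqrt 2))"
  have aff: "(\<xi> $ r + 2 * t) / sqrt 2 = \<xi> $ r / sqrt 2 + sqrt 2 * t" for r t
    by (simp add: add_divide_distrib real_div_sqrt mult.commute flip: times_divide_eq_right)
  have int: "integrable lborel (?f r)" for r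
    unfolding aff complex_of_real_integrable_eq
    by (rule lborel_integrable_real_affine[OF hermite_fun_orthonormal(1)]) simp
  have val: "(LINT t|lborel. ?f r t) = (if k r = l r then 1 else 0) / complex_of_real (sqrt 2)" for r
    using lborel_integral_real_affine[of "sqrt 2" "\<lambda>t. hermite_fun (k r) t * hermite_fun (l r) t" "\<xi> $ r / sqrt 2"]
      hermite_fun_orthonormal(2)[of "k r" "l r"]
    unfolding aff integral_complex_of_real by (auto simp: field_simps simp flip: of_real_mult of_real_divide)
  let ?D = "2 powr (real CARD('n) / 2) * pi powr (real CARD('n) / 4)"
  have L1: "(LINT v|lborel. complex_of_real (q_fun k \<xi> v) * complex_of_real (q_fun l \<xi> v))
      = (LINT v|lborel. complex_of_real (?D\<^sup>2) * (\<Prod>r\<in>UNIV. ?f r (v $ r)))"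
    by (simp add: q_fun_def hermite_prod_def prod.distrib power2_eq_square mult_ac)
  have L2: "(LINT v|lborel. complex_of_real (?D\<^sup>2) * (\<Prod>r\<in>UNIV. ?f r (v $ r)))
      = complex_of_real (?D\<^sup>2) * (\<Prod>r\<in>UNIV. (if k r = l r then 1 else 0) / complex_of_real (sqrt 2))"
    using lborel_vec_integral_prod(2)[OF int] val by simp
  have L3: "complex_of_real (?D\<^sup>2) * (\<Prod>r\<in>UNIV. (if k r = l r then 1 else 0) / complex_of_real (sqrt 2))
      = complex_of_real (?D\<^sup>2 * (1 / sqrt 2) ^ CARD('n)) * (if k = l then 1 else 0)"
  proof (cases "k = l")
    case False
    then obtain r where "k r \<noteq> l r" by (auto simp: fun_eq_iff)
    then have "(\<Prod>r\<in>UNIV. (if k r = l r then 1 else 0) / complex_of_real (sqrt 2)) = 0"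
      by (intro prod_zero) auto
    then show ?thesis using False by simp
  qed simp
  have L: "(LINT v|lborel. complex_of_real (q_fun k \<xi> v) * complex_of_real (q_fun l \<xi> v))
      = complex_of_real (?D\<^sup>2 * (1 / sqrt 2) ^ CARD('n)) * (if k = l then 1 else 0)"
    by (rule trans[OF L1 trans[OF L2 L3]])
  have *: "(LINT v|nlborel. complex_of_real (q_fun k \<xi> v) * complex_of_real (q_fun l \<xi> v))
      = complex_of_real (nl_const TYPE(real^'n) * (?D\<^sup>2 * (1 / sqrt 2) ^ CARD('n))) * (if k = l then 1 else 0)"
    unfolding integral_nlborel L scaleR_conv_of_real by (simp only: of_real_mult mult.assoc)
  have "nl_const TYPE(real^'n) * (?D\<^sup>2 * (1 / sqrt 2) ^ CARD('n)) = 1"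
  proof -
    have a: "?D\<^sup>2 = 2 powr (real CARD('n)) * pi powr (real CARD('n) / 2)"
      by (simp add: power2_eq_square powr_add[symmetric] mult_ac)
    have b: "(1 / sqrt 2) ^ CARD('n) = 2 powr (- (real CARD('n) / 2))"
    proof -
      have "1 / sqrt 2 = (2::real) powr (- (1/2))"
        by (simp add: powr_minus powr_half_sqrt inverse_eq_divide)
      then have "(1 / sqrt 2) ^ CARD('n) = ((2::real) powr (- (1/2))) powr (real CARD('n))"
        by (simp add: powr_realpow)
      then show ?thesis by (simp add: powr_powr)
    qed
    have c: "nl_const TYPE(real^'n) = 2 powr (- (real CARD('n) / 2)) * pi powr (- (real CARD('n) / 2))"
      by (simp add: nl_const_def powr_mult)
    have "2 powr (- (real CARD('n) / 2)) * 2 powr (real CARD('n)) * 2 powr (- (real CARD('n) / 2)) = (1::real)"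
      by (simp add: powr_add[symmetric])
    moreover have "pi powr (- (real CARD('n) / 2)) * pi powr (real CARD('n) / 2) = 1"
      by (simp add: powr_add[symmetric])
    moreover have "nl_const TYPE(real^'n) * (?D\<^sup>2 * (1 / sqrt 2) ^ CARD('n)) = (2 powr (- (real CARD('n) / 2)) * 2 powr (real CARD('n)) * 2 powr (- (real CARD('n) / 2)))
       * (pi powr (- (real CARD('n) / 2)) * pi powr (real CARD('n) / 2))"
      unfolding a b c by (simp add: mult_ac)
    ultimately show ?thesis by simp
  qed
  with * show ?thesis by simp
qed

text \<open>Solving t = (\<xi>_r + 2 v_r)/sqrt 2 for v_r gives v_r = (sqrt 2) t/2 - \<xi>_r/2, and
  \<open>herm_times_t\<close> rewrites the factor t. In this way a power of v is traded for
  neighbouring Hermite indices.\<close>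

lemma herm_prod_mult:
  "(v $ r - c) * herm_prod k \<xi> v =
     sqrt 2 / 4 * herm_prod (k(r := Suc (k r))) \<xi> v + sqrt 2 / 2 * real (k r) * herm_prod (k(r := k r - 1)) \<xi> v
     - (\<xi> $ r / 2 + c) * herm_prod k \<xi> v"
proof -
  define t where "t = (\<xi> $ r + 2 * v $ r) / sqrt 2"
  define R where "R = (\<Prod>s\<in>UNIV - {r}. poly (herm (k s)) ((\<xi> $ s + 2 * v $ s) / sqrt 2))"
  have e: "herm_prod (k(r := j)) \<xi> v = poly (herm j) t * R" for j
    unfolding herm_prod_def R_def t_def by (subst prod.remove[of _ r]) (auto intro!: prod.cong)
  have v: "v $ r = sqrt 2 / 2 * t - \<xi> $ r / 2" proof -
    have "sqrt 2 / 2 * t = (sqrt 2 / sqrt 2) * (\<xi> $ r + 2 * v $ r) / 2" unfolding t_def by simp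
    then show ?thesis by (simp add: add_divide_distrib)
  qed
  have "herm_prod k \<xi> v = poly (herm (k r)) t * R" using e[of "k r"] by simp
  then have "(v $ r - c) * herm_prod k \<xi> v = (sqrt 2 / 2 * (t * poly (herm (k r)) t) - (\<xi> $ r / 2 + c) * poly (herm (k r)) t) * R"
    unfolding v by (simp add: algebra_simps)
  then show ?thesis unfolding e[of "Suc (k r)"] e[of "k r - 1"] using e[of "k r"] herm_times_t[of t "k r"]
    by (simp add: algebra_simps del: herm.simps)
qed

section \<open>Smooth and polyanalytic functions\<close>

lemma has_derivative_dir_deriv:
  assumes "f differentiable_on UNIV"
  shows "(f has_derivative (\<lambda>v. dir_deriv v f z)) (at z)"
  using assms frechet_derivative_works[of f "at z"]
  by (auto simp: differentiable_on_def dir_deriv_def)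

lemma dir_deriv_eqI:
  assumes "\<And>z. (f has_derivative D z) (at z)"
  shows "f differentiable_on UNIV" "dir_deriv v f = (\<lambda>z. D z v)"
proof -
  show "f differentiable_on UNIV" using assms by (auto simp: differentiable_on_def differentiable_def)
  show "dir_deriv v f = (\<lambda>z. D z v)"
    unfolding dir_deriv_def using frechet_derivative_at[OF assms] by (auto simp: fun_eq_iff)
qed

text \<open>All iterated derivatives of f stay in the class X, so smoothness only requires X to be
  closed under one directional derivative and to consist of differentiable functions.\<close>

lemma smooth_coinduct:
  assumes "f \<in> X" and "\<And>g. g \<in> X \<Longrightarrow> g differentiable_on UNIV"
    and "\<And>g v. g \<in> X \<Longrightarrow> dir_deriv v g \<in> X"
  shows "smooth f"
proof -
  have "foldr dir_deriv vs f \<in> X" for vs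
    by (induction vs) (use assms in auto)
  with assms(2) show ?thesis by (auto simp: smooth_def)
qed

lemma smooth_differentiable: "smooth f \<Longrightarrow> f differentiable_on UNIV"
  unfolding smooth_def by (metis foldr.simps(1) id_apply)

lemma smooth_dir_deriv: "smooth f \<Longrightarrow> smooth (dir_deriv v f)"
  unfolding smooth_def
proof
  fix vs assume "\<forall>vs. foldr dir_deriv vs f differentiable_on UNIV"
  then have "foldr dir_deriv (vs @ [v]) f differentiable_on UNIV" by blast
  then show "foldr dir_deriv vs (dir_deriv v f) differentiable_on UNIV" by simp
qed

lemma smooth_has_derivative: "smooth f \<Longrightarrow> (f has_derivative (\<lambda>v. dir_deriv v f z)) (at z)"
  by (intro has_derivative_dir_deriv smooth_differentiable)

lemma smooth_continuous: "smooth f \<Longrightarrow> continuous_on UNIV f"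
  by (intro differentiable_imp_continuous_on smooth_differentiable)

text \<open>A class built to be closed under directional derivatives, hence one to which
  \<open>smooth_coinduct\<close> applies. It replaces Leibniz formulas for iterated derivatives of
  products and exponentials.\<close>

inductive smooth_alg :: "('a::real_normed_vector \<Rightarrow> complex) \<Rightarrow> bool" where
  smooth: "smooth f \<Longrightarrow> smooth_alg f"
| add: "smooth_alg f \<Longrightarrow> smooth_alg g \<Longrightarrow> smooth_alg (\<lambda>z. f z + g z)"
| mult: "smooth_alg f \<Longrightarrow> smooth_alg g \<Longrightarrow> smooth_alg (\<lambda>z. f z * g z)"
| exp: "smooth f \<Longrightarrow> smooth_alg (\<lambda>z. exp (f z))"

lemma dir_deriv_add:
  assumes "f differentiable_on UNIV" "g differentiable_on UNIV"
  shows "dir_deriv v (\<lambda>z. f z + g z) = (\<lambda>z. dir_deriv v f z + dir_deriv v g z)"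
    and "(\<lambda>z. f z + g z) differentiable_on UNIV"
  using dir_deriv_eqI[of "\<lambda>z. f z + g z" "\<lambda>z v. dir_deriv v f z + dir_deriv v g z"]
    has_derivative_add[OF has_derivative_dir_deriv[OF assms(1)] has_derivative_dir_deriv[OF assms(2)]]
  by blast+

lemma dir_deriv_mult:
  assumes "f differentiable_on UNIV" "g differentiable_on UNIV"
  shows "dir_deriv v (\<lambda>z. f z * g z) = (\<lambda>z. f z * dir_deriv v g z + dir_deriv v f z * g z)"
    and "(\<lambda>z. f z * g z) differentiable_on UNIV"
  using dir_deriv_eqI[of "\<lambda>z. f z * g z" "\<lambda>z v. f z * dir_deriv v g z + dir_deriv v f z * g z"]
    has_derivative_mult[OF has_derivative_dir_deriv[OF assms(1)] has_derivative_dir_deriv[OF assms(2)]]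
  by blast+

lemma dir_deriv_exp:
  assumes "f differentiable_on UNIV"
  shows "dir_deriv v (\<lambda>z. exp (f z)) = (\<lambda>z. dir_deriv v f z * exp (f z))"
    and "(\<lambda>z. exp (f z)) differentiable_on UNIV"
proof -
  have "((\<lambda>z. exp (f z)) has_derivative (\<lambda>v. dir_deriv v f z * exp (f z))) (at z)" for z
    using has_derivative_compose[OF has_derivative_dir_deriv[OF assms] DERIV_exp[THEN has_field_derivative_imp_has_derivative]]
    by (simp add: mult.commute)
  from dir_deriv_eqI[of "\<lambda>z. exp (f z)", OF this]
  show "dir_deriv v (\<lambda>z. exp (f z)) = (\<lambda>z. dir_deriv v f z * exp (f z))" "(\<lambda>z. exp (f z)) differentiable_on UNIV"
    by blast+
qed

lemma smooth_alg_smooth: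
  fixes f :: "'a::real_normed_vector \<Rightarrow> complex"
  assumes "smooth_alg f"
  shows "smooth f"
proof (rule smooth_coinduct[of _ "Collect smooth_alg"])
  have *: "g differentiable_on UNIV \<and> (\<forall>v. smooth_alg (dir_deriv v g))" if "smooth_alg g" for g :: "'a \<Rightarrow> complex"
    using that
  proof induction
    case (smooth f)
    then show ?case by (auto intro: smooth_alg.smooth smooth_dir_deriv smooth_differentiable)
  next
    case (add f g)
    then show ?case by (auto simp: dir_deriv_add intro: smooth_alg.intros)
  next
    case (mult f g)
    then show ?case by (auto simp: dir_deriv_mult intro!: smooth_alg.add smooth_alg.mult)
  next
    case (exp f)
    then show ?case
      by (auto simp: dir_deriv_exp smooth_differentiable
          intro!: smooth_alg.mult smooth_alg.smooth[OF smooth_dir_deriv] smooth_alg.exp)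
  qed
  show "f \<in> Collect smooth_alg" using assms by simp
  show "g differentiable_on UNIV" if "g \<in> Collect smooth_alg" for g :: "'a \<Rightarrow> complex" using * that by blast
  show "dir_deriv v g \<in> Collect smooth_alg" if "g \<in> Collect smooth_alg" for g :: "'a \<Rightarrow> complex" and v using * that by blast
qed

lemma smooth_add: "smooth f \<Longrightarrow> smooth g \<Longrightarrow> smooth (\<lambda>z. f z + g z)"
  by (rule smooth_alg_smooth[OF smooth_alg.add[OF smooth_alg.smooth smooth_alg.smooth]])

lemma smooth_mult: "smooth f \<Longrightarrow> smooth g \<Longrightarrow> smooth (\<lambda>z. f z * g z)"
  by (rule smooth_alg_smooth[OF smooth_alg.mult[OF smooth_alg.smooth smooth_alg.smooth]])

lemma smooth_exp: "smooth f \<Longrightarrow> smooth (\<lambda>z. exp (f z))"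
  by (rule smooth_alg_smooth[OF smooth_alg.exp])

lemma dir_deriv_const: "dir_deriv v (\<lambda>z. c) = (\<lambda>z. 0)"
  by (rule dir_deriv_eqI(2)) (rule has_derivative_const)

lemma smooth_const: "smooth (\<lambda>z. c)"
  by (rule smooth_coinduct[of _ "{\<lambda>z. c |c. True}"]) (auto simp: dir_deriv_const)

lemma smooth_cmult: "smooth f \<Longrightarrow> smooth (\<lambda>z. c * f z)"
  by (intro smooth_mult smooth_const)

lemma dir_deriv_cmult: "smooth f \<Longrightarrow> dir_deriv v (\<lambda>z. c * f z) = (\<lambda>z. c * dir_deriv v f z)"
  by (simp add: dir_deriv_mult smooth_differentiable smooth_const dir_deriv_const)

lemma dir_deriv_bounded_linear:
  assumes "bounded_linear f"
  shows "dir_deriv v f = (\<lambda>z. f v)"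
  by (rule dir_deriv_eqI(2)) (rule bounded_linear_imp_has_derivative[OF assms])

lemma smooth_bounded_linear:
  assumes "bounded_linear f"
  shows "smooth f"
proof (rule smooth_coinduct[of _ "insert f {\<lambda>z. c |c. True}"])
  show "g differentiable_on UNIV" if "g \<in> insert f {\<lambda>z. c |c. True}" for g
    using that smooth_differentiable[OF smooth_const] dir_deriv_eqI(1)[OF bounded_linear_imp_has_derivative[OF assms]] by auto
qed (auto simp: dir_deriv_const dir_deriv_bounded_linear[OF assms])

section \<open>Symmetry of second derivatives\<close>

lemma smooth_line_derivative:
  assumes "smooth f"
  shows "((\<lambda>s. Re (f (a + s *\<^sub>R u))) has_real_derivative Re (dir_deriv u f (a + s *\<^sub>R u))) (at s)"
proof -
  have "((\<lambda>s. a + s *\<^sub>R u) has_derivative (\<lambda>t. t *\<^sub>R u)) (at s)"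
    by (auto intro!: derivative_eq_intros)
  from has_derivative_compose[OF this smooth_has_derivative[OF assms]]
  have "((\<lambda>s. f (a + s *\<^sub>R u)) has_derivative (\<lambda>t. dir_deriv (t *\<^sub>R u) f (a + s *\<^sub>R u))) (at s)" .
  from bounded_linear.has_derivative[OF bounded_linear_Re this]
  have "((\<lambda>s. Re (f (a + s *\<^sub>R u))) has_derivative (\<lambda>t. Re (dir_deriv (t *\<^sub>R u) f (a + s *\<^sub>R u)))) (at s)" .
  moreover have "dir_deriv (t *\<^sub>R u) f (a + s *\<^sub>R u) = t *\<^sub>R dir_deriv u f (a + s *\<^sub>R u)" for t
    using linear_scale[OF has_derivative_linear[OF smooth_has_derivative[OF assms]]] .
  ultimately show ?thesis by (simp add: has_field_derivative_def mult_commute_abs)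
qed

text \<open>The second difference is the increment in s of f(z + h v + s u) - f(z + s u). One mean
  value theorem in s and a second one in direction v produce the mixed derivative at an intermediate
  point. Real parts are taken because the mean value theorem holds for real values only.\<close>

lemma second_difference_mvt:
  assumes f: "smooth f" and h: "h > 0"
  obtains s t where "0 < s" "s < h" "0 < t" "t < h"
    "Re (f (z + h *\<^sub>R u + h *\<^sub>R v)) - Re (f (z + h *\<^sub>R u)) - Re (f (z + h *\<^sub>R v)) + Re (f z)
      = h * (h * Re (dir_deriv v (dir_deriv u f) (z + s *\<^sub>R u + t *\<^sub>R v)))"
proof -
  define F where "F s = Re (f ((z + h *\<^sub>R v) + s *\<^sub>R u)) - Re (f (z + s *\<^sub>R u))" for s
  have "\<exists>s>0. s < h \<and> F h - F 0 = (h - 0) * (Re (dir_deriv u f ((z + h *\<^sub>R v) + s *\<^sub>R u)) - Re (dir_deriv u f (z + s *\<^sub>R u)))"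
    unfolding F_def by (rule MVT2[OF h]) (intro DERIV_diff smooth_line_derivative f)
  then obtain s where s: "0 < s" "s < h"
    "F h - F 0 = (h - 0) * (Re (dir_deriv u f ((z + h *\<^sub>R v) + s *\<^sub>R u)) - Re (dir_deriv u f (z + s *\<^sub>R u)))"
    by blast
  define G where "G t = Re (dir_deriv u f ((z + s *\<^sub>R u) + t *\<^sub>R v))" for t
  have "\<exists>t>0. t < h \<and> G h - G 0 = (h - 0) * Re (dir_deriv v (dir_deriv u f) ((z + s *\<^sub>R u) + t *\<^sub>R v))"
    unfolding G_def by (rule MVT2[OF h]) (intro smooth_line_derivative smooth_dir_deriv f)
  then obtain t where t: "0 < t" "t < h"
    "G h - G 0 = (h - 0) * Re (dir_deriv v (dir_deriv u f) ((z + s *\<^sub>R u) + t *\<^sub>R v))"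
    by blast
  have "F h - F 0 = h * (G h - G 0)" using s(3) by (simp add: G_def add_ac)
  then show ?thesis using s t that[of s t] by (simp add: F_def add_ac)
qed

text \<open>The second difference is symmetric in u and v, so the two mixed derivatives agree at
  points of a shrinking parallelogram at z, and both are continuous.\<close>

lemma Re_dir_deriv_commute:
  assumes f: "smooth f"
  shows "Re (dir_deriv v (dir_deriv u f) z) = Re (dir_deriv u (dir_deriv v f) z)"
proof -
  define h where "h n = 1 / real (Suc n)" for n
  have h: "h n > 0" for n by (simp add: h_def)
  have hlim: "h \<longlonglongrightarrow> 0" unfolding h_def using LIMSEQ_inverse_real_of_nat by (simp add: inverse_eq_divide)
  have "\<exists>s t s' t'. (0 < s \<and> s < h n) \<and> (0 < t \<and> t < h n) \<and> (0 < s' \<and> s' < h n) \<and> (0 < t' \<and> t' < h n) \<and>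
     Re (dir_deriv v (dir_deriv u f) (z + s *\<^sub>R u + t *\<^sub>R v)) = Re (dir_deriv u (dir_deriv v f) (z + s' *\<^sub>R v + t' *\<^sub>R u))" for n
  proof -
    obtain s t where 1: "0 < s" "s < h n" "0 < t" "t < h n"
      "Re (f (z + h n *\<^sub>R u + h n *\<^sub>R v)) - Re (f (z + h n *\<^sub>R u)) - Re (f (z + h n *\<^sub>R v)) + Re (f z)
      = h n * (h n * Re (dir_deriv v (dir_deriv u f) (z + s *\<^sub>R u + t *\<^sub>R v)))"
      using second_difference_mvt[OF f h[of n], of z u v] by blast
    obtain s' t' where 2: "0 < s'" "s' < h n" "0 < t'" "t' < h n"
      "Re (f (z + h n *\<^sub>R v + h n *\<^sub>R u)) - Re (f (z + h n *\<^sub>R v)) - Re (f (z + h n *\<^sub>R u)) + Re (f z)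
      = h n * (h n * Re (dir_deriv u (dir_deriv v f) (z + s' *\<^sub>R v + t' *\<^sub>R u)))"
      using second_difference_mvt[OF f h[of n], of z v u] by blast
    have e: "z + h n *\<^sub>R u + h n *\<^sub>R v = z + h n *\<^sub>R v + h n *\<^sub>R u" by (simp add: add_ac)
    have "h n * (h n * Re (dir_deriv v (dir_deriv u f) (z + s *\<^sub>R u + t *\<^sub>R v)))
       = h n * (h n * Re (dir_deriv u (dir_deriv v f) (z + s' *\<^sub>R v + t' *\<^sub>R u)))"
      using 1(5) 2(5) unfolding e by linarith
    then have "Re (dir_deriv v (dir_deriv u f) (z + s *\<^sub>R u + t *\<^sub>R v)) = Re (dir_deriv u (dir_deriv v f) (z + s' *\<^sub>R v + t' *\<^sub>R u))"
      using h[of n] by simp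
    with 1 2 show ?thesis by blast
  qed
  then obtain s t s' t' where st: "\<And>n. 0 < s n \<and> s n < h n" "\<And>n. 0 < t n \<and> t n < h n"
    "\<And>n. 0 < s' n \<and> s' n < h n" "\<And>n. 0 < t' n \<and> t' n < h n"
    "\<And>n. Re (dir_deriv v (dir_deriv u f) (z + s n *\<^sub>R u + t n *\<^sub>R v)) = Re (dir_deriv u (dir_deriv v f) (z + s' n *\<^sub>R v + t' n *\<^sub>R u))"
    by metis
  have lim0: "x \<longlonglongrightarrow> 0" if "\<And>n. 0 < x n \<and> x n < h n" for x
    by (rule tendsto_sandwich[OF _ _ tendsto_const hlim]) (rule always_eventually, use that in \<open>auto intro: less_imp_le\<close>)+
  have L: "(\<lambda>n. Re (dir_deriv b (dir_deriv a f) (z + x n *\<^sub>R a + y n *\<^sub>R b))) \<longlonglongrightarrow> Re (dir_deriv b (dir_deriv a f) z)"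
    if "x \<longlonglongrightarrow> 0" "y \<longlonglongrightarrow> 0" for a b x y
  proof -
    have "(\<lambda>n. z + x n *\<^sub>R a + y n *\<^sub>R b) \<longlonglongrightarrow> z + 0 *\<^sub>R a + 0 *\<^sub>R b"
      by (intro tendsto_intros that)
    then have "(\<lambda>n. dir_deriv b (dir_deriv a f) (z + x n *\<^sub>R a + y n *\<^sub>R b)) \<longlonglongrightarrow> dir_deriv b (dir_deriv a f) z"
      by (intro continuous_on_tendsto_compose[OF smooth_continuous[OF smooth_dir_deriv[OF smooth_dir_deriv[OF f]]]]) auto
    then show ?thesis by (rule tendsto_Re)
  qed
  show ?thesis
  proof (rule LIMSEQ_unique)
    show "(\<lambda>n. Re (dir_deriv v (dir_deriv u f) (z + s n *\<^sub>R u + t n *\<^sub>R v))) \<longlonglongrightarrow> Re (dir_deriv v (dir_deriv u f) z)"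
      by (rule L[OF lim0[OF st(1)] lim0[OF st(2)]])
    show "(\<lambda>n. Re (dir_deriv v (dir_deriv u f) (z + s n *\<^sub>R u + t n *\<^sub>R v))) \<longlonglongrightarrow> Re (dir_deriv u (dir_deriv v f) z)"
      unfolding st(5) by (rule L[OF lim0[OF st(3)] lim0[OF st(4)]])
  qed
qed

lemma dir_deriv_commute:
  assumes f: "smooth f"
  shows "dir_deriv v (dir_deriv u f) = dir_deriv u (dir_deriv v f)"
proof
  fix z
  \<comment> \<open>The real part of -i w is the imaginary part of w, so the real case applied to -i
    f settles the imaginary parts.\<close>
  have s: "smooth (\<lambda>z. - \<i> * f z)" by (rule smooth_cmult[OF f])
  have "dir_deriv v (dir_deriv u (\<lambda>z. - \<i> * f z)) z = - \<i> * dir_deriv v (dir_deriv u f) z" for u v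
    unfolding dir_deriv_cmult[OF f] dir_deriv_cmult[OF smooth_dir_deriv[OF f]] ..
  then have "Im (dir_deriv v (dir_deriv u f) z) = Im (dir_deriv u (dir_deriv v f) z)"
    using Re_dir_deriv_commute[OF s, of v u z] by simp
  with Re_dir_deriv_commute[OF f, of v u z]
  show "dir_deriv v (dir_deriv u f) z = dir_deriv u (dir_deriv v f) z" by (simp add: complex_eq_iff)
qed

section \<open>Wirtinger derivatives\<close>

lemma smooth_dbar: "smooth f \<Longrightarrow> smooth (dbar r f)"
proof -
  assume f: "smooth f"
  have "smooth (\<lambda>z. (1/2) * (dir_deriv (axis r 1) f z + \<i> * dir_deriv (axis r \<i>) f z))"
    by (intro smooth_cmult smooth_add smooth_dir_deriv f)
  then show ?thesis by (simp add: dbar_def)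
qed

lemma dbar_add: "smooth f \<Longrightarrow> smooth g \<Longrightarrow> dbar r (\<lambda>z. f z + g z) = (\<lambda>z. dbar r f z + dbar r g z)"
  by (auto simp: dbar_def dir_deriv_add smooth_differentiable fun_eq_iff field_simps)

lemma dbar_mult: "smooth f \<Longrightarrow> smooth g \<Longrightarrow> dbar r (\<lambda>z. f z * g z) = (\<lambda>z. f z * dbar r g z + dbar r f z * g z)"
  by (auto simp: dbar_def dir_deriv_mult smooth_differentiable fun_eq_iff field_simps)

lemma dbar_exp: "smooth f \<Longrightarrow> dbar r (\<lambda>z. exp (f z)) = (\<lambda>z. dbar r f z * exp (f z))"
  by (auto simp: dbar_def dir_deriv_exp smooth_differentiable fun_eq_iff field_simps)

lemma dbar_const: "dbar r (\<lambda>z. c) = (\<lambda>z. 0)"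
  by (simp add: dbar_def dir_deriv_const)

lemma dbar_cmult: "smooth f \<Longrightarrow> dbar r (\<lambda>z. c * f z) = (\<lambda>z. c * dbar r f z)"
  by (simp add: dbar_mult smooth_const dbar_const)

lemma dbar_bounded_linear:
  "bounded_linear f \<Longrightarrow> dbar r f = (\<lambda>z. (f (axis r 1) + \<i> * f (axis r \<i>)) / 2)"
  by (simp add: dbar_def dir_deriv_bounded_linear)

lemma dbar_commute:
  assumes f: "smooth f"
  shows "dbar r (dbar s f) = dbar s (dbar r f)"
proof -
  have D: "dir_deriv v (dbar s f) = (\<lambda>z. (dir_deriv v (dir_deriv (axis s 1) f) z + \<i> * dir_deriv v (dir_deriv (axis s \<i>) f) z) / 2)" for v s
  proof -
    have eq: "dbar s f = (\<lambda>z. (1/2) * (dir_deriv (axis s 1) f z + \<i> * dir_deriv (axis s \<i>) f z))"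
      by (simp add: dbar_def)
    have 1: "smooth (dir_deriv (axis s 1) f)" "smooth (dir_deriv (axis s \<i>) f)"
      by (intro smooth_dir_deriv f)+
    have 2: "smooth (\<lambda>z. \<i> * dir_deriv (axis s \<i>) f z)" by (rule smooth_cmult[OF 1(2)])
    show ?thesis
      unfolding eq dir_deriv_cmult[OF smooth_add[OF 1(1) 2]] dir_deriv_cmult[OF 1(2)]
        dir_deriv_add(1)[OF smooth_differentiable[OF 1(1)] smooth_differentiable[OF 2]] by simp
  qed
  show ?thesis
    unfolding dbar_def[of r "dbar s f"] dbar_def[of s "dbar r f"] D
    by (simp add: fun_eq_iff dir_deriv_commute[OF f, of "axis r _" "axis s _"] algebra_simps add_divide_distrib)
qed

text \<open>The order is peeled off one Wirtinger derivative at a time, in arbitrary coordinates.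
  This fits inductions with the Leibniz rule; \<open>m_analytic_iff_poly_an\<close> links it to
  multi-indices.\<close>

fun poly_an :: "nat \<Rightarrow> (complex^'n::finite \<Rightarrow> complex) \<Rightarrow> bool" where
  "poly_an 0 f \<longleftrightarrow> f = (\<lambda>z. 0)"
| "poly_an (Suc m) f \<longleftrightarrow> smooth f \<and> (\<forall>r. poly_an m (dbar r f))"

lemma poly_an_smooth: "poly_an m f \<Longrightarrow> smooth f"
  by (cases m) (auto simp: smooth_const)

lemma poly_an_zero: "poly_an m (\<lambda>z. 0)"
  by (induction m) (auto simp: smooth_const dbar_const)

lemma poly_an_Suc: "poly_an m f \<Longrightarrow> poly_an (Suc m) f"
  by (induction m arbitrary: f) (auto simp: smooth_const dbar_const)

lemma poly_an_mono: "m \<le> m' \<Longrightarrow> poly_an m f \<Longrightarrow> poly_an m' f"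
  by (induction m' rule: dec_induct) (auto intro: poly_an_Suc simp del: poly_an.simps)

lemma poly_an_add: "poly_an m f \<Longrightarrow> poly_an m g \<Longrightarrow> poly_an m (\<lambda>z. f z + g z)"
  by (induction m arbitrary: f g) (auto simp: smooth_add dbar_add)

lemma poly_an_cmult: "poly_an m f \<Longrightarrow> poly_an m (\<lambda>z. c * f z)"
  by (induction m arbitrary: f) (auto simp: smooth_cmult dbar_cmult)

lemma poly_an_sum: "(\<And>i. i \<in> I \<Longrightarrow> poly_an m (f i)) \<Longrightarrow> poly_an m (\<lambda>z. \<Sum>i\<in>I. f i z)"
  by (induction I rule: infinite_finite_induct) (auto simp: poly_an_zero intro!: poly_an_add)

text \<open>Order 1 means holomorphic, and a holomorphic factor passes through every Wirtinger
  derivative.\<close>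

lemma poly_an_mult_hol:
  assumes "poly_an 1 g"
  shows "poly_an m f \<Longrightarrow> poly_an m (\<lambda>z. g z * f z)"
proof (induction m arbitrary: f)
  case (Suc m)
  have g: "smooth g" "dbar r g = (\<lambda>z. 0)" for r using assms by auto
  with Suc show ?case by (auto simp: dbar_mult smooth_mult)
qed simp

lemma bounded_linear_Im_nth: "bounded_linear (\<lambda>z::complex^'n. complex_of_real (Im (z $ r)))"
  using bounded_linear_compose[OF bounded_linear_of_real
    bounded_linear_compose[OF bounded_linear_Im bounded_linear_vec_nth[of r]]] by simp

text \<open>Every Wirtinger derivative of Im z_r is constant. In the Leibniz rule one term keeps the
  factor but has a derivative of f, the other is a multiple of f; both are of order
  \<open>Suc m\<close> when f is.\<close>

lemma poly_an_mult_Im: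
  fixes f :: "complex^'n \<Rightarrow> complex"
  shows "poly_an m f \<Longrightarrow> poly_an (Suc m) (\<lambda>z. complex_of_real (Im (z $ r)) * f z)"
proof (induction m arbitrary: f)
  case 0
  then show ?case by (simp add: smooth_const dbar_const)
next
  case (Suc m)
  let ?v = "\<lambda>z::complex^'n. complex_of_real (Im (z $ r))"
  have v: "smooth ?v" "dbar s ?v = (\<lambda>z. (?v (axis s 1) + \<i> * ?v (axis s \<i>)) / 2)" for s
    using smooth_bounded_linear[OF bounded_linear_Im_nth[of r]] dbar_bounded_linear[OF bounded_linear_Im_nth[of r]]
    by auto
  have f: "smooth f" "poly_an m (dbar s f)" for s using Suc.prems by auto
  have "poly_an (Suc m) (dbar s (\<lambda>z. ?v z * f z))" for s
    unfolding dbar_mult[OF v(1) f(1)] v(2)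
    by (intro poly_an_add Suc.IH f poly_an_cmult Suc.prems)
  then show ?case using v f by (simp add: smooth_mult)
qed

section \<open>Words in the Wirtinger derivatives and multi-indices\<close>

lemma foldr_dbar_poly_an:
  "poly_an m f \<Longrightarrow> length rs = m \<Longrightarrow> foldr dbar rs f = (\<lambda>z. 0)"
proof (induction rs arbitrary: m f rule: rev_induct)
  case (snoc r rs)
  then show ?case by (cases m) auto
qed simp

lemma poly_an_if_words:
  "smooth f \<Longrightarrow> (\<And>rs. length rs = m \<Longrightarrow> foldr dbar rs f = (\<lambda>z. 0)) \<Longrightarrow> poly_an m f"
proof (induction m arbitrary: f)
  case 0
  then show ?case using "0.prems"(2)[of "[]"] by simp
next
  case (Suc m)
  have "poly_an m (dbar r f)" for r
  proof (rule Suc.IH)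
    show "smooth (dbar r f)" by (rule smooth_dbar[OF Suc.prems(1)])
    show "foldr dbar rs (dbar r f) = (\<lambda>z. 0)" if "length rs = m" for rs
      using Suc.prems(2)[of "rs @ [r]"] that by simp
  qed
  with Suc.prems show ?case by simp
qed

lemma smooth_foldr_dbar: "smooth f \<Longrightarrow> smooth (foldr dbar rs f)"
  by (induction rs) (auto intro: smooth_dbar)

lemma foldr_dbar_remove1:
  "smooth f \<Longrightarrow> r \<in> set rs \<Longrightarrow> foldr dbar rs f = dbar r (foldr dbar (remove1 r rs) f)"
  by (induction rs) (auto simp: dbar_commute[OF smooth_foldr_dbar])

lemma foldr_dbar_perm:
  "smooth f \<Longrightarrow> mset rs = mset rs' \<Longrightarrow> foldr dbar rs f = foldr dbar rs' f"
proof (induction rs arbitrary: rs')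
  case (Cons r rs)
  have "r \<in> set rs'" using Cons.prems(2) by (metis list.set_intros(1) mset_eq_setD)
  moreover have eq: "mset rs = mset (remove1 r rs')" using Cons.prems(2) by (metis mset_remove1 remove1.simps(2))
  ultimately show ?case
    using Cons.IH[OF Cons.prems(1) eq] foldr_dbar_remove1[OF Cons.prems(1), of r rs'] by simp
qed simp

definition word_of :: "('n::{finite,linorder} \<Rightarrow> nat) \<Rightarrow> 'n list" where
  "word_of k = concat (map (\<lambda>r. replicate (k r) r) (sorted_list_of_set UNIV))"

lemma foldr_dbar_replicate: "foldr dbar (replicate n r) f = (dbar r ^^ n) f"
  by (induction n) auto

lemma dbar_multi_word: "dbar_multi k f = foldr dbar (word_of k) f"
proof -
  have "foldr (\<lambda>r. dbar r ^^ k r) xs f = foldr dbar (concat (map (\<lambda>r. replicate (k r) r) xs)) f" for xs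
    by (induction xs) (auto simp: foldr_dbar_replicate)
  then show ?thesis by (simp add: dbar_multi_def word_of_def)
qed

lemma count_word_of: "count (mset (word_of k)) r = k r"
proof -
  have "count (mset (concat (map (\<lambda>r. replicate (k r) r) xs))) r = (if r \<in> set xs then k r else 0)" if "distinct xs" for xs
    using that by (induction xs) auto
  from this[of "sorted_list_of_set UNIV"] show ?thesis by (simp add: word_of_def)
qed

lemma length_word_of: "length (word_of k) = (\<Sum>r\<in>UNIV. k r)"
proof -
  have "size (mset (word_of k)) = (\<Sum>r\<in>set_mset (mset (word_of k)). k r)"
    unfolding size_multiset_overloaded_eq count_word_of ..
  also have "\<dots> = (\<Sum>r\<in>UNIV. k r)"
    by (rule sum.mono_neutral_left) (auto, metis count_word_of count_mset_0_iff)
  finally show ?thesis by simp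
qed

text \<open>\<open>m_analytic\<close> tests sorted words only, \<open>poly_an\<close> all words of
  length m. Since Wirtinger derivatives of smooth functions commute, a word matters only through the
  multiplicities of its letters.\<close>

lemma m_analytic_iff_poly_an: "m_analytic m f \<longleftrightarrow> poly_an m f"
proof
  assume *: "m_analytic m f"
  then have f: "smooth f" by (simp add: m_analytic_def)
  show "poly_an m f"
  proof (rule poly_an_if_words[OF f])
    fix rs :: "'a list" assume "length rs = m"
    define k where "k r = count (mset rs) r" for r
    have eq: "mset (word_of k) = mset rs" by (rule multiset_eqI) (simp only: count_word_of k_def)
    then have "(\<Sum>r\<in>UNIV. k r) = m" using \<open>length rs = m\<close> length_word_of[of k] by (metis size_mset)
    then have "dbar_multi k f = (\<lambda>z. 0)" using * by (simp add: m_analytic_def)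
    then show "foldr dbar rs f = (\<lambda>z. 0)"
      using foldr_dbar_perm[OF f eq] by (simp add: dbar_multi_word)
  qed
next
  assume *: "poly_an m f"
  then show "m_analytic m f"
    unfolding m_analytic_def dbar_multi_word
    by (auto intro: poly_an_smooth foldr_dbar_poly_an simp: length_word_of)
qed

section \<open>Fourier--Laplace transforms\<close>

definition cdot :: "real^'n::finite \<Rightarrow> complex^'n \<Rightarrow> complex" where
  "cdot \<xi> z = (\<Sum>r\<in>UNIV. complex_of_real (\<xi> $ r) * z $ r)"

lemma cdot_add: "cdot \<xi> (z + w) = cdot \<xi> z + cdot \<xi> w"
  by (simp add: cdot_def distrib_left sum.distrib)

lemma cdot_scaleR: "cdot \<xi> (t *\<^sub>R w) = t *\<^sub>R cdot \<xi> w"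
  by (simp add: cdot_def scaleR_sum_right)

lemma norm_cdot_le: "norm (cdot \<xi> z) \<le> norm \<xi> * norm z"
proof -
  have "norm (cdot \<xi> z) \<le> (\<Sum>r\<in>UNIV. \<bar>\<xi> $ r\<bar> * \<bar>norm (z $ r)\<bar>)"
    unfolding cdot_def by (rule order_trans[OF norm_sum]) (simp add: norm_mult)
  also have "\<dots> \<le> L2_set (\<lambda>r. \<xi> $ r) UNIV * L2_set (\<lambda>r. norm (z $ r)) UNIV"
    by (rule L2_set_mult_ineq)
  also have "\<dots> = norm \<xi> * norm z"
    by (simp add: norm_vec_def L2_set_def)
  finally show ?thesis .
qed

lemma cdot_axis: "cdot \<xi> (axis r c) = complex_of_real (\<xi> $ r) * c"
proof -
  have "cdot \<xi> (axis r c) = (\<Sum>s\<in>UNIV. if s = r then complex_of_real (\<xi> $ r) * c else 0)"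
    unfolding cdot_def by (rule sum.cong) (auto simp: axis_def)
  then show ?thesis by simp
qed

lemma cdot_measurable [measurable]: "(\<lambda>\<xi>. cdot \<xi> z) \<in> borel_measurable borel"
  unfolding cdot_def by (intro borel_measurable_continuous_onI continuous_intros)

text \<open>Decay beyond every exponential: it survives multiplication by polynomials in \<xi>, and
  it makes the Fourier-Laplace integral converge at every complex point.\<close>

definition superexp :: "('a::euclidean_space \<Rightarrow> complex) \<Rightarrow> bool" where
  "superexp h \<longleftrightarrow> h \<in> borel_measurable borel \<and> (\<forall>c. integrable nlborel (\<lambda>\<xi>. norm (h \<xi>) * exp (c * norm \<xi>)))"

lemma superexp_measurable: "superexp h \<Longrightarrow> h \<in> borel_measurable borel"
  by (simp add: superexp_def)

lemma superexp_bound: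
  assumes h: "superexp h" and m: "g \<in> borel_measurable borel"
    and le: "\<And>\<xi>. norm (g \<xi>) \<le> C * (norm (h \<xi>) * exp (c * norm \<xi>))"
  shows "superexp g" "integrable nlborel g"
proof -
  note [measurable] = m superexp_measurable[OF h]
  have gm: "g \<in> borel_measurable nlborel" using m by (simp cong: measurable_cong_sets)
  have "integrable nlborel (\<lambda>\<xi>. norm (g \<xi>) * exp (b * norm \<xi>))" for b
  proof (rule Bochner_Integration.integrable_bound)
    show "integrable nlborel (\<lambda>\<xi>. C * (norm (h \<xi>) * exp ((c + b) * norm \<xi>)))"
      using h by (simp add: superexp_def)
    show "AE \<xi> in nlborel. norm (norm (g \<xi>) * exp (b * norm \<xi>)) \<le> norm (C * (norm (h \<xi>) * exp ((c + b) * norm \<xi>)))"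
    proof (intro always_eventually allI)
      fix \<xi>
      have "norm (g \<xi>) * exp (b * norm \<xi>) \<le> C * (norm (h \<xi>) * exp (c * norm \<xi>)) * exp (b * norm \<xi>)"
        by (intro mult_right_mono le) simp
      also have "\<dots> = C * (norm (h \<xi>) * exp ((c + b) * norm \<xi>))"
        by (simp add: exp_add distrib_right)
      finally show "norm (norm (g \<xi>) * exp (b * norm \<xi>)) \<le> norm (C * (norm (h \<xi>) * exp ((c + b) * norm \<xi>)))"
        by simp
    qed
  qed (use gm in measurable)
  then show "superexp g" using m by (simp add: superexp_def)
  show "integrable nlborel g"
  proof (rule Bochner_Integration.integrable_bound[OF _ gm])
    show "integrable nlborel (\<lambda>\<xi>. C * (norm (h \<xi>) * exp (c * norm \<xi>)))"
      using h by (simp add: superexp_def)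
    show "AE \<xi> in nlborel. norm (g \<xi>) \<le> norm (C * (norm (h \<xi>) * exp (c * norm \<xi>)))"
      by (intro always_eventually allI order_trans[OF le]) simp
  qed
qed

lemma superexp_add:
  assumes "superexp g" "superexp h"
  shows "superexp (\<lambda>\<xi>. g \<xi> + h \<xi>)"
proof -
  note [measurable] = superexp_measurable[OF assms(1)] superexp_measurable[OF assms(2)]
  have "integrable nlborel (\<lambda>\<xi>. norm (g \<xi> + h \<xi>) * exp (c * norm \<xi>))" for c
  proof (rule Bochner_Integration.integrable_bound)
    show "integrable nlborel (\<lambda>\<xi>. norm (g \<xi>) * exp (c * norm \<xi>) + norm (h \<xi>) * exp (c * norm \<xi>))"
      using assms by (simp add: superexp_def)
    show "AE \<xi> in nlborel. norm (norm (g \<xi> + h \<xi>) * exp (c * norm \<xi>)) \<le> norm (norm (g \<xi>) * exp (c * norm \<xi>) + norm (h \<xi>) * exp (c * norm \<xi>))"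
    proof (intro always_eventually allI)
      fix \<xi>
      have "norm (g \<xi> + h \<xi>) * exp (c * norm \<xi>) \<le> (norm (g \<xi>) + norm (h \<xi>)) * exp (c * norm \<xi>)"
        by (intro mult_right_mono norm_triangle_ineq) simp
      then show "norm (norm (g \<xi> + h \<xi>) * exp (c * norm \<xi>)) \<le> norm (norm (g \<xi>) * exp (c * norm \<xi>) + norm (h \<xi>) * exp (c * norm \<xi>))"
        by (simp add: distrib_right)
    qed
  next
    have "(\<lambda>\<xi>. norm (g \<xi> + h \<xi>) * exp (c * norm \<xi>)) \<in> borel_measurable borel" by measurable
    then show "(\<lambda>\<xi>. norm (g \<xi> + h \<xi>) * exp (c * norm \<xi>)) \<in> borel_measurable nlborel" by (simp cong: measurable_cong_sets)
  qed
  then show ?thesis by (simp add: superexp_def)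
qed

definition exp_transform :: "real \<Rightarrow> (real^'n::finite \<Rightarrow> complex) \<Rightarrow> complex^'n \<Rightarrow> complex" where
  "exp_transform s h z = (LINT \<xi>|nlborel. h \<xi> * exp (\<i> * s * cdot \<xi> z))"

lemma norm_exp_cdot_le: "norm (exp (\<i> * complex_of_real s * cdot \<xi> z)) \<le> exp (\<bar>s\<bar> * norm z * norm \<xi>)"
proof -
  have "norm (exp (\<i> * complex_of_real s * cdot \<xi> z)) \<le> exp (norm (\<i> * complex_of_real s * cdot \<xi> z))"
    by (rule norm_exp)
  also have "\<dots> \<le> exp (\<bar>s\<bar> * norm z * norm \<xi>)"
    using mult_left_mono[OF norm_cdot_le[of \<xi> z], of "\<bar>s\<bar>"] by (simp add: norm_mult mult_ac)
  finally show ?thesis .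
qed

lemma exp_transform_integrable:
  assumes h: "superexp h"
  shows "integrable nlborel (\<lambda>\<xi>. h \<xi> * exp (\<i> * complex_of_real s * cdot \<xi> z))"
proof (rule superexp_bound(2)[OF h, where C=1])
  show "norm (h \<xi> * exp (\<i> * complex_of_real s * cdot \<xi> z)) \<le> 1 * (norm (h \<xi>) * exp ((\<bar>s\<bar> * norm z) * norm \<xi>))" for \<xi>
    using mult_left_mono[OF norm_exp_cdot_le[of s \<xi> z], of "norm (h \<xi>)"] by (simp add: norm_mult)
qed (use superexp_measurable[OF h] in measurable)

lemma exp_transform_add:
  assumes "superexp g" "superexp h"
  shows "exp_transform s (\<lambda>\<xi>. g \<xi> + h \<xi>) z = exp_transform s g z + exp_transform s h z"
  unfolding exp_transform_def
  using exp_transform_integrable[OF assms(1)] exp_transform_integrable[OF assms(2)]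
  by (simp add: distrib_right)

lemma exp_transform_cmult: "exp_transform s (\<lambda>\<xi>. c * h \<xi>) z = c * exp_transform s h z"
  unfolding exp_transform_def by (simp add: mult.assoc)

lemma superexp_cdot:
  assumes h: "superexp h"
  shows "superexp (\<lambda>\<xi>. h \<xi> * (\<i> * complex_of_real s * cdot \<xi> w))"
proof (rule superexp_bound(1)[OF h])
  show "norm (h \<xi> * (\<i> * complex_of_real s * cdot \<xi> w)) \<le> (\<bar>s\<bar> * norm w) * (norm (h \<xi>) * exp (1 * norm \<xi>))" for \<xi>
  proof -
    have "norm \<xi> \<le> exp (norm \<xi>)" using exp_ge_add_one_self[of "norm \<xi>"] by linarith
    then have "norm (cdot \<xi> w) \<le> exp (norm \<xi>) * norm w"
      by (intro order_trans[OF norm_cdot_le] mult_right_mono) auto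
    then have "\<bar>s\<bar> * norm (h \<xi>) * norm (cdot \<xi> w) \<le> \<bar>s\<bar> * norm (h \<xi>) * (exp (norm \<xi>) * norm w)"
      by (intro mult_left_mono) auto
    then show ?thesis by (simp add: norm_mult mult_ac)
  qed
qed (use superexp_measurable[OF h] in measurable)

lemma norm_exp_taylor1:
  fixes x :: complex
  shows "norm (exp x - 1 - x) \<le> (norm x)\<^sup>2 * exp (norm x)"
proof -
  have "norm (exp x - (\<Sum>i\<le>1. x ^ i / fact i)) \<le> exp \<bar>Re x\<bar> * (norm x) ^ Suc 1 / fact 1"
    by (rule Taylor_exp)
  then have "norm (exp x - 1 - x) \<le> exp \<bar>Re x\<bar> * (norm x)\<^sup>2"
    by (simp add: diff_diff_eq power2_eq_square)
  also have "\<dots> \<le> exp (norm x) * (norm x)\<^sup>2"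
    using abs_Re_le_cmod[of x] by (intro mult_right_mono) auto
  finally show ?thesis by (simp add: mult.commute)
qed

text \<open>The integrand is expanded to first order in w. The bound |e^x - 1 - x| \<le> |x|^2 e^|x|
  makes the remainder quadratic in w after integration, because h outweighs every
  exponential.\<close>

lemma exp_transform_has_derivative:
  assumes h: "superexp h" and s: "s > 0"
  shows "(exp_transform s h has_derivative (\<lambda>w. exp_transform s (\<lambda>\<xi>. h \<xi> * (\<i> * complex_of_real s * cdot \<xi> w)) z)) (at z)"
proof -
  note [measurable] = superexp_measurable[OF h]
  let ?e = "\<lambda>\<xi>. exp (\<i> * complex_of_real s * cdot \<xi> z)"
  let ?D = "\<lambda>w. exp_transform s (\<lambda>\<xi>. h \<xi> * (\<i> * complex_of_real s * cdot \<xi> w)) z"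
  \<comment> \<open>Of the three multiples of s|\<xi>|, one bounds the exponent |x| when |w| \<le>
    1, and two come from replacing the factor (s|\<xi>|)^2 by e^(2 s|\<xi>|).\<close>
  define C where "C = (LINT \<xi>|nlborel. norm (h \<xi>) * exp ((s * norm z + 3 * s) * norm \<xi>))"
  have Ci: "integrable nlborel (\<lambda>\<xi>. norm (h \<xi>) * exp ((s * norm z + 3 * s) * norm \<xi>))"
    using h by (simp add: superexp_def)
  have Dadd: "?D (v + w) = ?D v + ?D w" for v w
    using exp_transform_add[OF superexp_cdot[OF h] superexp_cdot[OF h], of s s v s w z] by (simp add: cdot_add distrib_left)
  have Dscale: "?D (t *\<^sub>R w) = t *\<^sub>R ?D w" for t w
  proof -
    have eq: "(\<lambda>\<xi>. h \<xi> * (\<i> * complex_of_real s * cdot \<xi> (t *\<^sub>R w)))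
        = (\<lambda>\<xi>. complex_of_real t * (h \<xi> * (\<i> * complex_of_real s * cdot \<xi> w)))"
      by (simp add: cdot_scaleR scaleR_conv_of_real[of _ "_::complex"] mult_ac)
    show ?thesis unfolding eq exp_transform_cmult scaleR_conv_of_real[of t "_::complex"] ..
  qed
  have "linear ?D" by (rule linearI) (fact Dadd Dscale)+
  then have lin: "bounded_linear ?D" by (simp add: linear_conv_bounded_linear)
  have rem: "norm (exp_transform s h (z + w) - exp_transform s h z - ?D w) \<le> (norm w)\<^sup>2 * C" if w: "norm w \<le> 1" for w
  proof -
    have "exp_transform s h (z + w) - exp_transform s h z - ?D w
        = (LINT \<xi>|nlborel. h \<xi> * exp (\<i> * complex_of_real s * cdot \<xi> (z + w)) - h \<xi> * ?e \<xi>
             - h \<xi> * (\<i> * complex_of_real s * cdot \<xi> w) * ?e \<xi>)"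
      unfolding exp_transform_def
      using exp_transform_integrable[OF h, of s "z + w"] exp_transform_integrable[OF h, of s z]
        exp_transform_integrable[OF superexp_cdot[OF h, of s w], of s z]
      by simp
    also have "norm \<dots> \<le> (LINT \<xi>|nlborel. (norm w)\<^sup>2 * (norm (h \<xi>) * exp ((s * norm z + 3 * s) * norm \<xi>)))"
    proof (rule order_trans[OF integral_norm_bound integral_mono])
      show "integrable nlborel (\<lambda>\<xi>. norm (h \<xi> * exp (\<i> * complex_of_real s * cdot \<xi> (z + w)) - h \<xi> * ?e \<xi>
             - h \<xi> * (\<i> * complex_of_real s * cdot \<xi> w) * ?e \<xi>))"
        using exp_transform_integrable[OF h, of s "z + w"] exp_transform_integrable[OF h, of s z]
          exp_transform_integrable[OF superexp_cdot[OF h, of s w], of s z]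
        by simp
      show "integrable nlborel (\<lambda>\<xi>. (norm w)\<^sup>2 * (norm (h \<xi>) * exp ((s * norm z + 3 * s) * norm \<xi>)))"
        using Ci by simp
      fix \<xi> :: "real^'a"
      let ?x = "\<i> * complex_of_real s * cdot \<xi> w"
      have x1: "norm ?x \<le> s * norm \<xi> * norm w"
        using mult_left_mono[OF norm_cdot_le[of \<xi> w], of s] s by (simp add: norm_mult mult_ac)
      also have "\<dots> \<le> s * norm \<xi> * 1" using w s by (intro mult_left_mono) auto
      finally have x2: "norm ?x \<le> s * norm \<xi>" by simp
      have "norm (exp ?x - 1 - ?x) \<le> (norm ?x)\<^sup>2 * exp (norm ?x)" by (rule norm_exp_taylor1)
      also have "\<dots> \<le> (s * norm \<xi> * norm w)\<^sup>2 * exp (s * norm \<xi>)"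
        using x1 x2 by (intro mult_mono power_mono) auto
      also have "\<dots> = (norm w)\<^sup>2 * ((s * norm \<xi>)\<^sup>2 * exp (s * norm \<xi>))" by (simp add: power_mult_distrib)
      also have "\<dots> \<le> (norm w)\<^sup>2 * ((exp (s * norm \<xi>))\<^sup>2 * exp (s * norm \<xi>))"
      proof (intro mult_left_mono mult_right_mono power_mono)
        show "s * norm \<xi> \<le> exp (s * norm \<xi>)" using exp_ge_add_one_self[of "s * norm \<xi>"] by linarith
      qed (use s in auto)
      also have "\<dots> = (norm w)\<^sup>2 * exp (3 * s * norm \<xi>)"
        by (simp add: exp_double[symmetric] exp_add[symmetric])
      finally have b1: "norm (exp ?x - 1 - ?x) \<le> (norm w)\<^sup>2 * exp (3 * s * norm \<xi>)" .
      have b2: "norm (?e \<xi>) \<le> exp (s * norm z * norm \<xi>)"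
        using norm_exp_cdot_le[of s \<xi> z] s by simp
      have "h \<xi> * exp (\<i> * complex_of_real s * cdot \<xi> (z + w)) - h \<xi> * ?e \<xi> - h \<xi> * ?x * ?e \<xi>
          = h \<xi> * (?e \<xi> * (exp ?x - 1 - ?x))"
        by (simp add: cdot_add distrib_left exp_add algebra_simps)
      also have "norm \<dots> \<le> norm (h \<xi>) * (exp (s * norm z * norm \<xi>) * ((norm w)\<^sup>2 * exp (3 * s * norm \<xi>)))"
        unfolding norm_mult[of "h \<xi>"] norm_mult[of "?e \<xi>"] using b1 b2 by (intro mult_left_mono mult_mono) auto
      also have "\<dots> = (norm w)\<^sup>2 * (norm (h \<xi>) * exp ((s * norm z + 3 * s) * norm \<xi>))"
        by (simp add: distrib_right exp_add)
      finally show "norm (h \<xi> * exp (\<i> * complex_of_real s * cdot \<xi> (z + w)) - h \<xi> * ?e \<xi> - h \<xi> * ?x * ?e \<xi>)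
          \<le> (norm w)\<^sup>2 * (norm (h \<xi>) * exp ((s * norm z + 3 * s) * norm \<xi>))" .
    qed
    also have "\<dots> = (norm w)\<^sup>2 * C" by (simp add: C_def)
    finally show ?thesis .
  qed
  show ?thesis unfolding has_derivative_at
  proof (intro conjI lin)
    show "(\<lambda>w. norm (exp_transform s h (z + w) - exp_transform s h z - ?D w) / norm w) \<midarrow>0\<rightarrow> 0"
    proof (rule Lim_null_comparison)
      have "((\<lambda>w::complex^'a. norm w * C) \<longlongrightarrow> norm (0::complex^'a) * C) (at 0)"
        by (rule tendsto_mult[OF tendsto_norm[OF tendsto_ident_at] tendsto_const])
      then show "(\<lambda>w::complex^'a. norm w * C) \<midarrow>0\<rightarrow> 0" by simp
      show "\<forall>\<^sub>F w in at 0. norm (norm (exp_transform s h (z + w) - exp_transform s h z - ?D w) / norm w) \<le> norm w * C"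
        unfolding eventually_at
      proof (intro exI[of _ 1] conjI ballI impI)
        fix w :: "complex^'a" assume w: "w \<noteq> 0 \<and> dist w 0 < 1"
        then have "norm w \<le> 1" by simp
        from divide_right_mono[OF rem[OF this], of "norm w"] w
        show "norm (norm (exp_transform s h (z + w) - exp_transform s h z - ?D w) / norm w) \<le> norm w * C"
          by (simp add: power2_eq_square)
      qed simp
    qed
  qed
qed

text \<open>A directional derivative is again a transform, of h times a linear function of \<xi>,
  and this factor keeps the decay.\<close>

lemma smooth_exp_transform:
  assumes h: "superexp h" and s: "s > 0"
  shows "smooth (exp_transform s h)"
proof (rule smooth_coinduct[of _ "{exp_transform s h |h. superexp h}"])
  note D = dir_deriv_eqI[OF exp_transform_has_derivative[OF _ s]]
  show "g differentiable_on UNIV" if "g \<in> {exp_transform s h |h. superexp h}" for g :: "complex^'a \<Rightarrow> complex"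
    using that D(1) by blast
  show "dir_deriv v g \<in> {exp_transform s h |h. superexp h}" if g: "g \<in> {exp_transform s h |h. superexp h}" for g :: "complex^'a \<Rightarrow> complex" and v
  proof -
    obtain h where h: "superexp h" "g = exp_transform s h" using g by blast
    have "dir_deriv v g = exp_transform s (\<lambda>\<xi>. h \<xi> * (\<i> * complex_of_real s * cdot \<xi> v))"
      unfolding h(2) D(2)[OF h(1)] ..
    then show ?thesis using superexp_cdot[OF h(1)] by blast
  qed
qed (use h in blast)

text \<open>The derivative in direction w depends on w through the complex linear
  \<open>cdot\<close>, so passing from direction 1 to direction i multiplies it by i.\<close>

lemma dbar_exp_transform:
  assumes h: "superexp h" and s: "s > 0"
  shows "dbar r (exp_transform s h) = (\<lambda>z. 0)"
proof
  fix z
  note D = dir_deriv_eqI(2)[OF exp_transform_has_derivative[OF h s]]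
  have "exp_transform s (\<lambda>\<xi>. h \<xi> * (\<i> * complex_of_real s * cdot \<xi> (axis r \<i>))) z
      = exp_transform s (\<lambda>\<xi>. \<i> * (h \<xi> * (\<i> * complex_of_real s * cdot \<xi> (axis r 1)))) z"
    by (simp add: cdot_axis mult_ac)
  also have "\<dots> = \<i> * exp_transform s (\<lambda>\<xi>. h \<xi> * (\<i> * complex_of_real s * cdot \<xi> (axis r 1))) z"
    by (rule exp_transform_cmult)
  finally show "dbar r (exp_transform s h) z = 0" unfolding dbar_def D by simp
qed

lemma poly_an_exp_transform: "superexp h \<Longrightarrow> s > 0 \<Longrightarrow> poly_an 1 (exp_transform s h)"
  by (simp add: smooth_exp_transform dbar_exp_transform)

text \<open>\<open>poly_xv d P\<close>: \<open>P\<close> is a polynomial in \<open>\<xi>\<close> and \<open>v\<close> whose degree in \<open>v\<close> is at most \<open>d\<close>.\<close>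

inductive poly_xv :: "nat \<Rightarrow> (real^'n::finite \<Rightarrow> real^'n \<Rightarrow> real) \<Rightarrow> bool" where
  const: "poly_xv 0 (\<lambda>\<xi> v. c)"
| xi: "poly_xv d P \<Longrightarrow> poly_xv d (\<lambda>\<xi> v. \<xi> $ r * P \<xi> v)"
| v: "poly_xv d P \<Longrightarrow> poly_xv (Suc d) (\<lambda>\<xi> v. v $ r * P \<xi> v)"
| add: "poly_xv d P \<Longrightarrow> poly_xv d Q \<Longrightarrow> poly_xv d (\<lambda>\<xi> v. P \<xi> v + Q \<xi> v)"
| weaken: "poly_xv d P \<Longrightarrow> poly_xv (Suc d) P"

lemma poly_xv_mono: "d \<le> e \<Longrightarrow> poly_xv d P \<Longrightarrow> poly_xv e P"
  by (induction e rule: dec_induct) (auto intro: poly_xv.weaken)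

lemma poly_xv_mult:
  assumes "poly_xv d P" "poly_xv e Q"
  shows "poly_xv (d + e) (\<lambda>\<xi> v. P \<xi> v * Q \<xi> v)"
  using assms(1)
proof induction
  case (const c)
  show ?case using assms(2)
  proof induction
    case (const b)
    show ?case using poly_xv.const[of "c * b"] by simp
  next
    case (xi d P r)
    from poly_xv.xi[OF xi.IH, of r] show ?case by (simp add: mult_ac)
  next
    case (v d P r)
    from poly_xv.v[OF v.IH, of r] show ?case by (simp add: mult_ac)
  next
    case (add d P Q)
    from poly_xv.add[OF add.IH] show ?case by (simp add: distrib_left)
  next
    case (weaken d P)
    from poly_xv.weaken[OF weaken.IH] show ?case by simp
  qed
next
  case (xi d P r)
  from poly_xv.xi[OF xi.IH, of r] show ?case by (simp add: mult.assoc)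
next
  case (v d P r)
  from poly_xv.v[OF v.IH, of r] show ?case by (simp add: mult.assoc)
next
  case (add d P Q)
  from poly_xv.add[OF add.IH] show ?case by (simp add: distrib_right)
next
  case (weaken d P)
  from poly_xv.weaken[OF weaken.IH] show ?case by simp
qed

lemma poly_xv_prod:
  assumes "\<And>r. r \<in> I \<Longrightarrow> poly_xv (k r) (P r)"
  shows "poly_xv (\<Sum>r\<in>I. k r) (\<lambda>\<xi> v. \<Prod>r\<in>I. P r \<xi> v)"
  using assms
proof (induction I rule: infinite_finite_induct)
  case (insert x F)
  then show ?case using poly_xv_mult[of "k x" "P x" "\<Sum>r\<in>F. k r" "\<lambda>\<xi> v. \<Prod>r\<in>F. P r \<xi> v"] by simp
qed (auto intro: poly_xv.const)

lemma poly_xv_poly: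
  assumes t: "poly_xv 1 t"
  shows "degree p \<le> d \<Longrightarrow> poly_xv d (\<lambda>\<xi> v. poly p (t \<xi> v))"
proof (induction p arbitrary: d)
  case 0
  show ?case using poly_xv_mono[OF _ poly_xv.const[of 0]] by simp
next
  case (pCons a p)
  show ?case
  proof (cases "p = 0")
    case True
    then show ?thesis using poly_xv_mono[OF _ poly_xv.const[of a]] by simp
  next
    case False
    then obtain e where e: "d = Suc e" "degree p \<le> e"
      using pCons.prems by (cases d) auto
    from poly_xv_mult[OF t pCons.IH[OF e(2)]]
    have "poly_xv d (\<lambda>\<xi> v. t \<xi> v * poly p (t \<xi> v))" by (simp add: e)
    from poly_xv.add[OF poly_xv_mono[OF _ poly_xv.const[of a]] this] show ?thesis by simp
  qed
qed

lemma degree_herm: "degree (herm j) \<le> j"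
proof (induction j)
  case (Suc j)
  have "degree ([:0, 2:] * herm j) \<le> Suc j"
    using degree_mult_le[of "[:0, 2:]" "herm j"] Suc by simp
  moreover have "degree (pderiv (herm j)) \<le> Suc j"
    using Suc by (simp add: degree_pderiv)
  ultimately show ?case unfolding herm.simps by (rule degree_diff_le)
qed simp

lemma poly_xv_herm_prod:
  fixes k :: "'n::finite \<Rightarrow> nat"
  shows "poly_xv (\<Sum>r\<in>UNIV. k r) (herm_prod k)"
proof -
  have t: "poly_xv 1 (\<lambda>\<xi> v::real^'n. (\<xi> $ r + 2 * v $ r) / sqrt 2)" for r
  proof -
    have a: "poly_xv 1 (\<lambda>\<xi> v::real^'n. \<xi> $ r * (1 / sqrt 2))"
      using poly_xv.weaken[OF poly_xv.xi[OF poly_xv.const[of "1 / sqrt 2"], of r]] by simp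
    have b: "poly_xv 1 (\<lambda>\<xi> v::real^'n. v $ r * (2 / sqrt 2))"
      using poly_xv.v[OF poly_xv.const[of "2 / sqrt 2"], of r] by simp
    from poly_xv.add[OF a b] show ?thesis by (simp add: add_divide_distrib mult.commute)
  qed
  have "herm_prod k = (\<lambda>\<xi> v. \<Prod>r\<in>UNIV. poly (herm (k r)) ((\<xi> $ r + 2 * v $ r) / sqrt 2))"
    by (simp add: herm_prod_def fun_eq_iff)
  then show ?thesis
    using poly_xv_prod[of UNIV k "\<lambda>r \<xi> v. poly (herm (k r)) ((\<xi> $ r + 2 * v $ r) / sqrt 2)"]
      poly_xv_poly[OF t degree_herm] by simp
qed

lemma superexp_poly_xv:
  assumes "poly_xv d P" "superexp h"
  shows "superexp (\<lambda>\<xi>. h \<xi> * complex_of_real (P \<xi> w))"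
  using assms
proof (induction arbitrary: h)
  case (const c)
  show ?case
    by (rule superexp_bound(1)[OF const, where C="\<bar>c\<bar>" and c=0])
      (use superexp_measurable[OF const] in \<open>auto simp: norm_mult\<close>)
next
  case (xi d P r)
  have "superexp (\<lambda>\<xi>. h \<xi> * complex_of_real (\<xi> $ r))"
    using superexp_bound(1)[OF superexp_cdot[OF xi.prems, of 1 "axis r 1"], of "\<lambda>\<xi>. h \<xi> * complex_of_real (\<xi> $ r)" 1 0]
      superexp_measurable[OF xi.prems]
    by (simp add: cdot_axis norm_mult)
  from xi.IH[OF this] show ?case by (simp add: mult_ac)
next
  case (v d P r)
  have "superexp (\<lambda>\<xi>. h \<xi> * complex_of_real (w $ r))"
    by (rule superexp_bound(1)[OF v.prems, where C="\<bar>w $ r\<bar>" and c=0])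
      (use superexp_measurable[OF v.prems] in \<open>auto simp: norm_mult\<close>)
  from v.IH[OF this] show ?case by (simp add: mult_ac)
next
  case (add d P Q)
  from superexp_add[OF add.IH(1)[OF add.prems] add.IH(2)[OF add.prems]] show ?case by (simp add: distrib_left)
qed

definition imv :: "real \<Rightarrow> complex^'n \<Rightarrow> real^'n" where
  "imv s z = (\<chi> r. s * Im (z $ r))"

text \<open>A factor \<xi>_r is absorbed into h. A factor v_r stands for s Im z_r, leaves the
  integral and raises the order by one. Degree d in v thus gives order d + 1, where the 1 is the
  order of the holomorphic transform itself.\<close>

lemma poly_an_poly_xv:
  assumes "poly_xv d P" "superexp h" "s > 0"
  shows "poly_an (Suc d) (\<lambda>z. exp_transform s (\<lambda>\<xi>. h \<xi> * complex_of_real (P \<xi> (imv s z))) z)"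
  using assms
proof (induction arbitrary: h)
  case (const c)
  have "poly_an 1 (\<lambda>z. c * exp_transform s h z)"
    by (intro poly_an_cmult poly_an_exp_transform const)
  then show ?case by (simp add: exp_transform_cmult mult.commute[of "h _"] del: poly_an.simps)
next
  case (xi d P r)
  have "superexp (\<lambda>\<xi>. h \<xi> * complex_of_real (\<xi> $ r))"
    using superexp_poly_xv[OF poly_xv.xi[OF poly_xv.const[of 1], of r] xi.prems(1)] by simp
  from xi.IH[OF this xi.prems(2)] show ?case by (simp add: mult_ac del: poly_an.simps)
next
  case (v d P r)
  have "poly_an (Suc (Suc d)) (\<lambda>z. complex_of_real (Im (z $ r)) * (complex_of_real s * exp_transform s (\<lambda>\<xi>. h \<xi> * complex_of_real (P \<xi> (imv s z))) z))"
    by (intro poly_an_mult_Im poly_an_cmult v.IH v.prems)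
  moreover have "complex_of_real (Im (z $ r)) * (complex_of_real s * exp_transform s (\<lambda>\<xi>. h \<xi> * complex_of_real (P \<xi> (imv s z))) z)
     = exp_transform s (\<lambda>\<xi>. h \<xi> * complex_of_real (imv s z $ r * P \<xi> (imv s z))) z" for z
    using exp_transform_cmult[of s "complex_of_real (imv s z $ r)" "\<lambda>\<xi>. h \<xi> * complex_of_real (P \<xi> (imv s z))" z]
    by (simp add: imv_def mult_ac)
  ultimately show ?case by (simp del: poly_an.simps)
next
  case (add d P Q)
  from poly_an_add[OF add.IH(1)[OF add.prems] add.IH(2)[OF add.prems]]
  show ?case
    using exp_transform_add[OF superexp_poly_xv[OF add.hyps(1) add.prems(1)] superexp_poly_xv[OF add.hyps(2) add.prems(1)]]
    by (simp add: distrib_left del: poly_an.simps)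
next
  case (weaken d P)
  show ?case by (rule poly_an_Suc[OF weaken.IH[OF weaken.prems]])
qed

lemma bounded_linear_nth_complex: "bounded_linear (\<lambda>z::complex^'n. z $ r)"
  by (rule bounded_linear_vec_nth)

lemma poly_an_exp_square:
  fixes c :: complex
  shows "poly_an 1 (\<lambda>z::complex^'n::finite. exp (c * (\<Sum>r\<in>UNIV. (z $ r)\<^sup>2)))"
proof -
  have 1: "poly_an 1 (\<lambda>z::complex^'n. z $ r)" for r
    using smooth_bounded_linear[OF bounded_linear_nth_complex[of r]]
      dbar_bounded_linear[OF bounded_linear_nth_complex[of r]]
    by (auto simp: axis_def)
  have "poly_an 1 (\<lambda>z::complex^'n. c * (\<Sum>r\<in>UNIV. z $ r * z $ r))"
    by (intro poly_an_cmult poly_an_sum poly_an_mult_hol 1)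
  then have "smooth (\<lambda>z::complex^'n. c * (\<Sum>r\<in>UNIV. (z $ r)\<^sup>2))"
    "dbar s (\<lambda>z::complex^'n. c * (\<Sum>r\<in>UNIV. (z $ r)\<^sup>2)) = (\<lambda>z. 0)" for s
    by (auto simp: power2_eq_square)
  then show ?thesis by (simp add: smooth_exp dbar_exp)
qed

section \<open>Circle averages of polyanalytic functions\<close>

text \<open>A relation between \<phi> and its Wirtinger derivative \<psi>, asking for real
  differentiability of \<phi> at every point. The iterated derivatives on a line can so be supplied
  one by one, without a second development of smoothness.\<close>

definition has_wirtinger :: "(complex \<Rightarrow> complex) \<Rightarrow> (complex \<Rightarrow> complex) \<Rightarrow> bool" where
  "has_wirtinger \<phi> \<psi> \<longleftrightarrow> (\<forall>\<zeta>. \<exists>D. (\<phi> has_derivative D) (at \<zeta>) \<and> (D 1 + \<i> * D \<i>) / 2 = \<psi> \<zeta>)"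

fun poly_an1 :: "nat \<Rightarrow> (complex \<Rightarrow> complex) \<Rightarrow> bool" where
  "poly_an1 0 \<phi> \<longleftrightarrow> \<phi> = (\<lambda>\<zeta>. 0)"
| "poly_an1 (Suc m) \<phi> \<longleftrightarrow> (\<exists>\<psi>. poly_an1 m \<psi> \<and> has_wirtinger \<phi> \<psi>)"

lemma has_wirtinger_add:
  assumes "has_wirtinger \<phi> \<psi>" "has_wirtinger \<phi>' \<psi>'"
  shows "has_wirtinger (\<lambda>\<zeta>. \<phi> \<zeta> + \<phi>' \<zeta>) (\<lambda>\<zeta>. \<psi> \<zeta> + \<psi>' \<zeta>)"
  unfolding has_wirtinger_def
proof
  fix \<zeta>
  obtain D where D: "(\<phi> has_derivative D) (at \<zeta>)" "(D 1 + \<i> * D \<i>) / 2 = \<psi> \<zeta>"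
    using assms(1) by (auto simp: has_wirtinger_def)
  obtain D' where D': "(\<phi>' has_derivative D') (at \<zeta>)" "(D' 1 + \<i> * D' \<i>) / 2 = \<psi>' \<zeta>"
    using assms(2) by (auto simp: has_wirtinger_def)
  show "\<exists>D. ((\<lambda>\<zeta>. \<phi> \<zeta> + \<phi>' \<zeta>) has_derivative D) (at \<zeta>) \<and> (D 1 + \<i> * D \<i>) / 2 = \<psi> \<zeta> + \<psi>' \<zeta>"
    by (rule exI, rule conjI, rule has_derivative_add[OF D(1) D'(1)])
      (simp add: D(2)[symmetric] D'(2)[symmetric] algebra_simps add_divide_distrib)
qed

lemma has_wirtinger_cmult:
  assumes "has_wirtinger \<phi> \<psi>"
  shows "has_wirtinger (\<lambda>\<zeta>. c * \<phi> \<zeta>) (\<lambda>\<zeta>. c * \<psi> \<zeta>)"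
  unfolding has_wirtinger_def
proof
  fix \<zeta>
  obtain D where D: "(\<phi> has_derivative D) (at \<zeta>)" "(D 1 + \<i> * D \<i>) / 2 = \<psi> \<zeta>"
    using assms(1) by (auto simp: has_wirtinger_def)
  show "\<exists>D. ((\<lambda>\<zeta>. c * \<phi> \<zeta>) has_derivative D) (at \<zeta>) \<and> (D 1 + \<i> * D \<i>) / 2 = c * \<psi> \<zeta>"
    by (rule exI, rule conjI, rule has_derivative_mult_right[OF D(1)])
      (simp add: D(2)[symmetric] algebra_simps)
qed

lemma has_wirtinger_zero: "has_wirtinger (\<lambda>\<zeta>. 0) (\<lambda>\<zeta>. 0)"
  unfolding has_wirtinger_def by (auto intro!: exI[of _ "\<lambda>h. 0"])

lemma poly_an1_zero: "poly_an1 m (\<lambda>\<zeta>. 0)"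
  by (induction m) (auto intro: has_wirtinger_zero)

lemma poly_an1_add: "poly_an1 m \<phi> \<Longrightarrow> poly_an1 m \<phi>' \<Longrightarrow> poly_an1 m (\<lambda>\<zeta>. \<phi> \<zeta> + \<phi>' \<zeta>)"
proof (induction m arbitrary: \<phi> \<phi>')
  case (Suc m)
  then show ?case by simp (blast intro: has_wirtinger_add)
qed simp

lemma poly_an1_cmult: "poly_an1 m \<phi> \<Longrightarrow> poly_an1 m (\<lambda>\<zeta>. c * \<phi> \<zeta>)"
proof (induction m arbitrary: \<phi>)
  case (Suc m)
  then show ?case by simp (blast intro: has_wirtinger_cmult)
qed simp

lemma poly_an1_sum: "(\<And>i. i \<in> I \<Longrightarrow> poly_an1 m (\<phi> i)) \<Longrightarrow> poly_an1 m (\<lambda>\<zeta>. \<Sum>i\<in>I. \<phi> i \<zeta>)"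
  by (induction I rule: infinite_finite_induct) (auto simp: poly_an1_zero intro!: poly_an1_add)

text \<open>The Cauchy-Riemann equations: D(i) = i D(1) makes the real linear derivative complex
  linear.\<close>

lemma holomorphic_if_wirtinger_zero:
  assumes "has_wirtinger \<phi> (\<lambda>\<zeta>. 0)"
  shows "\<phi> holomorphic_on UNIV"
proof -
  have "\<exists>c. (\<phi> has_field_derivative c) (at \<zeta>)" for \<zeta>
  proof -
    obtain D where D: "(\<phi> has_derivative D) (at \<zeta>)" "D 1 + \<i> * D \<i> = 0"
      using assms by (auto simp: has_wirtinger_def)
    have lin: "linear D" using D(1) by (rule has_derivative_linear)
    have Di: "D \<i> = \<i> * D 1" using arg_cong[OF D(2), of "\<lambda>x. \<i> * x"] by (simp add: algebra_simps)
    have "D h = D 1 * h" for h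
    proof -
      have "h = Re h *\<^sub>R 1 + Im h *\<^sub>R \<i>" by (simp add: complex_eq_iff)
      then have "D h = D (Re h *\<^sub>R 1 + Im h *\<^sub>R \<i>)" by (rule arg_cong)
      also have "\<dots> = Re h *\<^sub>R D 1 + Im h *\<^sub>R D \<i>" by (simp only: linear_add[OF lin] linear_scale[OF lin])
      also have "\<dots> = D 1 * (complex_of_real (Re h) + \<i> * complex_of_real (Im h))"
        unfolding Di by (simp add: scaleR_conv_of_real algebra_simps)
      finally show ?thesis by (simp flip: complex_eq)
    qed
    then have "D = (*) (D 1)" by (rule ext)
    with D(1) show ?thesis unfolding has_field_derivative_def by metis
  qed
  then show ?thesis by (simp add: holomorphic_on_open)
qed

text \<open>The Wirtinger derivative has such an expansion by induction. Integrating it formally in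
  the conjugate variable gives a function with the same Wirtinger derivative, and the difference is
  entire and becomes the coefficient of degree 0.\<close>

lemma poly_an1_decomp:
  "poly_an1 m \<phi> \<Longrightarrow> \<exists>c. (\<forall>j<m. c j holomorphic_on UNIV) \<and> (\<forall>\<zeta>. \<phi> \<zeta> = (\<Sum>j<m. cnj \<zeta> ^ j * c j \<zeta>))"
proof (induction m arbitrary: \<phi>)
  case (Suc m)
  then obtain \<psi> where \<psi>: "poly_an1 m \<psi>" "has_wirtinger \<phi> \<psi>" by auto
  from Suc.IH[OF \<psi>(1)] obtain c where c: "\<And>j. j < m \<Longrightarrow> c j holomorphic_on UNIV"
    "\<And>\<zeta>. \<psi> \<zeta> = (\<Sum>j<m. cnj \<zeta> ^ j * c j \<zeta>)" by auto
  \<comment> \<open>Each power of the conjugate is raised by one and divided by its new exponent,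
    while the entire coefficients count as constants.\<close>
  define Q where "Q \<zeta> = (\<Sum>j<m. cnj \<zeta> ^ Suc j * (c j \<zeta> / of_nat (Suc j)))" for \<zeta>
  have "has_wirtinger (\<lambda>\<zeta>. - 1 * Q \<zeta>) (\<lambda>\<zeta>. - 1 * \<psi> \<zeta>)"
  proof (rule has_wirtinger_cmult)
    show "has_wirtinger Q \<psi>" unfolding has_wirtinger_def
    proof
      fix \<zeta>
      define D where "D h = (\<Sum>j<m. cnj \<zeta> ^ Suc j * (deriv (c j) \<zeta> / of_nat (Suc j) * h)
          + (of_nat (Suc j) * cnj h * cnj \<zeta> ^ j) * (c j \<zeta> / of_nat (Suc j)))" for h
      have "(Q has_derivative D) (at \<zeta>)"
        unfolding Q_def[abs_def] D_def
      proof (rule has_derivative_sum)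
        fix j assume "j \<in> {..<m}"
        then have "(c j has_field_derivative deriv (c j) \<zeta>) (at \<zeta>)"
          using c(1) by (intro holomorphic_derivI[of _ UNIV]) auto
        then have 1: "((\<lambda>\<zeta>. c j \<zeta> / of_nat (Suc j)) has_derivative (\<lambda>h. deriv (c j) \<zeta> / of_nat (Suc j) * h)) (at \<zeta>)"
          by (intro has_field_derivative_imp_has_derivative DERIV_cdivide)
        have 2: "((\<lambda>\<zeta>. cnj \<zeta> ^ Suc j) has_derivative (\<lambda>h. of_nat (Suc j) * cnj h * cnj \<zeta> ^ j)) (at \<zeta>)"
          using has_derivative_power[OF bounded_linear_imp_has_derivative[OF bounded_linear_cnj], of "Suc j" \<zeta> UNIV]
          by simp
        show "((\<lambda>\<zeta>. cnj \<zeta> ^ Suc j * (c j \<zeta> / of_nat (Suc j))) has_derivative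
            (\<lambda>h. cnj \<zeta> ^ Suc j * (deriv (c j) \<zeta> / of_nat (Suc j) * h)
          + (of_nat (Suc j) * cnj h * cnj \<zeta> ^ j) * (c j \<zeta> / of_nat (Suc j)))) (at \<zeta>)"
          by (rule has_derivative_mult[OF 2 1])
      qed
      moreover have "(D 1 + \<i> * D \<i>) / 2 = \<psi> \<zeta>"
      proof -
        have "D 1 + \<i> * D \<i> = (\<Sum>j<m. 2 * (cnj \<zeta> ^ j * c j \<zeta>))"
          unfolding D_def sum_distrib_left sum.distrib[symmetric]
        proof (rule sum.cong[OF refl])
          fix j
          have n: "of_nat (Suc j) * x * y * (w / of_nat (Suc j)) = x * y * w" for x y w :: complex
            using of_nat_neq_0[of j, where 'a=complex] by simp
          show "cnj \<zeta> ^ Suc j * (deriv (c j) \<zeta> / of_nat (Suc j) * 1) + of_nat (Suc j) * cnj 1 * cnj \<zeta> ^ j * (c j \<zeta> / of_nat (Suc j))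
             + \<i> * (cnj \<zeta> ^ Suc j * (deriv (c j) \<zeta> / of_nat (Suc j) * \<i>) + of_nat (Suc j) * cnj \<i> * cnj \<zeta> ^ j * (c j \<zeta> / of_nat (Suc j)))
             = 2 * (cnj \<zeta> ^ j * c j \<zeta>)"
            unfolding n by (simp add: algebra_simps del: of_nat_Suc)
        qed
        then show ?thesis by (simp add: c(2) sum_distrib_left[symmetric])
      qed
      ultimately show "\<exists>D. (Q has_derivative D) (at \<zeta>) \<and> (D 1 + \<i> * D \<i>) / 2 = \<psi> \<zeta>" by blast
    qed
  qed
  from has_wirtinger_add[OF \<psi>(2) this]
  have hol: "(\<lambda>\<zeta>. \<phi> \<zeta> - Q \<zeta>) holomorphic_on UNIV"
    by (intro holomorphic_if_wirtinger_zero) simp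
  define d where "d j = (case j of 0 \<Rightarrow> (\<lambda>\<zeta>. \<phi> \<zeta> - Q \<zeta>) | Suc i \<Rightarrow> (\<lambda>\<zeta>. c i \<zeta> / of_nat (Suc i)))" for j
  have "\<forall>j<Suc m. d j holomorphic_on UNIV"
    using hol c(1) by (auto simp: d_def split: nat.split intro!: holomorphic_intros)
  moreover have "\<phi> \<zeta> = (\<Sum>j<Suc m. cnj \<zeta> ^ j * d j \<zeta>)" for \<zeta>
    by (subst sum.lessThan_Suc_shift) (simp add: d_def Q_def)
  ultimately show ?case by blast
qed simp

definition cis_unit :: "real \<Rightarrow> complex" where "cis_unit t = exp (2 * of_real pi * \<i> * of_real t)"

text \<open>On the circle of radius r the conjugate of \<zeta> equals r^2/\<zeta>, so the integrand
  is r^(2j) c(\<zeta>)/\<zeta>^j and its mean value is given by Cauchy's formula for the j-th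
  derivative at 0.\<close>

lemma circle_average_monomial:
  assumes hol: "c holomorphic_on UNIV" and r: "r \<ge> 0"
  shows "((\<lambda>t. cnj (r * cis_unit t) ^ j * c (r * cis_unit t)) has_integral
    (complex_of_real r) ^ (2 * j) * ((deriv ^^ j) c 0 / fact j)) {0..1}"
proof (cases "r = 0")
  \<comment> \<open>At r = 0 there is no circle to integrate over; the integrand is constant, equal
    to c(0) for j = 0 and to 0 otherwise.\<close>
  case True
  then show ?thesis using has_integral_const_real[of "c 0" 0 1]
    by (cases j) auto
next
  case False
  with r have r: "r > 0" by simp
  have "((\<lambda>u. c u / (u - 0) ^ Suc j) has_contour_integral (2 * pi * \<i> / fact j) * (deriv ^^ j) c 0) (circlepath 0 r)"
    by (rule Cauchy_has_contour_integral_higher_derivative_circlepath)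
      (use hol r in \<open>auto intro!: holomorphic_on_imp_continuous_on intro: holomorphic_on_subset\<close>)
  then have "((\<lambda>t. c (circlepath 0 r t) / circlepath 0 r t ^ Suc j * vector_derivative (circlepath 0 r) (at t within {0..1}))
     has_integral (2 * pi * \<i> / fact j) * (deriv ^^ j) c 0) {0..1}"
    by (simp add: has_contour_integral_def)
  then have "((\<lambda>t. c (r * cis_unit t) / (r * cis_unit t) ^ Suc j * (2 * of_real pi * \<i> * (r * cis_unit t)))
     has_integral (2 * pi * \<i> / fact j) * (deriv ^^ j) c 0) {0..1}"
  proof (rule has_integral_eq[rotated])
    fix t :: real assume t: "t \<in> {0..1}"
    then have "vector_derivative (circlepath 0 r) (at t within {0..1}) = 2 * of_real pi * \<i> * (r * cis_unit t)"
      using vector_derivative_circlepath01[of t 0 r] by (simp add: cis_unit_def mult_ac)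
    then show "c (circlepath 0 r t) / circlepath 0 r t ^ Suc j * vector_derivative (circlepath 0 r) (at t within {0..1})
      = c (r * cis_unit t) / (r * cis_unit t) ^ Suc j * (2 * of_real pi * \<i> * (r * cis_unit t))"
      by (simp add: circlepath cis_unit_def mult_ac)
  qed
  from has_integral_mult_right[OF this, of "complex_of_real r ^ (2 * j) / (2 * of_real pi * \<i>)"]
  show ?thesis
  proof (rule has_integral_eq_rhs[OF has_integral_eq[rotated]])
    fix t :: real
    let ?z = "complex_of_real r * cis_unit t"
    have nz: "?z \<noteq> 0" using r by (simp add: cis_unit_def)
    have "cnj (cis_unit t) * cis_unit t = 1" by (simp add: cis_unit_def exp_cnj flip: exp_add)
    then have "cnj ?z * ?z = complex_of_real r ^ 2" by (simp add: power2_eq_square mult_ac)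
    then have "(cnj ?z * ?z) ^ j = complex_of_real r ^ (2 * j)" by (simp add: power_mult)
    then have e: "complex_of_real r ^ (2 * j) = cnj ?z ^ j * ?z ^ j" by (simp add: power_mult_distrib)
    show "complex_of_real r ^ (2 * j) / (2 * of_real pi * \<i>) * (c ?z / ?z ^ Suc j * (2 * of_real pi * \<i> * ?z)) = cnj ?z ^ j * c ?z"
      unfolding e using nz by (simp add: field_simps)
  qed (simp add: field_simps)
qed

lemma poly_an1_circle_average:
  assumes "poly_an1 m \<phi>" "m \<ge> 1"
  obtains a :: "nat \<Rightarrow> complex" where "a 0 = \<phi> 0"
    "\<And>r. r \<ge> 0 \<Longrightarrow> ((\<lambda>t. \<phi> (complex_of_real r * cis_unit t)) has_integral (\<Sum>j<m. a j * complex_of_real r ^ (2 * j))) {0..1}"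
proof -
  obtain c where c: "\<And>j. j < m \<Longrightarrow> c j holomorphic_on UNIV" "\<And>\<zeta>. \<phi> \<zeta> = (\<Sum>j<m. cnj \<zeta> ^ j * c j \<zeta>)"
    using poly_an1_decomp[OF assms(1)] by blast
  define a where "a j = (deriv ^^ j) (c j) 0 / fact j" for j
  have "((\<lambda>t. \<phi> (complex_of_real r * cis_unit t)) has_integral (\<Sum>j<m. a j * complex_of_real r ^ (2 * j))) {0..1}" if "r \<ge> 0" for r
    unfolding c(2)
    by (rule has_integral_sum) (use circle_average_monomial[OF c(1) that] in \<open>auto simp: a_def mult.commute\<close>)
  moreover have "a 0 = \<phi> 0"
  proof -
    have "\<phi> 0 = (\<Sum>j\<in>{0}. cnj 0 ^ j * c j 0)"
      unfolding c(2) using assms(2) by (intro sum.mono_neutral_right) (auto simp: power_0_left)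
    then show ?thesis by (simp add: a_def)
  qed
  ultimately show ?thesis using that by blast
qed

section \<open>Restriction of polyanalytic functions to complex lines\<close>

lemma complex_vec_axis_sum:
  fixes w :: "complex^'n"
  shows "w = (\<Sum>r\<in>UNIV. Re (w $ r) *\<^sub>R axis r 1 + Im (w $ r) *\<^sub>R axis r \<i>)"
proof (simp add: vec_eq_iff, intro allI)
  fix i
  have "(\<Sum>r\<in>UNIV. Re (w $ r) *\<^sub>R axis r 1 $ i + Im (w $ r) *\<^sub>R axis r \<i> $ i) = (\<Sum>r\<in>UNIV. if r = i then w $ i else 0)"
    by (rule sum.cong) (auto simp: axis_def complex_eq_iff)
  then show "w $ i = (\<Sum>r\<in>UNIV. Re (w $ r) *\<^sub>R axis r 1 $ i + Im (w $ r) *\<^sub>R axis r \<i> $ i)" by simp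
qed

text \<open>Twice the Wirtinger chain rule along the line in direction \<omega>: the holomorphic
  derivatives cancel, and the direction enters through its conjugate.\<close>

lemma dir_deriv_dbar_identity:
  fixes f :: "complex^'n \<Rightarrow> complex"
  assumes f: "smooth f"
  shows "dir_deriv \<omega> f z + \<i> * dir_deriv (\<chi> r. \<i> * \<omega> $ r) f z = 2 * (\<Sum>r\<in>UNIV. cnj (\<omega> $ r) * dbar r f z)"
proof -
  have lin: "linear (\<lambda>v. dir_deriv v f z)" by (rule has_derivative_linear[OF smooth_has_derivative[OF f]])
  have D: "dir_deriv w f z = (\<Sum>r\<in>UNIV. Re (w $ r) *\<^sub>R dir_deriv (axis r 1) f z + Im (w $ r) *\<^sub>R dir_deriv (axis r \<i>) f z)" for w
    by (subst complex_vec_axis_sum[of w])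
      (simp only: linear_sum[OF lin] linear_add[OF lin] linear_scale[OF lin])
  show ?thesis
    unfolding D[of \<omega>] D[of "\<chi> r. \<i> * \<omega> $ r"] sum_distrib_left sum.distrib[symmetric]
    by (rule sum.cong) (auto simp: dbar_def scaleR_conv_of_real complex_eq_iff algebra_simps)
qed

definition line :: "complex^'n \<Rightarrow> complex^'n \<Rightarrow> complex \<Rightarrow> complex^'n" where
  "line z0 \<omega> \<zeta> = (\<chi> r. z0 $ r + \<zeta> * \<omega> $ r)"

lemma line_has_derivative:
  fixes z0 :: "complex^'n"
  shows "(line z0 \<omega> has_derivative (\<lambda>h. \<chi> r. h * \<omega> $ r)) (at \<zeta>)"
proof -
  have "bounded_linear (\<lambda>h::complex. (\<chi> r. h * \<omega> $ r) :: complex^'n)"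
    by (rule linear_conv_bounded_linear[THEN iffD1], unfold_locales)
      (auto simp: vec_eq_iff algebra_simps)
  from bounded_linear_imp_has_derivative[OF this]
  have "((\<lambda>\<zeta>. z0 + (\<chi> r. \<zeta> * \<omega> $ r)) has_derivative (\<lambda>h. 0 + (\<chi> r. h * \<omega> $ r))) (at \<zeta>)"
    by (intro has_derivative_add has_derivative_const)
  moreover have "(\<lambda>\<zeta>. z0 + (\<chi> r. \<zeta> * \<omega> $ r)) = line z0 \<omega>" by (auto simp: line_def vec_eq_iff)
  ultimately show ?thesis by simp
qed

text \<open>The Wirtinger derivative of a slice is a combination of slices of Wirtinger derivatives
  of f, with constant coefficients. The exponential is holomorphic and rides along; it is the factor
  that remains when a Gaussian is recentred.\<close>

lemma poly_an_slice:
  fixes f :: "complex^'n \<Rightarrow> complex"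
  assumes "poly_an m f"
  shows "poly_an1 m (\<lambda>\<zeta>. f (line z0 \<omega> \<zeta>) * exp (c * \<zeta>))"
  using assms
proof (induction m arbitrary: f)
  case (Suc m)
  then have f: "smooth f" "\<And>r. poly_an m (dbar r f)" by auto
  let ?\<psi> = "\<lambda>\<zeta>. \<Sum>r\<in>UNIV. cnj (\<omega> $ r) * (dbar r f (line z0 \<omega> \<zeta>) * exp (c * \<zeta>))"
  have "poly_an1 m ?\<psi>"
    by (intro poly_an1_sum poly_an1_cmult Suc.IH f)
  moreover have "has_wirtinger (\<lambda>\<zeta>. f (line z0 \<omega> \<zeta>) * exp (c * \<zeta>)) ?\<psi>"
    unfolding has_wirtinger_def
  proof
    fix \<zeta>
    let ?z = "line z0 \<omega> \<zeta>"
    have 1: "((\<lambda>\<zeta>. f (line z0 \<omega> \<zeta>)) has_derivative (\<lambda>h. dir_deriv (\<chi> r. h * \<omega> $ r) f ?z)) (at \<zeta>)"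
      by (rule has_derivative_compose[OF line_has_derivative smooth_has_derivative[OF f(1)]])
    have "((\<lambda>\<zeta>. exp (c * \<zeta>)) has_field_derivative c * exp (c * \<zeta>)) (at \<zeta>)"
      by (auto intro!: derivative_eq_intros)
    then have 2: "((\<lambda>\<zeta>. exp (c * \<zeta>)) has_derivative (\<lambda>h. c * exp (c * \<zeta>) * h)) (at \<zeta>)"
      by (rule has_field_derivative_imp_has_derivative)
    let ?D = "\<lambda>h. f ?z * (c * exp (c * \<zeta>) * h) + dir_deriv (\<chi> r. h * \<omega> $ r) f ?z * exp (c * \<zeta>)"
    have "(?D 1 + \<i> * ?D \<i>) / 2 = ?\<psi> \<zeta>"
    proof -
      have "?D 1 + \<i> * ?D \<i> = (dir_deriv \<omega> f ?z + \<i> * dir_deriv (\<chi> r. \<i> * \<omega> $ r) f ?z) * exp (c * \<zeta>)"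
        by (simp add: algebra_simps)
      also have "\<dots> = 2 * ?\<psi> \<zeta>"
        unfolding dir_deriv_dbar_identity[OF f(1)] by (simp add: sum_distrib_left sum_distrib_right mult_ac)
      finally show ?thesis by simp
    qed
    with has_derivative_mult[OF 1 2]
    show "\<exists>D. ((\<lambda>\<zeta>. f (line z0 \<omega> \<zeta>) * exp (c * \<zeta>)) has_derivative D) (at \<zeta>) \<and> (D 1 + \<i> * D \<i>) / 2 = ?\<psi> \<zeta>"
      by blast
  qed
  ultimately show ?case by auto
qed simp

section \<open>Vanishing Gaussian moments\<close>

text \<open>The point is that the l i do not depend on p: values at the nodes can be integrated over
  a family of polynomials without touching their coefficients.\<close>

lemma lagrange_interpolation:
  fixes x :: "nat \<Rightarrow> complex"
  assumes "inj_on x {..<m}"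
  obtains l :: "nat \<Rightarrow> complex poly" where "\<And>i. i < m \<Longrightarrow> degree (l i) < m"
    "\<And>p y. degree p < m \<Longrightarrow> poly p y = (\<Sum>i<m. poly (l i) y * poly p (x i))"
proof -
  define l where "l i = (\<Prod>j\<in>{..<m} - {i}. smult (1 / (x i - x j)) [:- x j, 1:])" for i
  have deg: "degree (l i) < m" if "i < m" for i
  proof -
    have "degree (l i) \<le> (\<Sum>j\<in>{..<m} - {i}. degree (smult (1 / (x i - x j)) [:- x j, 1:]))"
      unfolding l_def by (rule order_trans[OF degree_prod_sum_le]) (auto simp: o_def)
    also have "\<dots> \<le> (\<Sum>j\<in>{..<m} - {i}. 1)"
      by (rule sum_mono) (auto intro: order_trans[OF degree_smult_le])
    also have "\<dots> = m - 1" using that by simp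
    finally show ?thesis using that by simp
  qed
  have val: "poly (l i) (x k) = (if i = k then 1 else 0)" if "i < m" "k < m" for i k
  proof (cases "i = k")
    case True
    have "poly (l k) (x k) = (\<Prod>j\<in>{..<m} - {k}. 1)"
      unfolding l_def poly_prod
    proof (rule prod.cong[OF refl])
      fix j assume "j \<in> {..<m} - {k}"
      then have "x k \<noteq> x j" using assms that by (auto simp: inj_on_def)
      then show "poly (smult (1 / (x k - x j)) [:- x j, 1:]) (x k) = 1" by (simp add: diff_divide_distrib[symmetric])
    qed
    then show ?thesis using True by simp
  next
    case False
    then have "poly (l i) (x k) = 0"
      unfolding l_def poly_prod using that by (intro prod_zero) (auto intro!: bexI[of _ k])
    then show ?thesis using False by simp
  qed
  have "poly p y = (\<Sum>i<m. poly (l i) y * poly p (x i))" if p: "degree p < m" for p y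
  proof -
    let ?q = "\<Sum>i<m. smult (poly p (x i)) (l i)"
    have "p = ?q"
    proof (rule poly_eqI_degree[of "x ` {..<m}"])
      fix z assume "z \<in> x ` {..<m}"
      then obtain k where k: "k < m" "z = x k" by auto
      have "poly ?q z = (\<Sum>i<m. if i = k then poly p (x k) else 0)"
        unfolding poly_sum k by (rule sum.cong) (use val k in auto)
      then show "poly p z = poly ?q z" using k by simp
    next
      show "degree p < card (x ` {..<m})" using p by (simp add: card_image[OF assms])
      have "m > 0" using p by simp
      then have "degree ?q < m"
        by (intro degree_sum_less) (auto simp: deg)
      then show "degree ?q < card (x ` {..<m})" by (simp add: card_image[OF assms])
    qed
    then have "poly p y = poly ?q y" by simp
    then show ?thesis by (simp add: poly_sum mult.commute)
  qed
  with deg that show ?thesis by blast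
qed

text \<open>Split off the exact power of X - 1. It is smaller than m because of the degree, so the
  cofactor would still tend to 0 at 1, although 1 is not a root of it.\<close>

lemma poly_zero_if_small:
  fixes L :: "complex poly"
  assumes deg: "degree L < m" and small: "\<And>x::real. 1 < x \<Longrightarrow> x < 5/4 \<Longrightarrow> norm (poly L (of_real x)) \<le> C * (x - 1) ^ m"
  shows "L = 0"
proof (rule ccontr)
  assume L: "L \<noteq> 0"
  obtain Q where Q: "L = [:- 1, 1:] ^ order 1 L * Q" "\<not> [:- 1, 1:] dvd Q"
    using order_decomp[OF L, of 1] by auto
  let ?k = "order 1 L"
  have k: "?k < m" using order_degree[OF L, of 1] deg by simp
  \<comment> \<open>The shift by 5 keeps the whole sequence inside the interval from 1 to 5/4 where
    the bound is available.\<close>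
  define x where "x n = 1 + 1 / (real n + 5)" for n
  have x: "1 < x n" "x n < 5/4" for n by (auto simp: x_def field_simps)
  have xlim: "x \<longlonglongrightarrow> 1" unfolding x_def by real_asymp
  have le: "norm (poly Q (of_real (x n))) \<le> C * (x n - 1) ^ (m - ?k)" for n
  proof -
    have "(x n - 1) ^ ?k * norm (poly Q (of_real (x n))) = norm (poly L (of_real (x n)))"
    proof -
      have "poly L (of_real (x n)) = (of_real (x n - 1)) ^ ?k * poly Q (of_real (x n))"
        by (subst Q(1)) (simp add: poly_power)
      then have "norm (poly L (of_real (x n))) = \<bar>x n - 1\<bar> ^ ?k * norm (poly Q (of_real (x n)))"
        by (simp only: norm_mult norm_power norm_of_real)
      then show ?thesis using x(1)[of n] by simp
    qed
    also have "\<dots> \<le> C * (x n - 1) ^ m" by (rule small[OF x])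
    also have "\<dots> = (x n - 1) ^ ?k * (C * (x n - 1) ^ (m - ?k))"
      using k by (simp flip: power_add)
    finally show ?thesis using x(1)[of n] by (simp add: mult_le_cancel_left_pos)
  qed
  have "(\<lambda>n. C * (x n - 1) ^ (m - ?k)) \<longlonglongrightarrow> C * (1 - 1) ^ (m - ?k)"
    by (intro tendsto_intros xlim)
  then have "(\<lambda>n. C * (x n - 1) ^ (m - ?k)) \<longlonglongrightarrow> 0"
    using k by (simp add: power_0_left)
  then have "(\<lambda>n. poly Q (of_real (x n))) \<longlonglongrightarrow> 0"
    by (rule Lim_null_comparison[OF always_eventually[OF allI[OF le]]])
  moreover have "(\<lambda>n. poly Q (of_real (x n))) \<longlonglongrightarrow> poly Q (of_real 1)"
    by (intro tendsto_intros xlim)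
  ultimately have "poly Q 1 = 0" using LIMSEQ_unique by fastforce
  with Q(2) show False by (simp add: poly_eq_0_iff_dvd)
qed

section \<open>Integrability against Gaussian weights\<close>

lemma cnj_borel [measurable]: "cnj \<in> borel_measurable borel"
  by (intro borel_measurable_continuous_onI continuous_intros)

definition exp_growth :: "('a::euclidean_space \<Rightarrow> complex) \<Rightarrow> bool" where
  "exp_growth K \<longleftrightarrow> K \<in> borel_measurable borel \<and> (\<exists>C\<ge>0. \<exists>c\<ge>0. \<forall>p. norm (K p) \<le> C * exp (c * norm p))"

lemma exp_growthI:
  assumes "K \<in> borel_measurable borel" "\<And>p. norm (K p) \<le> C * exp (c * norm p)"
  shows "exp_growth K"
proof -
  have "norm (K p) \<le> \<bar>C\<bar> * exp (\<bar>c\<bar> * norm p)" for p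
  proof -
    have "C * exp (c * norm p) \<le> \<bar>C\<bar> * exp (\<bar>c\<bar> * norm p)"
      by (intro mult_mono) (auto intro: mult_right_mono)
    with assms(2)[of p] show ?thesis by linarith
  qed
  then show ?thesis unfolding exp_growth_def using assms(1) abs_ge_zero by blast
qed

lemma exp_growth_measurable: "exp_growth K \<Longrightarrow> K \<in> borel_measurable borel"
  by (simp add: exp_growth_def)

lemma exp_growth_const: "exp_growth (\<lambda>p. c)"
  by (rule exp_growthI[of _ "norm c" 0]) auto

lemma exp_growth_mult:
  assumes "exp_growth K" "exp_growth L"
  shows "exp_growth (\<lambda>p. K p * L p)"
proof -
  obtain C c where C: "C \<ge> 0" "c \<ge> 0" "\<And>p. norm (K p) \<le> C * exp (c * norm p)" using assms(1) by (auto simp: exp_growth_def)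
  obtain D d where D: "D \<ge> 0" "d \<ge> 0" "\<And>p. norm (L p) \<le> D * exp (d * norm p)" using assms(2) by (auto simp: exp_growth_def)
  show ?thesis
  proof (rule exp_growthI)
    fix p
    have "norm (K p) * norm (L p) \<le> (C * exp (c * norm p)) * (D * exp (d * norm p))"
      using C D by (intro mult_mono) auto
    also have "\<dots> = (C * D) * exp ((c + d) * norm p)"
      by (simp add: distrib_right exp_add)
    finally show "norm (K p * L p) \<le> (C * D) * exp ((c + d) * norm p)"
      by (simp only: norm_mult)
  qed (use assms[THEN exp_growth_measurable] in measurable)
qed

lemma exp_growth_add:
  assumes "exp_growth K" "exp_growth L"
  shows "exp_growth (\<lambda>p. K p + L p)"
proof -
  obtain C c where C: "C \<ge> 0" "c \<ge> 0" "\<And>p. norm (K p) \<le> C * exp (c * norm p)" using assms(1) by (auto simp: exp_growth_def)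
  obtain D d where D: "D \<ge> 0" "d \<ge> 0" "\<And>p. norm (L p) \<le> D * exp (d * norm p)" using assms(2) by (auto simp: exp_growth_def)
  show ?thesis
  proof (rule exp_growthI)
    fix p
    have "norm (K p + L p) \<le> C * exp (c * norm p) + D * exp (d * norm p)"
      by (intro order_trans[OF norm_triangle_ineq] add_mono C D)
    also have "\<dots> \<le> C * exp ((c + d) * norm p) + D * exp ((c + d) * norm p)"
      using C D by (intro add_mono mult_left_mono) (auto intro: mult_right_mono)
    finally show "norm (K p + L p) \<le> (C + D) * exp ((c + d) * norm p)" by (simp add: distrib_right)
  qed (use assms[THEN exp_growth_measurable] in measurable)
qed

lemma exp_growth_prod_list: "(\<And>r. r \<in> set rs \<Longrightarrow> exp_growth (K r)) \<Longrightarrow> exp_growth (\<lambda>p. prod_list (map (\<lambda>r. K r p) rs))"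
  by (induction rs) (auto intro: exp_growth_const exp_growth_mult)

lemma exp_growth_le_norm:
  assumes "K \<in> borel_measurable borel" "\<And>p. norm (K p) \<le> C * norm p"
  shows "exp_growth K"
proof (rule exp_growthI[OF assms(1), of "\<bar>C\<bar>" 1])
  fix p
  have "norm (K p) \<le> \<bar>C\<bar> * norm p" using assms(2)[of p] mult_right_mono[OF abs_ge_self[of C] norm_ge_zero[of p]] by linarith
  also have "\<dots> \<le> \<bar>C\<bar> * exp (norm p)"
    using exp_ge_add_one_self[of "norm p"] by (intro mult_left_mono) linarith+
  finally show "norm (K p) \<le> \<bar>C\<bar> * exp (1 * norm p)" by simp
qed

lemma exp_growth_exp:
  assumes "L \<in> borel_measurable borel" "\<And>p. norm (L p) \<le> C * norm p"
  shows "exp_growth (\<lambda>p. exp (L p))"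
proof (rule exp_growthI[of _ 1 C])
  show "norm (exp (L p)) \<le> 1 * exp (C * norm p)" for p
    using norm_exp[of "L p"] assms(2)[of p] by (simp add: order_trans)
qed (use assms(1) in measurable)

lemma exp_growth_norm_power: "exp_growth (\<lambda>p::'a::euclidean_space. complex_of_real ((norm (p - a)) ^ k))"
proof (induction k)
  case (Suc k)
  have "exp_growth (\<lambda>p. complex_of_real (norm (p - a)))"
  proof (rule exp_growthI[of _ "1 + norm a" 1])
    fix p :: 'a
    have "1 \<le> exp (norm p)" by simp
    then have "norm a * 1 \<le> norm a * exp (norm p)" by (intro mult_left_mono) auto
    moreover have "norm p \<le> exp (norm p)" using exp_ge_add_one_self[of "norm p"] by linarith
    ultimately show "norm (complex_of_real (norm (p - a))) \<le> (1 + norm a) * exp (1 * norm p)"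
      using norm_triangle_ineq4[of p a] by (simp add: distrib_right)
  qed measurable
  from exp_growth_mult[OF this Suc] show ?case by simp
qed (simp add: exp_growth_const)

definition gauss_sq :: "('a::euclidean_space \<Rightarrow> complex) \<Rightarrow> bool" where
  "gauss_sq \<Psi> \<longleftrightarrow> \<Psi> \<in> borel_measurable borel \<and> integrable lborel (\<lambda>p. (norm (\<Psi> p))\<^sup>2 * exp (- (norm p)\<^sup>2))"

lemma exp_growth_gauss_integrable:
  fixes K :: "'a::euclidean_space \<Rightarrow> complex"
  assumes K: "exp_growth K" and a: "a > 0"
  shows "integrable lborel (\<lambda>p. (norm (K p))\<^sup>2 * exp (- a * (norm p)\<^sup>2))"
proof -
  obtain C c where C: "C \<ge> 0" "\<And>p. norm (K p) \<le> C * exp (c * norm p)" using K by (auto simp: exp_growth_def)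
  note [measurable] = exp_growth_measurable[OF K]
  have "integrable lborel (\<lambda>p::'a. C\<^sup>2 * exp (- a * (norm p)\<^sup>2 + (2 * c) * norm p))"
    by (intro integrable_mult_right integrable_exp_norm a)
  then show ?thesis
  proof (rule Bochner_Integration.integrable_bound)
    show "AE p in lborel. norm ((norm (K p))\<^sup>2 * exp (- a * (norm p)\<^sup>2)) \<le> norm (C\<^sup>2 * exp (- a * (norm p)\<^sup>2 + (2 * c) * norm p))"
    proof (intro always_eventually allI)
      fix p
      have "(norm (K p))\<^sup>2 * exp (- a * (norm p)\<^sup>2) \<le> (C * exp (c * norm p))\<^sup>2 * exp (- a * (norm p)\<^sup>2)"
        by (intro mult_right_mono power_mono C) auto
      also have "\<dots> = C\<^sup>2 * exp (- a * (norm p)\<^sup>2 + (2 * c) * norm p)"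
        by (simp add: power_mult_distrib exp_double[symmetric] exp_add[symmetric] mult.assoc algebra_simps)
      finally show "norm ((norm (K p))\<^sup>2 * exp (- a * (norm p)\<^sup>2)) \<le> norm (C\<^sup>2 * exp (- a * (norm p)\<^sup>2 + (2 * c) * norm p))"
        by simp
    qed
  qed measurable
qed

text \<open>Square integrability of \<Psi> against e^(-|p|^2) uses up the factor e^(-|p|^2/2). The
  rest, of rate \<tau> - 1/2, has to tame K, whence the threshold 1/2.\<close>

lemma gauss_sq_integrable:
  assumes \<Psi>: "gauss_sq \<Psi>" and K: "exp_growth K" and \<tau>: "\<tau> > 1/2"
  shows "integrable lborel (\<lambda>p. \<Psi> p * K p * complex_of_real (exp (- \<tau> * (norm p)\<^sup>2)))"
proof (rule Bochner_Integration.integrable_bound)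
  have [measurable]: "\<Psi> \<in> borel_measurable borel" "K \<in> borel_measurable borel"
    using \<Psi> K by (auto simp: gauss_sq_def exp_growth_def)
  show "(\<lambda>p. \<Psi> p * K p * complex_of_real (exp (- \<tau> * (norm p)\<^sup>2))) \<in> borel_measurable lborel" by measurable
  show "integrable lborel (\<lambda>p. (norm (\<Psi> p))\<^sup>2 * exp (- (norm p)\<^sup>2) + (norm (K p))\<^sup>2 * exp (- (2 * \<tau> - 1) * (norm p)\<^sup>2))"
    using \<Psi> exp_growth_gauss_integrable[OF K, of "2 * \<tau> - 1"] \<tau> by (simp add: gauss_sq_def)
  show "AE p in lborel. norm (\<Psi> p * K p * complex_of_real (exp (- \<tau> * (norm p)\<^sup>2))) \<le>
      norm ((norm (\<Psi> p))\<^sup>2 * exp (- (norm p)\<^sup>2) + (norm (K p))\<^sup>2 * exp (- (2 * \<tau> - 1) * (norm p)\<^sup>2))"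
  proof (intro always_eventually allI)
    fix p
    let ?a = "norm (\<Psi> p) * exp (- (norm p)\<^sup>2 / 2)" and ?b = "norm (K p) * exp (- (\<tau> - 1/2) * (norm p)\<^sup>2)"
    have e: "exp (- (norm p)\<^sup>2 / 2) * exp (- (\<tau> - 1/2) * (norm p)\<^sup>2) = exp (- \<tau> * (norm p)\<^sup>2)"
      by (simp add: exp_add[symmetric] algebra_simps)
    have "norm (\<Psi> p * K p * complex_of_real (exp (- \<tau> * (norm p)\<^sup>2))) = ?a * ?b"
      unfolding e[symmetric] by (simp add: norm_mult)
    also have "\<dots> \<le> ?a\<^sup>2 + ?b\<^sup>2"
    proof -
      have "0 \<le> ?a * ?b" by simp
      then show ?thesis using sum_squares_bound[of ?a ?b] by linarith
    qed
    also have "?a\<^sup>2 = (norm (\<Psi> p))\<^sup>2 * exp (- (norm p)\<^sup>2)"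
      by (simp add: power_mult_distrib exp_double[symmetric])
    also have "?b\<^sup>2 = (norm (K p))\<^sup>2 * exp (- (2 * \<tau> - 1) * (norm p)\<^sup>2)"
      by (simp add: power_mult_distrib exp_double[symmetric] algebra_simps)
    finally show "norm (\<Psi> p * K p * complex_of_real (exp (- \<tau> * (norm p)\<^sup>2))) \<le>
      norm ((norm (\<Psi> p))\<^sup>2 * exp (- (norm p)\<^sup>2) + (norm (K p))\<^sup>2 * exp (- (2 * \<tau> - 1) * (norm p)\<^sup>2))"
      by simp
  qed
qed

section \<open>Multipliers annihilated against all exponentials\<close>

definition bdot :: "(real^'n) \<times> (real^'n) \<Rightarrow> complex^'n \<Rightarrow> complex" where
  "bdot p b = (\<Sum>r\<in>UNIV. cnj (cvec p $ r) * b $ r)"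

lemma cvec_nth_measurable [measurable]: "(\<lambda>p. cvec p $ r) \<in> borel_measurable borel"
  by (intro borel_measurable_continuous_onI
    linear_continuous_on[OF bounded_linear_compose[OF bounded_linear_vec_nth bounded_linear_cvec, unfolded o_def]])

lemma norm_cvec_nth_le: "norm (cvec p $ r) \<le> norm p"
proof -
  have "norm (cvec p $ r) \<le> norm (cvec p)" by (rule Finite_Cartesian_Product.norm_nth_le)
  also have "\<dots> = norm p"
    using norm_cvec[of "fst p" "snd p"] by (simp add: norm_prod_def real_sqrt_unique)
  finally show ?thesis .
qed

lemma bdot_add: "bdot p (b + c) = bdot p b + bdot p c"
  by (simp add: bdot_def distrib_left sum.distrib)

lemma bdot_axis: "bdot p (axis r c) = cnj (cvec p $ r) * c"
proof -
  have "bdot p (axis r c) = (\<Sum>s\<in>UNIV. if s = r then cnj (cvec p $ r) * c else 0)"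
    unfolding bdot_def by (rule sum.cong) (auto simp: axis_def)
  then show ?thesis by simp
qed

lemma bdot_measurable [measurable]: "(\<lambda>p. bdot p b) \<in> borel_measurable borel"
  unfolding bdot_def
  by (intro borel_measurable_sum borel_measurable_times borel_measurable_const
    measurable_compose[OF cvec_nth_measurable cnj_borel])

lemma norm_bdot_le: "norm (bdot p b) \<le> (\<Sum>r\<in>UNIV. norm (b $ r)) * norm p"
proof -
  have "norm (bdot p b) \<le> (\<Sum>r\<in>UNIV. norm p * norm (b $ r))"
    unfolding bdot_def
    by (intro order_trans[OF norm_sum] sum_mono) (auto simp: norm_mult intro!: mult_right_mono norm_cvec_nth_le)
  then show ?thesis by (simp add: sum_distrib_left mult.commute)
qed

lemma exp_growth_bdot: "exp_growth (\<lambda>p. exp (bdot p b))"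
  by (rule exp_growth_exp[OF _ norm_bdot_le]) measurable

lemma exp_growth_cnj_nth: "exp_growth (\<lambda>p. cnj (cvec p $ r))"
  by (rule exp_growth_le_norm[of _ 1])
    (auto simp: norm_cvec_nth_le intro!: measurable_compose[OF cvec_nth_measurable cnj_borel])

text \<open>Orthogonality to K times every exponential of \<open>bdot p b\<close>, an antilinear
  expression in the complex vector of p. All b are included so that the condition can be
  differentiated in b. The factor \<open>- 1\<close> in the exponent matches
  \<open>gauss_sq_integrable\<close> at \<tau> = 1.\<close>

definition annih :: "((real^'n) \<times> (real^'n) \<Rightarrow> complex) \<Rightarrow> ((real^'n) \<times> (real^'n) \<Rightarrow> complex) \<Rightarrow> bool" where
  "annih \<Phi> K \<longleftrightarrow> exp_growth K \<and>
     (\<forall>b. (LINT p|lborel. \<Phi> p * (K p * exp (bdot p b)) * complex_of_real (exp (- 1 * (norm p)\<^sup>2))) = 0)"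

lemma annih_add:
  assumes \<Phi>: "gauss_sq \<Phi>" and "annih \<Phi> K" "annih \<Phi> L"
  shows "annih \<Phi> (\<lambda>p. K p + L p)"
proof -
  have K: "exp_growth K" and L: "exp_growth L" using assms by (auto simp: annih_def)
  have i: "integrable lborel (\<lambda>p. \<Phi> p * (M p * exp (bdot p b)) * complex_of_real (exp (- 1 * (norm p)\<^sup>2)))"
    if "exp_growth M" for M b
    by (rule gauss_sq_integrable[OF \<Phi> exp_growth_mult[OF that exp_growth_bdot]]) simp
  have "(LINT p|lborel. \<Phi> p * ((K p + L p) * exp (bdot p b)) * complex_of_real (exp (- 1 * (norm p)\<^sup>2)))
     = (LINT p|lborel. \<Phi> p * (K p * exp (bdot p b)) * complex_of_real (exp (- 1 * (norm p)\<^sup>2)))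
     + (LINT p|lborel. \<Phi> p * (L p * exp (bdot p b)) * complex_of_real (exp (- 1 * (norm p)\<^sup>2)))" for b
    using i[OF K, of b] i[OF L, of b] by (subst Bochner_Integration.integral_add[symmetric]) (auto simp: algebra_simps)
  then show ?thesis using assms exp_growth_add[OF K L] by (simp add: annih_def)
qed

lemma annih_cmult:
  assumes "annih \<Phi> K"
  shows "annih \<Phi> (\<lambda>p. c * K p)"
proof -
  have "(LINT p|lborel. \<Phi> p * (c * K p * exp (bdot p b)) * complex_of_real (exp (- 1 * (norm p)\<^sup>2)))
     = c * (LINT p|lborel. \<Phi> p * (K p * exp (bdot p b)) * complex_of_real (exp (- 1 * (norm p)\<^sup>2)))" for b
    by (subst Bochner_Integration.integral_mult_right_zero[symmetric]) (simp add: mult_ac)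
  then show ?thesis using assms exp_growth_mult[OF exp_growth_const[of c], of K] by (simp add: annih_def)
qed

lemma annih_zero: "annih \<Phi> (\<lambda>p. 0)"
  by (simp add: annih_def exp_growth_const)

lemma annih_sum: "gauss_sq \<Phi> \<Longrightarrow> (\<And>i. i \<in> I \<Longrightarrow> annih \<Phi> (K i)) \<Longrightarrow> annih \<Phi> (\<lambda>p. \<Sum>i\<in>I. K i p)"
  by (induction I rule: infinite_finite_induct) (auto simp: annih_zero intro: annih_add)

lemma norm_exp_minus_1_le: "norm (exp x - 1) \<le> norm (x::complex) * exp (norm x)"
proof -
  have "norm (exp x - (\<Sum>i\<le>0. x ^ i / fact i)) \<le> exp \<bar>Re x\<bar> * (norm x) ^ Suc 0 / fact 0"
    by (rule Taylor_exp)
  also have "\<dots> \<le> exp (norm x) * norm x"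
    using abs_Re_le_cmod[of x] by (simp add: mult_right_mono)
  finally show ?thesis by (simp add: mult.commute)
qed

text \<open>Differentiation with respect to \<open>b\<close> under the integral sign.\<close>

lemma annih_cnj_nth:
  assumes \<Phi>: "gauss_sq \<Phi>" and A: "annih \<Phi> K"
  shows "annih \<Phi> (\<lambda>p. cnj (cvec p $ r) * K p)"
proof -
  have K: "exp_growth K" using A by (simp add: annih_def)
  have [measurable]: "\<Phi> \<in> borel_measurable borel" "K \<in> borel_measurable borel"
    using \<Phi> K by (auto simp: gauss_sq_def exp_growth_def)
  have "(LINT p|lborel. \<Phi> p * (cnj (cvec p $ r) * K p * exp (bdot p b)) * complex_of_real (exp (- 1 * (norm p)\<^sup>2))) = 0" for b
  proof -
    \<comment> \<open>Difference quotients in b along the r-th axis are integrals that vanish for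
      every step. Steps of modulus at most 1 give the common bound |p| e^|p| for the quotients, so
      that dominated convergence applies.\<close>
    define t where "t k = complex_of_real (1 / real (Suc k))" for k
    have t0: "t k \<noteq> 0" "norm (t k) \<le> 1" for k 
      unfolding t_def norm_of_real of_real_eq_0_iff by auto
    have tlim: "t \<longlonglongrightarrow> 0"
    proof -
      have "(\<lambda>k. 1 / real (Suc k)) \<longlonglongrightarrow> 0" using LIMSEQ_inverse_real_of_nat by (simp add: inverse_eq_divide)
      from tendsto_of_real[OF this, where 'a=complex] show ?thesis unfolding t_def[abs_def] by (simp only: of_real_0)
    qed
    define B where "B p = \<Phi> p * (K p * exp (bdot p b)) * complex_of_real (exp (- 1 * (norm p)\<^sup>2))" for p
    have [measurable]: "B \<in> borel_measurable borel" unfolding B_def by measurable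
    define q where "q k p = (exp (t k * cnj (cvec p $ r)) - 1) / t k" for k p
    have [measurable]: "q k \<in> borel_measurable borel" for k unfolding q_def by measurable
    have i: "integrable lborel (\<lambda>p. \<Phi> p * (K p * exp (bdot p b)) * complex_of_real (exp (- 1 * (norm p)\<^sup>2)))" for b
      by (rule gauss_sq_integrable[OF \<Phi> exp_growth_mult[OF K exp_growth_bdot]]) simp
    have zero: "(LINT p|lborel. B p * q k p) = 0" for k
    proof -
      have "B p * q k p = (1 / t k) * (\<Phi> p * (K p * exp (bdot p (b + axis r (t k)))) * complex_of_real (exp (- 1 * (norm p)\<^sup>2))
          - \<Phi> p * (K p * exp (bdot p b)) * complex_of_real (exp (- 1 * (norm p)\<^sup>2)))" for p
        using t0(1)[of k] by (simp add: B_def q_def bdot_add bdot_axis exp_add field_simps)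
      then show ?thesis using A i[of b] i[of "b + axis r (t k)"] by (simp add: annih_def)
    qed
    have "(\<lambda>k. LINT p|lborel. B p * q k p) \<longlonglongrightarrow> (LINT p|lborel. B p * cnj (cvec p $ r))"
    proof (rule integral_dominated_convergence)
      have g: "exp_growth (\<lambda>p::(real^'a)\<times>(real^'a). complex_of_real (norm p) * exp (complex_of_real (norm p)))"
        by (rule exp_growth_mult[OF exp_growth_le_norm[of _ 1] exp_growth_exp[of _ 1]]) auto
      have "integrable lborel (\<lambda>p. \<Phi> p * (K p * exp (bdot p b) * (complex_of_real (norm p) * exp (complex_of_real (norm p)))) * complex_of_real (exp (- 1 * (norm p)\<^sup>2)))"
        by (rule gauss_sq_integrable[OF \<Phi> exp_growth_mult[OF exp_growth_mult[OF K exp_growth_bdot] g]]) simp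
      then have "integrable lborel (\<lambda>p. B p * (complex_of_real (norm p) * exp (complex_of_real (norm p))))"
        by (simp add: B_def mult_ac)
      then show "integrable lborel (\<lambda>p. norm (B p * (complex_of_real (norm p) * exp (complex_of_real (norm p)))))"
        by (rule integrable_norm)
      show "AE p in lborel. norm (B p * q k p) \<le> norm (B p * (complex_of_real (norm p) * exp (complex_of_real (norm p))))" for k
      proof (intro always_eventually allI)
        fix p :: "(real^'a)\<times>(real^'a)"
        let ?x = "t k * cnj (cvec p $ r)"
        have x: "norm ?x \<le> norm (t k) * norm p"
          using norm_cvec_nth_le[of p r] by (simp add: norm_mult mult_left_mono)
        have x': "norm ?x \<le> norm p"
          using x mult_right_mono[OF t0(2)[of k], of "norm p"] by simp
        have "norm (exp ?x - 1) \<le> norm ?x * exp (norm ?x)" by (rule norm_exp_minus_1_le)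
        also have "\<dots> \<le> (norm (t k) * norm p) * exp (norm p)"
          using x x' by (intro mult_mono) auto
        finally have "norm (q k p) \<le> norm p * exp (norm p)"
          using t0(1)[of k] by (simp add: q_def norm_divide field_simps)
        then show "norm (B p * q k p) \<le> norm (B p * (complex_of_real (norm p) * exp (complex_of_real (norm p))))"
          by (simp add: norm_mult mult_left_mono)
      qed
      show "AE p in lborel. (\<lambda>k. B p * q k p) \<longlonglongrightarrow> B p * cnj (cvec p $ r)"
      proof (intro always_eventually allI tendsto_mult tendsto_const)
        fix p :: "(real^'a)\<times>(real^'a)"
        have "((\<lambda>t. exp (t * cnj (cvec p $ r))) has_field_derivative cnj (cvec p $ r)) (at 0)"
          by (auto intro!: derivative_eq_intros)
        then have "((\<lambda>t. (exp (t * cnj (cvec p $ r)) - 1) / t) \<longlongrightarrow> cnj (cvec p $ r)) (at 0)"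
          by (simp add: has_field_derivative_iff)
        from filterlim_compose[OF this, of t sequentially]
        show "(\<lambda>k. q k p) \<longlonglongrightarrow> cnj (cvec p $ r)"
          unfolding q_def using tlim t0(1) by (simp add: filterlim_at)
      qed
    qed measurable
    then have "(LINT p|lborel. B p * cnj (cvec p $ r)) = 0"
      unfolding zero by (simp add: LIMSEQ_const_iff)
    then show ?thesis by (simp add: B_def mult_ac)
  qed
  then show ?thesis using exp_growth_mult[OF exp_growth_cnj_nth K] by (simp add: annih_def)
qed

definition vprod :: "'n list \<Rightarrow> real^'n \<Rightarrow> real^'n \<Rightarrow> complex" where
  "vprod rs c v = prod_list (map (\<lambda>r. complex_of_real (v $ r - c $ r)) rs)"

text \<open>For complex w with conjugate w' one has w = w' + 2i Im w, hence |w|^2 = w'^2 + 2i w' Im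
  w. Conjugate factors are free by \<open>annih_cnj_nth\<close>, and only the second term lengthens
  the word in Im (p - a). Each factor |p - a|^2 therefore costs at most one of the d available
  degrees.\<close>

lemma annih_norm_power:
  assumes \<Phi>: "gauss_sq \<Phi>"
    and words: "\<And>rs. length rs \<le> d \<Longrightarrow> annih \<Phi> (\<lambda>p. vprod rs (snd a) (snd p))"
  shows "length rs + j \<le> d \<Longrightarrow> annih \<Phi> (\<lambda>p. complex_of_real ((norm (p - a)) ^ (2 * j)) * vprod rs (snd a) (snd p))"
proof (induction j arbitrary: rs)
  case 0
  then show ?case using words[of rs] by simp
next
  case (Suc j)
  let ?N = "\<lambda>p. complex_of_real ((norm (p - a)) ^ (2 * j))"
  have cn: "annih \<Phi> (\<lambda>p. (cnj (cvec p $ r) - cnj (cvec a $ r)) * K p)" if "annih \<Phi> K" for K r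
  proof -
    have "annih \<Phi> (\<lambda>p. cnj (cvec p $ r) * K p + (- cnj (cvec a $ r)) * K p)"
      by (intro annih_add[OF \<Phi>] annih_cnj_nth[OF \<Phi>] annih_cmult that)
    then show ?thesis by (simp add: left_diff_distrib)
  qed
  have sq: "complex_of_real ((norm (p - a))\<^sup>2) = (\<Sum>r\<in>UNIV. (cnj (cvec p $ r) - cnj (cvec a $ r)) * (cnj (cvec p $ r) - cnj (cvec a $ r))
       + 2 * \<i> * ((cnj (cvec p $ r) - cnj (cvec a $ r)) * complex_of_real (snd p $ r - snd a $ r)))" for p
  proof -
    have e: "(norm (p - a))\<^sup>2 = (\<Sum>r\<in>UNIV. (fst p $ r - fst a $ r)\<^sup>2 + (snd p $ r - snd a $ r)\<^sup>2)"
      by (simp add: norm_prod_def norm_sq_vec sum.distrib sum_nonneg)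
    show ?thesis unfolding e of_real_sum
      by (rule sum.cong) (simp_all add: cvec_nth complex_eq_iff power2_eq_square algebra_simps)
  qed
  have "annih \<Phi> (\<lambda>p. \<Sum>r\<in>UNIV. (cnj (cvec p $ r) - cnj (cvec a $ r)) * ((cnj (cvec p $ r) - cnj (cvec a $ r)) * (?N p * vprod rs (snd a) (snd p)))
      + 2 * \<i> * ((cnj (cvec p $ r) - cnj (cvec a $ r)) * (?N p * vprod (r # rs) (snd a) (snd p))))"
    using Suc.prems by (intro annih_sum[OF \<Phi>] annih_add[OF \<Phi>] annih_cmult cn Suc.IH) auto
  moreover have "(\<Sum>r\<in>UNIV. (cnj (cvec p $ r) - cnj (cvec a $ r)) * ((cnj (cvec p $ r) - cnj (cvec a $ r)) * (?N p * vprod rs (snd a) (snd p)))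
      + 2 * \<i> * ((cnj (cvec p $ r) - cnj (cvec a $ r)) * (?N p * vprod (r # rs) (snd a) (snd p))))
      = complex_of_real ((norm (p - a)) ^ (2 * Suc j)) * vprod rs (snd a) (snd p)" for p
  proof -
    have "complex_of_real ((norm (p - a)) ^ (2 * Suc j)) * vprod rs (snd a) (snd p)
        = complex_of_real ((norm (p - a))\<^sup>2) * (?N p * vprod rs (snd a) (snd p))"
      by (simp add: power2_eq_square)
    then show ?thesis unfolding sq sum_distrib_right
      by (simp add: vprod_def algebra_simps)
  qed
  ultimately show ?case by simp
qed

section \<open>Averages over the circle action\<close>

definition circle_avg :: "('a::euclidean_space \<times> 'a \<Rightarrow> complex) \<Rightarrow> 'a \<times> 'a \<Rightarrow> complex" where
  "circle_avg \<Psi> q = (LINT t|lborel. indicator {0..1} t *\<^sub>R \<Psi> (rot (2 * pi * t) q))"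

lemma rot_continuous: "continuous_on UNIV (\<lambda>p. rot (2 * pi * fst p) (snd p) :: 'a::euclidean_space \<times> 'a)"
  unfolding rot_def case_prod_beta' by (intro continuous_intros)

lemma norm_rot: "norm (rot \<theta> q) = norm q"
proof -
  have "(norm (c *\<^sub>R x - s *\<^sub>R y))\<^sup>2 + (norm (s *\<^sub>R x + c *\<^sub>R y))\<^sup>2 = (c\<^sup>2 + s\<^sup>2) * ((norm x)\<^sup>2 + (norm y)\<^sup>2)"
    for c s and x y :: 'a
    unfolding power2_norm_eq_inner
    by (simp add: inner_add_left inner_add_right inner_diff_left inner_diff_right inner_commute[of y x]
        power2_eq_square algebra_simps)
  from this[of "cos \<theta>" "fst q" "sin \<theta>" "snd q"] show ?thesis
    by (simp add: norm_prod_def rot_def case_prod_beta')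
qed

text \<open>Lebesgue measure and the Gaussian weight are both rotation invariant, so by Fubini every
  angle contributes the same integral.\<close>

lemma circle_avg_gauss_integral:
  fixes \<Psi> :: "'a::euclidean_space \<times> 'a \<Rightarrow> complex"
  assumes cont: "continuous_on UNIV \<Psi>" and \<Psi>: "gauss_sq \<Psi>" and \<tau>: "\<tau> > 1/2"
  shows "integrable lborel (\<lambda>q. circle_avg \<Psi> q * complex_of_real (exp (- \<tau> * (norm q)\<^sup>2)))"
    and "(LINT q|lborel. circle_avg \<Psi> q * complex_of_real (exp (- \<tau> * (norm q)\<^sup>2)))
      = (LINT q|lborel. \<Psi> q * complex_of_real (exp (- \<tau> * (norm q)\<^sup>2)))"
proof -
  define B where "B q = \<Psi> q * complex_of_real (exp (- \<tau> * (norm q)\<^sup>2))" for q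
  have Bc: "continuous_on UNIV B" unfolding B_def by (intro continuous_intros cont)
  then have [measurable]: "B \<in> borel_measurable borel" by (rule borel_measurable_continuous_onI)
  have Bi: "integrable lborel B"
    using gauss_sq_integrable[OF \<Psi> exp_growth_const[of 1] \<tau>] by (simp add: B_def[abs_def])
  have inv: "integrable lborel (\<lambda>q. B (rot (2 * pi * t) q))" "(LINT q|lborel. B (rot (2 * pi * t) q)) = (LINT q|lborel. B q)"
    "(\<integral>\<^sup>+q. ennreal (norm (B (rot (2 * pi * t) q))) \<partial>lborel) = (\<integral>\<^sup>+q. ennreal (norm (B q)) \<partial>lborel)"
    if "t \<in> {0..<1}" for t
  proof -
    have "2 * pi * t < 2 * pi * 1" using that by (intro mult_strict_left_mono) auto
    then have "preserves (rot (2 * pi * t) :: 'a \<times> 'a \<Rightarrow> _)" using that by (intro preserves_rot) auto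
    from preserves_integral[OF this, of B] preserves_nn_integral[OF this, of "\<lambda>q. ennreal (norm (B q))"] Bi
    show "integrable lborel (\<lambda>q. B (rot (2 * pi * t) q))" "(LINT q|lborel. B (rot (2 * pi * t) q)) = (LINT q|lborel. B q)"
      "(\<integral>\<^sup>+q. ennreal (norm (B (rot (2 * pi * t) q))) \<partial>lborel) = (\<integral>\<^sup>+q. ennreal (norm (B q)) \<partial>lborel)"
      by auto
  qed
  \<comment> \<open>The full turn t = 1 is outside the range of \<open>preserves_rot\<close>, but it
    is a single point.\<close>
  have AE1: "AE t in lborel. t \<noteq> (1::real)" by (rule AE_lborel_singleton)
  define g where "g t q = indicator {0..1} t *\<^sub>R B (rot (2 * pi * t) q)" for t and q :: "'a \<times> 'a"
  have gm: "(\<lambda>p. g (fst p) (snd p)) \<in> borel_measurable (lborel \<Otimes>\<^sub>M lborel)"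
  proof -
    have "(\<lambda>p. B (rot (2 * pi * fst p) (snd p))) \<in> borel_measurable borel"
      by (intro borel_measurable_continuous_onI continuous_on_compose2[OF Bc rot_continuous]) auto
    then have 1: "(\<lambda>p. B (rot (2 * pi * fst p) (snd p))) \<in> borel_measurable (lborel \<Otimes>\<^sub>M lborel)"
      unfolding lborel_prod by simp
    have 2: "(\<lambda>p. indicator {0..1} (fst p) :: real) \<in> borel_measurable ((lborel :: real measure) \<Otimes>\<^sub>M (lborel :: ('a \<times> 'a) measure))"
      by (rule measurable_compose[OF measurable_fst, of "indicator {0..1}"]) (simp add: borel_measurable_indicator)
    show ?thesis unfolding g_def by (rule borel_measurable_scaleR[OF 2 1])
  qed
  have gi: "integrable (lborel \<Otimes>\<^sub>M lborel) (case_prod g)"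
  proof (rule integrableI_bounded)
    show "case_prod g \<in> borel_measurable (lborel \<Otimes>\<^sub>M lborel)" using gm by (simp add: case_prod_beta')
    have "(\<integral>\<^sup>+p. ennreal (norm (case_prod g p)) \<partial>(lborel \<Otimes>\<^sub>M lborel)) = (\<integral>\<^sup>+t. \<integral>\<^sup>+q. ennreal (norm (g t q)) \<partial>lborel \<partial>lborel)"
      using gm by (subst lborel.nn_integral_fst[symmetric]) (auto simp: case_prod_beta')
    also have "\<dots> = (\<integral>\<^sup>+t. indicator {0..1} t * (\<integral>\<^sup>+q. ennreal (norm (B q)) \<partial>lborel) \<partial>(lborel :: real measure))"
    proof (rule nn_integral_cong_AE, use AE1 in eventually_elim)
      case (elim t)
      show ?case
      proof (cases "t \<in> {0..1}")
        case True
        then have "t \<in> {0..<1}" using elim by auto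
        then show ?thesis using inv(3)[of t] True by (simp add: g_def)
      qed (simp add: g_def)
    qed
    also have "\<dots> = (\<integral>\<^sup>+q. ennreal (norm (B q)) \<partial>lborel)"
      by (subst nn_integral_multc) auto
    also have "\<dots> < \<infinity>" using Bi by (simp add: integrable_iff_bounded)
    finally show "(\<integral>\<^sup>+p. ennreal (norm (case_prod g p)) \<partial>(lborel \<Otimes>\<^sub>M lborel)) < \<infinity>" .
  qed
  have cg: "circle_avg \<Psi> q * complex_of_real (exp (- \<tau> * (norm q)\<^sup>2)) = (LINT t|lborel. g t q)" for q
  proof -
    have e: "g t q = (indicator {0..1} t *\<^sub>R \<Psi> (rot (2 * pi * t) q)) * complex_of_real (exp (- \<tau> * (norm q)\<^sup>2))" for t
      by (simp add: g_def B_def norm_rot)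
    show ?thesis unfolding circle_avg_def e
      by (rule Bochner_Integration.integral_mult_left_zero[symmetric])
  qed
  show "integrable lborel (\<lambda>q. circle_avg \<Psi> q * complex_of_real (exp (- \<tau> * (norm q)\<^sup>2)))"
    unfolding cg by (rule lborel_pair.integrable_snd[OF gi])
  have "(LINT q|lborel. (LINT t|lborel. g t q)) = (LINT t|lborel. (LINT q|lborel. g t q))"
    by (rule lborel_pair.Fubini_integral[OF gi])
  also have "\<dots> = (LINT t|lborel. indicator {0..1} (t::real) *\<^sub>R (LINT q|lborel. B q))"
  proof (rule integral_cong_AE)
    show "AE t in lborel. (LINT q|lborel. g t q) = indicator {0..1} t *\<^sub>R (LINT q|lborel. B q)"
      using AE1
    proof eventually_elim
      case (elim t)
      show ?case
      proof (cases "t \<in> {0..1}")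
        case True
        then have "t \<in> {0..<1}" using elim by auto
        then show ?thesis using inv(2)[of t] True by (simp add: g_def)
      qed (simp add: g_def)
    qed
    show "(\<lambda>t. LINT q|lborel. g t q) \<in> borel_measurable lborel"
      using lborel_pair.integrable_fst[OF gi] by (rule borel_measurable_integrable)
  qed measurable
  also have "\<dots> = (LINT q|lborel. B q)" by simp
  finally show "(LINT q|lborel. circle_avg \<Psi> q * complex_of_real (exp (- \<tau> * (norm q)\<^sup>2)))
      = (LINT q|lborel. \<Psi> q * complex_of_real (exp (- \<tau> * (norm q)\<^sup>2)))"
    unfolding cg B_def .
qed

lemma norm_exp_taylor:
  fixes x :: real
  assumes "m \<ge> 1"
  shows "norm (exp x - (\<Sum>i<m. x ^ i / fact i)) \<le> exp \<bar>x\<bar> * \<bar>x\<bar> ^ m"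
proof -
  obtain n where n: "m = Suc n" using assms by (cases m) auto
  have "norm (exp (complex_of_real x) - (\<Sum>i\<le>n. complex_of_real x ^ i / fact i))
     \<le> exp \<bar>Re (complex_of_real x)\<bar> * (norm (complex_of_real x)) ^ Suc n / fact n"
    by (rule Taylor_exp)
  also have "exp (complex_of_real x) - (\<Sum>i\<le>n. complex_of_real x ^ i / fact i) = complex_of_real (exp x - (\<Sum>i<m. x ^ i / fact i))"
    by (simp add: n exp_of_real[symmetric] lessThan_Suc_atMost)
  also have "exp \<bar>Re (complex_of_real x)\<bar> * (norm (complex_of_real x)) ^ Suc n / fact n \<le> exp \<bar>x\<bar> * \<bar>x\<bar> ^ m"
    using mult_left_mono[of 1 "fact n" "exp \<bar>x\<bar> * \<bar>x\<bar> ^ m"] fact_ge_1[of n, where 'a=real]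
    by (simp add: n field_simps)
  finally show ?thesis by (simp only: norm_of_real real_norm_def)
qed

text \<open>The function \<open>\<tau> \<mapsto> \<integral> \<Psi> e\<^bsup>-\<tau>|q|\<^sup>2\<^esup>\<close> vanishes to order \<open>m\<close> at \<open>1\<close>, whereas by homogeneity of
  the circle averages it is \<open>\<tau>\<^bsup>-n\<^esup>\<close> times a polynomial of degree less than \<open>m\<close> in \<open>1/\<tau>\<close>, whose
  constant term is a multiple of \<open>\<Psi>(0)\<close>.\<close>

lemma vanishing_moments_imp_zero:
  fixes \<Psi> :: "'a::euclidean_space \<times> 'a \<Rightarrow> complex"
  assumes m: "m \<ge> 1" and cont: "continuous_on UNIV \<Psi>" and \<Psi>: "gauss_sq \<Psi>"
    and mom: "\<And>i. i < m \<Longrightarrow> (LINT q|lborel. \<Psi> q * complex_of_real ((norm q) ^ (2 * i)) * complex_of_real (exp (- 1 * (norm q)\<^sup>2))) = 0"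
    and avg: "\<And>q. \<exists>a. a 0 = \<Psi> 0 \<and> (\<forall>r\<ge>0. circle_avg \<Psi> (r *\<^sub>R q) = (\<Sum>j<m. a j * complex_of_real r ^ (2 * j)))"
  shows "\<Psi> 0 = 0"
proof -
  define N where "N = DIM('a \<times> 'a)"
  define I where "I \<tau> = (LINT q|lborel. \<Psi> q * complex_of_real (exp (- \<tau> * (norm q)\<^sup>2)))" for \<tau>
  define J where "J x = (LINT q|lborel. circle_avg \<Psi> (sqrt x *\<^sub>R q) * complex_of_real (exp (- 1 * (norm q)\<^sup>2)))" for x
  \<comment> \<open>The dilation by sqrt x turns e^(-|q|^2/x) into the fixed weight e^(-|q|^2) and
    moves the parameter into the circle average. The bound x < 2 says that 1/x exceeds the threshold
    1/2.\<close>
  have scale: "integrable lborel (\<lambda>q. circle_avg \<Psi> (sqrt x *\<^sub>R q) * complex_of_real (exp (- 1 * (norm q)\<^sup>2)))"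
    "I (1 / x) = complex_of_real (sqrt x ^ N) * J x" if x: "0 < x" "x < 2" for x
  proof -
    let ?f = "\<lambda>q. circle_avg \<Psi> q * complex_of_real (exp (- (1/x) * (norm q)\<^sup>2))"
    have \<tau>: "1 / x > 1/2" using x by (simp add: field_simps)
    note c = circle_avg_gauss_integral[OF cont \<Psi> \<tau>]
    have e: "?f (sqrt x *\<^sub>R q) = circle_avg \<Psi> (sqrt x *\<^sub>R q) * complex_of_real (exp (- 1 * (norm q)\<^sup>2))" for q
      using x by (simp add: power_mult_distrib)
    have s0: "sqrt x \<noteq> 0" using x by simp
    show "integrable lborel (\<lambda>q. circle_avg \<Psi> (sqrt x *\<^sub>R q) * complex_of_real (exp (- 1 * (norm q)\<^sup>2)))"
      using integral_lborel_scale(1)[OF c(1) s0] unfolding e .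
    show "I (1 / x) = complex_of_real (sqrt x ^ N) * J x"
      using integral_lborel_scale(2)[OF c(1) s0] c(2) x unfolding e I_def J_def N_def
      by (simp add: scaleR_conv_of_real)
  qed
  \<comment> \<open>Any m distinct nodes between 0 and 2 serve; there \<open>scale\<close> provides
    integrability.\<close>
  define x where "x i = 1 / real (Suc i)" for i
  have x: "0 < x i" "x i < 2" for i by (auto simp: x_def field_simps)
  have "inj_on (\<lambda>i. complex_of_real (x i)) {..<m}"
    by (auto simp: inj_on_def x_def simp del: of_real_divide)
  then obtain l :: "nat \<Rightarrow> complex poly" where l: "\<And>i. i < m \<Longrightarrow> degree (l i) < m"
    "\<And>p y. degree p < m \<Longrightarrow> poly p y = (\<Sum>i<m. poly (l i) y * poly p (complex_of_real (x i)))"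
    using lagrange_interpolation by blast
  \<comment> \<open>The coefficients a depend on q, and nothing is known about their measurability.
    Interpolation expresses the average at any radius by averages at the nodes with weights
    independent of q, so that the integral over q is again a polynomial in y.\<close>
  have interp: "circle_avg \<Psi> (sqrt y *\<^sub>R q) = (\<Sum>i<m. poly (l i) (complex_of_real y) * circle_avg \<Psi> (sqrt (x i) *\<^sub>R q))" if "y \<ge> 0" for y q
  proof -
    obtain a where a: "a 0 = \<Psi> 0" "\<And>r. r \<ge> 0 \<Longrightarrow> circle_avg \<Psi> (r *\<^sub>R q) = (\<Sum>j<m. a j * complex_of_real r ^ (2 * j))"
      using avg[of q] by blast
    define p where "p = (\<Sum>j<m. monom (a j) j)"
    have "degree p \<le> m - 1"
      unfolding p_def by (intro degree_sum_le) (auto intro!: order_trans[OF degree_monom_le])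
    then have dp: "degree p < m" using m by simp
    have p: "circle_avg \<Psi> (sqrt y *\<^sub>R q) = poly p (complex_of_real y)" if "y \<ge> 0" for y
    proof -
      have "complex_of_real (sqrt y) ^ (2 * j) = complex_of_real y ^ j" for j
        unfolding power_mult of_real_power[symmetric] using that by simp
      then show ?thesis using a(2)[of "sqrt y"] that by (simp add: p_def poly_sum poly_monom)
    qed
    show ?thesis unfolding p[OF that] p[OF less_imp_le[OF x(1)]] by (rule l(2)[OF dp])
  qed
  define L where "L = (\<Sum>i<m. smult (J (x i)) (l i))"
  have JL: "J y = poly L (complex_of_real y)" if y: "y \<ge> 0" for y
  proof -
    have "J y = (LINT q|lborel. (\<Sum>i<m. poly (l i) (complex_of_real y) * (circle_avg \<Psi> (sqrt (x i) *\<^sub>R q) * complex_of_real (exp (- 1 * (norm q)\<^sup>2)))))"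
      unfolding J_def interp[OF y] by (simp add: sum_distrib_right mult.assoc)
    also have "\<dots> = (\<Sum>i<m. poly (l i) (complex_of_real y) * J (x i))"
      unfolding J_def using scale(1)[OF x]
      by (subst Bochner_Integration.integral_sum) auto
    finally show ?thesis by (simp add: L_def poly_sum mult.commute)
  qed
  have degL: "degree L < m"
    unfolding L_def using m by (intro degree_sum_less) (auto simp: l)
  \<comment> \<open>For |1 - \<tau>| \<le> 1/4 the Taylor remainder costs at most a factor
    e^(|q|^2/4), which leaves the weight of rate 3/4, still above 1/2.\<close>
  define C where "C = (LINT q|lborel. norm (\<Psi> q * complex_of_real ((norm q) ^ (2 * m)) * complex_of_real (exp (- (3/4) * (norm q)\<^sup>2))))"
  have Ci: "integrable lborel (\<lambda>q. \<Psi> q * complex_of_real ((norm q) ^ (2 * m)) * complex_of_real (exp (- (3/4) * (norm q)\<^sup>2)))"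
    using gauss_sq_integrable[OF \<Psi> exp_growth_norm_power[of 0 "2 * m"], of "3/4"] by simp
  have Ibound: "norm (I \<tau>) \<le> \<bar>1 - \<tau>\<bar> ^ m * C" if \<tau>: "3/4 < \<tau>" "\<tau> < 5/4" for \<tau>
  proof -
    let ?T = "\<lambda>q. \<Sum>i<m. ((1 - \<tau>) * (norm q)\<^sup>2) ^ i / fact i :: real"
    have i1: "integrable lborel (\<lambda>q. \<Psi> q * complex_of_real (exp (- \<tau> * (norm q)\<^sup>2)))"
      using gauss_sq_integrable[OF \<Psi> exp_growth_const[of 1], of \<tau>] \<tau> by simp
    have im: "integrable lborel (\<lambda>q. \<Psi> q * complex_of_real ((norm q) ^ (2 * i)) * complex_of_real (exp (- 1 * (norm q)\<^sup>2)))" for i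
      using gauss_sq_integrable[OF \<Psi> exp_growth_norm_power[of 0 "2 * i"], of 1] by simp
    have T: "\<Psi> q * complex_of_real (?T q * exp (- 1 * (norm q)\<^sup>2)) = (\<Sum>i<m. complex_of_real ((1 - \<tau>) ^ i / fact i) * (\<Psi> q * complex_of_real ((norm q) ^ (2 * i)) * complex_of_real (exp (- 1 * (norm q)\<^sup>2))))" for q
      by (simp add: sum_distrib_left sum_distrib_right power_mult_distrib power_mult[symmetric] mult_ac)
    have i2: "integrable lborel (\<lambda>q. \<Psi> q * complex_of_real (?T q * exp (- 1 * (norm q)\<^sup>2)))"
      unfolding T using im by auto
    have "(LINT q|lborel. \<Psi> q * complex_of_real (?T q * exp (- 1 * (norm q)\<^sup>2))) = 0"
      unfolding T using im mom by (subst Bochner_Integration.integral_sum) auto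
    then have "I \<tau> = (LINT q|lborel. \<Psi> q * complex_of_real (exp (- \<tau> * (norm q)\<^sup>2)) - \<Psi> q * complex_of_real (?T q * exp (- 1 * (norm q)\<^sup>2)))"
      unfolding I_def using i1 i2 by simp
    also have "norm \<dots> \<le> (LINT q|lborel. \<bar>1 - \<tau>\<bar> ^ m * norm (\<Psi> q * complex_of_real ((norm q) ^ (2 * m)) * complex_of_real (exp (- (3/4) * (norm q)\<^sup>2))))"
    proof (rule order_trans[OF integral_norm_bound integral_mono])
      show "integrable lborel (\<lambda>q. norm (\<Psi> q * complex_of_real (exp (- \<tau> * (norm q)\<^sup>2)) - \<Psi> q * complex_of_real (?T q * exp (- 1 * (norm q)\<^sup>2))))"
        using i1 i2 by auto
      show "integrable lborel (\<lambda>q. \<bar>1 - \<tau>\<bar> ^ m * norm (\<Psi> q * complex_of_real ((norm q) ^ (2 * m)) * complex_of_real (exp (- (3/4) * (norm q)\<^sup>2))))"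
        using integrable_norm[OF Ci] by (rule integrable_mult_right)
      fix q :: "'a \<times> 'a"
      let ?y = "(1 - \<tau>) * (norm q)\<^sup>2"
      have "exp (- \<tau> * (norm q)\<^sup>2) = exp ?y * exp (- 1 * (norm q)\<^sup>2)" by (simp add: exp_add[symmetric] algebra_simps)
      then have "\<Psi> q * complex_of_real (exp (- \<tau> * (norm q)\<^sup>2)) - \<Psi> q * complex_of_real (?T q * exp (- 1 * (norm q)\<^sup>2))
          = \<Psi> q * complex_of_real ((exp ?y - ?T q) * exp (- 1 * (norm q)\<^sup>2))"
        by (simp only: of_real_mult of_real_diff) (simp add: algebra_simps)
      also have "norm \<dots> = norm (\<Psi> q) * (\<bar>exp ?y - ?T q\<bar> * exp (- 1 * (norm q)\<^sup>2))"
        by (simp only: norm_mult norm_of_real abs_mult abs_exp_cancel)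
      also have "\<dots> \<le> norm (\<Psi> q) * ((exp \<bar>?y\<bar> * \<bar>?y\<bar> ^ m) * exp (- 1 * (norm q)\<^sup>2))"
        using norm_exp_taylor[OF m, of ?y] by (intro mult_left_mono mult_right_mono) auto
      also have "\<dots> = \<bar>1 - \<tau>\<bar> ^ m * (norm (\<Psi> q) * (norm q) ^ (2 * m) * (exp \<bar>?y\<bar> * exp (- 1 * (norm q)\<^sup>2)))"
        by (simp add: abs_mult power_mult_distrib power_mult[symmetric] mult_ac)
      also have "\<dots> \<le> \<bar>1 - \<tau>\<bar> ^ m * (norm (\<Psi> q) * (norm q) ^ (2 * m) * exp (- (3/4) * (norm q)\<^sup>2))"
      proof (intro mult_left_mono)
        have "\<bar>1 - \<tau>\<bar> \<le> 1/4" using \<tau> by linarith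
        then have "\<bar>1 - \<tau>\<bar> * (norm q)\<^sup>2 \<le> (1/4) * (norm q)\<^sup>2" by (rule mult_right_mono) simp
        then have "\<bar>?y\<bar> \<le> (1/4) * (norm q)\<^sup>2" by (simp add: abs_mult)
        then show "exp \<bar>?y\<bar> * exp (- 1 * (norm q)\<^sup>2) \<le> exp (- (3/4) * (norm q)\<^sup>2)"
          by (simp flip: exp_add)
      qed auto
      also have "\<dots> = \<bar>1 - \<tau>\<bar> ^ m * norm (\<Psi> q * complex_of_real ((norm q) ^ (2 * m)) * complex_of_real (exp (- (3/4) * (norm q)\<^sup>2)))"
        by (simp add: norm_mult norm_power)
      finally show "norm (\<Psi> q * complex_of_real (exp (- \<tau> * (norm q)\<^sup>2)) - \<Psi> q * complex_of_real (?T q * exp (- 1 * (norm q)\<^sup>2)))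
         \<le> \<bar>1 - \<tau>\<bar> ^ m * norm (\<Psi> q * complex_of_real ((norm q) ^ (2 * m)) * complex_of_real (exp (- (3/4) * (norm q)\<^sup>2)))" .
    qed
    also have "\<dots> = \<bar>1 - \<tau>\<bar> ^ m * C"
      unfolding C_def by (rule Bochner_Integration.integral_mult_right_zero)
    finally show ?thesis .
  qed
  have C0: "C \<ge> 0" unfolding C_def by simp
  \<comment> \<open>For y > 1 the factor sqrt y ^ N is at least 1, so J y inherits the bound on I
    (1/y), and 1 - 1/y is at most y - 1.\<close>
  have "L = 0"
  proof (rule poly_zero_if_small[OF degL])
    fix y :: real assume y: "1 < y" "y < 5/4"
    have "norm (poly L (complex_of_real y)) = norm (J y)" using JL y by simp
    also have "\<dots> \<le> norm (I (1 / y))"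
    proof -
      have "1 \<le> sqrt y ^ N" using y by (intro one_le_power) auto
      then have "1 * norm (J y) \<le> sqrt y ^ N * norm (J y)" by (intro mult_right_mono) auto
      then show ?thesis using scale(2)[of y] y by (simp add: norm_mult norm_power)
    qed
    also have "\<dots> \<le> \<bar>1 - 1 / y\<bar> ^ m * C"
      using y by (intro Ibound) (auto simp: field_simps)
    also have "\<dots> \<le> (y - 1) ^ m * C"
    proof (intro mult_right_mono power_mono C0)
      have "1 - 1 / y = (y - 1) / y" using y by (simp add: field_simps)
      also have "\<dots> \<le> (y - 1) / 1" using y by (intro divide_left_mono) auto
      finally show "\<bar>1 - 1 / y\<bar> \<le> y - 1" using y by simp
    qed auto
    finally show "norm (poly L (complex_of_real y)) \<le> C * (y - 1) ^ m" by (simp add: mult.commute)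
  qed
  \<comment> \<open>The polynomial identity for J extends to 0, where the substitution itself makes
    no sense. There every average is taken at the centre, so J 0 is the value of \<Psi> at 0 times
    the mass of the Gaussian.\<close>
  then have "J 0 = 0" using JL[of 0] by simp
  moreover have "J 0 = \<Psi> 0 * complex_of_real (LINT q|lborel. exp (- 1 * (norm (q::'a\<times>'a))\<^sup>2))"
  proof -
    obtain a where a: "a 0 = \<Psi> 0" "\<And>r. r \<ge> 0 \<Longrightarrow> circle_avg \<Psi> (r *\<^sub>R 0) = (\<Sum>j<m. a j * complex_of_real r ^ (2 * j))"
      using avg[of 0] by blast
    have e: "(\<Sum>j<m. a j * complex_of_real 0 ^ (2 * j)) = (\<Sum>j\<in>{0}. a j * complex_of_real 0 ^ (2 * j))"
      by (rule sum.mono_neutral_right) (use m in \<open>auto simp: power_0_left\<close>)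
    have "circle_avg \<Psi> (0 *\<^sub>R 0) = (\<Sum>j\<in>{0}. a j * complex_of_real 0 ^ (2 * j))"
      unfolding e[symmetric] by (rule a(2)) simp
    then have "circle_avg \<Psi> 0 = \<Psi> 0" using a(1) by simp
    then show ?thesis unfolding J_def by simp
  qed
  moreover have "(LINT q|lborel. exp (- 1 * (norm (q::'a\<times>'a))\<^sup>2)) \<noteq> 0"
  proof
    assume "(LINT q|lborel. exp (- 1 * (norm (q::'a\<times>'a))\<^sup>2)) = 0"
    moreover have "integrable lborel (\<lambda>q::'a\<times>'a. exp (- 1 * (norm q)\<^sup>2))"
      using integrable_exp_norm[of 1 0, where 'a="'a\<times>'a"] by simp
    ultimately have "AE q in (lborel :: ('a\<times>'a) measure). exp (- 1 * (norm q)\<^sup>2) = 0"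
      by (subst (asm) integral_nonneg_eq_0_iff_AE) auto
    then have "AE q in (lborel :: ('a\<times>'a) measure). False" by simp
    then have "emeasure (lborel :: ('a\<times>'a) measure) UNIV = 0"
      using AE_iff_measurable[of UNIV "lborel :: ('a\<times>'a) measure" "\<lambda>_. False"] by simp
    then show False by simp
  qed
  ultimately show ?thesis by simp
qed

section \<open>Multi-indices\<close>

text \<open>The rank of an element, one more than the number of its predecessors, is injective with
  values in {1..card A}; the enumeration is its inverse.\<close>

lemma finite_strict_order_enum:
  fixes R :: "'a \<Rightarrow> 'a \<Rightarrow> bool"
  assumes fin: "finite A" and irr: "\<And>x. \<not> R x x" and tr: "\<And>x y z. R x y \<Longrightarrow> R y z \<Longrightarrow> R x z"
    and tot: "\<And>x y. x \<in> A \<Longrightarrow> y \<in> A \<Longrightarrow> R x y \<or> x = y \<or> R y x"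
  shows "\<exists>\<phi>. bij_betw \<phi> {1..card A} A \<and> (\<forall>i\<in>{1..card A}. \<forall>j\<in>{1..card A}. i < j \<longrightarrow> R (\<phi> i) (\<phi> j))"
proof -
  define rk where "rk x = Suc (card {y\<in>A. R y x})" for x
  have mono: "rk x < rk y" if "x \<in> A" "R x y" for x y
  proof -
    have "{z\<in>A. R z x} \<subset> {z\<in>A. R z y}" using that irr tr by blast
    then show ?thesis unfolding rk_def using fin by (simp add: psubset_card_mono)
  qed
  have inj: "inj_on rk A"
    by (rule inj_onI) (metis mono tot less_irrefl)
  have sub: "rk ` A \<subseteq> {1..card A}"
  proof
    fix i assume "i \<in> rk ` A"
    then obtain x where x: "x \<in> A" "i = rk x" by auto
    have "{y\<in>A. R y x} \<subset> A" using x irr by blast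
    then have "card {y\<in>A. R y x} < card A" using fin by (rule psubset_card_mono[rotated])
    then show "i \<in> {1..card A}" using x by (simp add: rk_def)
  qed
  have "rk ` A = {1..card A}"
    by (rule card_subset_eq) (use sub in \<open>auto simp: card_image[OF inj]\<close>)
  then have bij: "bij_betw rk A {1..card A}" using inj by (simp add: bij_betw_def)
  let ?\<phi> = "inv_into A rk"
  have "bij_betw ?\<phi> {1..card A} A" using bij by (rule bij_betw_inv_into)
  moreover have "R (?\<phi> i) (?\<phi> j)" if "i \<in> {1..card A}" "j \<in> {1..card A}" "i < j" for i j
  proof -
    have "?\<phi> i \<in> A" "?\<phi> j \<in> A" "rk (?\<phi> i) = i" "rk (?\<phi> j) = j"
      using that bij bij_betw_inv_into_right[OF bij] bij_betwE[OF bij_betw_inv_into[OF bij]] by auto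
    then show ?thesis using tot[of "?\<phi> i" "?\<phi> j"] mono[of "?\<phi> j" "?\<phi> i"] that(3) by auto
  qed
  ultimately show ?thesis by blast
qed

text \<open>Stars and bars: appending the slack m - 1 - sum k turns the multi-indices into lists of
  length n + 1 with sum exactly m - 1.\<close>

lemma J_set_card:
  assumes m: "m \<ge> 1"
  shows "finite (J_set m :: ('n::{finite,linorder} \<Rightarrow> nat) set)"
    and "card (J_set m :: ('n::{finite,linorder} \<Rightarrow> nat) set) = (CARD('n) + m - 1) choose CARD('n)"
proof -
  define xs where "xs = sorted_list_of_set (UNIV :: 'n set)"
  have xs: "distinct xs" "set xs = UNIV" "length xs = CARD('n)" by (simp_all add: xs_def)
  let ?L = "{l::nat list. length l = CARD('n) + 1 \<and> sum_list l = m - 1}"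
  define F where "F k = map k xs @ [m - 1 - (\<Sum>r\<in>UNIV. k r)]" for k :: "'n \<Rightarrow> nat"
  have sum: "sum_list (map k xs) = (\<Sum>r\<in>UNIV. k r)" for k :: "'n \<Rightarrow> nat"
    using sum_list_distinct_conv_sum_set[OF xs(1), of k] by (simp add: xs(2))
  have bij: "bij_betw F (J_set m) ?L"
  proof (rule bij_betw_imageI)
    show "inj_on F (J_set m)"
      by (rule inj_onI) (auto simp: F_def xs(2) fun_eq_iff)
    show "F ` J_set m = ?L"
    proof
      show "F ` J_set m \<subseteq> ?L" by (auto simp: F_def J_set_def sum xs(3))
      show "?L \<subseteq> F ` J_set m"
      proof
        fix l assume "l \<in> ?L"
        then have l: "length l = CARD('n) + 1" "sum_list l = m - 1" by auto
        have b: "bij_betw ((!) xs) {..<CARD('n)} UNIV"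
          using bij_betw_nth[OF xs(1)] xs by auto
        define k where "k r = l ! (inv_into {..<CARD('n)} ((!) xs) r)" for r
        have mk: "map k xs = butlast l"
        proof (rule nth_equalityI)
          fix i assume "i < length (map k xs)"
          then have i: "i < CARD('n)" by (simp add: xs(3))
          have "inv_into {..<CARD('n)} ((!) xs) (xs ! i) = i"
            using bij_betw_inv_into_left[OF b] i by simp
          then show "map k xs ! i = butlast l ! i"
            using i l(1) by (simp add: k_def xs(3) nth_butlast)
        qed (simp add: xs(3) l(1))
        have ne: "l \<noteq> []" using l(1) by auto
        have "sum_list (butlast l @ [last l]) = m - 1" using append_butlast_last_id[OF ne] l(2) by simp
        then have s: "(\<Sum>r\<in>UNIV. k r) + last l = m - 1" unfolding mk[symmetric] by (simp add: sum)
        then have "k \<in> J_set m" by (simp add: J_set_def)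
        moreover have "F k = l"
          unfolding F_def mk using s append_butlast_last_id[OF ne] by (metis diff_add_inverse)
        ultimately show "l \<in> F ` J_set m" by blast
      qed
    qed
  qed
  have "card ?L = (m - 1 + (CARD('n) + 1) - 1) choose (m - 1)"
    by (rule card_length_sum_list)
  also have "\<dots> = (CARD('n) + m - 1) choose CARD('n)"
    using m binomial_symmetric[of "m - 1" "CARD('n) + m - 1"] by (simp add: add.commute)
  finally have cL: "card ?L = (CARD('n) + m - 1) choose CARD('n)" .
  then show "card (J_set m :: ('n \<Rightarrow> nat) set) = (CARD('n) + m - 1) choose CARD('n)"
    using bij_betw_same_card[OF bij] by simp
  have "card ?L > 0" unfolding cL using m by (simp add: zero_less_binomial_iff)
  then have "finite ?L" by (rule card_ge_0_finite)
  then show "finite (J_set m :: ('n \<Rightarrow> nat) set)" using bij_betw_finite[OF bij] by simp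
qed

text \<open>The lexicographic order is a strict total order, so an increasing enumeration exists and
  the choice in \<open>lex_enum\<close> has its defining property.\<close>

lemma lex_enum_bij:
  assumes m: "m \<ge> 1" and d: "d = (CARD('n::{finite,linorder}) + m - 1) choose CARD('n)"
  shows "bij_betw (lex_enum m :: nat \<Rightarrow> ('n \<Rightarrow> nat)) {1..d} (J_set m)"
proof -
  let ?J = "J_set m :: ('n \<Rightarrow> nat) set"
  have "\<exists>\<phi>. bij_betw \<phi> {1..card ?J} ?J \<and> (\<forall>i\<in>{1..card ?J}. \<forall>j\<in>{1..card ?J}. i < j \<longrightarrow> less_fun (\<phi> i) (\<phi> j))"
  proof (rule finite_strict_order_enum[OF J_set_card(1)[OF m]])
    show "\<not> less_fun x x" for x :: "'n \<Rightarrow> nat" by (auto elim: less_funE)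
    show "less_fun x y \<or> x = y \<or> less_fun y x" for x y :: "'n \<Rightarrow> nat"
      using less_fun_trichotomy[of x y] by auto
  qed (rule less_fun_trans)
  from someI_ex[OF this]
  show ?thesis unfolding lex_enum_def[symmetric] by (simp add: J_set_card(2)[OF m] d)
qed

section \<open>Vanishing of polyanalytic functions\<close>

lemma cvec_add: "cvec (p + q) = cvec p + cvec q"
  by (simp add: cvec_def vec_eq_iff complex_eq_iff)

lemma cvec_scaleR: "cvec (c *\<^sub>R p) = c *\<^sub>R cvec p"
  by (simp add: cvec_def vec_eq_iff complex_eq_iff)

lemma cvec_rot_nth: "cvec (rot \<theta> q) $ r = exp (\<i> * complex_of_real \<theta>) * cvec q $ r"
  by (simp add: cvec_nth rot_def case_prod_beta' complex_eq_iff Re_exp Im_exp)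

lemma bdot_plus_left: "bdot (p + q) b = bdot p b + bdot q b"
  by (simp add: bdot_def cvec_add distrib_right sum.distrib)

lemma cnj_bdot: "cnj (bdot q b) = (\<Sum>r\<in>UNIV. cvec q $ r * cnj (b $ r))"
  by (simp add: bdot_def)

lemma norm_pair_sq: "(norm (p :: 'a::real_normed_vector \<times> 'b::real_normed_vector))\<^sup>2 = (norm (fst p))\<^sup>2 + (norm (snd p))\<^sup>2"
  by (simp add: norm_prod_def)

lemma bdot_self: "bdot a (cvec a) = complex_of_real ((norm a)\<^sup>2)"
proof -
  have "bdot a (cvec a) = (\<Sum>r\<in>UNIV. complex_of_real ((fst a $ r)\<^sup>2 + (snd a $ r)\<^sup>2))"
    unfolding bdot_def by (rule sum.cong) (auto simp: cvec_nth complex_eq_iff power2_eq_square)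
  then show ?thesis by (simp add: norm_pair_sq norm_sq_vec sum.distrib)
qed

lemma Re_bdot: "Re (bdot q (cvec a)) = q \<bullet> a"
  by (cases q; cases a) (simp add: bdot_def cvec_nth inner_vec_def sum.distrib)

lemma norm_plus_sq:
  fixes q a :: "'a::real_inner"
  shows "(norm (q + a))\<^sup>2 = (norm q)\<^sup>2 + (norm a)\<^sup>2 + 2 * (q \<bullet> a)"
  by (simp add: power2_norm_eq_inner inner_add_left inner_add_right inner_commute)

text \<open>Translating a to the origin reduces the claim to
  \<open>vanishing_moments_imp_zero\<close>. The exponential with parameter b =
  \<open>cvec a\<close> is the one that turns e^(-|q + a|^2) into e^(-|q|^2) up to a factor
  holomorphic in q, so slices through the new centre remain polyanalytic of order m.\<close>

lemma vanish_at_point: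
  fixes f :: "complex^'n::finite \<Rightarrow> complex" and s :: real and a :: "(real^'n) \<times> (real^'n)"
  defines "\<Phi> \<equiv> \<lambda>p. f ((1 / s) *\<^sub>R cvec p)"
  assumes m: "m \<ge> 1" and f: "poly_an m f" and \<Phi>: "gauss_sq \<Phi>"
    and words: "\<And>rs. length rs \<le> m - 1 \<Longrightarrow> annih \<Phi> (\<lambda>p. vprod rs (snd a) (snd p))"
  shows "\<Phi> a = 0"
proof -
  \<comment> \<open>The exponent is the conjugate of an antilinear expression in q, hence complex
    linear; its value at q = 0 is 0, so \<open>\<Psi> 0\<close> is \<open>\<Phi> a\<close>.\<close>
  define \<Psi> where "\<Psi> q = \<Phi> (q + a) * exp (- cnj (bdot q (cvec a)))" for q
  have fc: "continuous_on UNIV f" using f by (intro smooth_continuous poly_an_smooth)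
  have \<Phi>c: "continuous_on UNIV \<Phi>"
    unfolding \<Phi>_def
    by (intro continuous_on_compose2[OF fc] continuous_intros linear_continuous_on bounded_linear_cvec) auto
  have bc: "continuous_on UNIV (\<lambda>q. cnj (bdot q (cvec a)))"
    unfolding cnj_bdot
    by (intro continuous_intros continuous_on_compose2[OF linear_continuous_on[OF bounded_linear_vec_nth]] linear_continuous_on bounded_linear_cvec) auto
  have \<Psi>c: "continuous_on UNIV \<Psi>"
    unfolding \<Psi>_def
    by (intro continuous_intros continuous_on_compose2[OF \<Phi>c] continuous_on_compose2[OF bc]) auto
  have expo: "exp (bdot (q + a) (cvec a)) * complex_of_real (exp (- 1 * (norm (q + a))\<^sup>2))
      = exp (- cnj (bdot q (cvec a))) * complex_of_real (exp (- 1 * (norm q)\<^sup>2))" for q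
  proof -
    have "complex_of_real (2 * (q \<bullet> a)) = bdot q (cvec a) + cnj (bdot q (cvec a))"
      by (simp add: complex_eq_iff Re_bdot)
    then have "bdot q (cvec a) = complex_of_real (2 * (q \<bullet> a)) - cnj (bdot q (cvec a))" by simp
    then have "bdot (q + a) (cvec a) + complex_of_real (- 1 * (norm (q + a))\<^sup>2)
      = - cnj (bdot q (cvec a)) + complex_of_real (- 1 * (norm q)\<^sup>2)"
      unfolding bdot_plus_left bdot_self norm_plus_sq by (simp add: algebra_simps)
    then show ?thesis by (simp only: exp_add[symmetric] exp_of_real[symmetric])
  qed
  have \<Psi>g: "gauss_sq \<Psi>"
  proof -
    have i: "integrable lborel (\<lambda>p. (norm (\<Phi> p))\<^sup>2 * exp (- (norm p)\<^sup>2))" using \<Phi> by (simp add: gauss_sq_def)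
    have e: "(norm (\<Psi> q))\<^sup>2 * exp (- (norm q)\<^sup>2) = exp ((norm a)\<^sup>2) * ((norm (\<Phi> (q + a)))\<^sup>2 * exp (- (norm (q + a))\<^sup>2))" for q
    proof -
      have "(norm (exp (- cnj (bdot q (cvec a)))))\<^sup>2 * exp (- (norm q)\<^sup>2) = exp ((norm a)\<^sup>2) * exp (- (norm (q + a))\<^sup>2)"
        by (simp add: Re_bdot norm_plus_sq exp_double[symmetric] exp_add[symmetric])
      then show ?thesis unfolding \<Psi>_def norm_mult power_mult_distrib by (simp add: mult_ac)
    qed
    have "integrable lborel (\<lambda>q. (norm (\<Psi> q))\<^sup>2 * exp (- (norm q)\<^sup>2))"
      unfolding e using integrable_lborel_plus_iff(1)[of "\<lambda>p. (norm (\<Phi> p))\<^sup>2 * exp (- (norm p)\<^sup>2)" a] i by simp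
    then show ?thesis using borel_measurable_continuous_onI[OF \<Psi>c] by (simp add: gauss_sq_def)
  qed
  have "\<Psi> 0 = 0"
  proof (rule vanishing_moments_imp_zero[OF m \<Psi>c \<Psi>g])
    fix i assume "i < m"
    then have "annih \<Phi> (\<lambda>p. complex_of_real ((norm (p - a)) ^ (2 * i)) * vprod [] (snd a) (snd p))"
      using m by (intro annih_norm_power[OF \<Phi> words]) auto
    then have 0: "(LINT p|lborel. \<Phi> p * (complex_of_real ((norm (p - a)) ^ (2 * i)) * vprod [] (snd a) (snd p) * exp (bdot p (cvec a))) * complex_of_real (exp (- 1 * (norm p)\<^sup>2))) = 0"
      unfolding annih_def by blast
    let ?f = "\<lambda>p. \<Phi> p * (complex_of_real ((norm (p - a)) ^ (2 * i)) * vprod [] (snd a) (snd p) * exp (bdot p (cvec a))) * complex_of_real (exp (- 1 * (norm p)\<^sup>2))"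
    have e: "?f (q + a) = \<Psi> q * complex_of_real ((norm q) ^ (2 * i)) * complex_of_real (exp (- 1 * (norm q)\<^sup>2))" for q
    proof -
      have "?f (q + a) = \<Phi> (q + a) * complex_of_real ((norm q) ^ (2 * i)) * (exp (bdot (q + a) (cvec a)) * complex_of_real (exp (- 1 * (norm (q + a))\<^sup>2)))"
        by (simp add: vprod_def)
      then show ?thesis unfolding expo by (simp add: \<Psi>_def)
    qed
    show "(LINT q|lborel. \<Psi> q * complex_of_real ((norm q) ^ (2 * i)) * complex_of_real (exp (- 1 * (norm q)\<^sup>2))) = 0"
      using integrable_lborel_plus_iff(2)[of ?f a] 0 unfolding e by metis
  next
    fix q :: "(real^'n) \<times> (real^'n)"
    define c where "c = - cnj (bdot q (cvec a))"
    define \<phi> where "\<phi> \<zeta> = f (line ((1 / s) *\<^sub>R cvec a) ((1 / s) *\<^sub>R cvec q) \<zeta>) * exp (c * \<zeta>)" for \<zeta>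
    have "poly_an1 m \<phi>" unfolding \<phi>_def by (rule poly_an_slice[OF f])
    then obtain b :: "nat \<Rightarrow> complex" where b: "b 0 = \<phi> 0"
      "\<And>r. r \<ge> 0 \<Longrightarrow> ((\<lambda>t. \<phi> (complex_of_real r * cis_unit t)) has_integral (\<Sum>j<m. b j * complex_of_real r ^ (2 * j))) {0..1}"
      using poly_an1_circle_average[OF _ m] by blast
    have \<Psi>\<phi>: "\<Psi> (rot (2 * pi * t) (r *\<^sub>R q)) = \<phi> (complex_of_real r * cis_unit t)" for r t
    proof -
      have cis: "exp (\<i> * complex_of_real (2 * pi * t)) = cis_unit t" by (simp add: cis_unit_def mult_ac)
      have n: "cvec (rot (2 * pi * t) (r *\<^sub>R q)) $ k = complex_of_real r * cis_unit t * cvec q $ k" for k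
        unfolding cvec_rot_nth cis cvec_scaleR by (simp add: scaleR_conv_of_real[of r "_ :: complex"])
      have "(1 / s) *\<^sub>R cvec (rot (2 * pi * t) (r *\<^sub>R q) + a) = line ((1 / s) *\<^sub>R cvec a) ((1 / s) *\<^sub>R cvec q) (complex_of_real r * cis_unit t)"
        by (simp add: vec_eq_iff line_def cvec_add n scaleR_add_right add.commute)
      moreover have "- cnj (bdot (rot (2 * pi * t) (r *\<^sub>R q)) (cvec a)) = c * (complex_of_real r * cis_unit t)"
        unfolding c_def cnj_bdot n by (simp add: sum_distrib_left sum_distrib_right mult_ac)
      ultimately show ?thesis by (simp add: \<Psi>_def \<Phi>_def \<phi>_def)
    qed
    have \<phi>0: "\<phi> 0 = \<Psi> 0"
      using \<Psi>\<phi>[of 0 0] by (simp add: rot_def)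
    show "\<exists>b. b 0 = \<Psi> 0 \<and> (\<forall>r\<ge>0. circle_avg \<Psi> (r *\<^sub>R q) = (\<Sum>j<m. b j * complex_of_real r ^ (2 * j)))"
    proof (intro exI[of _ b] conjI allI impI)
      show "b 0 = \<Psi> 0" using b(1) \<phi>0 by simp
      fix r :: real assume r: "r \<ge> 0"
      let ?g = "\<lambda>t. \<Psi> (rot (2 * pi * t) (r *\<^sub>R q))"
      have gc: "continuous_on {0..1} ?g"
        unfolding rot_def case_prod_beta'
        by (intro continuous_on_compose2[OF \<Psi>c] continuous_intros) auto
      then have "set_integrable lborel {0..1} ?g" by (rule borel_integrable_atLeastAtMost')
      from set_borel_integral_eq_integral(2)[OF this]
      have "circle_avg \<Psi> (r *\<^sub>R q) = integral {0..1} ?g"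
        by (simp add: circle_avg_def set_lebesgue_integral_def)
      also have "\<dots> = (\<Sum>j<m. b j * complex_of_real r ^ (2 * j))"
        unfolding \<Psi>\<phi> by (rule integral_unique[OF b(2)[OF r]])
      finally show "circle_avg \<Psi> (r *\<^sub>R q) = (\<Sum>j<m. b j * complex_of_real r ^ (2 * j))" .
    qed
  qed
  then show ?thesis by (simp add: \<Psi>_def bdot_def cvec_def)
qed

section \<open>The Fourier transform\<close>

lemma norm_LINT_le:
  fixes f :: "'a \<Rightarrow> 'b::{banach,second_countable_topology}"
  shows "ennreal (norm (LINT x|M. f x)) \<le> (\<integral>\<^sup>+x. ennreal (norm (f x)) \<partial>M)"
  by (cases "integrable M f") (auto simp: not_integrable_integral_eq intro: integral_norm_bound_ennreal)

lemma (in pair_sigma_finite) integrable_mult_pair: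
  fixes f :: "'a \<Rightarrow> 'c::{real_normed_field,banach,second_countable_topology}"
  assumes "integrable M1 f" "integrable M2 g"
  shows "integrable (M1 \<Otimes>\<^sub>M M2) (\<lambda>p. f (fst p) * g (snd p))"
proof (rule integrableI_bounded)
  have [measurable]: "f \<in> borel_measurable M1" "g \<in> borel_measurable M2" using assms by auto
  show "(\<lambda>p. f (fst p) * g (snd p)) \<in> borel_measurable (M1 \<Otimes>\<^sub>M M2)" by measurable
  have "(\<integral>\<^sup>+p. ennreal (norm (f (fst p) * g (snd p))) \<partial>(M1 \<Otimes>\<^sub>M M2))
    = (\<integral>\<^sup>+x. \<integral>\<^sup>+y. ennreal (norm (f x)) * ennreal (norm (g y)) \<partial>M2 \<partial>M1)"
    by (subst M2.nn_integral_fst[symmetric]) (auto simp: norm_mult ennreal_mult)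
  also have "\<dots> = (\<integral>\<^sup>+x. ennreal (norm (f x)) \<partial>M1) * (\<integral>\<^sup>+y. ennreal (norm (g y)) \<partial>M2)"
    by (simp add: nn_integral_cmult nn_integral_multc)
  also have "\<dots> < \<infinity>"
    using assms by (auto simp: integrable_iff_bounded ennreal_mult_less_top)
  finally show "(\<integral>\<^sup>+p. ennreal (norm (f (fst p) * g (snd p))) \<partial>(M1 \<Otimes>\<^sub>M M2)) < \<infinity>" .
qed

abbreviation (input) chr :: "'a::euclidean_space \<Rightarrow> 'a \<Rightarrow> complex" where
  "chr u \<xi> \<equiv> exp (- \<i> * complex_of_real (u \<bullet> \<xi>))"

lemma norm_chr [simp]: "norm (chr u \<xi>) = 1"
  by simp

lemma fourier_measurable [measurable]:
  assumes [measurable]: "h \<in> borel_measurable borel"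
  shows "fourier_integral h \<in> borel_measurable borel"
proof -
  have "(\<lambda>\<xi>. LINT u|nlborel. h u * chr u \<xi>) \<in> borel_measurable nlborel"
    by measurable
  then show ?thesis by (simp add: fourier_integral_def cong: measurable_cong_sets)
qed

lemma fourier_integrable:
  assumes "integrable nlborel h"
  shows "integrable nlborel (\<lambda>u. h u * chr u \<xi>)"
  by (rule Bochner_Integration.integrable_bound[OF assms])
    (use borel_measurable_integrable[OF assms] in \<open>auto simp: norm_mult\<close>)

lemma fourier_bound:
  assumes "integrable nlborel h"
  shows "norm (fourier_integral h \<xi>) \<le> (LINT u|nlborel. norm (h u))"
proof -
  have "norm (fourier_integral h \<xi>) \<le> (LINT u|nlborel. norm (h u * chr u \<xi>))"
    unfolding fourier_integral_def by (rule integral_norm_bound)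
  then show ?thesis by (simp add: norm_mult)
qed

lemma fourier_diff:
  assumes "integrable nlborel h" "integrable nlborel k"
  shows "fourier_integral (\<lambda>u. h u - k u) \<xi> = fourier_integral h \<xi> - fourier_integral k \<xi>"
  unfolding fourier_integral_def
  using fourier_integrable[OF assms(1), of \<xi>] fourier_integrable[OF assms(2), of \<xi>]
  by (simp add: left_diff_distrib)

lemma fourier_add:
  assumes "integrable nlborel h" "integrable nlborel k"
  shows "fourier_integral (\<lambda>u. h u + k u) \<xi> = fourier_integral h \<xi> + fourier_integral k \<xi>"
  unfolding fourier_integral_def
  using fourier_integrable[OF assms(1), of \<xi>] fourier_integrable[OF assms(2), of \<xi>]
  by (simp add: distrib_right)

lemma fourier_cmult: "fourier_integral (\<lambda>u. c * h u) \<xi> = c * fourier_integral h \<xi>"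
  unfolding fourier_integral_def by (simp add: mult.assoc)

lemma fourier_mult_formula:
  fixes f g :: "'a::euclidean_space \<Rightarrow> complex"
  assumes f: "integrable nlborel f" and g: "integrable nlborel g"
  shows "(LINT \<xi>|nlborel. fourier_integral f \<xi> * g \<xi>) = (LINT u|nlborel. f u * fourier_integral g u)"
proof -
  have [measurable]: "f \<in> borel_measurable borel" "g \<in> borel_measurable borel"
    using f g borel_measurable_integrable by fastforce+
  have int: "integrable (nlborel \<Otimes>\<^sub>M nlborel) (case_prod (\<lambda>u \<xi>. f u * chr u \<xi> * g \<xi>))"
    by (rule Bochner_Integration.integrable_bound[OF nlborel_pair.integrable_mult_pair[OF f g]])
      (auto simp: norm_mult)
  have "(LINT \<xi>|nlborel. fourier_integral f \<xi> * g \<xi>) = (LINT \<xi>|nlborel. LINT u|nlborel. f u * chr u \<xi> * g \<xi>)"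
    by (simp add: fourier_integral_def)
  also have "\<dots> = (LINT u|nlborel. LINT \<xi>|nlborel. f u * chr u \<xi> * g \<xi>)"
    by (rule nlborel_pair.Fubini_integral[OF int])
  also have "\<dots> = (LINT u|nlborel. f u * fourier_integral g u)"
    by (simp add: fourier_integral_def mult.assoc inner_commute[of _ "_::'a"] mult.commute[of "g _"])
  finally show ?thesis .
qed

lemma fourier_cnj:
  "cnj (fourier_integral h \<xi>) = fourier_integral (\<lambda>u. cnj (h u)) (- \<xi>)"
  unfolding fourier_integral_def by (subst Bochner_Integration.integral_cnj[symmetric]) (simp add: exp_cnj)

section \<open>Gaussian kernels and the \<open>L2\<close> bound for Fourier integrals\<close>

definition gauss_kernel :: "real \<Rightarrow> 'a::euclidean_space \<Rightarrow> real" where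
  "gauss_kernel t x = (1 / t) ^ DIM('a) * exp (- (norm (x /\<^sub>R t))\<^sup>2 / 2)"

lemma gauss_kernel_measurable [measurable]: "gauss_kernel t \<in> borel_measurable borel"
  unfolding gauss_kernel_def by measurable

lemma gauss_kernel_nonneg: "t > 0 \<Longrightarrow> gauss_kernel t x \<ge> 0"
  by (simp add: gauss_kernel_def)

lemma gauss_kernel_le: "t > 0 \<Longrightarrow> gauss_kernel t (x::'a::euclidean_space) \<le> (1 / t) ^ DIM('a)"
  unfolding gauss_kernel_def by (rule mult_left_le) auto

lemma gauss_kernel_minus: "gauss_kernel t (- x) = gauss_kernel t x"
  by (simp add: gauss_kernel_def)

lemma gauss_kernel_diff_commute: "gauss_kernel t (x - y) = gauss_kernel t (y - x)"
  using gauss_kernel_minus[of t "x - y"] by simp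

lemma gauss_integral:
  shows "integrable nlborel (\<lambda>x::'a::euclidean_space. exp (- (norm x)\<^sup>2 / 2))"
    and "(LINT x|nlborel. exp (- (norm (x::'a))\<^sup>2 / 2)) = 1"
proof -
  have eq: "exp (complex_of_real (- (norm \<xi>)\<^sup>2 / 2 - \<xi> \<bullet> 0) + \<i> * complex_of_real (\<xi> \<bullet> 0))
      = complex_of_real (exp (- (norm \<xi>)\<^sup>2 / 2))" for \<xi> :: 'a
    by (simp add: exp_of_real[symmetric])
  show "integrable nlborel (\<lambda>x::'a. exp (- (norm x)\<^sup>2 / 2))"
    using integrable_norm[OF gauss_fourier(1)[of "0::'a" 0]] by simp
  have "complex_of_real (LINT x|nlborel. exp (- (norm (x::'a))\<^sup>2 / 2)) = 1"
    using gauss_fourier(2)[of "0::'a" 0] unfolding eq by simp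
  then show "(LINT x|nlborel. exp (- (norm (x::'a))\<^sup>2 / 2)) = 1"
    using of_real_eq_1_iff by blast
qed

text \<open>Identifies \<open>gauss_kernel t\<close> as the transform of a Gaussian of width 1/t: as
  t tends to 0 the damping on one side disappears while the kernel on the other
  concentrates.\<close>

lemma gauss_fourier_scaled:
  fixes x :: "'a::euclidean_space"
  assumes t: "t > 0"
  shows "integrable nlborel (\<lambda>\<xi>. complex_of_real (exp (- (norm (t *\<^sub>R \<xi>))\<^sup>2 / 2)) * exp (\<i> * complex_of_real (\<xi> \<bullet> x)))" (is ?A)
    and "(LINT \<xi>|nlborel. complex_of_real (exp (- (norm (t *\<^sub>R \<xi>))\<^sup>2 / 2)) * exp (\<i> * complex_of_real (\<xi> \<bullet> x)))
      = complex_of_real (gauss_kernel t x)" (is ?B)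
proof -
  let ?g = "\<lambda>\<xi>::'a. exp (complex_of_real (- (norm \<xi>)\<^sup>2 / 2 - \<xi> \<bullet> 0) + \<i> * complex_of_real (\<xi> \<bullet> (x /\<^sub>R t)))"
  have eq: "complex_of_real (exp (- (norm (t *\<^sub>R \<xi>))\<^sup>2 / 2)) * exp (\<i> * complex_of_real (\<xi> \<bullet> x)) = ?g (t *\<^sub>R \<xi>)" for \<xi>
    using t by (simp add: exp_of_real[symmetric] exp_add[symmetric] field_simps)
  have i: "integrable lborel ?g"
    using gauss_fourier(1)[of 0 "x /\<^sub>R t"] by (simp add: integrable_nlborel_iff)
  show ?A unfolding eq integrable_nlborel_iff using integral_lborel_scale(1)[OF i, of t] t by simp
  have "(LINT \<xi>|nlborel. ?g \<xi>) = complex_of_real (t ^ DIM('a)) * (LINT \<xi>|nlborel. ?g (t *\<^sub>R \<xi>))"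
    unfolding integral_nlborel using integral_lborel_scale(2)[OF i, of t] t
    by (simp add: scaleR_conv_of_real)
  moreover have "(LINT \<xi>|nlborel. ?g \<xi>) = complex_of_real (exp (- (norm (x /\<^sub>R t))\<^sup>2 / 2))"
    by (subst gauss_fourier(2)) (simp add: exp_of_real[symmetric])
  ultimately show ?B unfolding eq gauss_kernel_def using t
    by (simp add: field_simps)
qed

lemma nn_integral_gauss_kernel:
  fixes y :: "'a::euclidean_space"
  assumes t: "t > 0"
  shows "(\<integral>\<^sup>+x. ennreal (gauss_kernel t (x - y)) \<partial>nlborel) = 1"
proof -
  have "(\<integral>\<^sup>+x. ennreal (gauss_kernel t (x - y)) \<partial>nlborel) = (\<integral>\<^sup>+x. ennreal (gauss_kernel t (x::'a)) \<partial>nlborel)"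
    using nn_integral_lborel_plus[of "\<lambda>x. ennreal (gauss_kernel t x)" "- y"]
    by (simp add: nn_integral_nlborel)
  also have "\<dots> = ennreal (t ^ DIM('a)) * (\<integral>\<^sup>+x. ennreal (gauss_kernel t (t *\<^sub>R (x::'a))) \<partial>nlborel)"
    using nn_integral_lborel_scale[of "\<lambda>x::'a. ennreal (gauss_kernel t x)" t] t
    by (simp add: nn_integral_nlborel mult_ac)
  also have "\<dots> = (\<integral>\<^sup>+x. ennreal (exp (- (norm (x::'a))\<^sup>2 / 2)) \<partial>nlborel)"
    using t by (subst nn_integral_cmult[symmetric])
      (auto simp: gauss_kernel_def ennreal_mult'[symmetric] power_divide)
  also have "\<dots> = 1"
    using gauss_integral[where 'a='a] by (subst nn_integral_eq_integral) auto
  finally show ?thesis .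
qed

text \<open>Damping \<open>\<bar>h^\<bar>\<^sup>2\<close> by a Gaussian turns its integral into a Gaussian average of \<open>h(u) h(y)\<close>,
  which is at most \<open>\<parallel>h\<parallel>\<^sup>2\<close> by the inequality between the arithmetic and the geometric mean.\<close>

lemma fourier_damped_le:
  fixes h :: "'a::euclidean_space \<Rightarrow> complex"
  assumes h: "integrable nlborel h" and t: "t > 0"
  shows "(\<integral>\<^sup>+\<xi>. ennreal ((norm (fourier_integral h \<xi>))\<^sup>2 * exp (- (norm (t *\<^sub>R \<xi>))\<^sup>2 / 2)) \<partial>nlborel)
    \<le> (\<integral>\<^sup>+u. ennreal ((norm (h u))\<^sup>2) \<partial>nlborel)"
proof -
  have [measurable]: "h \<in> borel_measurable borel"
    using h borel_measurable_integrable by fastforce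
  define G where "G \<xi> = complex_of_real (exp (- (norm (t *\<^sub>R \<xi>))\<^sup>2 / 2))" for \<xi> :: 'a
  have G_meas[measurable]: "G \<in> borel_measurable borel" unfolding G_def by measurable
  have Gi: "integrable nlborel (\<lambda>\<xi>. G \<xi> * exp (\<i> * complex_of_real (\<xi> \<bullet> x)))" for x
    using gauss_fourier_scaled(1)[OF t, of x] by (simp add: G_def)
  have FG: "fourier_integral (\<lambda>\<xi>. G \<xi> * exp (\<i> * complex_of_real (\<xi> \<bullet> u))) y = complex_of_real (gauss_kernel t (u - y))" for u y
  proof -
    have "fourier_integral (\<lambda>\<xi>. G \<xi> * exp (\<i> * complex_of_real (\<xi> \<bullet> u))) y
        = (LINT \<xi>|nlborel. G \<xi> * exp (\<i> * complex_of_real (\<xi> \<bullet> (u - y))))"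
      unfolding fourier_integral_def
      by (intro Bochner_Integration.integral_cong) (auto simp: mult.assoc exp_add[symmetric] inner_diff_right algebra_simps)
    then show ?thesis using gauss_fourier_scaled(2)[OF t, of "u - y"] by (simp add: G_def)
  qed
  define B where "B = (LINT u|nlborel. norm (h u))"
  \<comment> \<open>The damped square integral is the integral of the transform of h against k. The
    multiplication formula moves the transform to k, where it becomes the Gaussian average of the
    conjugate of h.\<close>
  define k where "k \<xi> = cnj (fourier_integral h \<xi>) * G \<xi>" for \<xi>
  have k: "integrable nlborel k"
  proof (rule Bochner_Integration.integrable_bound)
    show "integrable nlborel (\<lambda>\<xi>. B *\<^sub>R G \<xi>)" using Gi[of 0] by simp
    show "AE \<xi> in nlborel. norm (k \<xi>) \<le> norm (B *\<^sub>R G \<xi>)"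
      using fourier_bound[OF h] by (auto simp: k_def norm_mult B_def intro!: mult_right_mono order_trans[OF fourier_bound[OF h]])
    show "k \<in> borel_measurable nlborel"
      unfolding k_def fourier_cnj by measurable
  qed
  have Fk: "fourier_integral k u = (LINT y|nlborel. cnj (h y) * complex_of_real (gauss_kernel t (u - y)))" for u
  proof -
    have "fourier_integral k u = cnj (LINT \<xi>|nlborel. fourier_integral h \<xi> * (G \<xi> * exp (\<i> * complex_of_real (\<xi> \<bullet> u))))"
      unfolding fourier_integral_def[of k] Bochner_Integration.integral_cnj[symmetric] 
      by (intro Bochner_Integration.integral_cong) (auto simp: k_def G_def exp_cnj)
    also have "\<dots> = cnj (LINT y|nlborel. h y * complex_of_real (gauss_kernel t (u - y)))"
      by (subst fourier_mult_formula[OF h Gi]) (simp add: FG)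
    finally show ?thesis by (simp add: Bochner_Integration.integral_cnj[symmetric])
  qed
  have i: "integrable nlborel (\<lambda>\<xi>. fourier_integral h \<xi> * k \<xi>)"
  proof (rule Bochner_Integration.integrable_bound)
    show "integrable nlborel (\<lambda>\<xi>. B *\<^sub>R k \<xi>)" using k by simp
    show "AE \<xi> in nlborel. norm (fourier_integral h \<xi> * k \<xi>) \<le> norm (B *\<^sub>R k \<xi>)"
      by (auto simp: norm_mult B_def intro!: mult_right_mono order_trans[OF fourier_bound[OF h]])
  qed (use borel_measurable_integrable[OF k] in measurable)
  have eq: "fourier_integral h \<xi> * k \<xi> = complex_of_real ((norm (fourier_integral h \<xi>))\<^sup>2 * exp (- (norm (t *\<^sub>R \<xi>))\<^sup>2 / 2))" for \<xi>
    unfolding k_def G_def mult.assoc[symmetric] complex_norm_square[symmetric] by simp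
  have "(\<integral>\<^sup>+\<xi>. ennreal ((norm (fourier_integral h \<xi>))\<^sup>2 * exp (- (norm (t *\<^sub>R \<xi>))\<^sup>2 / 2)) \<partial>nlborel)
      = ennreal (LINT \<xi>|nlborel. (norm (fourier_integral h \<xi>))\<^sup>2 * exp (- (norm (t *\<^sub>R \<xi>))\<^sup>2 / 2))"
    using i unfolding eq by (intro nn_integral_eq_integral) (auto simp: complex_of_real_integrable_eq simp del: of_real_mult)
  also have "\<dots> \<le> ennreal (norm (LINT \<xi>|nlborel. fourier_integral h \<xi> * k \<xi>))"
    unfolding eq integral_complex_of_real norm_of_real by (intro ennreal_leI) simp
  also have "(LINT \<xi>|nlborel. fourier_integral h \<xi> * k \<xi>) = (LINT u|nlborel. h u * fourier_integral k u)"
    by (rule fourier_mult_formula[OF h k])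
  also have "ennreal (norm \<dots>) \<le> (\<integral>\<^sup>+u. ennreal (norm (h u * fourier_integral k u)) \<partial>nlborel)"
    by (rule norm_LINT_le)
  also have "\<dots> \<le> (\<integral>\<^sup>+u. \<integral>\<^sup>+y. (ennreal ((norm (h u))\<^sup>2 / 2) + ennreal ((norm (h y))\<^sup>2 / 2)) * ennreal (gauss_kernel t (u - y)) \<partial>nlborel \<partial>nlborel)"
  proof (rule nn_integral_mono)
    fix u
    have "ennreal (norm (h u * fourier_integral k u)) \<le> ennreal (norm (h u)) * (\<integral>\<^sup>+y. ennreal (norm (cnj (h y) * complex_of_real (gauss_kernel t (u - y)))) \<partial>nlborel)"
      unfolding norm_mult[of "h u"] ennreal_mult''[OF norm_ge_zero] Fk
      by (intro mult_left_mono norm_LINT_le zero_le)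
    also have "\<dots> = (\<integral>\<^sup>+y. ennreal (norm (h u) * norm (h y) * gauss_kernel t (u - y)) \<partial>nlborel)"
      using gauss_kernel_nonneg[OF t]
      by (subst nn_integral_cmult[symmetric]) (auto simp: norm_mult ennreal_mult' mult.assoc abs_of_nonneg[OF gauss_kernel_nonneg[OF t]])
    also have "\<dots> \<le> (\<integral>\<^sup>+y. (ennreal ((norm (h u))\<^sup>2 / 2) + ennreal ((norm (h y))\<^sup>2 / 2)) * ennreal (gauss_kernel t (u - y)) \<partial>nlborel)"
    proof (rule nn_integral_mono)
      fix y
      have "norm (h u) * norm (h y) * gauss_kernel t (u - y) \<le> ((norm (h u))\<^sup>2 / 2 + (norm (h y))\<^sup>2 / 2) * gauss_kernel t (u - y)"
        using sum_squares_bound[of "norm (h u)" "norm (h y)"]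
        by (intro mult_right_mono gauss_kernel_nonneg[OF t]) simp
      then show "ennreal (norm (h u) * norm (h y) * gauss_kernel t (u - y)) \<le>
          (ennreal ((norm (h u))\<^sup>2 / 2) + ennreal ((norm (h y))\<^sup>2 / 2)) * ennreal (gauss_kernel t (u - y))"
        using gauss_kernel_nonneg[OF t, of "u - y"]
        by (simp flip: ennreal_plus ennreal_mult add: ennreal_leI)
    qed
    finally show "ennreal (norm (h u * fourier_integral k u)) \<le> \<dots>" .
  qed
  also have "\<dots> = (\<integral>\<^sup>+u. \<integral>\<^sup>+y. ennreal ((norm (h u))\<^sup>2 / 2) * ennreal (gauss_kernel t (y - u)) \<partial>nlborel \<partial>nlborel)
      + (\<integral>\<^sup>+u. \<integral>\<^sup>+y. ennreal ((norm (h y))\<^sup>2 / 2) * ennreal (gauss_kernel t (u - y)) \<partial>nlborel \<partial>nlborel)"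
    by (simp add: distrib_right nn_integral_add gauss_kernel_diff_commute[of t])
  also have "(\<integral>\<^sup>+u. \<integral>\<^sup>+y. ennreal ((norm (h y))\<^sup>2 / 2) * ennreal (gauss_kernel t (u - y)) \<partial>nlborel \<partial>nlborel)
      = (\<integral>\<^sup>+y. \<integral>\<^sup>+u. ennreal ((norm (h y))\<^sup>2 / 2) * ennreal (gauss_kernel t (u - y)) \<partial>nlborel \<partial>nlborel)"
    by (rule nlborel_pair.Fubini') measurable
  also have "(\<integral>\<^sup>+u. \<integral>\<^sup>+y. ennreal ((norm (h u))\<^sup>2 / 2) * ennreal (gauss_kernel t (y - u)) \<partial>nlborel \<partial>nlborel)
      + \<dots> = (\<integral>\<^sup>+u. ennreal ((norm (h u))\<^sup>2 / 2) \<partial>nlborel) + (\<integral>\<^sup>+u. ennreal ((norm (h u))\<^sup>2 / 2) \<partial>nlborel)"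
    by (simp add: nn_integral_cmult nn_integral_gauss_kernel[OF t])
  also have "\<dots> = (\<integral>\<^sup>+u. ennreal ((norm (h u))\<^sup>2) \<partial>nlborel)"
    by (subst nn_integral_add[symmetric]) (auto simp flip: ennreal_plus)
  finally show ?thesis .
qed

text \<open>Fatou's lemma removes the damping along t = 1/(k + 1), since
  \<open>fourier_damped_le\<close> is uniform in t.\<close>

lemma fourier_contraction:
  fixes h :: "'a::euclidean_space \<Rightarrow> complex"
  assumes h: "integrable nlborel h"
  shows "(\<integral>\<^sup>+\<xi>. ennreal ((norm (fourier_integral h \<xi>))\<^sup>2) \<partial>nlborel) \<le> (\<integral>\<^sup>+u. ennreal ((norm (h u))\<^sup>2) \<partial>nlborel)"
proof -
  have [measurable]: "h \<in> borel_measurable borel"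
    using h borel_measurable_integrable by fastforce
  let ?g = "\<lambda>k \<xi>. ennreal ((norm (fourier_integral h \<xi>))\<^sup>2 * exp (- (norm ((1 / Suc k) *\<^sub>R \<xi>))\<^sup>2 / 2))"
  have "(\<integral>\<^sup>+\<xi>. ennreal ((norm (fourier_integral h \<xi>))\<^sup>2) \<partial>nlborel) = (\<integral>\<^sup>+\<xi>. liminf (\<lambda>k. ?g k \<xi>) \<partial>nlborel)"
  proof (rule nn_integral_cong)
    fix \<xi> :: 'a
    have "(\<lambda>k. 1 / real (Suc k)) \<longlonglongrightarrow> 0" using LIMSEQ_inverse_real_of_nat by (simp add: inverse_eq_divide)
    then have "(\<lambda>k. (norm (fourier_integral h \<xi>))\<^sup>2 * exp (- (norm ((1 / real (Suc k)) *\<^sub>R \<xi>))\<^sup>2 / 2))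
        \<longlonglongrightarrow> (norm (fourier_integral h \<xi>))\<^sup>2 * exp (- (norm (0 *\<^sub>R \<xi>))\<^sup>2 / 2)"
      by (intro tendsto_intros) simp_all
    then have "(\<lambda>k. ?g k \<xi>) \<longlonglongrightarrow> ennreal ((norm (fourier_integral h \<xi>))\<^sup>2)"
      by (intro tendsto_ennrealI) simp
    from lim_imp_Liminf[OF _ this] show "ennreal ((norm (fourier_integral h \<xi>))\<^sup>2) = liminf (\<lambda>k. ?g k \<xi>)"
      by simp
  qed
  also have "\<dots> \<le> liminf (\<lambda>k. \<integral>\<^sup>+\<xi>. ?g k \<xi> \<partial>nlborel)"
    by (intro nn_integral_liminf) measurable
  also have "\<dots> \<le> limsup (\<lambda>k. \<integral>\<^sup>+\<xi>. ?g k \<xi> \<partial>nlborel)"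
    by (rule Liminf_le_Limsup) simp
  also have "\<dots> \<le> (\<integral>\<^sup>+u. ennreal ((norm (h u))\<^sup>2) \<partial>nlborel)"
    by (intro Limsup_bounded always_eventually allI fourier_damped_le[OF h]) auto
  finally show ?thesis .
qed

lemma fourier_L2:
  assumes "integrable nlborel h" "h \<in> L2 nlborel"
  shows "fourier_integral h \<in> L2 nlborel"
  using fourier_contraction[OF assms(1)] assms L2_measurable[of h nlborel]
  by (auto simp: L2_iff cong: measurable_cong_sets intro: order.strict_trans1 fourier_measurable)

section \<open>Uniqueness of Fourier integrals\<close>

lemma AE_zero_if_box_integrals_zero_real:
  fixes w :: "'a::euclidean_space \<Rightarrow> real"
  assumes w: "integrable lborel w"
    and box: "\<And>l u. (LINT x|lborel. indicator (box l u) x * w x) = 0"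
  shows "AE x in lborel. w x = 0"
proof -
  have [measurable]: "w \<in> borel_measurable borel" using w by auto
  \<comment> \<open>These are the densities of the positive and of the negative part of w. They are
    finite measures that agree on boxes, a generator stable under intersection, hence they are
    equal.\<close>
  let ?M = "density lborel (\<lambda>x. ennreal (w x))" and ?N = "density lborel (\<lambda>x. ennreal (- w x))"
  have fin: "(\<integral>\<^sup>+x. ennreal (w x) \<partial>lborel) \<noteq> \<infinity>" "(\<integral>\<^sup>+x. ennreal (- w x) \<partial>lborel) \<noteq> \<infinity>"
    using w by (auto simp: real_integrable_def)
  have eq: "emeasure ?M (box l u) = emeasure ?N (box l u)" for l u
  proof -
    have i: "integrable lborel (\<lambda>x. indicator (box l u) x * w x)"
      using integrable_real_mult_indicator[of "box l u" lborel w] w by (simp add: mult.commute)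
    have M: "emeasure ?M (box l u) = (\<integral>\<^sup>+x. ennreal (indicator (box l u) x * w x) \<partial>lborel)"
      by (subst emeasure_density) (auto intro!: nn_integral_cong split: split_indicator)
    have N: "emeasure ?N (box l u) = (\<integral>\<^sup>+x. ennreal (- (indicator (box l u) x * w x)) \<partial>lborel)"
      by (subst emeasure_density) (auto intro!: nn_integral_cong split: split_indicator)
    have "enn2real (\<integral>\<^sup>+x. ennreal (indicator (box l u) x * w x) \<partial>lborel)
        = enn2real (\<integral>\<^sup>+x. ennreal (- (indicator (box l u) x * w x)) \<partial>lborel)"
      using box[of l u] i by (simp add: real_lebesgue_integral_def)
    moreover have "(\<integral>\<^sup>+x. ennreal (indicator (box l u) x * w x) \<partial>lborel) < \<infinity>"
      "(\<integral>\<^sup>+x. ennreal (- (indicator (box l u) x * w x)) \<partial>lborel) < \<infinity>"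
      using i by (auto simp: real_integrable_def less_top)
    ultimately show ?thesis unfolding M N
      by (metis ennreal_enn2real infinity_ennreal_def)
  qed
  have "?M = ?N"
  proof (rule measure_eqI_generator_eq)
    show "Int_stable (range (\<lambda>(a, b). box a b :: 'a set))"
      by (auto simp: Int_stable_def box_Int_box)
    show "range (\<lambda>(a, b). box a b) \<subseteq> Pow (UNIV :: 'a set)" by auto
    show "range (\<lambda>n::nat. box (- real n *\<^sub>R One) (real n *\<^sub>R One)) \<subseteq> range (\<lambda>(a, b). box a b :: 'a set)" by auto
    show "(\<Union>n::nat. box (- real n *\<^sub>R One) (real n *\<^sub>R One)) = (UNIV :: 'a set)"
      using UN_box_eq_UNIV[where 'a='a] by simp
    show "emeasure ?M (box (- real n *\<^sub>R One) (real n *\<^sub>R One)) \<noteq> \<infinity>" for n :: nat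
    proof -
      have "emeasure ?M (box (- real n *\<^sub>R One) (real n *\<^sub>R One)) \<le> emeasure ?M UNIV"
        by (rule emeasure_mono) auto
      also have "\<dots> = (\<integral>\<^sup>+x. ennreal (w x) \<partial>lborel)" by (subst emeasure_density) auto
      finally show ?thesis using fin(1) by (auto simp: top_unique)
    qed
  qed (auto simp: eq borel_eq_box)
  then have "AE x in lborel. ennreal (w x) = ennreal (- w x)"
    by (subst (asm) finite_density_unique) (use fin in auto)
  then show ?thesis
  proof eventually_elim
    case (elim x)
    then show ?case
      by (cases "w x \<ge> 0") (auto simp: ennreal_neg ennreal_eq_0_iff)
  qed
qed

lemma AE_zero_if_box_integrals_zero:
  fixes w :: "'a::euclidean_space \<Rightarrow> complex"
  assumes w: "integrable lborel w"
    and box: "\<And>l u. (LINT x|lborel. indicator (box l u) x *\<^sub>R w x) = 0"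
  shows "AE x in lborel. w x = 0"
proof -
  have i: "integrable lborel (\<lambda>x. indicator (box l u) x *\<^sub>R w x)" for l u
    using w by (intro integrable_mult_indicator) auto
  have "AE x in lborel. Re (w x) = 0"
  proof (rule AE_zero_if_box_integrals_zero_real)
    show "(LINT x|lborel. indicator (box l u) x * Re (w x)) = 0" for l u
      using arg_cong[OF box[of l u], of Re] i[of l u] by (simp flip: integral_Re)
  qed (use w in auto)
  moreover have "AE x in lborel. Im (w x) = 0"
  proof (rule AE_zero_if_box_integrals_zero_real)
    show "(LINT x|lborel. indicator (box l u) x * Im (w x)) = 0" for l u
      using arg_cong[OF box[of l u], of Im] i[of l u] by (simp flip: integral_Im)
  qed (use w in auto)
  ultimately show ?thesis by eventually_elim (simp add: complex_eq_iff)
qed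

text \<open>All Gaussian mollifications of w vanish by the multiplication formula. Integrated over a
  box and with the width sent to 0 they give vanishing box integrals of w itself.\<close>

lemma fourier_uniqueness:
  fixes w :: "'a::euclidean_space \<Rightarrow> complex"
  assumes w: "integrable nlborel w" and zero: "\<And>b. fourier_integral w b = 0"
  shows "AE x in nlborel. w x = 0"
proof -
  have w': "integrable lborel w" using w by (simp add: integrable_nlborel_iff)
  have [measurable]: "w \<in> borel_measurable borel" using w' by auto
  define \<gamma> where "\<gamma> x = exp (- (norm x)\<^sup>2 / 2)" for x :: 'a
  have \<gamma>_meas[measurable]: "\<gamma> \<in> borel_measurable borel" unfolding \<gamma>_def by measurable
  have \<gamma>i: "integrable lborel (\<lambda>z. complex_of_real (\<gamma> z))"
    using gauss_integral(1)[where 'a='a] by (simp add: \<gamma>_def integrable_nlborel_iff)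
  \<comment> \<open>g is the modulated Gaussian whose transform is the kernel centred at c; the
    substitution \<xi> = c - t z then frees the weight \<gamma> from t.\<close>
  have conv0: "(LINT z|lborel. w (c - t *\<^sub>R z) * complex_of_real (\<gamma> z)) = 0" if t: "t > 0" for t c
  proof -
    define g where "g b = complex_of_real (exp (- (norm (t *\<^sub>R b))\<^sup>2 / 2)) * exp (\<i> * complex_of_real (b \<bullet> c))" for b :: 'a
    have gi: "integrable nlborel g" unfolding g_def by (rule gauss_fourier_scaled(1)[OF t])
    have Fg: "fourier_integral g \<xi> = complex_of_real (gauss_kernel t (c - \<xi>))" for \<xi>
    proof -
      have "fourier_integral g \<xi> = (LINT b|nlborel. complex_of_real (exp (- (norm (t *\<^sub>R b))\<^sup>2 / 2)) * exp (\<i> * complex_of_real (b \<bullet> (c - \<xi>))))"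
        unfolding fourier_integral_def g_def
        by (intro Bochner_Integration.integral_cong) (auto simp: mult.assoc exp_add[symmetric] inner_diff_right algebra_simps)
      then show ?thesis using gauss_fourier_scaled(2)[OF t, of "c - \<xi>"] by simp
    qed
    have "(LINT \<xi>|nlborel. w \<xi> * complex_of_real (gauss_kernel t (c - \<xi>))) = 0"
      using fourier_mult_formula[OF w gi] zero by (simp add: Fg)
    then have 0: "(LINT \<xi>|lborel. w \<xi> * complex_of_real (gauss_kernel t (c - \<xi>))) = 0"
      by (simp add: integral_nlborel less_imp_neq[OF nl_const_pos, symmetric])
    have i: "integrable lborel (\<lambda>\<xi>. w \<xi> * complex_of_real (gauss_kernel t (c - \<xi>)))"
    proof (rule Bochner_Integration.integrable_bound)
      show "integrable lborel (\<lambda>\<xi>. ((1/t) ^ DIM('a)) *\<^sub>R w \<xi>)" using w' by simp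
      show "AE \<xi> in lborel. norm (w \<xi> * complex_of_real (gauss_kernel t (c - \<xi>))) \<le> norm (((1/t) ^ DIM('a)) *\<^sub>R w \<xi>)"
      proof (intro always_eventually allI)
        fix \<xi>
        have "norm (w \<xi>) * gauss_kernel t (c - \<xi>) \<le> norm (w \<xi>) * (1/t) ^ DIM('a)"
          by (intro mult_left_mono gauss_kernel_le t) simp
        then show "norm (w \<xi> * complex_of_real (gauss_kernel t (c - \<xi>))) \<le> norm (((1/t) ^ DIM('a)) *\<^sub>R w \<xi>)"
          using t gauss_kernel_nonneg[OF t, of "c - \<xi>"] by (simp add: norm_mult norm_power norm_divide mult.commute)
      qed
    qed measurable
    let ?F = "\<lambda>\<xi>. w \<xi> * complex_of_real (gauss_kernel t (c - \<xi>))"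
    have i2: "integrable lborel (\<lambda>\<xi>. ?F (\<xi> + c))" using integrable_lborel_plus_iff(1)[of ?F c] i by simp
    have "(LINT \<xi>|lborel. ?F (\<xi> + c)) = 0" using integrable_lborel_plus_iff(2)[of ?F c] 0 by simp
    then have "(LINT z|lborel. ?F ((- t) *\<^sub>R z + c)) = 0"
      using integral_lborel_scale(2)[OF i2, of "- t"] t by simp
    moreover have "?F ((- t) *\<^sub>R z + c) = ((1/t) ^ DIM('a)) *\<^sub>R (w (c - t *\<^sub>R z) * complex_of_real (\<gamma> z))" for z
      using t by (simp add: gauss_kernel_def \<gamma>_def scaleR_conv_of_real mult_ac)
    ultimately show ?thesis using t by simp
  qed
  have "(LINT x|lborel. indicator (box l u) x *\<^sub>R w x) = 0" for l u
  proof -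
    let ?A = "box l u"
    define t where "t k = 1 / real (Suc k)" for k
    have t: "t k > 0" for k by (simp add: t_def)
    have tlim: "t \<longlonglongrightarrow> 0" unfolding t_def using LIMSEQ_inverse_real_of_nat by (simp add: inverse_eq_divide)
    \<comment> \<open>The dilation t k acts inside the indicator and leaves w alone, so pointwise
      convergence needs no continuity of w. It fails only on the boundary of the box, a null
      set.\<close>
    let ?f = "\<lambda>k p. indicator ?A (fst p + t k *\<^sub>R snd p) *\<^sub>R (w (fst p) * complex_of_real (\<gamma> (snd p)))"
    have wg: "integrable (lborel \<Otimes>\<^sub>M lborel) (\<lambda>p. w (fst p) * complex_of_real (\<gamma> (snd p)))"
      by (rule lborel_pair.integrable_mult_pair[OF w' \<gamma>i])
    have lim: "(\<lambda>k. integral\<^sup>L (lborel \<Otimes>\<^sub>M lborel) (?f k)) \<longlonglongrightarrow>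
        integral\<^sup>L (lborel \<Otimes>\<^sub>M lborel) (\<lambda>p. indicator ?A (fst p) *\<^sub>R (w (fst p) * complex_of_real (\<gamma> (snd p))))"
    proof (rule integral_dominated_convergence[OF _ _ wg[THEN integrable_norm]])
      have "cbox l u - ?A \<in> null_sets lborel"
        using negligible_frontier_interval[of l u]
        by (simp add: negligible_iff_null_sets null_sets_completion_iff)
      then have "AE x in lborel. x \<notin> cbox l u - ?A" by (rule AE_not_in)
      then have "AE x in lborel. AE z in (lborel :: 'a measure). fst (x, z) \<notin> cbox l u - ?A"
        by eventually_elim simp
      then have "AE p in lborel \<Otimes>\<^sub>M (lborel :: 'a measure). fst p \<notin> cbox l u - ?A"
        by (rule lborel_pair.AE_pair_measure[rotated]) measurable
      then show "AE p in lborel \<Otimes>\<^sub>M lborel. (\<lambda>k. ?f k p) \<longlonglongrightarrow> indicator ?A (fst p) *\<^sub>R (w (fst p) * complex_of_real (\<gamma> (snd p)))"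
      proof eventually_elim
        case (elim p)
        have lim: "(\<lambda>k. fst p + t k *\<^sub>R snd p) \<longlonglongrightarrow> fst p + 0 *\<^sub>R snd p"
          by (intro tendsto_intros tlim)
        have "\<forall>\<^sub>F k in sequentially. indicator ?A (fst p + t k *\<^sub>R snd p) = (indicator ?A (fst p) :: real)"
        proof (cases "fst p \<in> ?A")
          case True
          have "\<forall>\<^sub>F k in sequentially. fst p + t k *\<^sub>R snd p \<in> ?A"
            by (rule topological_tendstoD[OF lim]) (use True in auto)
          then show ?thesis by eventually_elim (use True in auto)
        next
          case False
          with elim have "fst p \<in> - cbox l u" by auto
          have "\<forall>\<^sub>F k in sequentially. fst p + t k *\<^sub>R snd p \<in> - cbox l u"
            by (rule topological_tendstoD[OF lim]) (use \<open>fst p \<in> - cbox l u\<close> in \<open>auto simp: closed_cbox open_Compl\<close>)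
          then show ?thesis
            by eventually_elim (use False box_subset_cbox[of l u] in \<open>auto split: split_indicator\<close>)
        qed
        then show ?case
          by (intro tendsto_eventually) (auto elim!: eventually_mono)
      qed
      show "AE p in lborel \<Otimes>\<^sub>M lborel. norm (?f k p) \<le> norm (w (fst p) * complex_of_real (\<gamma> (snd p)))" for k
        by (auto split: split_indicator)
    qed measurable
    have "integral\<^sup>L (lborel \<Otimes>\<^sub>M lborel) (?f k) = 0" for k
    proof -
      have i: "integrable (lborel \<Otimes>\<^sub>M lborel) (\<lambda>p. ?f k p)"
        by (rule Bochner_Integration.integrable_bound[OF wg]) (auto split: split_indicator)
      have "integral\<^sup>L (lborel \<Otimes>\<^sub>M lborel) (?f k) = (LINT z|lborel. (LINT x|lborel. ?f k (x, z)))"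
        using lborel_pair.integral_snd[of "\<lambda>x z. ?f k (x, z)"] i by (simp add: case_prod_beta')
      also have "\<dots> = (LINT z|lborel. (LINT c|lborel. indicator ?A c *\<^sub>R (w (c - t k *\<^sub>R z) * complex_of_real (\<gamma> z))))"
      proof (rule Bochner_Integration.integral_cong[OF refl])
        fix z :: 'a
        show "(LINT x|lborel. ?f k (x, z)) = (LINT c|lborel. indicator ?A c *\<^sub>R (w (c - t k *\<^sub>R z) * complex_of_real (\<gamma> z)))"
          using integrable_lborel_plus_iff(2)[of "\<lambda>c. indicator ?A c *\<^sub>R (w (c - t k *\<^sub>R z) * complex_of_real (\<gamma> z))" "t k *\<^sub>R z"]
          by simp
      qed
      also have "\<dots> = (LINT c|lborel. (LINT z|lborel. indicator ?A c *\<^sub>R (w (c - t k *\<^sub>R z) * complex_of_real (\<gamma> z))))"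
      \<comment> \<open>The shear (x, z) to (x + t z, z) carries this integrand to
        \<open>?f k\<close>, whose integrability is already known.\<close>
      proof (rule lborel_pair.Fubini_integral)
        show "integrable (lborel \<Otimes>\<^sub>M lborel) (\<lambda>(c, z). indicator ?A c *\<^sub>R (w (c - t k *\<^sub>R z) * complex_of_real (\<gamma> z)))"
          using preserves_integral(1)[OF preserves_shear1[of "t k"], of "\<lambda>(c, z). indicator ?A c *\<^sub>R (w (c - t k *\<^sub>R z) * complex_of_real (\<gamma> z))"] i
          by (simp add: lborel_prod case_prod_beta' borel_prod[symmetric])
      qed
      also have "\<dots> = 0" using conv0[OF t] by simp
      finally show ?thesis .
    qed
    with lim have "(\<lambda>k::nat. 0) \<longlonglongrightarrow> integral\<^sup>L (lborel \<Otimes>\<^sub>M lborel) (\<lambda>p. indicator ?A (fst p) *\<^sub>R (w (fst p) * complex_of_real (\<gamma> (snd p))))"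
      by simp
    then have "integral\<^sup>L (lborel \<Otimes>\<^sub>M lborel) (\<lambda>p. indicator ?A (fst p) *\<^sub>R (w (fst p) * complex_of_real (\<gamma> (snd p)))) = 0"
      by (rule LIMSEQ_unique) (rule tendsto_const)
    moreover have "integral\<^sup>L (lborel \<Otimes>\<^sub>M lborel) (\<lambda>p. (indicator ?A (fst p) *\<^sub>R w (fst p)) * complex_of_real (\<gamma> (snd p)))
        = (LINT x|lborel. indicator ?A x *\<^sub>R w x) * (LINT z|lborel. complex_of_real (\<gamma> z))"
    proof -
      have iA: "integrable lborel (\<lambda>x. indicator ?A x *\<^sub>R w x)" using w' by (intro integrable_mult_indicator) auto
      show ?thesis
        using lborel_pair.integral_fst[of "\<lambda>x z. (indicator ?A x *\<^sub>R w x) * complex_of_real (\<gamma> z)"]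
           lborel_pair.integrable_mult_pair[OF iA \<gamma>i]
        by (simp add: case_prod_beta' del: mult_scaleR_left)
    qed
    moreover have "(LINT z|lborel. complex_of_real (\<gamma> z)) \<noteq> 0"
      using gauss_integral(2)[where 'a='a] by (auto simp: integral_nlborel \<gamma>_def)
    ultimately show ?thesis by (simp del: mult_scaleR_left mult_eq_0_iff add: mult_scaleR_left[symmetric])
  qed
  with w' have "AE x in lborel. w x = 0" by (rule AE_zero_if_box_integrals_zero)
  then show ?thesis by (simp add: AE_nlborel_iff)
qed

section \<open>The Plancherel theorem\<close>

abbreviation (input) sqint :: "'a::euclidean_space measure \<Rightarrow> ('a \<Rightarrow> complex) \<Rightarrow> ennreal" where
  "sqint M f \<equiv> \<integral>\<^sup>+x. ennreal ((norm (f x))\<^sup>2) \<partial>M"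

text \<open>The predicate under the choice operator in \<open>fourier_plancherel\<close>. As a
  relation it is stable under linear combinations, limits of test integrals and changes on null
  sets.\<close>

definition plancherel_rel :: "('a::euclidean_space \<Rightarrow> complex) \<Rightarrow> ('a \<Rightarrow> complex) \<Rightarrow> bool" where
  "plancherel_rel h g \<longleftrightarrow> g \<in> L2 nlborel \<and>
     (\<exists>hs. (\<forall>k. hs k \<in> L2 nlborel \<and> integrable nlborel (hs k)) \<and>
        L2_tendsto nlborel hs h \<and> L2_tendsto nlborel (\<lambda>k. fourier_integral (hs k)) g)"

lemma L2_nlborel_measurable: "f \<in> L2 nlborel \<Longrightarrow> f \<in> borel_measurable borel"
  using L2_measurable[of f nlborel] by (simp cong: measurable_cong_sets)

lemma sqint_triangle:
  assumes [measurable]: "f \<in> borel_measurable borel" "g \<in> borel_measurable borel" "h \<in> borel_measurable borel"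
  shows "sqint nlborel (\<lambda>x. f x - h x) \<le> 2 * sqint nlborel (\<lambda>x. f x - g x) + 2 * sqint nlborel (\<lambda>x. g x - h x)"
  using nn_integral_norm_add_sq_le[of "\<lambda>x. f x - g x" nlborel "\<lambda>x. g x - h x"] by simp

lemma sqint_diff_commute: "sqint M (\<lambda>x. f x - g x) = sqint M (\<lambda>x. g x - f x)"
  by (simp add: norm_minus_commute)

lemma sqint_zero_AE:
  assumes "f \<in> borel_measurable borel" "sqint nlborel f = 0"
  shows "AE x in nlborel. f x = 0"
  using assms by (subst (asm) nn_integral_0_iff_AE) (auto)

lemma ennreal_squeeze0:
  fixes f g :: "nat \<Rightarrow> ennreal"
  assumes "\<And>k. f k \<le> g k" "g \<longlonglongrightarrow> 0"
  shows "f \<longlonglongrightarrow> 0"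
  by (rule tendsto_sandwich[OF _ _ tendsto_const assms(2)]) (auto simp: assms(1))

lemma ennreal_tendsto_lin0:
  fixes f g :: "nat \<Rightarrow> ennreal"
  assumes "f \<longlonglongrightarrow> 0" "g \<longlonglongrightarrow> 0"
  shows "(\<lambda>k. 2 * f k + 2 * g k) \<longlonglongrightarrow> 0"
proof -
  have "(\<lambda>k. 2 * f k + 2 * g k) \<longlonglongrightarrow> 2 * 0 + 2 * 0"
    by (intro tendsto_add ennreal_tendsto_cmult assms) auto
  then show ?thesis by simp
qed

lemma plancherel_rel_lin:
  assumes "plancherel_rel h1 g1" "plancherel_rel h2 g2"
    and [measurable]: "h1 \<in> borel_measurable borel" "h2 \<in> borel_measurable borel"
  shows "plancherel_rel (\<lambda>x. a * h1 x + b * h2 x) (\<lambda>x. a * g1 x + b * g2 x)"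
proof -
  obtain hs1 where 1: "g1 \<in> L2 nlborel" "\<And>k. hs1 k \<in> L2 nlborel" "\<And>k. integrable nlborel (hs1 k)"
    "L2_tendsto nlborel hs1 h1" "L2_tendsto nlborel (\<lambda>k. fourier_integral (hs1 k)) g1"
    using assms(1) unfolding plancherel_rel_def by blast
  obtain hs2 where 2: "g2 \<in> L2 nlborel" "\<And>k. hs2 k \<in> L2 nlborel" "\<And>k. integrable nlborel (hs2 k)"
    "L2_tendsto nlborel hs2 h2" "L2_tendsto nlborel (\<lambda>k. fourier_integral (hs2 k)) g2"
    using assms(2) unfolding plancherel_rel_def by blast
  have [measurable]: "g1 \<in> borel_measurable borel" "g2 \<in> borel_measurable borel"
    "hs1 k \<in> borel_measurable borel" "hs2 k \<in> borel_measurable borel" for k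
    using 1 2 by (auto intro: L2_nlborel_measurable)
  have key: "L2_tendsto nlborel (\<lambda>k x. a * p k x + b * q k x) (\<lambda>x. a * p' x + b * q' x)"
    if p: "L2_tendsto nlborel p p'" and q: "L2_tendsto nlborel q q'"
      and [measurable]: "p' \<in> borel_measurable borel" "q' \<in> borel_measurable borel"
        "\<And>k. p k \<in> borel_measurable borel" "\<And>k. q k \<in> borel_measurable borel"
      for p q :: "nat \<Rightarrow> 'a \<Rightarrow> complex" and p' q'
  proof -
    have le: "sqint nlborel (\<lambda>x. (a * p k x + b * q k x) - (a * p' x + b * q' x)) \<le>
        2 * (ennreal ((norm a)\<^sup>2) * sqint nlborel (\<lambda>x. p k x - p' x)) + 2 * (ennreal ((norm b)\<^sup>2) * sqint nlborel (\<lambda>x. q k x - q' x))" for k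
    proof -
      have "sqint nlborel (\<lambda>x. (a * p k x + b * q k x) - (a * p' x + b * q' x))
          = sqint nlborel (\<lambda>x. a * (p k x - p' x) + b * (q k x - q' x))"
        by (simp add: algebra_simps)
      also have "\<dots> \<le> 2 * sqint nlborel (\<lambda>x. a * (p k x - p' x)) + 2 * sqint nlborel (\<lambda>x. b * (q k x - q' x))"
        by (rule nn_integral_norm_add_sq_le) measurable
      finally show ?thesis
        by (simp add: norm_mult power_mult_distrib ennreal_mult nn_integral_cmult)
    qed
    have "(\<lambda>k. ennreal ((norm a)\<^sup>2) * sqint nlborel (\<lambda>x. p k x - p' x)) \<longlonglongrightarrow> ennreal ((norm a)\<^sup>2) * 0"
      "(\<lambda>k. ennreal ((norm b)\<^sup>2) * sqint nlborel (\<lambda>x. q k x - q' x)) \<longlonglongrightarrow> ennreal ((norm b)\<^sup>2) * 0"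
      using p q unfolding L2_tendsto_def by (intro ennreal_tendsto_cmult; simp)+
    then have "(\<lambda>k. 2 * (ennreal ((norm a)\<^sup>2) * sqint nlborel (\<lambda>x. p k x - p' x)) + 2 * (ennreal ((norm b)\<^sup>2) * sqint nlborel (\<lambda>x. q k x - q' x))) \<longlonglongrightarrow> 0"
      by (intro ennreal_tendsto_lin0) simp_all
    then show ?thesis unfolding L2_tendsto_def
      by (rule ennreal_squeeze0[OF le])
  qed
  have F: "fourier_integral (\<lambda>x. a * hs1 k x + b * hs2 k x) = (\<lambda>\<xi>. a * fourier_integral (hs1 k) \<xi> + b * fourier_integral (hs2 k) \<xi>)" for k
    using fourier_add[of "\<lambda>x. a * hs1 k x" "\<lambda>x. b * hs2 k x"] 1(3)[of k] 2(3)[of k] by (auto simp: fourier_cmult)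
  show ?thesis unfolding plancherel_rel_def
  proof (intro conjI exI[of _ "\<lambda>k x. a * hs1 k x + b * hs2 k x"] allI)
    show "L2_tendsto nlborel (\<lambda>k. fourier_integral (\<lambda>x. a * hs1 k x + b * hs2 k x)) (\<lambda>x. a * g1 x + b * g2 x)"
      unfolding F by (rule key[OF 1(5) 2(5)]) measurable
    show "L2_tendsto nlborel (\<lambda>k x. a * hs1 k x + b * hs2 k x) (\<lambda>x. a * h1 x + b * h2 x)"
      by (rule key[OF 1(4) 2(4)]) measurable
  qed (use 1 2 in \<open>auto intro!: L2_add L2_cmult\<close>)
qed

lemma plancherel_rel_AE_cong:
  assumes "plancherel_rel h g" "AE x in nlborel. g x = g' x" "g' \<in> borel_measurable borel"
  shows "plancherel_rel h g'"
proof -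
  have "sqint nlborel (\<lambda>x. f x - g x) = sqint nlborel (\<lambda>x. f x - g' x)" for f
    using assms(2) by (intro nn_integral_cong_AE) auto
  moreover have "g' \<in> L2 nlborel"
  proof (rule L2_cong_AE[OF _ _ assms(2)])
    show "g \<in> L2 nlborel" using assms(1) by (simp add: plancherel_rel_def)
    show "g' \<in> borel_measurable nlborel" using assms(3) by (simp cong: measurable_cong_sets)
  qed
  ultimately show ?thesis using assms(1) unfolding plancherel_rel_def L2_tendsto_def by simp
qed

lemma plancherel_rel_L2: "plancherel_rel h g \<Longrightarrow> g \<in> L2 nlborel"
  by (simp add: plancherel_rel_def)

text \<open>The constant 4 stems from using |a + b|^2 \<le> 2|a|^2 + 2|b|^2 twice. It is applied
  with h = 0, where any finite constant gives uniqueness.\<close>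

lemma plancherel_rel_contraction:
  fixes h :: "'a::euclidean_space \<Rightarrow> complex"
  assumes "plancherel_rel h g" and [measurable]: "h \<in> borel_measurable borel"
  shows "sqint nlborel g \<le> 4 * sqint nlborel h"
proof -
  obtain hs where hs: "g \<in> L2 nlborel" "\<And>k. hs k \<in> L2 nlborel" "\<And>k. integrable nlborel (hs k)"
    "L2_tendsto nlborel hs h" "L2_tendsto nlborel (\<lambda>k. fourier_integral (hs k)) g"
    using assms(1) unfolding plancherel_rel_def by blast
  have [measurable]: "g \<in> borel_measurable borel" "hs k \<in> borel_measurable borel" for k
    using hs by (auto intro: L2_nlborel_measurable)
  have "sqint nlborel g \<le> 4 * sqint nlborel h +
      (2 * sqint nlborel (\<lambda>x. fourier_integral (hs k) x - g x) + 2 * (2 * sqint nlborel (\<lambda>x. hs k x - h x)))" for k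
  proof -
    have "sqint nlborel g \<le> 2 * sqint nlborel (\<lambda>x. g x - fourier_integral (hs k) x) + 2 * sqint nlborel (fourier_integral (hs k))"
      using sqint_triangle[of g "fourier_integral (hs k)" "\<lambda>x. 0"] by simp
    also have "sqint nlborel (fourier_integral (hs k)) \<le> sqint nlborel (hs k)"
      by (rule fourier_contraction[OF hs(3)])
    also have "sqint nlborel (hs k) \<le> 2 * sqint nlborel (\<lambda>x. hs k x - h x) + 2 * sqint nlborel h"
      using sqint_triangle[of "hs k" h "\<lambda>x. 0"] by simp
    finally have "sqint nlborel g \<le> 2 * sqint nlborel (\<lambda>x. g x - fourier_integral (hs k) x) + 2 * (2 * sqint nlborel (\<lambda>x. hs k x - h x) + 2 * sqint nlborel h)"
      by (simp add: add_left_mono mult_left_mono)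
    then show ?thesis
      by (simp add: sqint_diff_commute[of _ g] distrib_left add_ac mult.assoc[symmetric])
  qed
  moreover have "(\<lambda>k. 4 * sqint nlborel h +
      (2 * sqint nlborel (\<lambda>x. fourier_integral (hs k) x - g x) + 2 * (2 * sqint nlborel (\<lambda>x. hs k x - h x)))) \<longlonglongrightarrow> 4 * sqint nlborel h + 0"
  proof (intro tendsto_add tendsto_const ennreal_tendsto_lin0)
    have "(\<lambda>k. 2 * sqint nlborel (\<lambda>x. hs k x - h x)) \<longlonglongrightarrow> 2 * 0"
      using hs(4) unfolding L2_tendsto_def by (intro ennreal_tendsto_cmult) auto
    then show "(\<lambda>k. 2 * sqint nlborel (\<lambda>x. hs k x - h x)) \<longlonglongrightarrow> 0" by simp
  qed (use hs in \<open>auto simp: L2_tendsto_def\<close>)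
  ultimately show ?thesis using LIMSEQ_le_const by fastforce
qed

text \<open>By linearity the difference of two transforms of h is a transform of 0.\<close>

lemma plancherel_rel_unique:
  assumes "plancherel_rel h g1" "plancherel_rel h g2" and [measurable]: "h \<in> borel_measurable borel"
  shows "AE x in nlborel. g1 x = g2 x"
proof -
  have "plancherel_rel (\<lambda>x. 1 * h x + (-1) * h x) (\<lambda>x. 1 * g1 x + (-1) * g2 x)"
    by (rule plancherel_rel_lin[OF assms(1,2)]) fact+
  then have "sqint nlborel (\<lambda>x. g1 x - g2 x) \<le> 0"
    using plancherel_rel_contraction[of "\<lambda>x. 0" "\<lambda>x. g1 x - g2 x"] by simp
  then have "AE x in nlborel. g1 x - g2 x = 0"
    by (intro sqint_zero_AE) (use assms(1,2)[THEN plancherel_rel_L2, THEN L2_nlborel_measurable] in auto)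
  then show ?thesis by eventually_elim simp
qed

lemma fourier_plancherel_rel:
  assumes "plancherel_rel h g"
  shows "plancherel_rel h (fourier_plancherel h)"
proof -
  have "fourier_plancherel h = (SOME g. plancherel_rel h g)"
    by (simp add: fourier_plancherel_def plancherel_rel_def)
  with assms show ?thesis by (metis someI)
qed

lemma plancherel_rel_fourier_integral:
  assumes "h \<in> L2 nlborel" "integrable nlborel h"
  shows "plancherel_rel h (fourier_integral h)"
  unfolding plancherel_rel_def L2_tendsto_def using assms fourier_L2[of h]
  by (intro conjI exI[of _ "\<lambda>_. h"]) auto

lemma L2_tendsto_LINT_mult:
  assumes "L2_tendsto nlborel fs f" "\<And>k. fs k \<in> L2 nlborel" "f \<in> L2 nlborel" "E \<in> L2 nlborel"
  shows "(\<lambda>k. LINT x|nlborel. fs k x * E x) \<longlonglongrightarrow> (LINT x|nlborel. f x * E x)"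
proof -
  have [measurable]: "f \<in> borel_measurable borel" "E \<in> borel_measurable borel" "fs k \<in> borel_measurable borel" for k
    using assms by (auto intro: L2_nlborel_measurable)
  have le: "ennreal ((norm ((LINT x|nlborel. fs k x * E x) - (LINT x|nlborel. f x * E x)))\<^sup>2)
      \<le> sqint nlborel E * sqint nlborel (\<lambda>x. fs k x - f x)" for k
  proof -
    have "(LINT x|nlborel. fs k x * E x) - (LINT x|nlborel. f x * E x) = (LINT x|nlborel. (fs k x - f x) * E x)"
      using L2_mult_integrable[OF assms(2)[of k] assms(4)] L2_mult_integrable[OF assms(3,4)]
      by (simp add: left_diff_distrib)
    then show ?thesis
      using norm_LINT_mult_sq_le[of "\<lambda>x. fs k x - f x" nlborel E] by (simp add: mult.commute)
  qed
  have fin: "sqint nlborel E \<noteq> \<infinity>" using assms(4) by (auto simp: L2_iff)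
  have "(\<lambda>k. sqint nlborel E * sqint nlborel (\<lambda>x. fs k x - f x)) \<longlonglongrightarrow> sqint nlborel E * 0"
    using assms(1) fin unfolding L2_tendsto_def by (intro ennreal_tendsto_cmult) (auto simp: less_top)
  then have "(\<lambda>k. ennreal ((norm ((LINT x|nlborel. fs k x * E x) - (LINT x|nlborel. f x * E x)))\<^sup>2)) \<longlonglongrightarrow> 0"
    by (intro ennreal_squeeze0[OF le]) simp
  then have "(\<lambda>k. (norm ((LINT x|nlborel. fs k x * E x) - (LINT x|nlborel. f x * E x)))\<^sup>2) \<longlonglongrightarrow> 0"
    by (subst (asm) ennreal_0[symmetric], subst (asm) tendsto_ennreal_iff) auto
  then have "(\<lambda>k. sqrt ((norm ((LINT x|nlborel. fs k x * E x) - (LINT x|nlborel. f x * E x)))\<^sup>2)) \<longlonglongrightarrow> sqrt 0"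
    by (rule tendsto_real_sqrt)
  then have "(\<lambda>k. norm ((LINT x|nlborel. fs k x * E x) - (LINT x|nlborel. f x * E x))) \<longlonglongrightarrow> 0"
    by simp
  then show ?thesis by (rule LIM_zero_cancel[OF tendsto_norm_zero_cancel])
qed

text \<open>The multiplication formula holds along the approximating sequence, and both sides are
  continuous in \<open>L2\<close> by Cauchy-Schwarz.\<close>

lemma plancherel_rel_mult_formula:
  assumes "plancherel_rel h g" "h \<in> L2 nlborel" "integrable nlborel E" "E \<in> L2 nlborel"
  shows "(LINT x|nlborel. g x * E x) = (LINT x|nlborel. h x * fourier_integral E x)"
proof -
  obtain hs where hs: "g \<in> L2 nlborel" "\<And>k. hs k \<in> L2 nlborel" "\<And>k. integrable nlborel (hs k)"
    "L2_tendsto nlborel hs h" "L2_tendsto nlborel (\<lambda>k. fourier_integral (hs k)) g"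
    using assms(1) unfolding plancherel_rel_def by blast
  have "(\<lambda>k. LINT x|nlborel. fourier_integral (hs k) x * E x) \<longlonglongrightarrow> (LINT x|nlborel. g x * E x)"
    by (rule L2_tendsto_LINT_mult) (use hs assms fourier_L2 in auto)
  moreover have "(\<lambda>k. LINT x|nlborel. hs k x * fourier_integral E x) \<longlonglongrightarrow> (LINT x|nlborel. h x * fourier_integral E x)"
    by (rule L2_tendsto_LINT_mult) (use hs assms fourier_L2 in auto)
  moreover have "(LINT x|nlborel. fourier_integral (hs k) x * E x) = (LINT x|nlborel. hs k x * fourier_integral E x)" for k
    by (rule fourier_mult_formula[OF hs(3) assms(3)])
  ultimately show ?thesis using LIMSEQ_unique by auto
qed

section \<open>Modulated Gaussians and Fourier inversion\<close>

definition gauss_mod :: "'a::euclidean_space \<Rightarrow> 'a \<Rightarrow> 'a \<Rightarrow> complex" where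
  "gauss_mod p q \<xi> = exp (complex_of_real (- (norm \<xi>)\<^sup>2 / 2 - \<xi> \<bullet> q) + \<i> * complex_of_real (\<xi> \<bullet> p))"

lemma norm_gauss_mod: "norm (gauss_mod p q \<xi>) = exp (- (norm \<xi>)\<^sup>2 / 2 - \<xi> \<bullet> q)"
  by (simp add: gauss_mod_def)

lemma gauss_mod_integrable: "integrable nlborel (gauss_mod p q)"
  unfolding gauss_mod_def by (rule gauss_fourier(1))

lemma gauss_mod_L2: "gauss_mod p q \<in> L2 nlborel"
proof -
  have "integrable lborel (\<lambda>\<xi>. exp (- 1 * (norm \<xi>)\<^sup>2 + (2 * norm q) * norm \<xi>))"
    by (rule integrable_exp_norm) simp
  then have "integrable lborel (\<lambda>\<xi>. (norm (gauss_mod p q \<xi>))\<^sup>2)"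
  proof (rule Bochner_Integration.integrable_bound)
    show "AE \<xi> in lborel. norm ((norm (gauss_mod p q \<xi>))\<^sup>2) \<le> norm (exp (- 1 * (norm \<xi>)\<^sup>2 + (2 * norm q) * norm \<xi>))"
    proof (intro always_eventually allI)
      fix \<xi>
      have "- (\<xi> \<bullet> q) \<le> norm \<xi> * norm q"
        using Cauchy_Schwarz_ineq2[of \<xi> q] by linarith
      then show "norm ((norm (gauss_mod p q \<xi>))\<^sup>2) \<le> norm (exp (- 1 * (norm \<xi>)\<^sup>2 + (2 * norm q) * norm \<xi>))"
        by (simp add: norm_gauss_mod exp_double[symmetric] mult.commute)
    qed
  qed (use borel_measurable_integrable[OF gauss_mod_integrable[of p q]] in \<open>simp cong: measurable_cong_sets\<close>)
  then show ?thesis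
    using borel_measurable_integrable[OF gauss_mod_integrable[of p q]] by (simp add: L2_def integrable_nlborel_iff)
qed

lemma fourier_gauss_mod:
  "fourier_integral (gauss_mod p q) u =
     exp (complex_of_real (((norm q)\<^sup>2 - (norm (p - u))\<^sup>2) / 2) - \<i> * complex_of_real ((p - u) \<bullet> q))"
proof -
  have "fourier_integral (gauss_mod p q) u = (LINT \<xi>|nlborel. gauss_mod (p - u) q \<xi>)"
    unfolding fourier_integral_def gauss_mod_def
    by (intro Bochner_Integration.integral_cong) (auto simp: exp_add[symmetric] inner_diff_right algebra_simps)
  then show ?thesis using gauss_fourier(2)[of q "p - u"] by (simp add: gauss_mod_def)
qed

text \<open>Both sides are tested against modulated Gaussians, whose Fourier transforms are explicit.\<close>

lemma plancherel_rel_inversion: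
  fixes a :: "'a::euclidean_space \<Rightarrow> complex"
  assumes a: "integrable nlborel a" "a \<in> L2 nlborel"
    and rel: "plancherel_rel (\<lambda>u. fourier_integral a (- u)) B"
  shows "AE \<xi> in nlborel. B \<xi> = a \<xi>"
proof -
  have B: "B \<in> L2 nlborel" using rel by (rule plancherel_rel_L2)
  have [measurable]: "a \<in> borel_measurable borel" "B \<in> borel_measurable borel"
    using a B by (auto intro: L2_nlborel_measurable)
  let ?A = "\<lambda>u. fourier_integral a (- u)"
  have sq: "sqint nlborel ?A = sqint nlborel (fourier_integral a)"
  proof -
    have "(\<integral>\<^sup>+x. ennreal ((norm (fourier_integral a x))\<^sup>2) \<partial>lborel) = (\<integral>\<^sup>+x. ennreal ((norm (?A x))\<^sup>2) \<partial>lborel)"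
      using nn_integral_lborel_scale[of "\<lambda>x. ennreal ((norm (fourier_integral a x))\<^sup>2)" "-1"] by simp
    then show ?thesis by (simp add: nn_integral_nlborel)
  qed
  have A: "?A \<in> L2 nlborel"
    using fourier_L2[OF a] sq by (simp add: L2_iff cong: measurable_cong_sets)
  \<comment> \<open>The Gaussian factor makes the difference integrable, and the transform of w at b
    is the pairing of B - a with \<open>gauss_mod (- b) 0\<close>.\<close>
  define w where "w \<xi> = (B \<xi> - a \<xi>) * gauss_mod 0 0 \<xi>" for \<xi>
  have "integrable nlborel w" unfolding w_def
    by (intro L2_mult_integrable L2_diff B a gauss_mod_L2)
  moreover have "fourier_integral w b = 0" for b
  proof -
    let ?E = "gauss_mod (- b) 0"
    have wE: "w \<xi> * chr \<xi> b = (B \<xi> - a \<xi>) * ?E \<xi>" for \<xi>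
      by (simp add: w_def gauss_mod_def mult.assoc exp_add[symmetric])
    have FE: "fourier_integral ?E u = complex_of_real (exp (- (norm (u + b))\<^sup>2 / 2))" for u
    proof -
      have "- b - u = - (u + b)" by simp
      then have "norm (- b - u) = norm (u + b)" by (simp only: norm_minus_cancel)
      then show ?thesis by (simp add: fourier_gauss_mod exp_of_real[symmetric])
    qed
    have FEi: "integrable nlborel (fourier_integral ?E)"
    proof -
      have "integrable lborel (\<lambda>u. complex_of_real (exp (- (norm (u + b))\<^sup>2 / 2)))"
        using integrable_lborel_plus_iff(1)[of "\<lambda>u. complex_of_real (exp (- (norm u)\<^sup>2 / 2))" b]
           gauss_integral(1)[where 'a='a]
        by (simp add: integrable_nlborel_iff)
      then show ?thesis by (simp add: FE[abs_def] integrable_nlborel_iff)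
    qed
    have FEL2: "fourier_integral ?E \<in> L2 nlborel"
      by (intro fourier_L2 gauss_mod_L2 gauss_mod_integrable)
    \<comment> \<open>Inversion is an explicit computation for these test functions; two
      applications of the multiplication formula transfer it to a.\<close>
    have FFE: "fourier_integral (fourier_integral ?E) (- \<xi>) = ?E \<xi>" for \<xi>
    proof -
      let ?g = "\<lambda>u. complex_of_real (exp (- (norm u)\<^sup>2 / 2)) * exp (\<i> * complex_of_real (u \<bullet> \<xi>))"
      have "fourier_integral (fourier_integral ?E) (- \<xi>)
         = (LINT u|nlborel. exp (- \<i> * complex_of_real (b \<bullet> \<xi>)) * ?g (u + b))"
        unfolding fourier_integral_def[of "fourier_integral ?E"] FE
        by (intro Bochner_Integration.integral_cong) (auto simp: exp_add[symmetric] inner_add_left algebra_simps)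
      also have "\<dots> = exp (- \<i> * complex_of_real (b \<bullet> \<xi>)) * (LINT u|nlborel. ?g (u + b))"
        by simp
      also have "(LINT u|nlborel. ?g (u + b)) = (LINT u|nlborel. ?g u)"
        using integrable_lborel_plus_iff(2)[of ?g b] by (simp add: integral_nlborel)
      also have "\<dots> = complex_of_real (gauss_kernel 1 \<xi>)"
        using gauss_fourier_scaled(2)[of 1 \<xi>] by simp
      finally have eq: "fourier_integral (fourier_integral ?E) (- \<xi>)
          = exp (- \<i> * complex_of_real (b \<bullet> \<xi>)) * complex_of_real (gauss_kernel 1 \<xi>)" .
      show ?thesis unfolding eq
        by (simp add: gauss_mod_def gauss_kernel_def exp_of_real[symmetric] exp_add[symmetric] inner_commute[of b] algebra_simps)
    qed
    have "(LINT \<xi>|nlborel. B \<xi> * ?E \<xi>) = (LINT u|nlborel. ?A u * fourier_integral ?E u)"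
      by (rule plancherel_rel_mult_formula[OF rel A gauss_mod_integrable gauss_mod_L2])
    also have "\<dots> = (LINT u|nlborel. fourier_integral a u * fourier_integral ?E (- u))"
    proof -
      have i: "integrable lborel (\<lambda>u. fourier_integral a u * fourier_integral ?E (- u))"
      proof -
        have "integrable lborel (\<lambda>u. ?A u * fourier_integral ?E u)"
          using L2_mult_integrable[OF A FEL2] by (simp add: integrable_nlborel_iff)
        from integral_lborel_scale(1)[OF this, of "-1"] show ?thesis by simp
      qed
      show ?thesis using integral_lborel_scale(2)[OF i, of "-1"] by (simp add: integral_nlborel)
    qed
    also have "\<dots> = (LINT \<xi>|nlborel. a \<xi> * fourier_integral (\<lambda>u. fourier_integral ?E (- u)) \<xi>)"
    proof (rule fourier_mult_formula[OF a(1)])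
      show "integrable nlborel (\<lambda>u. fourier_integral ?E (- u))"
        using integral_lborel_scale(1)[of "fourier_integral ?E" "-1"] FEi by (simp add: integrable_nlborel_iff)
    qed
    also have "\<dots> = (LINT \<xi>|nlborel. a \<xi> * ?E \<xi>)"
    proof -
      have "fourier_integral (\<lambda>u. fourier_integral ?E (- u)) \<xi> = fourier_integral (fourier_integral ?E) (- \<xi>)" for \<xi>
      proof -
        have "integrable lborel (\<lambda>u. fourier_integral ?E u * chr u (- \<xi>))"
          using fourier_integrable[OF FEi, of "- \<xi>"] by (simp only: integrable_nlborel_iff)
        from integral_lborel_scale(2)[OF this, of "-1"] show ?thesis
          by (simp add: fourier_integral_def[of "\<lambda>u. fourier_integral ?E (- u)"]
              fourier_integral_def[of "fourier_integral ?E"] integral_nlborel)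
      qed
      then show ?thesis by (simp add: FFE)
    qed
    finally have "(LINT \<xi>|nlborel. (B \<xi> - a \<xi>) * ?E \<xi>) = 0"
      using L2_mult_integrable[OF B gauss_mod_L2[of "- b" 0]] L2_mult_integrable[OF a(2) gauss_mod_L2[of "- b" 0]]
      by (simp add: left_diff_distrib)
    then show ?thesis unfolding fourier_integral_def wE .
  qed
  ultimately have "AE \<xi> in nlborel. w \<xi> = 0" by (rule fourier_uniqueness)
  then show ?thesis by eventually_elim (simp add: w_def gauss_mod_def)
qed

section \<open>The partial Fourier--Plancherel transform\<close>

lemma measurable_nlborel_iff [simp]: "f \<in> borel_measurable nlborel \<longleftrightarrow> f \<in> borel_measurable borel"
  by (simp cong: measurable_cong_sets)

lemma borel_section_fst [measurable (raw)]:
  fixes h :: "'a::euclidean_space \<times> 'b::euclidean_space \<Rightarrow> 'c::topological_space"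
  assumes "h \<in> borel_measurable borel"
  shows "(\<lambda>u. h (u, v)) \<in> borel_measurable borel"
  using assms by measurable

lemma borel_section_snd:
  fixes h :: "'a::euclidean_space \<times> 'b::euclidean_space \<Rightarrow> 'c::topological_space"
  assumes "h \<in> borel_measurable borel"
  shows "(\<lambda>v. h (u, v)) \<in> borel_measurable borel"
  using assms by measurable

lemma borel_pair_nlborel:
  fixes h :: "'a::euclidean_space \<times> 'b::euclidean_space \<Rightarrow> 'c::topological_space"
  shows "h \<in> borel_measurable (nlborel \<Otimes>\<^sub>M nlborel) \<longleftrightarrow> h \<in> borel_measurable borel"
  by (simp only: nlborel_prod measurable_nlborel_iff)

lemma borel_swap:
  fixes h :: "'a::euclidean_space \<times> 'b::euclidean_space \<Rightarrow> 'c::topological_space"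
  assumes "h \<in> borel_measurable borel"
  shows "(\<lambda>p. h (snd p, fst p)) \<in> borel_measurable borel"
  by (rule measurable_compose[OF _ assms]) (intro borel_measurable_continuous_onI continuous_intros)

lemma sqint_Fubini:
  fixes h :: "'a::euclidean_space \<times> 'b::euclidean_space \<Rightarrow> complex"
  assumes [measurable]: "h \<in> borel_measurable borel"
  shows "sqint nlborel h = (\<integral>\<^sup>+v. sqint nlborel (\<lambda>u. h (u, v)) \<partial>nlborel)"
    and "sqint nlborel h = (\<integral>\<^sup>+u. sqint nlborel (\<lambda>v. h (u, v)) \<partial>nlborel)"
    and "(\<lambda>v. sqint nlborel (\<lambda>u. h (u, v))) \<in> borel_measurable borel"
    and "(\<lambda>u. sqint nlborel (\<lambda>v. h (u, v))) \<in> borel_measurable borel"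
proof -
  have m: "(\<lambda>p. ennreal ((norm (h p))\<^sup>2)) \<in> borel_measurable (nlborel \<Otimes>\<^sub>M nlborel)"
    unfolding borel_pair_nlborel by measurable
  show "sqint nlborel h = (\<integral>\<^sup>+v. sqint nlborel (\<lambda>u. h (u, v)) \<partial>nlborel)"
    using nlborel_pair.nn_integral_snd[OF m] by (simp add: nlborel_prod)
  show "sqint nlborel h = (\<integral>\<^sup>+u. sqint nlborel (\<lambda>v. h (u, v)) \<partial>nlborel)"
    using nlborel.nn_integral_fst[OF m] by (simp add: nlborel_prod)
  show "(\<lambda>u. sqint nlborel (\<lambda>v. h (u, v))) \<in> borel_measurable borel"
    using nlborel.borel_measurable_nn_integral_fst[OF m] by simp
  have [measurable]: "(\<lambda>p. h (snd p, fst p)) \<in> borel_measurable borel"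
    by (rule borel_swap) measurable
  have "(\<lambda>p. ennreal ((norm (h (snd p, fst p)))\<^sup>2)) \<in> borel_measurable (nlborel \<Otimes>\<^sub>M nlborel)"
    unfolding borel_pair_nlborel by measurable
  from nlborel.borel_measurable_nn_integral_fst[OF this]
  show "(\<lambda>v. sqint nlborel (\<lambda>u. h (u, v))) \<in> borel_measurable borel"
    by simp
qed

lemma L2_sections:
  fixes h :: "'a::euclidean_space \<times> 'b::euclidean_space \<Rightarrow> complex"
  assumes h: "h \<in> L2 nlborel"
  shows "AE v in nlborel. (\<lambda>u. h (u, v)) \<in> L2 nlborel"
    and "AE u in nlborel. (\<lambda>v. h (u, v)) \<in> L2 nlborel"
proof -
  have [measurable]: "h \<in> borel_measurable borel" using h by (rule L2_nlborel_measurable)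
  have fin: "sqint nlborel h \<noteq> \<infinity>" using h by (auto simp: L2_iff)
  have "AE v in nlborel. sqint nlborel (\<lambda>u. h (u, v)) \<noteq> \<infinity>"
    by (rule nn_integral_PInf_AE) (use fin sqint_Fubini[of h] in auto)
  then show "AE v in nlborel. (\<lambda>u. h (u, v)) \<in> L2 nlborel"
    by eventually_elim (auto simp: L2_iff less_top)
  have "AE u in nlborel. sqint nlborel (\<lambda>v. h (u, v)) \<noteq> \<infinity>"
    by (rule nn_integral_PInf_AE) (use fin sqint_Fubini[of h] in auto)
  then show "AE u in nlborel. (\<lambda>v. h (u, v)) \<in> L2 nlborel"
    by eventually_elim (auto simp: L2_iff less_top borel_section_snd)
qed

text \<open>Summable integrals make the sum of the f k finite almost everywhere, so the terms tend
  to 0 there and no subsequence has to be chosen.\<close>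

lemma AE_tendsto_0_if_geometric:
  fixes f :: "nat \<Rightarrow> 'a \<Rightarrow> ennreal"
  assumes [measurable]: "\<And>k. f k \<in> borel_measurable M"
    and le: "\<And>k. (\<integral>\<^sup>+x. f k x \<partial>M) \<le> ennreal ((1/4) ^ k)"
  shows "AE x in M. (\<lambda>k. f k x) \<longlonglongrightarrow> 0"
proof -
  have "(\<integral>\<^sup>+x. (\<Sum>k. f k x) \<partial>M) = (\<Sum>k. \<integral>\<^sup>+x. f k x \<partial>M)"
    by (rule nn_integral_suminf) simp
  also have "\<dots> \<le> (\<Sum>k. ennreal ((1/4) ^ k))"
    by (intro suminf_le summableI le)
  also have "\<dots> = ennreal (\<Sum>k. (1/4) ^ k)"
    by (intro suminf_ennreal2 summable_geometric) auto
  also have "\<dots> < \<infinity>" by simp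
  finally have "AE x in M. (\<Sum>k. f k x) \<noteq> \<infinity>"
    by (intro nn_integral_PInf_AE) auto
  then show ?thesis
  proof eventually_elim
    case (elim x)
    have fin: "f k x \<noteq> \<infinity>" for k
      using elim sum_le_suminf[OF summableI, of "{k}" "\<lambda>k. f k x"] by (auto simp: top_unique)
    then have eq: "f k x = ennreal (enn2real (f k x))" for k
      by (simp add: less_top)
    have "summable (\<lambda>k. enn2real (f k x))"
      by (rule summable_suminf_not_top) (use elim eq in auto)
    then have "(\<lambda>k. ennreal (enn2real (f k x))) \<longlonglongrightarrow> ennreal 0"
      by (intro tendsto_ennrealI summable_LIMSEQ_zero)
    then show ?case using eq by simp
  qed
qed

section \<open>Existence, uniqueness and linearity of a jointly measurable transform\<close>

lemma fourier_sections_measurable: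
  fixes h :: "'a::euclidean_space \<times> 'b::euclidean_space \<Rightarrow> complex"
  assumes [measurable]: "h \<in> borel_measurable borel"
  shows "(\<lambda>(\<xi>, v). fourier_integral (\<lambda>u. h (u, v)) \<xi>) \<in> borel_measurable borel"
proof -
  have m: "(\<lambda>q. h (snd q, snd (fst q)) * chr (snd q) (fst (fst q))) \<in> borel_measurable ((borel \<Otimes>\<^sub>M borel) \<Otimes>\<^sub>M (nlborel :: 'a measure))"
  proof -
    have "(\<lambda>q::('a \<times> 'b) \<times> 'a. h (snd q, snd (fst q)) * chr (snd q) (fst (fst q))) \<in> borel_measurable ((borel \<Otimes>\<^sub>M borel) \<Otimes>\<^sub>M borel)"
      by measurable
    then show ?thesis by (simp cong: measurable_cong_sets)
  qed
  have "(\<lambda>p::'a\<times>'b. LINT u|nlborel. h (u, snd p) * chr u (fst p)) \<in> borel_measurable (borel \<Otimes>\<^sub>M borel)"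
    by (rule nlborel.borel_measurable_lebesgue_integral) (use m in \<open>simp add: case_prod_beta'\<close>)
  then show ?thesis by (simp add: fourier_integral_def case_prod_beta' borel_prod)
qed

text \<open>Transforming each section separately would lose joint measurability. Instead h is cut
  off in its first variable, the cut-off functions are transformed by parameter integrals, and the
  limit is taken in \<open>L2\<close> of the product; geometric rates bring the convergence back to
  almost every section.\<close>

lemma plancherel_fst_exists:
  fixes h :: "'a::euclidean_space \<times> 'b::euclidean_space \<Rightarrow> complex"
  assumes h: "h \<in> L2 nlborel"
  obtains S where "S \<in> L2 nlborel" "AE v in nlborel. plancherel_rel (\<lambda>u. h (u, v)) (\<lambda>\<xi>. S (\<xi>, v))"
proof -
  have [measurable]: "h \<in> borel_measurable borel" using h by (rule L2_nlborel_measurable)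
  have hfin: "sqint nlborel h < \<infinity>" using h by (auto simp: L2_iff)
  \<comment> \<open>Cutting off in the first variable is enough: a square-integrable section
    supported in a ball is integrable.\<close>
  define I where "I N u = (indicator (ball 0 (real N)) u :: real)" for N and u :: 'a
  have [measurable]: "I N \<in> borel_measurable borel" for N
    unfolding I_def by (intro borel_measurable_indicator) simp
  have [measurable]: "(\<lambda>p::'a \<times> 'b. I N (fst p)) \<in> borel_measurable borel" for N
    by (rule measurable_compose[of fst borel borel "I N"])
      (auto intro!: borel_measurable_continuous_onI continuous_intros)
  have I01: "I N u = 0 \<or> I N u = 1" for N u by (auto simp: I_def split: split_indicator)
  define tail where "tail N = sqint nlborel (\<lambda>p. h p - I N (fst p) *\<^sub>R h p)" for N
  have "tail \<longlonglongrightarrow> sqint nlborel (\<lambda>p::'a\<times>'b. 0)"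
    unfolding tail_def
  proof (rule nn_integral_dominated_convergence[where w = "\<lambda>p. ennreal ((norm (h p))\<^sup>2)"])
    show "AE p in nlborel. ennreal ((norm (h p - I N (fst p) *\<^sub>R h p))\<^sup>2) \<le> ennreal ((norm (h p))\<^sup>2)" for N
    proof (intro always_eventually allI)
      fix p show "ennreal ((norm (h p - I N (fst p) *\<^sub>R h p))\<^sup>2) \<le> ennreal ((norm (h p))\<^sup>2)"
        using I01[of N "fst p"] by auto
    qed
    show "AE p in nlborel. (\<lambda>N. ennreal ((norm (h p - I N (fst p) *\<^sub>R h p))\<^sup>2)) \<longlonglongrightarrow> ennreal ((norm (0::complex))\<^sup>2)"
    proof (rule always_eventually, rule allI, rule tendsto_eventually)
      fix p :: "'a \<times> 'b"
      obtain N0 where N0: "norm (fst p) < real N0" using reals_Archimedean2 by blast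
      show "\<forall>\<^sub>F N in sequentially. ennreal ((norm (h p - I N (fst p) *\<^sub>R h p))\<^sup>2) = ennreal ((norm (0::complex))\<^sup>2)"
        using eventually_ge_at_top[of N0] by eventually_elim (use N0 in \<open>auto simp: I_def\<close>)
    qed
  qed (use hfin in auto)
  then have "tail \<longlonglongrightarrow> 0" by simp
  then have "\<exists>N. tail N \<le> ennreal ((1/4) ^ k / 2)" for k
  proof -
    have "\<forall>\<^sub>F N in sequentially. tail N < ennreal ((1/4) ^ k / 2)"
      by (rule order_tendstoD(2)[OF \<open>tail \<longlonglongrightarrow> 0\<close>]) simp
    then show ?thesis by (auto simp: eventually_sequentially intro: less_imp_le)
  qed
  then obtain N where N: "\<And>k. tail (N k) \<le> ennreal ((1/4) ^ k / 2)" by metis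
  define c where "c k p = I (N k) (fst p) *\<^sub>R h p" for k p
  have [measurable]: "c k \<in> borel_measurable borel" for k unfolding c_def by measurable
  have ch: "sqint nlborel (\<lambda>p. h p - c k p) \<le> ennreal ((1/4) ^ k / 2)" for k
    using N[of k] by (simp add: tail_def c_def)
  \<comment> \<open>Cut-off values are 0 or 1, so where two of them differ the difference is, in
    modulus, one of the two errors. No factor 2 appears, and the halves in the bounds on the tails
    add up to the rate demanded by \<open>L2_complete\<close>.\<close>
  have cc: "sqint nlborel (\<lambda>p. c j p - c k p) \<le> ennreal ((1/4) ^ k)" if "k \<le> j" for j k
  proof -
    have "sqint nlborel (\<lambda>p. c j p - c k p) \<le> (\<integral>\<^sup>+p. ennreal ((norm (h p - c j p))\<^sup>2) + ennreal ((norm (h p - c k p))\<^sup>2) \<partial>nlborel)"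
    proof (rule nn_integral_mono)
      fix p show "ennreal ((norm (c j p - c k p))\<^sup>2) \<le> ennreal ((norm (h p - c j p))\<^sup>2) + ennreal ((norm (h p - c k p))\<^sup>2)"
        using I01[of "N j" "fst p"] I01[of "N k" "fst p"] by (auto simp: c_def)
    qed
    also have "\<dots> = sqint nlborel (\<lambda>p. h p - c j p) + sqint nlborel (\<lambda>p. h p - c k p)"
      by (rule nn_integral_add) auto
    also have "\<dots> \<le> ennreal ((1/4) ^ j / 2) + ennreal ((1/4) ^ k / 2)"
      by (intro add_mono ch)
    also have "\<dots> = ennreal ((1/4) ^ j / 2 + (1/4) ^ k / 2)" by (simp add: ennreal_plus)
    also have "\<dots> \<le> ennreal ((1/4) ^ k)"
    proof (rule ennreal_leI)
      have "(1/4::real) ^ j \<le> (1/4) ^ k" by (rule power_decreasing[OF that]) auto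
      then show "(1/4::real) ^ j / 2 + (1/4) ^ k / 2 \<le> (1/4) ^ k" by linarith
    qed
    finally show ?thesis .
  qed
  have hv: "AE v in nlborel. (\<lambda>u. h (u, v)) \<in> L2 nlborel" by (rule L2_sections[OF h])
  have cL: "(\<lambda>u. c k (u, v)) \<in> L2 nlborel" "integrable nlborel (\<lambda>u. c k (u, v))"
    if "(\<lambda>u. h (u, v)) \<in> L2 nlborel" for k v
  proof -
    have eq: "(\<lambda>u. c k (u, v)) = (\<lambda>u. h (u, v) * complex_of_real (I (N k) u))"
      by (simp add: c_def scaleR_conv_of_real mult.commute)
    show "(\<lambda>u. c k (u, v)) \<in> L2 nlborel"
      unfolding eq
    proof (rule L2_bounded_mult[OF that, where B=1])
      show "norm (complex_of_real (I (N k) u)) \<le> 1" for u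
        using I01[of "N k" u] by auto
    qed simp
    have fin: "emeasure lborel (ball 0 (real (N k)) :: 'a set) < \<infinity>"
      by (rule emeasure_lborel_ball_finite)
    have "(norm (complex_of_real (I (N k) u)))\<^sup>2 = indicator (ball 0 (real (N k))) u" for u :: 'a
      by (auto simp: I_def split: split_indicator)
    moreover have "integrable lborel (indicator (ball 0 (real (N k)) :: 'a set) :: 'a \<Rightarrow> real)"
      using fin by (intro integrable_real_indicator) auto
    ultimately have "(\<lambda>u. complex_of_real (I (N k) u)) \<in> L2 nlborel"
      unfolding L2_def by (auto simp: integrable_nlborel_iff)
    then show "integrable nlborel (\<lambda>u. c k (u, v))"
      unfolding eq by (intro L2_mult_integrable that)
  qed
  define S where "S k = (\<lambda>(\<xi>, v). fourier_integral (\<lambda>u. c k (u, v)) \<xi>)" for k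
  have [measurable]: "S k \<in> borel_measurable borel" for k
    unfolding S_def by (rule fourier_sections_measurable) measurable
  have SL2: "S k \<in> L2 nlborel" for k
  proof -
    have "sqint nlborel (S k) = (\<integral>\<^sup>+v. sqint nlborel (\<lambda>\<xi>. S k (\<xi>, v)) \<partial>nlborel)"
      by (rule sqint_Fubini(1)) measurable
    also have "\<dots> \<le> (\<integral>\<^sup>+v. sqint nlborel (\<lambda>u. h (u, v)) \<partial>nlborel)"
    proof (rule nn_integral_mono_AE, use hv in eventually_elim)
      case (elim v)
      have "sqint nlborel (\<lambda>\<xi>. S k (\<xi>, v)) \<le> sqint nlborel (\<lambda>u. c k (u, v))"
        unfolding S_def using fourier_contraction[OF cL(2)[OF elim]] by simp
      also have "\<dots> \<le> sqint nlborel (\<lambda>u. h (u, v))"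
      proof (rule nn_integral_mono)
        fix u show "ennreal ((norm (c k (u, v)))\<^sup>2) \<le> ennreal ((norm (h (u, v)))\<^sup>2)"
          using I01[of "N k" u] by (auto simp: c_def)
      qed
      finally show ?case .
    qed
    also have "\<dots> = sqint nlborel h" by (rule sqint_Fubini(1)[symmetric]) measurable
    finally have "sqint nlborel (S k) < \<infinity>" using hfin by (rule order.strict_trans1)
    then show ?thesis by (simp add: L2_iff)
  qed
  have SS: "sqint nlborel (\<lambda>p. S j p - S k p) \<le> ennreal ((1/4) ^ k)" if "k \<le> j" for j k
  proof -
    have "sqint nlborel (\<lambda>p. S j p - S k p) = (\<integral>\<^sup>+v. sqint nlborel (\<lambda>\<xi>. S j (\<xi>, v) - S k (\<xi>, v)) \<partial>nlborel)"
      by (rule sqint_Fubini(1)) measurable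
    also have "\<dots> \<le> (\<integral>\<^sup>+v. sqint nlborel (\<lambda>u. c j (u, v) - c k (u, v)) \<partial>nlborel)"
    proof (rule nn_integral_mono_AE, use hv in eventually_elim)
      case (elim v)
      have "(\<lambda>\<xi>. S j (\<xi>, v) - S k (\<xi>, v)) = fourier_integral (\<lambda>u. c j (u, v) - c k (u, v))"
        unfolding S_def using fourier_diff[OF cL(2)[OF elim, of j] cL(2)[OF elim, of k]] by auto
      then have eq: "S j (\<xi>, v) - S k (\<xi>, v) = fourier_integral (\<lambda>u. c j (u, v) - c k (u, v)) \<xi>" for \<xi>
        by (rule fun_cong)
      show ?case unfolding eq
        using fourier_contraction[of "\<lambda>u. c j (u, v) - c k (u, v)"] cL(2)[OF elim] by simp
    qed
    also have "\<dots> = sqint nlborel (\<lambda>p. c j p - c k p)" by (rule sqint_Fubini(1)[symmetric]) measurable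
    also have "\<dots> \<le> ennreal ((1/4) ^ k)" by (rule cc[OF that])
    finally show ?thesis .
  qed
  obtain G where G: "G \<in> L2 nlborel" "\<And>k. sqint nlborel (\<lambda>p. S k p - G p) \<le> ennreal ((1/4) ^ k)"
    using L2_complete[of S nlborel, OF SL2 SS] by blast
  have [measurable]: "G \<in> borel_measurable borel" using G(1) by (rule L2_nlborel_measurable)
  have "AE v in nlborel. (\<lambda>k. sqint nlborel (\<lambda>\<xi>. S k (\<xi>, v) - G (\<xi>, v))) \<longlonglongrightarrow> 0"
  proof (rule AE_tendsto_0_if_geometric)
    show "(\<integral>\<^sup>+v. sqint nlborel (\<lambda>\<xi>. S k (\<xi>, v) - G (\<xi>, v)) \<partial>nlborel) \<le> ennreal ((1/4) ^ k)" for k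
      using G(2)[of k] sqint_Fubini(1)[of "\<lambda>p. S k p - G p"] by simp
    show "(\<lambda>v. sqint nlborel (\<lambda>\<xi>. S k (\<xi>, v) - G (\<xi>, v))) \<in> borel_measurable nlborel" for k
      using sqint_Fubini(3)[of "\<lambda>p. S k p - G p"] by simp
  qed
  moreover have "AE v in nlborel. (\<lambda>k. sqint nlborel (\<lambda>u. c k (u, v) - h (u, v))) \<longlonglongrightarrow> 0"
  proof (rule AE_tendsto_0_if_geometric)
    show "(\<integral>\<^sup>+v. sqint nlborel (\<lambda>u. c k (u, v) - h (u, v)) \<partial>nlborel) \<le> ennreal ((1/4) ^ k)" for k
    proof -
      have "(\<integral>\<^sup>+v. sqint nlborel (\<lambda>u. c k (u, v) - h (u, v)) \<partial>nlborel) = sqint nlborel (\<lambda>p. h p - c k p)"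
        using sqint_Fubini(1)[of "\<lambda>p. h p - c k p"] by (simp add: norm_minus_commute)
      also have "\<dots> \<le> ennreal ((1/4) ^ k)"
        by (rule order_trans[OF ch]) (intro ennreal_leI, simp)
      finally show ?thesis .
    qed
    show "(\<lambda>v. sqint nlborel (\<lambda>u. c k (u, v) - h (u, v))) \<in> borel_measurable nlborel" for k
      using sqint_Fubini(3)[of "\<lambda>p. c k p - h p"] by simp
  qed
  ultimately have "AE v in nlborel. plancherel_rel (\<lambda>u. h (u, v)) (\<lambda>\<xi>. G (\<xi>, v))"
    using hv L2_sections(1)[OF G(1)]
  proof eventually_elim
    case (elim v)
    show ?case unfolding plancherel_rel_def L2_tendsto_def
      by (intro conjI exI[of _ "\<lambda>k u. c k (u, v)"] allI)
        (use elim cL[OF elim(3)] in \<open>auto simp: S_def\<close>)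
  qed
  with G(1) that show ?thesis by blast
qed

text \<open>Sectionwise uniqueness shows that the function from \<open>plancherel_fst_exists\<close>
  meets the specification under the choice operator, so the chosen function meets it as
  well.\<close>

lemma fourier_plancherel_fst_rel:
  fixes h :: "'a::euclidean_space \<times> 'b::euclidean_space \<Rightarrow> complex"
  assumes h: "h \<in> L2 nlborel"
  shows "fourier_plancherel_fst h \<in> L2 nlborel"
    and "AE v in nlborel. plancherel_rel (\<lambda>u. h (u, v)) (\<lambda>\<xi>. fourier_plancherel_fst h (\<xi>, v))"
proof -
  have [measurable]: "h \<in> borel_measurable borel" using h by (rule L2_nlborel_measurable)
  obtain S where S: "S \<in> L2 nlborel" "AE v in nlborel. plancherel_rel (\<lambda>u. h (u, v)) (\<lambda>\<xi>. S (\<xi>, v))"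
    using plancherel_fst_exists[OF h] .
  let ?P = "\<lambda>g. g \<in> L2 nlborel \<and> (AE v in nlborel. AE \<xi> in nlborel. g (\<xi>, v) = fourier_plancherel (\<lambda>u. h (u, v)) \<xi>)"
  have "AE v in nlborel. AE \<xi> in nlborel. S (\<xi>, v) = fourier_plancherel (\<lambda>u. h (u, v)) \<xi>"
    using S(2)
  proof eventually_elim
    case (elim v)
    show ?case by (rule plancherel_rel_unique[OF elim fourier_plancherel_rel[OF elim]]) measurable
  qed
  with S(1) have "?P S" by blast
  then have "?P (SOME g. ?P g)" by (rule someI[of ?P])
  then have P: "?P (fourier_plancherel_fst h)" by (simp only: fourier_plancherel_fst_def)
  then show L2: "fourier_plancherel_fst h \<in> L2 nlborel" by blast
  have [measurable]: "fourier_plancherel_fst h \<in> borel_measurable borel" using L2 by (rule L2_nlborel_measurable)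
  from P have "AE v in nlborel. AE \<xi> in nlborel. fourier_plancherel_fst h (\<xi>, v) = fourier_plancherel (\<lambda>u. h (u, v)) \<xi>"
    by blast
  with S(2) show "AE v in nlborel. plancherel_rel (\<lambda>u. h (u, v)) (\<lambda>\<xi>. fourier_plancherel_fst h (\<xi>, v))"
  proof eventually_elim
    case (elim v)
    show ?case
      by (rule plancherel_rel_AE_cong[OF fourier_plancherel_rel[OF elim(1)]])
        (use elim(2) in \<open>auto elim: eventually_mono\<close>)
  qed
qed

text \<open>The partial transform is known for almost every v first and then for almost every \<xi>,
  whereas R integrates over v at fixed \<xi>. Measurability of the exceptional set permits the
  exchange.\<close>

lemma AE_pair_swapI:
  fixes P :: "'a::euclidean_space \<times> 'b::euclidean_space \<Rightarrow> bool"
  assumes "Measurable.pred borel P" and "AE v in nlborel. AE u in nlborel. P (u, v)"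
  shows "AE p in nlborel. P p"
proof -
  have P: "{p. P p} \<in> sets (nlborel \<Otimes>\<^sub>M nlborel)"
    using assms(1) unfolding nlborel_prod sets_nlborel by (simp add: pred_def)
  then have "{p \<in> space (nlborel \<Otimes>\<^sub>M nlborel). P (fst p, snd p)} \<in> sets (nlborel \<Otimes>\<^sub>M (nlborel :: 'b measure))"
    by (simp only: space_pair_measure space_nlborel) simp
  from nlborel_pair.AE_commute[OF this] assms(2)
  have "AE u in nlborel. AE v in nlborel. P (u, v)" by simp
  then have "AE p in nlborel \<Otimes>\<^sub>M nlborel. P p"
    by (rule nlborel_pair.AE_pair_measure[rotated]) (use P in \<open>simp only: space_pair_measure space_nlborel, simp\<close>)
  then show ?thesis by (simp only: nlborel_prod)
qed

lemma AE_pairD: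
  fixes P :: "'a::euclidean_space \<times> 'b::euclidean_space \<Rightarrow> bool"
  assumes "AE p in nlborel. P p"
  shows "AE u in nlborel. AE v in nlborel. P (u, v)"
proof -
  have "AE p in nlborel \<Otimes>\<^sub>M nlborel. P p" using assms by (simp only: nlborel_prod)
  from nlborel_pair.AE_pair[OF this] show ?thesis .
qed

lemma fourier_plancherel_fst_unique:
  fixes h :: "'a::euclidean_space \<times> 'b::euclidean_space \<Rightarrow> complex"
  assumes h: "h \<in> L2 nlborel" and [measurable]: "S \<in> borel_measurable borel"
    and S: "AE v in nlborel. plancherel_rel (\<lambda>u. h (u, v)) (\<lambda>\<xi>. S (\<xi>, v))"
  shows "AE p in nlborel. fourier_plancherel_fst h p = S p"
proof (rule AE_pair_swapI)
  have [measurable]: "h \<in> borel_measurable borel" "fourier_plancherel_fst h \<in> borel_measurable borel"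
    using h fourier_plancherel_fst_rel(1)[OF h] by (auto intro: L2_nlborel_measurable)
  show "Measurable.pred borel (\<lambda>p. fourier_plancherel_fst h p = S p)" by measurable
  show "AE v in nlborel. AE u in nlborel. fourier_plancherel_fst h (u, v) = S (u, v)"
    using S fourier_plancherel_fst_rel(2)[OF h]
  proof eventually_elim
    case (elim v)
    show ?case by (rule plancherel_rel_unique[OF elim(2,1)]) measurable
  qed
qed

lemma fourier_plancherel_fst_lin:
  fixes g h :: "'a::euclidean_space \<times> 'b::euclidean_space \<Rightarrow> complex"
  assumes g: "g \<in> L2 nlborel" and h: "h \<in> L2 nlborel"
  shows "AE p in nlborel. fourier_plancherel_fst (\<lambda>p. a * g p + b * h p) p
    = a * fourier_plancherel_fst g p + b * fourier_plancherel_fst h p"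
proof (rule fourier_plancherel_fst_unique)
  have [measurable]: "g \<in> borel_measurable borel" "h \<in> borel_measurable borel"
    "fourier_plancherel_fst g \<in> borel_measurable borel" "fourier_plancherel_fst h \<in> borel_measurable borel"
    using g h fourier_plancherel_fst_rel(1) by (auto intro!: L2_nlborel_measurable)
  show "(\<lambda>p. a * g p + b * h p) \<in> L2 nlborel" by (intro L2_add L2_cmult g h)
  show "(\<lambda>p. a * fourier_plancherel_fst g p + b * fourier_plancherel_fst h p) \<in> borel_measurable borel" by measurable
  show "AE v in nlborel. plancherel_rel (\<lambda>u. a * g (u, v) + b * h (u, v))
      (\<lambda>\<xi>. a * fourier_plancherel_fst g (\<xi>, v) + b * fourier_plancherel_fst h (\<xi>, v))"
    using fourier_plancherel_fst_rel(2)[OF g] fourier_plancherel_fst_rel(2)[OF h]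
  proof eventually_elim
    case (elim v)
    show ?case by (rule plancherel_rel_lin[OF elim]) measurable
  qed
qed

section \<open>The space \<open>H\<^sub>m\<close>\<close>

lemma integrable_lborel_scale_iff:
  fixes f :: "'a::euclidean_space \<Rightarrow> 'b::{banach,second_countable_topology}"
  assumes c: "c \<noteq> 0"
  shows "integrable lborel (\<lambda>x. f (c *\<^sub>R x)) \<longleftrightarrow> integrable lborel f"
  using integral_lborel_scale(1)[of f c] integral_lborel_scale(1)[of "\<lambda>x. f (c *\<^sub>R x)" "1 / c"] c by auto

lemma norm_cvec_sq: "(norm (cvec p))\<^sup>2 = (norm p)\<^sup>2"
  using norm_cvec[of "fst p" "snd p"] by (simp add: norm_pair_sq)

text \<open>The factor by which \<open>H_embed\<close> multiplies a rescaled Fock function. It never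
  vanishes, and its squared modulus is the Gaussian weight of the Fock space up to a
  constant.\<close>

definition twist :: "(real^'n) \<times> (real^'n) \<Rightarrow> complex" where
  "twist p = complex_of_real (2 powr (real CARD('n) / 2)) *
     exp (- complex_of_real ((norm p)\<^sup>2) / 2 - \<i> * complex_of_real (fst p \<bullet> snd p))"

lemma twist_measurable [measurable]: "twist \<in> borel_measurable borel"
  unfolding twist_def by (intro borel_measurable_continuous_onI continuous_intros) auto

lemma norm_twist_sq: "(norm (twist (p :: (real^'n) \<times> (real^'n))))\<^sup>2 = 2 powr real CARD('n) * exp (- (norm p)\<^sup>2)"
proof -
  have "(2 powr (real CARD('n) / 2))\<^sup>2 = 2 powr real CARD('n)"
    unfolding power2_eq_square powr_add[symmetric] by simp
  moreover have "Re (- complex_of_real ((norm p)\<^sup>2) / 2 - \<i> * complex_of_real (fst p \<bullet> snd p)) = - (norm p)\<^sup>2 / 2"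
    unfolding complex_of_real_def by simp
  ultimately show ?thesis
    unfolding twist_def norm_mult power_mult_distrib norm_exp_eq_Re by (simp add: exp_double[symmetric])
qed

lemma H_embed_eq: "H_embed \<alpha> f p = twist p * f ((1 / sqrt \<alpha>) *\<^sub>R cvec p)"
proof -
  have "(\<chi> r. (complex_of_real (fst p $ r) + \<i> * complex_of_real (snd p $ r)) / complex_of_real (sqrt \<alpha>)) = (1 / sqrt \<alpha>) *\<^sub>R cvec p"
    by (simp add: vec_eq_iff cvec_nth complex_eq_iff)
  moreover have "- complex_of_real ((norm (fst p))\<^sup>2) / 2 - complex_of_real ((norm (snd p))\<^sup>2) / 2 = - complex_of_real ((norm p)\<^sup>2) / 2"
    by (simp only: norm_pair_sq of_real_add) (simp add: field_simps)
  ultimately show ?thesis by (simp add: H_embed_def twist_def case_prod_beta')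
qed

lemma H_embed_measurable:
  assumes "poly_an m f"
  shows "(\<lambda>p. f ((1 / sqrt \<alpha>) *\<^sub>R cvec p)) \<in> borel_measurable borel" "H_embed \<alpha> f \<in> borel_measurable borel"
proof -
  have "continuous_on UNIV f" using assms by (intro smooth_continuous poly_an_smooth)
  then have [measurable]: "f \<in> borel_measurable borel" by (rule borel_measurable_continuous_onI)
  show "(\<lambda>p. f ((1 / sqrt \<alpha>) *\<^sub>R cvec p)) \<in> borel_measurable borel" by measurable
  then show "H_embed \<alpha> f \<in> borel_measurable borel"
    unfolding H_embed_eq[abs_def] by measurable
qed

text \<open>The dilation by 1/sqrt \<alpha> removes \<alpha> from the weight, so that from here on
  it enters only through the argument of f.\<close>

lemma fock_iff_gauss_sq:
  assumes \<alpha>: "\<alpha> > 0"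
  shows "f \<in> fock \<alpha> m \<longleftrightarrow> poly_an m f \<and> gauss_sq (\<lambda>p. f ((1 / sqrt \<alpha>) *\<^sub>R cvec p))"
proof (cases "poly_an m f")
  case True
  let ?F = "\<lambda>z. (norm (f z))\<^sup>2 * exp (- \<alpha> * (norm z)\<^sup>2)"
  have "continuous_on UNIV f" using True by (intro smooth_continuous poly_an_smooth)
  then have [measurable]: "f \<in> borel_measurable borel" by (rule borel_measurable_continuous_onI)
  have "integrable lborel ?F \<longleftrightarrow> integrable lborel (\<lambda>p. ?F (cvec p))"
    by (subst integrable_cvec_iff) auto
  also have "\<dots> \<longleftrightarrow> integrable lborel (\<lambda>p. ?F (cvec ((1 / sqrt \<alpha>) *\<^sub>R p)))"
    using \<alpha> by (intro integrable_lborel_scale_iff[symmetric]) auto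
  also have "(\<lambda>p. ?F (cvec ((1 / sqrt \<alpha>) *\<^sub>R p))) = (\<lambda>p. (norm (f ((1 / sqrt \<alpha>) *\<^sub>R cvec p)))\<^sup>2 * exp (- (norm p)\<^sup>2))"
    using \<alpha> by (simp add: fun_eq_iff cvec_scaleR norm_cvec_sq power_mult_distrib power_divide)
  finally show ?thesis
    using True H_embed_measurable(1)[OF True] by (simp add: fock_def m_analytic_iff_poly_an gauss_sq_def)
qed (simp add: fock_def m_analytic_iff_poly_an)

lemma fock_iff_L2:
  fixes f :: "complex^'n::{finite,linorder} \<Rightarrow> complex"
  assumes \<alpha>: "\<alpha> > 0"
  shows "f \<in> fock \<alpha> m \<longleftrightarrow> poly_an m f \<and> H_embed \<alpha> f \<in> L2 nlborel"
proof -
  have e: "(norm (H_embed \<alpha> f p))\<^sup>2 = (2 powr real CARD('n)) *\<^sub>R ((norm (f ((1 / sqrt \<alpha>) *\<^sub>R cvec p)))\<^sup>2 * exp (- (norm p)\<^sup>2))" for p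
    unfolding H_embed_eq norm_mult power_mult_distrib norm_twist_sq by (simp add: mult_ac)
  have "integrable nlborel (\<lambda>p. (norm (H_embed \<alpha> f p))\<^sup>2) \<longleftrightarrow>
     integrable lborel (\<lambda>p. (norm (f ((1 / sqrt \<alpha>) *\<^sub>R cvec p)))\<^sup>2 * exp (- (norm p)\<^sup>2))"
    unfolding e integrable_nlborel_iff by (rule integrable_scaleR_iff) simp
  then show ?thesis
    using H_embed_measurable[of m f \<alpha>] by (auto simp: fock_iff_gauss_sq[OF \<alpha>] gauss_sq_def L2_def)
qed

lemma H_space_L2: "\<alpha> > 0 \<Longrightarrow> H_space \<alpha> m \<subseteq> L2 nlborel"
  by (auto simp: H_space_def fock_iff_L2)

lemma H_space_lin:
  fixes g h :: "(real^'n::{finite,linorder}) \<times> (real^'n::{finite,linorder}) \<Rightarrow> complex"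
  assumes \<alpha>: "\<alpha> > 0" and g: "g \<in> H_space \<alpha> m" and h: "h \<in> H_space \<alpha> m"
  shows "(\<lambda>x. a * g x + b * h x) \<in> H_space \<alpha> m"
proof -
  obtain f f' where f: "f \<in> fock \<alpha> m" "g = H_embed \<alpha> f" and f': "f' \<in> fock \<alpha> m" "h = H_embed \<alpha> f'"
    using g h by (auto simp: H_space_def)
  have e: "(\<lambda>x. a * g x + b * h x) = H_embed \<alpha> (\<lambda>z. a * f z + b * f' z)"
    unfolding f(2) f'(2) H_embed_eq[abs_def] by (simp add: fun_eq_iff algebra_simps)
  moreover have "(\<lambda>z. a * f z + b * f' z) \<in> fock \<alpha> m"
    unfolding fock_iff_L2[OF \<alpha>] e[symmetric]
    using f f' by (auto simp: fock_iff_L2[OF \<alpha>] intro!: poly_an_add poly_an_cmult L2_add L2_cmult)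
  ultimately show ?thesis unfolding H_space_def by (metis imageI)
qed

section \<open>The right inverse of \<open>R\<close>\<close>

text \<open>A function that is not integrable has integral 0, so a nonzero integral of the square
  certifies integrability.\<close>

lemma L2I_integral_nonzero:
  fixes f :: "'a \<Rightarrow> real"
  assumes "f \<in> borel_measurable M" "(LINT x|M. complex_of_real (f x) * complex_of_real (f x)) \<noteq> 0"
  shows "(\<lambda>x. complex_of_real (f x)) \<in> L2 M"
proof -
  have "integrable M (\<lambda>x. complex_of_real (f x) * complex_of_real (f x))"
    using assms(2) not_integrable_integral_eq by blast
  then have "integrable M (\<lambda>x. norm (complex_of_real (f x) * complex_of_real (f x)))" by (rule integrable_norm)
  then show ?thesis using assms(1) by (simp add: L2_def norm_mult power2_eq_square)
qed

lemma q_fun_bounded: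
  obtains C where "C \<ge> 0" "\<And>\<xi> v. \<bar>q_fun k \<xi> v\<bar> \<le> C"
proof -
  obtain C where C: "C \<ge> 0" "\<And>\<xi> v. \<bar>q_fun k \<xi> v\<bar> \<le> C * exp (- (norm (\<xi> + 2 *\<^sub>R v))\<^sup>2 / 8)"
    using q_fun_bound[of k] by blast
  have "\<bar>q_fun k \<xi> v\<bar> \<le> C" for \<xi> v
  proof -
    have "C * exp (- (norm (\<xi> + 2 *\<^sub>R v))\<^sup>2 / 8) \<le> C * 1" using C(1) by (intro mult_left_mono) auto
    then show ?thesis using C(2)[of \<xi> v] by simp
  qed
  with C(1) show ?thesis using that by blast
qed

lemma q_fun_L2_snd: "(\<lambda>v. complex_of_real (q_fun k \<xi> v)) \<in> L2 nlborel"
  by (rule L2I_integral_nonzero) (auto simp: q_fun_orthonormal)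

lemma q_fun_L2_fst:
  fixes v :: "real^'n::finite"
  shows "(\<lambda>\<xi>. complex_of_real (q_fun k \<xi> v)) \<in> L2 nlborel"
proof -
  obtain C where C: "C \<ge> 0" "\<And>\<xi> v. \<bar>q_fun k \<xi> v\<bar> \<le> C * exp (- (norm (\<xi> + 2 *\<^sub>R v))\<^sup>2 / 8)"
    using q_fun_bound[of k] by blast
  have "integrable lborel (\<lambda>\<xi>::real^'n. exp (- (1/4) * (norm (\<xi> + 2 *\<^sub>R v))\<^sup>2))"
    using integrable_lborel_plus_iff(1)[of "\<lambda>\<xi>::real^'n. exp (- (1/4) * (norm \<xi>)\<^sup>2)" "2 *\<^sub>R v"]
      integrable_exp_norm[of "1/4" 0, where 'a="real^'n"] by simp
  then have i: "integrable lborel (\<lambda>\<xi>::real^'n. C\<^sup>2 * exp (- (1/4) * (norm (\<xi> + 2 *\<^sub>R v))\<^sup>2))" by simp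
  have "integrable lborel (\<lambda>\<xi>. (norm (complex_of_real (q_fun k \<xi> v)))\<^sup>2)"
  proof (rule Bochner_Integration.integrable_bound[OF i])
    show "AE \<xi> in lborel. norm ((norm (complex_of_real (q_fun k \<xi> v)))\<^sup>2) \<le> norm (C\<^sup>2 * exp (- (1/4) * (norm (\<xi> + 2 *\<^sub>R v))\<^sup>2))"
    proof (rule AE_I2)
      fix \<xi> :: "real^'n"
      have "(norm (complex_of_real (q_fun k \<xi> v)))\<^sup>2 \<le> (C * exp (- (norm (\<xi> + 2 *\<^sub>R v))\<^sup>2 / 8))\<^sup>2"
        using C(2)[of \<xi> v] by (intro power_mono) auto
      also have "\<dots> = C\<^sup>2 * exp (- (1/4) * (norm (\<xi> + 2 *\<^sub>R v))\<^sup>2)"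
        by (simp add: power_mult_distrib exp_double[symmetric])
      finally show "norm ((norm (complex_of_real (q_fun k \<xi> v)))\<^sup>2) \<le> norm (C\<^sup>2 * exp (- (1/4) * (norm (\<xi> + 2 *\<^sub>R v))\<^sup>2))"
        by simp
    qed
  qed simp
  then show ?thesis by (simp add: L2_def integrable_nlborel_iff)
qed

lemma L2_mult_q_fun:
  fixes v :: "real^'n::finite"
  assumes h: "h \<in> L2 nlborel"
  shows "integrable nlborel (\<lambda>\<xi>. h \<xi> * complex_of_real (q_fun k \<xi> v))"
    and "(\<lambda>\<xi>. h \<xi> * complex_of_real (q_fun k \<xi> v)) \<in> L2 nlborel"
proof -
  show "integrable nlborel (\<lambda>\<xi>. h \<xi> * complex_of_real (q_fun k \<xi> v))"
    by (rule L2_mult_integrable[OF h q_fun_L2_fst])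
  obtain C where "C \<ge> 0" "\<And>\<xi> v. \<bar>q_fun k \<xi> v\<bar> \<le> C" using q_fun_bounded[of k] by blast
  then show "(\<lambda>\<xi>. h \<xi> * complex_of_real (q_fun k \<xi> v)) \<in> L2 nlborel"
    by (intro L2_bounded_mult[OF h, where B = C]) auto
qed

lemma LINT_sum_q_fun:
  assumes "finite I" "inj_on \<kappa> I" "j \<in> I"
  shows "(LINT v|nlborel. (\<Sum>i\<in>I. c i * complex_of_real (q_fun (\<kappa> i) \<xi> v)) * complex_of_real (q_fun (\<kappa> j) \<xi> v)) = c j"
proof -
  have i: "integrable nlborel (\<lambda>v. c i * (complex_of_real (q_fun (\<kappa> i) \<xi> v) * complex_of_real (q_fun (\<kappa> j) \<xi> v)))" for i
    by (intro integrable_mult_right L2_mult_integrable q_fun_L2_snd)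
  have "(LINT v|nlborel. (\<Sum>i\<in>I. c i * complex_of_real (q_fun (\<kappa> i) \<xi> v)) * complex_of_real (q_fun (\<kappa> j) \<xi> v))
    = (\<Sum>i\<in>I. c i * (LINT v|nlborel. complex_of_real (q_fun (\<kappa> i) \<xi> v) * complex_of_real (q_fun (\<kappa> j) \<xi> v)))"
    unfolding sum_distrib_right mult.assoc by (subst Bochner_Integration.integral_sum) (use i in auto)
  also have "\<dots> = (\<Sum>i\<in>I. if i = j then c i else 0)"
    using assms by (intro sum.cong) (auto simp: q_fun_orthonormal inj_on_def)
  finally show ?thesis using assms by simp
qed

lemma complex_LINT_norm_sq:
  "complex_of_real (LINT x|M. (norm (f x))\<^sup>2) = (LINT x|M. f x * cnj (f x))"
  by (simp only: complex_norm_square[symmetric] integral_complex_of_real of_real_power[symmetric])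

text \<open>Parseval's identity in v for fixed \<xi>; the coefficients c i will be the values of the
  h i at \<xi>.\<close>

lemma sqint_sum_q_fun:
  assumes I: "finite I" "inj_on \<kappa> I"
  shows "sqint nlborel (\<lambda>v. \<Sum>i\<in>I. c i * complex_of_real (q_fun (\<kappa> i) \<xi> v)) = (\<Sum>i\<in>I. ennreal ((norm (c i))\<^sup>2))"
proof -
  let ?f = "\<lambda>v. \<Sum>i\<in>I. c i * complex_of_real (q_fun (\<kappa> i) \<xi> v)"
  have L2: "?f \<in> L2 nlborel" by (intro L2_sum L2_cmult q_fun_L2_snd)
  have i: "integrable nlborel (\<lambda>v. cnj (c j) * (?f v * complex_of_real (q_fun (\<kappa> j) \<xi> v)))" for j
    by (intro integrable_mult_right L2_mult_integrable q_fun_L2_snd L2)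
  have "complex_of_real (LINT v|nlborel. (norm (?f v))\<^sup>2) = (LINT v|nlborel. ?f v * cnj (?f v))"
    by (rule complex_LINT_norm_sq)
  also have "\<dots> = (LINT v|nlborel. (\<Sum>j\<in>I. cnj (c j) * (?f v * complex_of_real (q_fun (\<kappa> j) \<xi> v))))"
    by (simp add: sum_distrib_left mult_ac)
  also have "\<dots> = (\<Sum>j\<in>I. LINT v|nlborel. cnj (c j) * (?f v * complex_of_real (q_fun (\<kappa> j) \<xi> v)))"
    by (rule Bochner_Integration.integral_sum) (rule i)
  also have "\<dots> = (\<Sum>j\<in>I. cnj (c j) * c j)"
    by (intro sum.cong refl) (simp only: Bochner_Integration.integral_mult_right_zero LINT_sum_q_fun[OF I])
  also have "\<dots> = complex_of_real (\<Sum>j\<in>I. (norm (c j))\<^sup>2)"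
    by (simp only: of_real_sum complex_norm_square mult.commute)
  finally have "(LINT v|nlborel. (norm (?f v))\<^sup>2) = (\<Sum>j\<in>I. (norm (c j))\<^sup>2)"
    unfolding of_real_eq_iff .
  then show ?thesis
    using nn_integral_L2_eq[OF L2] by (simp add: L2_norm_def sum_nonneg sum_ennreal)
qed

section \<open>Synthesis from the functions q\<close>

definition hermite_synthesis :: "('i \<Rightarrow> 'n::finite \<Rightarrow> nat) \<Rightarrow> 'i set \<Rightarrow> ('i \<Rightarrow> real^'n \<Rightarrow> complex) \<Rightarrow> (real^'n) \<times> (real^'n) \<Rightarrow> complex" where
  "hermite_synthesis \<kappa> I h p = (\<Sum>i\<in>I. h i (fst p) * complex_of_real (q_fun (\<kappa> i) (fst p) (snd p)))"

lemma hermite_synthesis_L2: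
  fixes h :: "'i \<Rightarrow> real^'n::finite \<Rightarrow> complex"
  assumes I: "finite I" "inj_on \<kappa> I" and h: "\<And>i. i \<in> I \<Longrightarrow> h i \<in> L2 nlborel"
  shows "hermite_synthesis \<kappa> I h \<in> L2 nlborel"
    and "sqint nlborel (hermite_synthesis \<kappa> I h) = (\<Sum>i\<in>I. sqint nlborel (h i))"
    and "integrable nlborel (\<lambda>\<xi>. hermite_synthesis \<kappa> I h (\<xi>, v))"
    and "(\<lambda>\<xi>. hermite_synthesis \<kappa> I h (\<xi>, v)) \<in> L2 nlborel"
proof -
  have hm: "h i \<in> borel_measurable borel" if "i \<in> I" for i using L2_nlborel_measurable[OF h[OF that]] .
  have hm': "(\<lambda>p. h i (fst p)) \<in> borel_measurable (borel :: ((real^'n) \<times> (real^'n)) measure)" if "i \<in> I" for i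
    by (rule measurable_compose[OF borel_measurable_continuous_onI[OF continuous_on_fst[OF continuous_on_id]] hm[OF that]])
  have m: "hermite_synthesis \<kappa> I h \<in> borel_measurable borel"
    unfolding hermite_synthesis_def by (intro borel_measurable_sum borel_measurable_times hm') auto
  have "sqint nlborel (hermite_synthesis \<kappa> I h) = (\<integral>\<^sup>+\<xi>. (\<Sum>i\<in>I. ennreal ((norm (h i \<xi>))\<^sup>2)) \<partial>nlborel)"
    unfolding sqint_Fubini(2)[OF m] unfolding hermite_synthesis_def fst_conv snd_conv by (simp only: sqint_sum_q_fun[OF I])
  also have "\<dots> = (\<Sum>i\<in>I. sqint nlborel (h i))"
    by (rule nn_integral_sum) (use hm in auto)
  finally show sq: "sqint nlborel (hermite_synthesis \<kappa> I h) = (\<Sum>i\<in>I. sqint nlborel (h i))" .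
  have "(\<Sum>i\<in>I. sqint nlborel (h i)) < \<infinity>"
    using h I(1) by (simp add: L2_iff ennreal_sum_less_top)
  then show "hermite_synthesis \<kappa> I h \<in> L2 nlborel"
    unfolding L2_iff sq using m by simp
  show "integrable nlborel (\<lambda>\<xi>. hermite_synthesis \<kappa> I h (\<xi>, v))"
    unfolding hermite_synthesis_def using h by (auto intro!: Bochner_Integration.integrable_sum L2_mult_q_fun)
  show "(\<lambda>\<xi>. hermite_synthesis \<kappa> I h (\<xi>, v)) \<in> L2 nlborel"
    unfolding hermite_synthesis_def using h by (auto intro!: L2_sum L2_mult_q_fun)
qed

section \<open>The inverse transform of a synthesis\<close>

lemma sqint_uminus:
  fixes f :: "'a::euclidean_space \<Rightarrow> complex"
  assumes [measurable]: "f \<in> borel_measurable borel"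
  shows "sqint nlborel (\<lambda>u. f (- u)) = sqint nlborel f"
proof -
  have "(\<integral>\<^sup>+x. ennreal ((norm (f x))\<^sup>2) \<partial>lborel) = (\<integral>\<^sup>+x. ennreal ((norm (f (- x)))\<^sup>2) \<partial>lborel)"
    using nn_integral_lborel_scale[of "\<lambda>x. ennreal ((norm (f x))\<^sup>2)" "-1"] by simp
  then show ?thesis by (subst (1 2) nn_integral_nlborel) auto
qed

text \<open>The inverse transform \<open>u \<mapsto> a\<^bsup>\<and>\<^esup>(-u)\<close> preserves the norm because \<open>a\<close> is in turn its
  Fourier--Plancherel transform; testing this against the conjugate of \<open>a\<close> yields the isometry.\<close>

lemma sqint_inverse_fourier:
  fixes a :: "'a::euclidean_space \<Rightarrow> complex"
  assumes a: "integrable nlborel a" "a \<in> L2 nlborel"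
    and rel: "plancherel_rel (\<lambda>u. fourier_integral a (- u)) B"
  shows "sqint nlborel (\<lambda>u. fourier_integral a (- u)) = sqint nlborel a"
proof -
  let ?G = "\<lambda>u. fourier_integral a (- u)"
  have am[measurable]: "a \<in> borel_measurable borel" using a(2) by (rule L2_nlborel_measurable)
  have Gm: "?G \<in> borel_measurable borel" by measurable
  have G: "?G \<in> L2 nlborel"
    using fourier_L2[OF a] sqint_uminus[of "fourier_integral a"] Gm by (simp add: L2_iff)
  have "plancherel_rel ?G a"
    by (rule plancherel_rel_AE_cong[OF rel plancherel_rel_inversion[OF a rel] am])
  then have "(LINT x|nlborel. a x * cnj (a x)) = (LINT x|nlborel. ?G x * fourier_integral (\<lambda>x. cnj (a x)) x)"
    using a by (intro plancherel_rel_mult_formula G L2_cnj) auto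
  also have "\<dots> = (LINT x|nlborel. ?G x * cnj (?G x))"
    by (simp add: fourier_cnj)
  finally have "(LINT x|nlborel. (norm (a x))\<^sup>2) = (LINT x|nlborel. (norm (?G x))\<^sup>2)"
    unfolding complex_LINT_norm_sq[symmetric] of_real_eq_iff .
  then show ?thesis
    unfolding nn_integral_L2_eq[OF G] nn_integral_L2_eq[OF a(2)] L2_norm_def by simp
qed

text \<open>e^(-|\<xi>|^2/4) is the part of the Gaussian in q that does not involve v. By
  Cauchy-Schwarz it gives every square-integrable h the decay that an entire Fourier-Laplace
  transform requires.\<close>

lemma superexp_gauss:
  fixes h :: "'a::euclidean_space \<Rightarrow> complex"
  assumes h: "h \<in> L2 nlborel"
  shows "superexp (\<lambda>\<xi>. h \<xi> * complex_of_real (exp (- (norm \<xi>)\<^sup>2 / 4)))"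
proof -
  have [measurable]: "h \<in> borel_measurable borel" using h by (rule L2_nlborel_measurable)
  have "integrable nlborel (\<lambda>\<xi>. norm (h \<xi> * complex_of_real (exp (- (norm \<xi>)\<^sup>2 / 4))) * exp (c * norm \<xi>))" for c
  proof -
    let ?E = "\<lambda>\<xi>::'a. complex_of_real (exp (- (norm \<xi>)\<^sup>2 / 4 + c * norm \<xi>))"
    have e: "(norm (?E \<xi>))\<^sup>2 = exp (- (1/2) * (norm \<xi>)\<^sup>2 + (2 * c) * norm \<xi>)" for \<xi>
      by (simp add: exp_double[symmetric] algebra_simps)
    have "integrable nlborel (\<lambda>\<xi>. (norm (?E \<xi>))\<^sup>2)"
      unfolding e integrable_nlborel_iff by (rule integrable_exp_norm) simp
    then have "?E \<in> L2 nlborel" by (simp add: L2_def)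
    from integrable_norm[OF L2_mult_integrable[OF h this]]
    show ?thesis by (simp add: norm_mult mult.assoc flip: exp_add)
  qed
  then show ?thesis unfolding superexp_def by simp
qed

lemma cdot_cvec: "cdot \<xi> (cvec p) = complex_of_real (\<xi> \<bullet> fst p) + \<i> * complex_of_real (\<xi> \<bullet> snd p)"
  by (simp add: cdot_def cvec_nth inner_vec_def Complex_eq distrib_left sum.distrib sum_distrib_left mult_ac)

lemma sum_cvec_sq:
  "(\<Sum>r\<in>UNIV. (cvec p $ r)\<^sup>2) = complex_of_real ((norm (fst p))\<^sup>2 - (norm (snd p))\<^sup>2) + \<i> * complex_of_real (2 * (fst p \<bullet> snd p))"
proof -
  have "(cvec p $ r)\<^sup>2 = complex_of_real ((fst p $ r)\<^sup>2 - (snd p $ r)\<^sup>2) + \<i> * complex_of_real (2 * (fst p $ r * snd p $ r))" for r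
    by (simp add: cvec_nth complex_eq_iff power2_eq_square)
  then show ?thesis
    by (simp add: norm_sq_vec inner_vec_def sum.distrib sum_subtractf sum_distrib_left)
qed

lemma norm_plus_2_sq:
  fixes \<xi> v :: "'a::real_inner"
  shows "(norm (\<xi> + 2 *\<^sub>R v))\<^sup>2 = (norm \<xi>)\<^sup>2 + 4 * (norm v)\<^sup>2 + 4 * (\<xi> \<bullet> v)"
  unfolding norm_plus_sq by (simp add: power_mult_distrib)

text \<open>For z = x + i y the exponent z.z/2 is (|x|^2 - |y|^2)/2 + i x.y. It cancels the phase
  and the x-part of \<open>twist\<close> and leaves -|y|^2, which explains the holomorphic factor in
  the preimage f.\<close>

lemma twist_exp_square:
  fixes p :: "(real^'n) \<times> (real^'n)"
  shows "twist p * (exp ((\<Sum>r\<in>UNIV. (cvec p $ r)\<^sup>2) / 2) * complex_of_real (2 powr (- (real CARD('n) / 2))))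
    = complex_of_real (exp (- (norm (snd p))\<^sup>2))"
proof -
  have assoc: "A * C * (D * B) = E" if "A * B = 1" "C * D = E" for A B C D E :: complex
  proof -
    have "A * C * (D * B) = (A * B) * (C * D)" by (simp only: mult_ac)
    then show ?thesis using that by simp
  qed
  have "complex_of_real (2 powr (real CARD('n) / 2)) * complex_of_real (2 powr (- (real CARD('n) / 2))) = 1"
    by (simp flip: of_real_mult powr_add)
  moreover have "- complex_of_real ((norm p)\<^sup>2) / 2 - \<i> * complex_of_real (fst p \<bullet> snd p) + (\<Sum>r\<in>UNIV. (cvec p $ r)\<^sup>2) / 2
      = complex_of_real (- (norm (snd p))\<^sup>2)"
    unfolding sum_cvec_sq norm_pair_sq by (simp add: field_simps)
  then have "exp (- complex_of_real ((norm p)\<^sup>2) / 2 - \<i> * complex_of_real (fst p \<bullet> snd p)) * exp ((\<Sum>r\<in>UNIV. (cvec p $ r)\<^sup>2) / 2)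
      = complex_of_real (exp (- (norm (snd p))\<^sup>2))"
    by (simp only: exp_add[symmetric] exp_of_real)
  ultimately show ?thesis
    unfolding twist_def by (rule assoc)
qed

text \<open>The Gaussian in q has exponent -|\<xi>|^2/4 - \<xi>.v - |v|^2. Its middle term joins i
  \<xi>.u to form i \<xi>.(u + i v), so the inverse Fourier integral becomes a Fourier-Laplace
  transform at the complex point; s only rescales that point.\<close>

lemma fourier_mult_q_fun:
  fixes p :: "(real^'n::finite) \<times> (real^'n)"
  assumes s: "s > 0"
  shows "fourier_integral (\<lambda>\<xi>. h \<xi> * complex_of_real (q_fun k \<xi> (snd p))) (- fst p)
    = complex_of_real (exp (- (norm (snd p))\<^sup>2)) * (complex_of_real (q_const k) *
       exp_transform s (\<lambda>\<xi>. (h \<xi> * complex_of_real (exp (- (norm \<xi>)\<^sup>2 / 4))) * complex_of_real (herm_prod k \<xi> (imv s ((1 / s) *\<^sub>R cvec p)))) ((1 / s) *\<^sub>R cvec p))"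
proof -
  have v: "imv s ((1 / s) *\<^sub>R cvec p) = snd p"
    using s by (simp add: imv_def vec_eq_iff cvec_nth)
  have e: "h \<xi> * complex_of_real (q_fun k \<xi> (snd p)) * exp (- \<i> * complex_of_real (\<xi> \<bullet> - fst p))
    = complex_of_real (exp (- (norm (snd p))\<^sup>2)) * (complex_of_real (q_const k) *
      (h \<xi> * complex_of_real (exp (- (norm \<xi>)\<^sup>2 / 4)) * complex_of_real (herm_prod k \<xi> (snd p)) *
        exp (\<i> * complex_of_real s * cdot \<xi> ((1 / s) *\<^sub>R cvec p))))" for \<xi>
  proof -
    have z: "\<i> * complex_of_real s * cdot \<xi> ((1 / s) *\<^sub>R cvec p) = - \<i> * complex_of_real (\<xi> \<bullet> - fst p) + complex_of_real (- (\<xi> \<bullet> snd p))"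
      using s unfolding cdot_scaleR cdot_cvec by (simp add: scaleR_conv_of_real algebra_simps)
    have "exp (- (norm (\<xi> + 2 *\<^sub>R snd p))\<^sup>2 / 4) = exp (- (norm \<xi>)\<^sup>2 / 4) * exp (- (norm (snd p))\<^sup>2) * exp (- (\<xi> \<bullet> snd p))"
      unfolding norm_plus_2_sq exp_add[symmetric] by (simp add: field_simps)
    then show ?thesis
      unfolding z exp_add exp_of_real q_fun_eq by simp
  qed
  show ?thesis
    unfolding fourier_integral_def exp_transform_def e v by simp
qed

text \<open>The preimage has to be exhibited as \<open>H_embed\<close> of a concrete f. The degree
  of \<open>herm_prod (\<kappa> i)\<close> in v is at most m - 1, and this is the source of the
  order m of f.\<close>

lemma hermite_synthesis_inverse:
  fixes h :: "'i \<Rightarrow> real^'n::{finite,linorder} \<Rightarrow> complex"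
  assumes \<alpha>: "\<alpha> > 0" and m: "m \<ge> 1" and I: "finite I" "inj_on \<kappa> I" and J: "\<And>i. i \<in> I \<Longrightarrow> \<kappa> i \<in> J_set m"
    and h: "\<And>i. i \<in> I \<Longrightarrow> h i \<in> L2 nlborel"
  obtains G where "G \<in> H_space \<alpha> m"
    and "AE p in nlborel. fourier_plancherel_fst G p = hermite_synthesis \<kappa> I h p"
    and "sqint nlborel G = (\<Sum>i\<in>I. sqint nlborel (h i))"
proof -
  define a where "a = hermite_synthesis \<kappa> I h"
  define s where "s = sqrt \<alpha>"
  have s: "s > 0" "s\<^sup>2 = \<alpha>" using \<alpha> by (simp_all add: s_def)
  define G where "G p = fourier_integral (\<lambda>\<xi>. a (\<xi>, snd p)) (- fst p)" for p
  \<comment> \<open>Obtained by solving G = \<open>H_embed \<alpha> f\<close> for f: the quotient of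
    e^(-|v|^2) by \<open>twist\<close> supplies the quadratic exponential and the power of 2, and
    \<alpha>/2 stands for 1/2 because z is rescaled by sqrt \<alpha>.\<close>
  define f where "f z = exp (complex_of_real (\<alpha> / 2) * (\<Sum>r\<in>UNIV. (z $ r)\<^sup>2)) * (complex_of_real (2 powr (- (real CARD('n) / 2))) *
    (\<Sum>i\<in>I. complex_of_real (q_const (\<kappa> i)) * exp_transform s (\<lambda>\<xi>. (h i \<xi> * complex_of_real (exp (- (norm \<xi>)\<^sup>2 / 4))) * complex_of_real (herm_prod (\<kappa> i) \<xi> (imv s z))) z))" for z
  have aL2: "a \<in> L2 nlborel" and asq: "sqint nlborel a = (\<Sum>i\<in>I. sqint nlborel (h i))"
    and a1: "integrable nlborel (\<lambda>\<xi>. a (\<xi>, v))" and a2: "(\<lambda>\<xi>. a (\<xi>, v)) \<in> L2 nlborel" for v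
    using hermite_synthesis_L2[OF I h] unfolding a_def by auto
  have am: "a \<in> borel_measurable borel" using aL2 by (rule L2_nlborel_measurable)
  have f: "poly_an m f"
    unfolding f_def
  proof (rule poly_an_mult_hol[OF poly_an_exp_square], rule poly_an_cmult, rule poly_an_sum, rule poly_an_cmult)
    fix i assume i: "i \<in> I"
    have "Suc (\<Sum>r\<in>UNIV. \<kappa> i r) \<le> m" using J[OF i] m by (simp add: J_set_def)
    then show "poly_an m (\<lambda>z. exp_transform s (\<lambda>\<xi>. (h i \<xi> * complex_of_real (exp (- (norm \<xi>)\<^sup>2 / 4))) * complex_of_real (herm_prod (\<kappa> i) \<xi> (imv s z))) z)"
      by (rule poly_an_mono[OF _ poly_an_poly_xv[OF poly_xv_herm_prod superexp_gauss[OF h[OF i]] s(1)]])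
  qed
  have Gf: "G = H_embed \<alpha> f"
  proof
    fix p :: "(real^'n::{finite,linorder}) \<times> (real^'n::{finite,linorder})"
    let ?T = "\<lambda>i. complex_of_real (q_const (\<kappa> i)) * exp_transform s (\<lambda>\<xi>. (h i \<xi> * complex_of_real (exp (- (norm \<xi>)\<^sup>2 / 4))) * complex_of_real (herm_prod (\<kappa> i) \<xi> (imv s ((1 / s) *\<^sub>R cvec p)))) ((1 / s) *\<^sub>R cvec p)"
    have "G p = (\<Sum>i\<in>I. fourier_integral (\<lambda>\<xi>. h i \<xi> * complex_of_real (q_fun (\<kappa> i) \<xi> (snd p))) (- fst p))"
      unfolding G_def a_def hermite_synthesis_def fourier_integral_def fst_conv snd_conv sum_distrib_right
      by (rule Bochner_Integration.integral_sum) (rule fourier_integrable[OF L2_mult_q_fun(1)[OF h]])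
    also have "\<dots> = (\<Sum>i\<in>I. complex_of_real (exp (- (norm (snd p))\<^sup>2)) * ?T i)"
      by (simp only: fourier_mult_q_fun[OF s(1)])
    also have "\<dots> = complex_of_real (exp (- (norm (snd p))\<^sup>2)) * (\<Sum>i\<in>I. ?T i)"
      by (simp only: sum_distrib_left)
    also have "\<dots> = twist p * (exp ((\<Sum>r\<in>UNIV. (cvec p $ r)\<^sup>2) / 2) * complex_of_real (2 powr (- (real CARD('n) / 2)))) * (\<Sum>i\<in>I. ?T i)"
      by (simp only: twist_exp_square)
    also have "(\<Sum>r\<in>UNIV. (cvec p $ r)\<^sup>2) / 2 = complex_of_real (\<alpha> / 2) * (\<Sum>r\<in>UNIV. (((1 / s) *\<^sub>R cvec p) $ r)\<^sup>2)"
    proof -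
      have "(((1 / s) *\<^sub>R cvec p) $ r)\<^sup>2 = complex_of_real (1 / \<alpha>) * (cvec p $ r)\<^sup>2" for r
        using s by (simp add: power_mult_distrib power_divide scaleR_conv_of_real[of _ "_::complex"] flip: of_real_power)
      then show ?thesis using \<alpha> by (simp only: sum_distrib_left[symmetric]) simp
    qed
    also have "twist p * (exp (complex_of_real (\<alpha> / 2) * (\<Sum>r\<in>UNIV. (((1 / s) *\<^sub>R cvec p) $ r)\<^sup>2)) * complex_of_real (2 powr (- (real CARD('n) / 2)))) * (\<Sum>i\<in>I. ?T i)
        = twist p * f ((1 / s) *\<^sub>R cvec p)"
      unfolding f_def by (simp only: mult.assoc)
    finally show "G p = H_embed \<alpha> f p"
      unfolding H_embed_eq s_def[symmetric] .
  qed
  have Gm: "G \<in> borel_measurable borel"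
    unfolding Gf by (rule H_embed_measurable(2)[OF f])
  have sec: "G (u, v) = fourier_integral (\<lambda>\<xi>. a (\<xi>, v)) (- u)" for u v
    by (simp add: G_def)
  \<comment> \<open>Only an inequality at this stage: membership of G in \<open>L2\<close> must come
    first, since it gives almost every section a Plancherel transform and so makes the inversion
    lemma applicable.\<close>
  have "sqint nlborel G = (\<integral>\<^sup>+v. sqint nlborel (\<lambda>u. fourier_integral (\<lambda>\<xi>. a (\<xi>, v)) (- u)) \<partial>nlborel)"
    unfolding sqint_Fubini(1)[OF Gm] sec ..
  also have "\<dots> = (\<integral>\<^sup>+v. sqint nlborel (fourier_integral (\<lambda>\<xi>. a (\<xi>, v))) \<partial>nlborel)"
    by (simp only: sqint_uminus[OF fourier_measurable[OF L2_nlborel_measurable[OF a2]]])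
  also have "\<dots> \<le> (\<integral>\<^sup>+v. sqint nlborel (\<lambda>\<xi>. a (\<xi>, v)) \<partial>nlborel)"
    by (intro nn_integral_mono fourier_contraction a1)
  also have "\<dots> = sqint nlborel a" by (rule sqint_Fubini(1)[OF am, symmetric])
  also have "\<dots> < \<infinity>" using aL2 by (simp add: L2_iff)
  finally have G: "G \<in> L2 nlborel" using Gm by (simp add: L2_iff)
  then have "f \<in> fock \<alpha> m" using f by (simp add: fock_iff_L2[OF \<alpha>] Gf)
  then have GH: "G \<in> H_space \<alpha> m" unfolding Gf H_space_def by (rule imageI)
  have rel: "AE v in nlborel. plancherel_rel (\<lambda>u. fourier_integral (\<lambda>\<xi>. a (\<xi>, v)) (- u)) (\<lambda>\<xi>. fourier_plancherel_fst G (\<xi>, v))"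
    using fourier_plancherel_fst_rel(2)[OF G] unfolding sec .
  have inv: "AE v in nlborel. AE \<xi> in nlborel. fourier_plancherel_fst G (\<xi>, v) = a (\<xi>, v)"
    using rel by eventually_elim (rule plancherel_rel_inversion[OF a1 a2])
  have "AE p in nlborel. fourier_plancherel_fst G p = a p"
    by (rule AE_pair_swapI[OF _ inv])
      (use am L2_nlborel_measurable[OF fourier_plancherel_fst_rel(1)[OF G]] in measurable)
  \<comment> \<open>With the transform available the inequality becomes an equality on almost every
    section.\<close>
  moreover have "AE v in nlborel. sqint nlborel (\<lambda>u. fourier_integral (\<lambda>\<xi>. a (\<xi>, v)) (- u)) = sqint nlborel (\<lambda>\<xi>. a (\<xi>, v))"
    using rel by eventually_elim (rule sqint_inverse_fourier[OF a1 a2])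
  then have "sqint nlborel G = sqint nlborel a"
    unfolding sqint_Fubini(1)[OF Gm] sqint_Fubini(1)[OF am] sec by (rule nn_integral_cong_AE)
  ultimately show ?thesis using that[OF GH] asq unfolding a_def by simp
qed

section \<open>Injectivity of \<open>R\<close>\<close>

lemma LINT_nlborel_pair:
  fixes f :: "'a::euclidean_space \<times> 'b::euclidean_space \<Rightarrow> complex"
  assumes f: "integrable nlborel f"
  shows "(LINT p|nlborel. f p) = (LINT v|nlborel. LINT u|nlborel. f (u, v))"
    and "(LINT p|nlborel. f p) = (LINT u|nlborel. LINT v|nlborel. f (u, v))"
  using nlborel_pair.integral_snd[of "\<lambda>u v. f (u, v)"] nlborel_pair.integral_fst[of "\<lambda>u v. f (u, v)"] f
  by (simp_all add: nlborel_prod)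

section \<open>Growth of the test factors\<close>

lemma exp_growth_prod: "(\<And>i. i \<in> I \<Longrightarrow> exp_growth (K i)) \<Longrightarrow> exp_growth (\<lambda>p. \<Prod>i\<in>I. K i p)"
  by (induction I rule: infinite_finite_induct) (auto intro: exp_growth_const exp_growth_mult)

lemma exp_growth_poly:
  assumes t: "exp_growth (\<lambda>p. complex_of_real (t p))"
  shows "exp_growth (\<lambda>p. complex_of_real (poly q (t p)))"
proof (induction q)
  case 0
  show ?case using exp_growth_const[of 0] by simp
next
  case (pCons a q)
  show ?case
    using exp_growth_add[OF exp_growth_const exp_growth_mult[OF t pCons.IH], of "complex_of_real a"] by simp
qed

lemma exp_growth_nth:
  "exp_growth (\<lambda>v::real^'n::finite. complex_of_real (v $ r))"
  "exp_growth (\<lambda>p::(real^'n) \<times> (real^'n). complex_of_real (snd p $ r))"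
proof -
  show "exp_growth (\<lambda>v::real^'n. complex_of_real (v $ r))"
    by (rule exp_growth_le_norm[where C = 1]) (auto simp: component_le_norm_cart)
  have "\<bar>snd p $ r\<bar> \<le> norm p" for p :: "(real^'n) \<times> (real^'n)"
    using component_le_norm_cart[of "snd p" r] norm_snd_le[of "snd p" "fst p"] by simp
  then show "exp_growth (\<lambda>p::(real^'n) \<times> (real^'n). complex_of_real (snd p $ r))"
    by (intro exp_growth_le_norm[where C = 1] borel_measurable_continuous_onI continuous_intros) auto
qed

lemma exp_growth_vprod:
  fixes c :: "real^'n::finite"
  shows "exp_growth (\<lambda>v. vprod rs c v)" "exp_growth (\<lambda>p::(real^'n) \<times> (real^'n). vprod rs c (snd p))"
proof -
  have e: "complex_of_real (v $ r - c $ r) = complex_of_real (v $ r) + complex_of_real (- c $ r)" for v r by simp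
  show "exp_growth (\<lambda>v. vprod rs c v)" "exp_growth (\<lambda>p::(real^'n) \<times> (real^'n). vprod rs c (snd p))"
    unfolding vprod_def e by (intro exp_growth_prod_list exp_growth_add exp_growth_nth exp_growth_const)+
qed

lemma exp_growth_herm_prod: "exp_growth (\<lambda>v. complex_of_real (herm_prod k \<xi> v))"
proof -
  have e: "complex_of_real ((\<xi> $ r + 2 * v $ r) / sqrt 2) = complex_of_real (\<xi> $ r / sqrt 2) + complex_of_real (2 / sqrt 2) * complex_of_real (v $ r)" for r v
    by (simp add: add_divide_distrib)
  show ?thesis
    unfolding herm_prod_def of_real_prod
    by (intro exp_growth_prod exp_growth_poly, unfold e) (intro exp_growth_add exp_growth_mult exp_growth_const exp_growth_nth)
qed

lemma exp_growth_inner: "exp_growth (\<lambda>v. complex_of_real (exp (- (\<xi> \<bullet> v))))"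
proof -
  have "exp_growth (\<lambda>v. exp (complex_of_real (- (\<xi> \<bullet> v))))"
    by (rule exp_growth_exp[where C = "norm \<xi>"]) (auto simp: Cauchy_Schwarz_ineq2)
  then show ?thesis by (simp only: exp_of_real)
qed

lemma exp_growth_gauss_L2:
  assumes K: "exp_growth K"
  shows "(\<lambda>v. K v * complex_of_real (exp (- (norm (\<xi> + 2 *\<^sub>R v))\<^sup>2 / 4))) \<in> L2 nlborel"
proof -
  let ?L = "\<lambda>v. K v * complex_of_real (exp (- (\<xi> \<bullet> v)))"
  have [measurable]: "K \<in> borel_measurable borel" using K by (rule exp_growth_measurable)
  have e: "exp (- (norm (\<xi> + 2 *\<^sub>R v))\<^sup>2 / 4) = exp (- (norm \<xi>)\<^sup>2 / 4) * (exp (- (\<xi> \<bullet> v)) * exp (- (norm v)\<^sup>2))" for v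
    unfolding norm_plus_2_sq exp_add[symmetric] by (simp add: field_simps)
  have "integrable lborel (\<lambda>v. (norm (?L v))\<^sup>2 * exp (- 2 * (norm v)\<^sup>2))"
    by (intro exp_growth_gauss_integrable exp_growth_mult K exp_growth_inner) simp
  moreover have "(norm (?L v * complex_of_real (exp (- (norm v)\<^sup>2))))\<^sup>2 = (norm (?L v))\<^sup>2 * exp (- 2 * (norm v)\<^sup>2)" for v
    unfolding norm_mult[of "?L v"] power_mult_distrib by (simp add: exp_double[symmetric])
  ultimately have "(\<lambda>v. ?L v * complex_of_real (exp (- (norm v)\<^sup>2))) \<in> L2 nlborel"
    by (simp add: L2_def integrable_nlborel_iff)
  then have "(\<lambda>v. complex_of_real (exp (- (norm \<xi>)\<^sup>2 / 4)) * (?L v * complex_of_real (exp (- (norm v)\<^sup>2)))) \<in> L2 nlborel"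
    by (rule L2_cmult)
  then show ?thesis unfolding e by (simp only: of_real_mult mult_ac)
qed

text \<open>By the Hermite recursion each linear factor \<open>v $ r - c $ r\<close> only changes the Hermite index, and
  raises its degree by at most one.\<close>

lemma q_fun_orthogonal_vprod:
  fixes F :: "real^'n::finite \<Rightarrow> complex"
  assumes F: "F \<in> L2 nlborel"
    and q: "\<And>k. k \<in> J_set m \<Longrightarrow> (LINT v|nlborel. F v * complex_of_real (q_fun k \<xi> v)) = 0"
  shows "length rs + (\<Sum>r\<in>UNIV. k r) \<le> m - 1 \<Longrightarrow>
    (LINT v|nlborel. F v * (vprod rs c v * complex_of_real (herm_prod k \<xi> v) * complex_of_real (exp (- (norm (\<xi> + 2 *\<^sub>R v))\<^sup>2 / 4)))) = 0"
proof (induction rs arbitrary: k)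
  case Nil
  then have "k \<in> J_set m" by (simp add: J_set_def)
  from q[OF this] have "(LINT v|nlborel. complex_of_real (q_const k) * (F v * (complex_of_real (herm_prod k \<xi> v) * complex_of_real (exp (- (norm (\<xi> + 2 *\<^sub>R v))\<^sup>2 / 4))))) = 0"
    unfolding q_fun_eq by (simp only: of_real_mult mult_ac)
  then show ?case using q_const_pos[of k] by (simp add: vprod_def)
next
  case (Cons r rs)
  let ?I = "\<lambda>k v. F v * (vprod rs c v * complex_of_real (herm_prod k \<xi> v) * complex_of_real (exp (- (norm (\<xi> + 2 *\<^sub>R v))\<^sup>2 / 4)))"
  have int: "integrable nlborel (?I k)" for k
    by (intro L2_mult_integrable F exp_growth_gauss_L2 exp_growth_mult exp_growth_vprod exp_growth_herm_prod)
  have upd: "(\<Sum>s\<in>UNIV. (k(r := x)) s) = x + (\<Sum>s\<in>UNIV - {r}. k s)" for x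
    by (subst sum.remove[of _ r]) auto
  have k: "(\<Sum>s\<in>UNIV. k s) = k r + (\<Sum>s\<in>UNIV - {r}. k s)" by (subst sum.remove[of _ r]) auto
  \<comment> \<open>Removing one letter pays for raising one Hermite index, so all three indices
    satisfy the induction hypothesis; when k r = 0 the lowered index is k itself and its term has
    coefficient 0.\<close>
  have 1: "integral\<^sup>L nlborel (?I (k(r := Suc (k r)))) = 0" and 2: "integral\<^sup>L nlborel (?I (k(r := k r - 1))) = 0"
    and 3: "integral\<^sup>L nlborel (?I k) = 0"
    using Cons.prems by (auto intro!: Cons.IH simp only: upd k list.size)
  have "(LINT v|nlborel. F v * (vprod (r # rs) c v * complex_of_real (herm_prod k \<xi> v) * complex_of_real (exp (- (norm (\<xi> + 2 *\<^sub>R v))\<^sup>2 / 4))))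
     = (LINT v|nlborel. complex_of_real (sqrt 2 / 4) * ?I (k(r := Suc (k r))) v
         + complex_of_real (sqrt 2 / 2 * real (k r)) * ?I (k(r := k r - 1)) v - complex_of_real (\<xi> $ r / 2 + c $ r) * ?I k v)"
  proof (rule Bochner_Integration.integral_cong[OF refl])
    fix v
    have e: "vprod (r # rs) c v * complex_of_real (herm_prod k \<xi> v) = vprod rs c v * complex_of_real ((v $ r - c $ r) * herm_prod k \<xi> v)"
      by (simp add: vprod_def)
    show "F v * (vprod (r # rs) c v * complex_of_real (herm_prod k \<xi> v) * complex_of_real (exp (- (norm (\<xi> + 2 *\<^sub>R v))\<^sup>2 / 4)))
      = complex_of_real (sqrt 2 / 4) * ?I (k(r := Suc (k r))) v
         + complex_of_real (sqrt 2 / 2 * real (k r)) * ?I (k(r := k r - 1)) v - complex_of_real (\<xi> $ r / 2 + c $ r) * ?I k v"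
      unfolding e unfolding herm_prod_mult of_real_diff of_real_add of_real_mult by (simp add: algebra_simps)
  qed
  also have "\<dots> = 0"
    using int 1 2 3 by simp
  finally show ?case .
qed

section \<open>Transferring the moments through the partial Fourier transform\<close>

lemma LINT_sections_measurable:
  fixes f :: "'a::euclidean_space \<times> 'b::euclidean_space \<Rightarrow> complex"
  assumes "integrable nlborel f"
  shows "(\<lambda>v. LINT u|nlborel. f (u, v)) \<in> borel_measurable borel"
  using nlborel_pair.integrable_snd[of "\<lambda>u v. f (u, v)"] assms
  by (simp add: nlborel_prod borel_measurable_integrable flip: measurable_nlborel_iff)

lemma bdot_cart:
  "bdot p b = complex_of_real (fst p \<bullet> (\<chi> r. Re (b $ r)) + snd p \<bullet> (\<chi> r. Im (b $ r)))
     + \<i> * complex_of_real (fst p \<bullet> (\<chi> r. Im (b $ r)) - snd p \<bullet> (\<chi> r. Re (b $ r)))"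
  by (simp add: bdot_def complex_eq_iff cvec_nth inner_vec_def sum.distrib sum_subtractf algebra_simps)

text \<open>Completing the square: as a function of \<open>u\<close> the exponential is the Fourier transform of a
  Gaussian, which moves the moment conditions to the transform side.\<close>

lemma exp_bdot_fourier:
  fixes p :: "(real^'n::finite) \<times> (real^'n)" and b :: "complex^'n"
  defines "b1 \<equiv> (\<chi> r. Re (b $ r))" and "b2 \<equiv> (\<chi> r. Im (b $ r))"
  shows "exp (bdot p b) * complex_of_real (exp (- 1 * (norm p)\<^sup>2)) =
    twist p * (exp (complex_of_real (((norm b1)\<^sup>2 - (norm b2)\<^sup>2) / 2) + \<i> * complex_of_real (b1 \<bullet> b2)) *
      complex_of_real (2 powr (- (real CARD('n) / 2)))) *
      (complex_of_real (exp (- (norm (snd p))\<^sup>2)) * fourier_integral (gauss_mod b1 (snd p + b2)) (fst p))"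
proof -
  obtain u v where p: "p = (u, v)" by (cases p)
  have c: "complex_of_real (2 powr (real CARD('n) / 2)) * complex_of_real (2 powr (- (real CARD('n) / 2))) = 1"
    by (simp flip: of_real_mult powr_add)
  let ?t = "- complex_of_real ((norm (u, v))\<^sup>2) / 2 - \<i> * complex_of_real (u \<bullet> v)"
  let ?k = "complex_of_real (((norm b1)\<^sup>2 - (norm b2)\<^sup>2) / 2) + \<i> * complex_of_real (b1 \<bullet> b2)"
  let ?g = "complex_of_real (((norm (v + b2))\<^sup>2 - (norm (b1 - u))\<^sup>2) / 2) - \<i> * complex_of_real ((b1 - u) \<bullet> (v + b2))"
  have n: "(norm (b1 - u))\<^sup>2 = (norm b1)\<^sup>2 + (norm u)\<^sup>2 - 2 * (u \<bullet> b1)"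
    using norm_plus_sq[of b1 "- u"] by (simp add: inner_commute)
  have "bdot p b + complex_of_real (- 1 * (norm p)\<^sup>2) = ?t + ?k + (complex_of_real (- (norm v)\<^sup>2) + ?g)"
    unfolding bdot_cart b1_def[symmetric] b2_def[symmetric] n norm_plus_sq
    by (simp add: p norm_pair_sq complex_eq_iff inner_diff_left inner_diff_right inner_add_right inner_commute field_simps)
  then have "exp (bdot p b) * complex_of_real (exp (- 1 * (norm p)\<^sup>2)) = exp ?t * exp ?k * (complex_of_real (exp (- (norm v)\<^sup>2)) * exp ?g)"
    by (simp only: exp_add[symmetric] exp_of_real[symmetric])
  also have "\<dots> = (complex_of_real (2 powr (real CARD('n) / 2)) * complex_of_real (2 powr (- (real CARD('n) / 2)))) * (exp ?t * exp ?k * (complex_of_real (exp (- (norm v)\<^sup>2)) * exp ?g))"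
    unfolding c by simp
  finally show ?thesis
    unfolding p twist_def fourier_gauss_mod fst_conv snd_conv by (simp only: mult_ac)
qed

text \<open>The shift of the tilt by v completes the square in \<xi> + 2v: what remains depends on
  \<xi> alone. For fixed \<xi> the kernel is therefore, as a function of v, the Gaussian contained
  in all q.\<close>

lemma moment_kernel_eq:
  "complex_of_real (exp (- (norm v)\<^sup>2)) * gauss_mod b1 (v + b2) \<xi>
    = complex_of_real (exp (- (norm (\<xi> + 2 *\<^sub>R v))\<^sup>2 / 4)) *
      exp (complex_of_real (- (norm \<xi>)\<^sup>2 / 4 - \<xi> \<bullet> b2) + \<i> * complex_of_real (\<xi> \<bullet> b1))"
proof -
  have "complex_of_real (- (norm v)\<^sup>2) + (complex_of_real (- (norm \<xi>)\<^sup>2 / 2 - \<xi> \<bullet> (v + b2)) + \<i> * complex_of_real (\<xi> \<bullet> b1))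
    = complex_of_real (- (norm (\<xi> + 2 *\<^sub>R v))\<^sup>2 / 4) + (complex_of_real (- (norm \<xi>)\<^sup>2 / 4 - \<xi> \<bullet> b2) + \<i> * complex_of_real (\<xi> \<bullet> b1))"
    unfolding norm_plus_2_sq by (simp add: complex_eq_iff inner_add_right field_simps)
  then show ?thesis unfolding gauss_mod_def by (simp only: exp_add[symmetric] exp_of_real[symmetric])
qed

text \<open>Joint square integrability in (\<xi>, v) is what permits Fubini for the product with the
  transform of g.\<close>

lemma moment_kernel_L2:
  fixes c :: "real^'n::finite"
  shows "(\<lambda>p. vprod rs c (snd p) * (complex_of_real (exp (- (norm (snd p))\<^sup>2)) * gauss_mod b1 (snd p + b2) (fst p))) \<in> L2 nlborel"
    (is "?W \<in> _")
proof -
  let ?K = "\<lambda>p::(real^'n) \<times> (real^'n). vprod rs c (snd p) * exp (complex_of_real (- (fst p \<bullet> b2)))"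
  have "\<bar>fst p \<bullet> b2\<bar> \<le> norm b2 * norm p" for p :: "(real^'n) \<times> (real^'n)"
    using Cauchy_Schwarz_ineq2[of "fst p" b2] norm_fst_le[of "fst p" "snd p"]
      mult_right_mono[of "norm (fst p)" "norm p" "norm b2"] by (simp add: mult.commute)
  then have "exp_growth (\<lambda>p::(real^'n) \<times> (real^'n). exp (complex_of_real (- (fst p \<bullet> b2))))"
    by (intro exp_growth_exp[where C = "norm b2"] borel_measurable_continuous_onI continuous_intros) auto
  then have K: "exp_growth ?K" by (intro exp_growth_mult exp_growth_vprod)
  have i: "integrable lborel (\<lambda>p. (norm (?K p))\<^sup>2 * exp (- (1/4) * (norm p)\<^sup>2))"
    by (rule exp_growth_gauss_integrable[OF K]) simp
  have vm: "(\<lambda>p::(real^'n) \<times> (real^'n). vprod rs c (snd p)) \<in> borel_measurable borel"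
    by (rule exp_growth_measurable[OF exp_growth_vprod(2)])
  have gm: "(\<lambda>p::(real^'n) \<times> (real^'n). complex_of_real (exp (- (norm (snd p))\<^sup>2)) * gauss_mod b1 (snd p + b2) (fst p)) \<in> borel_measurable borel"
    unfolding gauss_mod_def by (intro borel_measurable_continuous_onI continuous_intros) auto
  have Wm: "?W \<in> borel_measurable borel" by (intro borel_measurable_times vm gm)
  have le: "(norm (?W p))\<^sup>2 \<le> (norm (?K p))\<^sup>2 * exp (- (1/4) * (norm p)\<^sup>2)" for p
  proof -
    obtain \<xi> v where p: "p = (\<xi>, v)" by (cases p)
    \<comment> \<open>Shows that |\<xi>|^2 + 2 \<xi>.v + 2|v|^2 dominates a quarter of |\<xi>|^2 +
      |v|^2: the difference is 3/4 |\<xi>|^2 + 2 \<xi>.v + 7/4 |v|^2, and completing the square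
      leaves 7/4 - 4/3 = 5/12.\<close>
    have "0 \<le> 3 * (norm (\<xi> + (4/3) *\<^sub>R v))\<^sup>2 / 4 + 5 * (norm v)\<^sup>2 / 12" by simp
    then have "- 2 * (norm v)\<^sup>2 - (norm \<xi>)\<^sup>2 - 2 * (\<xi> \<bullet> v) \<le> - (1/4) * (norm p)\<^sup>2"
      unfolding norm_plus_sq by (simp add: p norm_pair_sq power_mult_distrib power2_eq_square[of "4/3::real"] field_simps)
    then have "exp (- 2 * (norm v)\<^sup>2 - (norm \<xi>)\<^sup>2 - 2 * (\<xi> \<bullet> v)) \<le> exp (- (1/4) * (norm p)\<^sup>2)" by simp
    then have "(norm (?K p))\<^sup>2 * exp (- 2 * (norm v)\<^sup>2 - (norm \<xi>)\<^sup>2 - 2 * (\<xi> \<bullet> v)) \<le> (norm (?K p))\<^sup>2 * exp (- (1/4) * (norm p)\<^sup>2)"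
      by (rule mult_left_mono) simp
    moreover have "(norm (?W p))\<^sup>2 = (norm (?K p))\<^sup>2 * exp (- 2 * (norm v)\<^sup>2 - (norm \<xi>)\<^sup>2 - 2 * (\<xi> \<bullet> v))"
    proof -
      have "(exp (- (norm v)\<^sup>2) * exp (- (norm \<xi>)\<^sup>2 / 2 - \<xi> \<bullet> (v + b2)))\<^sup>2 = (exp (- (\<xi> \<bullet> b2)))\<^sup>2 * exp (- 2 * (norm v)\<^sup>2 - (norm \<xi>)\<^sup>2 - 2 * (\<xi> \<bullet> v))"
        by (simp add: power_mult_distrib exp_double[symmetric] exp_add[symmetric] inner_add_right algebra_simps)
      then show ?thesis by (simp add: p norm_mult norm_gauss_mod power_mult_distrib mult_ac)
    qed
    ultimately show ?thesis by simp
  qed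
  have "integrable lborel (\<lambda>p. (norm (?W p))\<^sup>2)"
    using Wm le by (intro Bochner_Integration.integrable_bound[OF i]) auto
  then show ?thesis using Wm by (simp add: L2_def integrable_nlborel_iff)
qed

text \<open>Pairing g with the kernel in u is by Plancherel a pairing of its partial transform in
  \<xi>. After exchanging the order of integration the v-integral is one of those annihilated by
  hypothesis, and \<open>vanish_at_point\<close> applies at every a.\<close>

lemma H_embed_zero:
  fixes f :: "complex^'n::{finite,linorder} \<Rightarrow> complex"
  assumes \<alpha>: "\<alpha> > 0" and m: "m \<ge> 1" and f: "f \<in> fock \<alpha> m"
    and zero: "\<And>k. k \<in> J_set m \<Longrightarrow> AE \<xi> in nlborel.
      (LINT v|nlborel. fourier_plancherel_fst (H_embed \<alpha> f) (\<xi>, v) * complex_of_real (q_fun k \<xi> v)) = 0"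
  shows "H_embed \<alpha> f = (\<lambda>p. 0)"
proof -
  define g where "g = H_embed \<alpha> f"
  define F where "F = fourier_plancherel_fst g"
  define \<Phi> where "\<Phi> p = f ((1 / sqrt \<alpha>) *\<^sub>R cvec p)" for p
  have fp: "poly_an m f" and \<Phi>: "gauss_sq \<Phi>"
    using f unfolding fock_iff_gauss_sq[OF \<alpha>] \<Phi>_def[abs_def, symmetric] by auto
  have g: "g \<in> L2 nlborel" using f unfolding fock_iff_L2[OF \<alpha>] g_def by simp
  have g\<Phi>: "g p = twist p * \<Phi> p" for p unfolding g_def H_embed_eq \<Phi>_def ..
  have F: "F \<in> L2 nlborel" and rel: "AE v in nlborel. plancherel_rel (\<lambda>u. g (u, v)) (\<lambda>\<xi>. F (\<xi>, v))"
    using fourier_plancherel_fst_rel[OF g] unfolding F_def by auto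
  have "AE \<xi> in nlborel. \<forall>k\<in>J_set m. (LINT v|nlborel. F (\<xi>, v) * complex_of_real (q_fun k \<xi> v)) = 0"
    using zero J_set_card(1)[OF m] by (intro AE_finite_allI) (auto simp: F_def g_def)
  \<comment> \<open>The exceptional null set of \<xi> does not depend on the word or on c, because
    it comes from the finitely many k in \<open>J_set m\<close> and from the section of F.\<close>
  then have vanish: "AE \<xi> in nlborel. \<forall>rs c. length rs \<le> m - 1 \<longrightarrow>
      (LINT v|nlborel. F (\<xi>, v) * (vprod rs c v * complex_of_real (exp (- (norm (\<xi> + 2 *\<^sub>R v))\<^sup>2 / 4)))) = 0"
    using L2_sections(2)[OF F]
  proof eventually_elim
    case (elim \<xi>)
    show ?case
    proof (intro allI impI)
      fix rs :: "'n list" and c :: "real^'n::{finite,linorder}" assume "length rs \<le> m - 1"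
      then show "(LINT v|nlborel. F (\<xi>, v) * (vprod rs c v * complex_of_real (exp (- (norm (\<xi> + 2 *\<^sub>R v))\<^sup>2 / 4)))) = 0"
        using q_fun_orthogonal_vprod[of "\<lambda>v. F (\<xi>, v)" m \<xi> rs "\<lambda>r. 0" c] elim by (simp add: herm_prod_def)
    qed
  qed
  have ann: "annih \<Phi> (\<lambda>p. vprod rs c (snd p))" if rs: "length rs \<le> m - 1" for rs :: "'n list" and c
    unfolding annih_def
  proof (intro conjI allI exp_growth_vprod)
    fix b :: "complex^'n::{finite,linorder}"
    define b1 b2 where "b1 = (\<chi> r. Re (b $ r))" and "b2 = (\<chi> r. Im (b $ r))"
    define \<kappa> where "\<kappa> = exp (complex_of_real (((norm b1)\<^sup>2 - (norm b2)\<^sup>2) / 2) + \<i> * complex_of_real (b1 \<bullet> b2)) *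
      complex_of_real (2 powr (- (real CARD('n) / 2)))"
    let ?A = "\<lambda>p. \<Phi> p * (vprod rs c (snd p) * exp (bdot p b)) * complex_of_real (exp (- 1 * (norm p)\<^sup>2))"
    let ?V = "\<lambda>v. vprod rs c v * complex_of_real (exp (- (norm v)\<^sup>2))"
    define W where "W p = vprod rs c (snd p) * (complex_of_real (exp (- (norm (snd p))\<^sup>2)) * gauss_mod b1 (snd p + b2) (fst p))" for p
    have W: "W \<in> L2 nlborel" unfolding W_def by (rule moment_kernel_L2)
    have A: "?A p = \<kappa> * ?V (snd p) * (g p * fourier_integral (gauss_mod b1 (snd p + b2)) (fst p))" for p
    proof -
      have "?A p = \<Phi> p * vprod rs c (snd p) * (exp (bdot p b) * complex_of_real (exp (- 1 * (norm p)\<^sup>2)))" by (simp only: mult_ac)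
      then show ?thesis
        unfolding exp_bdot_fourier b1_def[symmetric] b2_def[symmetric] \<kappa>_def[symmetric] g\<Phi> by (simp only: mult_ac)
    qed
    have A2: "?A (u, v) = \<kappa> * ?V v * (g (u, v) * fourier_integral (gauss_mod b1 (v + b2)) u)" for u v
      using A[of "(u, v)"] by (simp only: fst_conv snd_conv)
    have "integrable lborel ?A"
      by (intro gauss_sq_integrable \<Phi> exp_growth_mult exp_growth_vprod exp_growth_bdot) simp
    then have Ai: "integrable nlborel ?A" by (simp add: integrable_nlborel_iff)
    have FW: "integrable nlborel (\<lambda>p. F p * W p)" by (rule L2_mult_integrable[OF F W])
    have "(LINT p|nlborel. ?A p) = (LINT v|nlborel. LINT u|nlborel. ?A (u, v))"
      by (rule LINT_nlborel_pair(1)[OF Ai])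
    \<comment> \<open>For almost every v the multiplication formula moves the transform from the
      Gaussian to the section of g; the remaining factors depend on v only and commute with
      it.\<close>
    also have "\<dots> = (LINT v|nlborel. \<kappa> * (LINT \<xi>|nlborel. F (\<xi>, v) * W (\<xi>, v)))"
    proof (rule integral_cong_AE)
      show "(\<lambda>v. LINT u|nlborel. ?A (u, v)) \<in> borel_measurable nlborel"
        using LINT_sections_measurable[OF Ai] by (simp only: measurable_nlborel_iff)
      show "(\<lambda>v. \<kappa> * (LINT \<xi>|nlborel. F (\<xi>, v) * W (\<xi>, v))) \<in> borel_measurable nlborel"
        using borel_measurable_times[OF borel_measurable_const LINT_sections_measurable[OF FW]] by (simp only: measurable_nlborel_iff)
      show "AE v in nlborel. (LINT u|nlborel. ?A (u, v)) = \<kappa> * (LINT \<xi>|nlborel. F (\<xi>, v) * W (\<xi>, v))"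
        using rel L2_sections(1)[OF g]
      proof eventually_elim
        case (elim v)
        have "(LINT u|nlborel. ?A (u, v)) = \<kappa> * ?V v * (LINT u|nlborel. g (u, v) * fourier_integral (gauss_mod b1 (v + b2)) u)"
          unfolding A2 by (rule Bochner_Integration.integral_mult_right_zero)
        also have "\<dots> = \<kappa> * ?V v * (LINT \<xi>|nlborel. F (\<xi>, v) * gauss_mod b1 (v + b2) \<xi>)"
          by (simp only: plancherel_rel_mult_formula[OF elim gauss_mod_integrable gauss_mod_L2])
        also have "\<dots> = \<kappa> * (LINT \<xi>|nlborel. ?V v * (F (\<xi>, v) * gauss_mod b1 (v + b2) \<xi>))"
          by (simp only: Bochner_Integration.integral_mult_right_zero mult.assoc)
        also have "\<dots> = \<kappa> * (LINT \<xi>|nlborel. F (\<xi>, v) * W (\<xi>, v))"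
          unfolding W_def fst_conv snd_conv by (simp only: mult_ac)
        finally show ?case .
      qed
    qed
    also have "\<dots> = \<kappa> * (LINT p|nlborel. F p * W p)"
      unfolding LINT_nlborel_pair(1)[OF FW] by (rule Bochner_Integration.integral_mult_right_zero)
    also have "(LINT p|nlborel. F p * W p) = (LINT \<xi>|nlborel. LINT v|nlborel. F (\<xi>, v) * W (\<xi>, v))"
      by (rule LINT_nlborel_pair(2)[OF FW])
    \<comment> \<open>By \<open>moment_kernel_eq\<close> the inner integral is a factor depending on
      \<xi> times a moment covered by \<open>vanish\<close>.\<close>
    also have "\<dots> = 0"
    proof (rule integral_eq_zero_AE)
      show "AE \<xi> in nlborel. (LINT v|nlborel. F (\<xi>, v) * W (\<xi>, v)) = 0"
        using vanish
      proof eventually_elim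
        case (elim \<xi>)
        let ?e = "exp (complex_of_real (- (norm \<xi>)\<^sup>2 / 4 - \<xi> \<bullet> b2) + \<i> * complex_of_real (\<xi> \<bullet> b1))"
        have "(LINT v|nlborel. F (\<xi>, v) * W (\<xi>, v)) = (LINT v|nlborel. ?e * (F (\<xi>, v) * (vprod rs c v * complex_of_real (exp (- (norm (\<xi> + 2 *\<^sub>R v))\<^sup>2 / 4)))))"
          unfolding W_def moment_kernel_eq fst_conv snd_conv by (simp only: mult_ac)
        also have "\<dots> = ?e * 0"
          using elim rs by (simp only: Bochner_Integration.integral_mult_right_zero)
        finally show ?case by simp
      qed
    qed
    finally have "(LINT p|nlborel. ?A p) = 0" by simp
    then show "(LINT p|lborel. ?A p) = 0"
      unfolding integral_nlborel using nl_const_pos[where 'a = "(real^'n::{finite,linorder}) \<times> (real^'n::{finite,linorder})"] by (simp add: less_imp_neq[symmetric])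
  qed
  have "\<Phi> a = 0" for a
    using vanish_at_point[OF m fp, of "sqrt \<alpha>" a] \<Phi> ann unfolding \<Phi>_def[abs_def] by blast
  then show ?thesis unfolding g_def[symmetric] by (simp add: g\<Phi> fun_eq_iff)
qed

section \<open>The operator \<open>R\<close>\<close>

lemma sqint_q_fun: "sqint nlborel (\<lambda>v. complex_of_real (q_fun k \<xi> v)) = 1"
  using sqint_sum_q_fun[of "{()}" "\<lambda>_. k" "\<lambda>_. 1" \<xi>] by simp

text \<open>For each \<xi> the function q has norm 1 in v, so Cauchy-Schwarz in v bounds the
  component by the norm of the section of the transform.\<close>

lemma R_op_L2:
  fixes g :: "(real^'n::{finite,linorder}) \<times> (real^'n::{finite,linorder}) \<Rightarrow> complex"
  assumes g: "g \<in> L2 nlborel"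
  shows "R_op m g j \<in> L2 nlborel"
proof -
  define F where "F = fourier_plancherel_fst g"
  let ?q = "\<lambda>\<xi> v. complex_of_real (q_fun (lex_enum m j :: 'n \<Rightarrow> nat) \<xi> v)"
  have F: "F \<in> L2 nlborel" unfolding F_def by (rule fourier_plancherel_fst_rel(1)[OF g])
  then have Fm: "F \<in> borel_measurable borel" by (rule L2_nlborel_measurable)
  have R: "R_op m g j = (\<lambda>\<xi>. LINT v|nlborel. F (\<xi>, v) * ?q \<xi> v)"
    by (simp add: R_op_def N_op_def F_def)
  have "(\<lambda>p. F p * ?q (fst p) (snd p)) \<in> borel_measurable borel"
    by (intro borel_measurable_times Fm measurable_compose[OF q_fun_measurable(1) borel_measurable_of_real])
  then have "(\<lambda>(\<xi>, v). F (\<xi>, v) * ?q \<xi> v) \<in> borel_measurable (nlborel \<Otimes>\<^sub>M nlborel)"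
    unfolding borel_pair_nlborel by (simp add: case_prod_beta')
  then have "R_op m g j \<in> borel_measurable nlborel"
    unfolding R by (rule nlborel.borel_measurable_lebesgue_integral)
  moreover have "sqint nlborel (R_op m g j) \<le> sqint nlborel F"
    unfolding sqint_Fubini(2)[OF Fm]
  proof (rule nn_integral_mono)
    fix \<xi> :: "real^'n::{finite,linorder}"
    have "ennreal ((norm (R_op m g j \<xi>))\<^sup>2) \<le> sqint nlborel (\<lambda>v. F (\<xi>, v)) * sqint nlborel (?q \<xi>)"
      unfolding R using borel_section_snd[OF Fm] by (intro norm_LINT_mult_sq_le) auto
    then show "ennreal ((norm (R_op m g j \<xi>))\<^sup>2) \<le> sqint nlborel (\<lambda>v. F (\<xi>, v))"
      by (simp only: sqint_q_fun mult_1_right)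
  qed
  ultimately show ?thesis using F by (auto simp: L2_iff)
qed

lemma R_op_lin:
  fixes g h :: "(real^'n::{finite,linorder}) \<times> (real^'n::{finite,linorder}) \<Rightarrow> complex"
  assumes g: "g \<in> L2 nlborel" and h: "h \<in> L2 nlborel"
  shows "AE \<xi> in nlborel. R_op m (\<lambda>p. a * g p + b * h p) j \<xi> = a * R_op m g j \<xi> + b * R_op m h j \<xi>"
  using AE_pairD[OF fourier_plancherel_fst_lin[OF g h, of a b]]
    L2_sections(2)[OF fourier_plancherel_fst_rel(1)[OF g]] L2_sections(2)[OF fourier_plancherel_fst_rel(1)[OF h]]
    L2_sections(2)[OF fourier_plancherel_fst_rel(1)[OF L2_add[OF L2_cmult[OF g, of a] L2_cmult[OF h, of b]]]]
proof eventually_elim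
  case (elim \<xi>)
  let ?q = "\<lambda>v. complex_of_real (q_fun (lex_enum m j :: 'n \<Rightarrow> nat) \<xi> v)"
  let ?F = "\<lambda>g v. fourier_plancherel_fst g (\<xi>, v)"
  have i: "integrable nlborel (\<lambda>v. ?F g v * ?q v)" "integrable nlborel (\<lambda>v. ?F h v * ?q v)"
    by (intro L2_mult_integrable elim q_fun_L2_snd)+
  have "R_op m (\<lambda>p. a * g p + b * h p) j \<xi> = (LINT v|nlborel. a * (?F g v * ?q v) + b * (?F h v * ?q v))"
    unfolding R_op_def N_op_def
  proof (rule integral_cong_AE)
    show "AE v in nlborel. ?F (\<lambda>p. a * g p + b * h p) v * ?q v = a * (?F g v * ?q v) + b * (?F h v * ?q v)"
      using elim(1) by eventually_elim (simp add: algebra_simps)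
    show "(\<lambda>v. ?F (\<lambda>p. a * g p + b * h p) v * ?q v) \<in> borel_measurable nlborel"
      by (intro borel_measurable_integrable L2_mult_integrable elim q_fun_L2_snd)
    show "(\<lambda>v. a * (?F g v * ?q v) + b * (?F h v * ?q v)) \<in> borel_measurable nlborel"
      by (intro borel_measurable_integrable Bochner_Integration.integrable_add integrable_mult_right i)
  qed
  then show ?case using i by (simp add: R_op_def N_op_def)
qed

text \<open>Orthonormality in v recovers the coefficients of the synthesis from its integrals
  against the q.\<close>

lemma R_op_right_inverse:
  fixes h :: "nat \<Rightarrow> real^'n::{finite,linorder} \<Rightarrow> complex"
  assumes \<alpha>: "\<alpha> > 0" and m: "m \<ge> 1" and d: "d = (CARD('n) + m - 1) choose CARD('n)"
    and h: "\<And>j. j \<in> {1..d} \<Longrightarrow> h j \<in> L2 nlborel"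
  obtains G where "G \<in> H_space \<alpha> m" "\<And>j. j \<in> {1..d} \<Longrightarrow> AE \<xi> in nlborel. R_op m G j \<xi> = h j \<xi>"
    "sqint nlborel G = (\<Sum>j\<in>{1..d}. sqint nlborel (h j))"
proof -
  have bij: "bij_betw (lex_enum m :: nat \<Rightarrow> 'n \<Rightarrow> nat) {1..d} (J_set m)" by (rule lex_enum_bij[OF m d])
  then have inj: "inj_on (lex_enum m :: nat \<Rightarrow> 'n \<Rightarrow> nat) {1..d}" and J: "\<And>j. j \<in> {1..d} \<Longrightarrow> (lex_enum m j :: 'n \<Rightarrow> nat) \<in> J_set m"
    by (auto simp: bij_betw_def)
  obtain G where G: "G \<in> H_space \<alpha> m"
    and eq: "AE p in nlborel. fourier_plancherel_fst G p = hermite_synthesis (lex_enum m) {1..d} h p"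
    and sq: "sqint nlborel G = (\<Sum>j\<in>{1..d}. sqint nlborel (h j))"
    using hermite_synthesis_inverse[OF \<alpha> m finite_atLeastAtMost inj, where h = h] J h by blast
  have GL: "G \<in> L2 nlborel" using G H_space_L2[OF \<alpha>] by blast
  have "AE \<xi> in nlborel. R_op m G j \<xi> = h j \<xi>" if j: "j \<in> {1..d}" for j
    using AE_pairD[OF eq] L2_sections(2)[OF fourier_plancherel_fst_rel(1)[OF GL]]
  proof eventually_elim
    case (elim \<xi>)
    let ?q = "\<lambda>j v. complex_of_real (q_fun (lex_enum m j :: 'n \<Rightarrow> nat) \<xi> v)"
    have "R_op m G j \<xi> = (LINT v|nlborel. (\<Sum>i\<in>{1..d}. h i \<xi> * ?q i v) * ?q j v)"
      unfolding R_op_def N_op_def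
    proof (rule integral_cong_AE)
      show "AE v in nlborel. fourier_plancherel_fst G (\<xi>, v) * ?q j v = (\<Sum>i\<in>{1..d}. h i \<xi> * ?q i v) * ?q j v"
        using elim(1) by eventually_elim (simp add: hermite_synthesis_def)
      show "(\<lambda>v. fourier_plancherel_fst G (\<xi>, v) * ?q j v) \<in> borel_measurable nlborel"
        by (intro borel_measurable_integrable L2_mult_integrable elim q_fun_L2_snd)
      show "(\<lambda>v. (\<Sum>i\<in>{1..d}. h i \<xi> * ?q i v) * ?q j v) \<in> borel_measurable nlborel"
        by (intro borel_measurable_integrable L2_mult_integrable L2_sum L2_cmult q_fun_L2_snd)
    qed
    also have "\<dots> = h j \<xi>" by (rule LINT_sum_q_fun[OF finite_atLeastAtMost inj j])
    finally show ?case .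
  qed
  with G sq show ?thesis using that by blast
qed

lemma R_op_zero:
  fixes g :: "(real^'n::{finite,linorder}) \<times> (real^'n::{finite,linorder}) \<Rightarrow> complex"
  assumes \<alpha>: "\<alpha> > 0" and m: "m \<ge> 1" and d: "d = (CARD('n) + m - 1) choose CARD('n)"
    and g: "g \<in> H_space \<alpha> m" and zero: "\<And>j. j \<in> {1..d} \<Longrightarrow> AE \<xi> in nlborel. R_op m g j \<xi> = 0"
  shows "g = (\<lambda>p. 0)"
proof -
  obtain f where f: "f \<in> fock \<alpha> m" "g = H_embed \<alpha> f" using g by (auto simp: H_space_def)
  show ?thesis
    unfolding f(2)
  proof (rule H_embed_zero[OF \<alpha> m f(1)])
    fix k :: "'n \<Rightarrow> nat" assume "k \<in> J_set m"
    then have "k \<in> lex_enum m ` {1..d}" using bij_betw_imp_surj_on[OF lex_enum_bij[OF m d]] by simp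
    then obtain j where "j \<in> {1..d}" "k = lex_enum m j" by blast
    then show "AE \<xi> in nlborel. (LINT v|nlborel. fourier_plancherel_fst (H_embed \<alpha> f) (\<xi>, v) * complex_of_real (q_fun k \<xi> v)) = 0"
      using zero[of j] by (simp add: R_op_def N_op_def f(2))
  qed
qed

lemma R_op_eqI:
  fixes g h :: "(real^'n::{finite,linorder}) \<times> (real^'n::{finite,linorder}) \<Rightarrow> complex"
  assumes \<alpha>: "\<alpha> > 0" and m: "m \<ge> 1" and d: "d = (CARD('n) + m - 1) choose CARD('n)"
    and g: "g \<in> H_space \<alpha> m" and h: "h \<in> H_space \<alpha> m"
    and eq: "\<And>j. j \<in> {1..d} \<Longrightarrow> AE \<xi> in nlborel. R_op m g j \<xi> = R_op m h j \<xi>"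
  shows "g = h"
proof -
  have L2: "g \<in> L2 nlborel" "h \<in> L2 nlborel" using g h H_space_L2[OF \<alpha>] by blast+
  have "(\<lambda>p. 1 * g p + (- 1) * h p) = (\<lambda>p. 0)"
  proof (rule R_op_zero[OF \<alpha> m d H_space_lin[OF \<alpha> g h]])
    fix j assume "j \<in> {1..d}"
    from eq[OF this] R_op_lin[OF L2, of m 1 "- 1" j]
    show "AE \<xi> in nlborel. R_op m (\<lambda>p. 1 * g p + (- 1) * h p) j \<xi> = 0" by eventually_elim simp
  qed
  then show ?thesis by (simp add: fun_eq_iff)
qed

text \<open>For integrable g almost every section is integrable, so its Plancherel transform is the
  Fourier integral; the uniformly bounded q then allows the double integral to be written as
  one.\<close>

lemma R_op_integral:
  fixes g :: "(real^'n::{finite,linorder}) \<times> (real^'n::{finite,linorder}) \<Rightarrow> complex"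
  assumes g: "g \<in> L2 nlborel" and g1: "integrable lborel g"
  shows "AE \<xi> in lborel. R_op m g j \<xi> =
          complex_of_real (1 / (2 powr (real CARD('n) / 2) * pi powr (3 * real CARD('n) / 4))) *
          (LINT (u, v)|lborel. g (u, v) * exp (- \<i> * complex_of_real (u \<bullet> \<xi>)) *
             complex_of_real (hermite_prod (lex_enum m j) \<xi> v))"
proof -
  have gm: "g \<in> borel_measurable borel" using g by (rule L2_nlborel_measurable)
  have gi: "integrable nlborel g" using g1 by (simp add: integrable_nlborel_iff)
  define S where "S = (\<lambda>(\<xi>, v). fourier_integral (\<lambda>u. g (u, v)) \<xi>)"
  have Sm: "S \<in> borel_measurable borel" unfolding S_def by (rule fourier_sections_measurable[OF gm])
  have "integrable (nlborel \<Otimes>\<^sub>M nlborel) (\<lambda>(u, v). g (u, v))" using gi by (simp add: nlborel_prod)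
  from nlborel_pair.AE_integrable_snd[OF this] L2_sections(1)[OF g]
  have "AE v in nlborel. plancherel_rel (\<lambda>u. g (u, v)) (\<lambda>\<xi>. S (\<xi>, v))"
    by eventually_elim (simp add: S_def plancherel_rel_fourier_integral)
  from AE_pairD[OF fourier_plancherel_fst_unique[OF g Sm this]]
  have "AE \<xi> in nlborel. R_op m g j \<xi> =
          complex_of_real (1 / (2 powr (real CARD('n) / 2) * pi powr (3 * real CARD('n) / 4))) *
          (LINT (u, v)|lborel. g (u, v) * exp (- \<i> * complex_of_real (u \<bullet> \<xi>)) *
             complex_of_real (hermite_prod (lex_enum m j) \<xi> v))"
    using L2_sections(2)[OF fourier_plancherel_fst_rel(1)[OF g]]
  proof eventually_elim
    case (elim \<xi>)
    let ?k = "lex_enum m j :: 'n \<Rightarrow> nat"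
    let ?c = "2 powr (real CARD('n) / 2) * pi powr (real CARD('n) / 4)"
    let ?G = "\<lambda>p. g p * (chr (fst p) \<xi> * complex_of_real (q_fun ?k \<xi> (snd p)))"
    obtain C where C: "C \<ge> 0" "\<And>\<xi> v. \<bar>q_fun ?k \<xi> v\<bar> \<le> C" using q_fun_bounded[of ?k] by blast
    have qm: "(\<lambda>p::(real^'n::{finite,linorder}) \<times> (real^'n::{finite,linorder}). complex_of_real (q_fun ?k \<xi> (snd p))) \<in> borel_measurable borel"
      by (rule measurable_compose[OF borel_measurable_continuous_onI[OF continuous_on_snd[OF continuous_on_id]] measurable_compose[OF q_fun_measurable(2) borel_measurable_of_real]])
    have Gm: "?G \<in> borel_measurable borel"
      by (intro borel_measurable_times gm qm borel_measurable_continuous_onI continuous_intros)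
    have G: "integrable nlborel ?G"
    proof (rule Bochner_Integration.integrable_bound[OF integrable_mult_right[OF gi, of "complex_of_real C"]])
      show "AE p in nlborel. norm (?G p) \<le> norm (complex_of_real C * g p)"
        using C by (intro AE_I2) (simp add: norm_mult mult.commute[of "norm (g _)"] mult_right_mono)
    qed (use Gm in simp)
    have "R_op m g j \<xi> = (LINT v|nlborel. LINT u|nlborel. ?G (u, v))"
      unfolding R_op_def N_op_def
    proof (rule integral_cong_AE)
      have e: "(LINT u|nlborel. ?G (u, v)) = S (\<xi>, v) * complex_of_real (q_fun ?k \<xi> v)" for v
        by (simp add: S_def fourier_integral_def mult.assoc[symmetric])
      show "AE v in nlborel. fourier_plancherel_fst g (\<xi>, v) * complex_of_real (q_fun ?k \<xi> v) = (LINT u|nlborel. ?G (u, v))"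
        unfolding e using elim(1) by eventually_elim simp
      show "(\<lambda>v. fourier_plancherel_fst g (\<xi>, v) * complex_of_real (q_fun ?k \<xi> v)) \<in> borel_measurable nlborel"
        by (intro borel_measurable_integrable L2_mult_integrable elim q_fun_L2_snd)
      show "(\<lambda>v. LINT u|nlborel. ?G (u, v)) \<in> borel_measurable nlborel"
        using LINT_sections_measurable[OF G] by (simp only: measurable_nlborel_iff)
    qed
    also have "\<dots> = (LINT p|nlborel. ?G p)" by (rule LINT_nlborel_pair(1)[OF G, symmetric])
    also have "\<dots> = complex_of_real (nl_const TYPE((real^'n::{finite,linorder}) \<times> (real^'n::{finite,linorder})) * ?c) *
        (LINT p|lborel. g p * chr (fst p) \<xi> * complex_of_real (hermite_prod ?k \<xi> (snd p)))"
    proof -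
      have "(LINT p|lborel. ?G p) = (LINT p|lborel. complex_of_real ?c * (g p * chr (fst p) \<xi> * complex_of_real (hermite_prod ?k \<xi> (snd p))))"
        unfolding q_fun_def of_real_mult by (simp only: mult_ac)
      also have "\<dots> = complex_of_real ?c * (LINT p|lborel. g p * chr (fst p) \<xi> * complex_of_real (hermite_prod ?k \<xi> (snd p)))"
        by (rule Bochner_Integration.integral_mult_right_zero)
      finally show ?thesis unfolding integral_nlborel scaleR_conv_of_real of_real_mult by (simp only: mult_ac)
    qed
    \<comment> \<open>The constant is (2 pi)^(-n), from normalising the measure in dimension 2n,
      times the prefactor 2^(n/2) pi^(n/4) of q.\<close>
    also have "nl_const TYPE((real^'n::{finite,linorder}) \<times> (real^'n::{finite,linorder})) * ?c = 1 / (2 powr (real CARD('n) / 2) * pi powr (3 * real CARD('n) / 4))"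
    proof -
      let ?n = "real CARD('n)"
      have "nl_const TYPE((real^'n::{finite,linorder}) \<times> (real^'n::{finite,linorder})) = 2 powr (- ?n) * pi powr (- ?n)"
        by (simp add: nl_const_def powr_mult)
      then have "nl_const TYPE((real^'n::{finite,linorder}) \<times> (real^'n::{finite,linorder})) * ?c = (2 powr (- ?n) * 2 powr (?n / 2)) * (pi powr (- ?n) * pi powr (?n / 4))"
        by simp
      also have "\<dots> = 2 powr (- (?n / 2)) * pi powr (- (3 * ?n / 4))"
        unfolding powr_add[symmetric] by (simp add: field_simps)
      finally show ?thesis by (simp add: powr_minus field_simps)
    qed
    finally show ?case by (simp add: case_prod_beta')
  qed
  then show ?thesis unfolding AE_nlborel_iff .
qed

theorem proposition9p1:
  fixes \<alpha> :: real and m d :: nat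
    and H :: "((real^'n::{finite,linorder}) \<times> (real^'n::{finite,linorder}) \<Rightarrow> complex) set"
  assumes "\<alpha> > 0" and "m \<ge> 1"
    and d_eq: "d = (CARD('n) + m - 1) choose CARD('n)"
    and H_eq: "H = H_space \<alpha> m"
  shows "L2_isometric_isomorphism nlborel H nlborel d (R_op m) \<and>
    (\<forall>g\<in>H. integrable lborel g \<longrightarrow>
      (\<forall>j\<in>{1..d}. AE \<xi> in lborel.
        R_op m g j \<xi> =
          complex_of_real (1 / (2 powr (real CARD('n) / 2) * pi powr (3 * real CARD('n) / 4))) *
          (LINT (u, v)|lborel. g (u, v) * exp (- \<i> * complex_of_real (u \<bullet> \<xi>)) *
             complex_of_real (hermite_prod (lex_enum m j) \<xi> v))))"
proof -
  note inverse = R_op_right_inverse[OF assms(1,2) d_eq, folded H_eq]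
  note eqI = R_op_eqI[OF assms(1,2) d_eq, folded H_eq]
  have L2: "g \<in> L2 nlborel" if "g \<in> H" for g
    using that H_space_L2[OF assms(1)] unfolding H_eq by blast
  have lin: "(\<lambda>x. a * g x + b * h x) \<in> H" if "g \<in> H" "h \<in> H" for g h a b
    using that unfolding H_eq by (rule H_space_lin[OF assms(1)])
  have R: "R_op m g j \<in> L2 nlborel" if "g \<in> H" for g j
    by (rule R_op_L2[OF L2[OF that]])
  \<comment> \<open>The right inverse preserves norms by construction. Applied to R g it gives an
    element of H with the same image as g, which is g by injectivity.\<close>
  have isometry: "L2_set (\<lambda>j. L2_norm nlborel (R_op m g j)) {1..d} = L2_norm nlborel g" if g: "g \<in> H" for g
  proof -
    obtain G where G: "G \<in> H" "\<And>j. j \<in> {1..d} \<Longrightarrow> AE \<xi> in nlborel. R_op m G j \<xi> = R_op m g j \<xi>"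
      "sqint nlborel G = (\<Sum>j\<in>{1..d}. sqint nlborel (R_op m g j))"
      using inverse[of "R_op m g"] R[OF g] by blast
    have "G = g" by (rule eqI[OF G(1) g G(2)])
    with G(3) have "ennreal ((L2_norm nlborel g)\<^sup>2) = ennreal (\<Sum>j\<in>{1..d}. (L2_norm nlborel (R_op m g j))\<^sup>2)"
      by (simp add: nn_integral_L2_eq[OF L2[OF g]] nn_integral_L2_eq[OF R[OF g]])
    then have "(L2_norm nlborel g)\<^sup>2 = (\<Sum>j\<in>{1..d}. (L2_norm nlborel (R_op m g j))\<^sup>2)"
      by (subst (asm) ennreal_inj) (auto intro: sum_nonneg)
    then show ?thesis unfolding L2_set_def by (metis L2_norm_nonneg real_sqrt_unique)
  qed
  have bijective: "\<exists>!g. g \<in> H \<and> (\<forall>j\<in>{1..d}. AE y in nlborel. R_op m g j y = h j y)"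
    if h: "\<forall>j\<in>{1..d}. h j \<in> L2 nlborel" for h
  proof -
    obtain G where G: "G \<in> H" "\<And>j. j \<in> {1..d} \<Longrightarrow> AE \<xi> in nlborel. R_op m G j \<xi> = h j \<xi>"
      using inverse[of h] h by blast
    show ?thesis
    proof (rule ex1I[of _ G])
      fix g assume g: "g \<in> H \<and> (\<forall>j\<in>{1..d}. AE y in nlborel. R_op m g j y = h j y)"
      show "g = G"
      proof (rule eqI)
        fix j assume j: "j \<in> {1..d}"
        with g have "AE y in nlborel. R_op m g j y = h j y" by blast
        with G(2)[OF j] show "AE \<xi> in nlborel. R_op m g j \<xi> = R_op m G j \<xi>" by eventually_elim simp
      qed (use g G in auto)
    qed (use G in auto)
  qed
  have "L2_isometric_isomorphism nlborel H nlborel d (R_op m)"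
    unfolding L2_isometric_isomorphism_def
    using L2 R isometry bijective R_op_lin[OF L2 L2] lin
    by (intro conjI ballI allI impI subsetI) auto
  moreover have "\<forall>g\<in>H. integrable lborel g \<longrightarrow> (\<forall>j\<in>{1..d}. AE \<xi> in lborel.
        R_op m g j \<xi> =
          complex_of_real (1 / (2 powr (real CARD('n) / 2) * pi powr (3 * real CARD('n) / 4))) *
          (LINT (u, v)|lborel. g (u, v) * exp (- \<i> * complex_of_real (u \<bullet> \<xi>)) *
             complex_of_real (hermite_prod (lex_enum m j) \<xi> v)))"
    by (intro ballI impI R_op_integral L2)
  ultimately show ?thesis by blast
qed

end
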